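(* Let $\kappa$ be a cardinal and assume $2^{<\kappa}=\kappa$ and $\diamondsuit_{\kappa^+}(\mathrm{CF}_\kappa)$. Then there is a sequence $\langle T_\alpha : \alpha<\kappa^+\rangle$ of $\kappa^+$-Souslin trees which is weakly able to realize every equivalence relation on $\kappa^+$.
   Context: $\mathrm{CF}_\kappa=\{\alpha<\kappa^+ : \mathrm{cf}(\alpha)=\kappa\}$; $\diamondsuit_{\kappa^+}(\mathrm{CF}_\kappa)$ asserts that there is a sequence $\langle D_\alpha : \alpha\in\mathrm{CF}_\kappa\rangle$ such that for every $A\subseteq\kappa^+$ the set $\{\alpha\in\mathrm{CF}_\kappa : A\cap\alpha=D_\alpha\}$ is stationary in $\kappa^+$. A $\kappa^+$-Souslin tree is a tree of height $\kappa^+$ with no branches and no antichains of size $\kappa^+$; a tree is rigid if it has no nontrivial automorphism. For a sequence $\vec T=\langle T_\gamma:\gamma<\lambda\rangle$ of rigid Souslin trees and an equivalence relation $E$ on $\lambda$: $\vec T$ realizes $E$ if for all $\alpha,\beta<\lambda$, $\alpha E\beta$ iff $T_\alpha\cong T_\beta$. $\vec T$ is weakly able to realize $E$ if there is a cofinality-preserving forcing notion $\mathbb P_E$ such that in every $\mathbb P_E$-generic extension, $\vec T$ is a sequence of rigid Souslin trees which realizes $E$. *)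

theory Defs
  imports Main
begin

unbundle cardinal_syntax

text \<open>
  Ordinals are well-orders (reflexive, as in the cardinal library), and the ordinals below an
  ordinal \<open>r\<close> are the elements of \<open>Field r\<close>. For a cardinal \<open>\<kappa>\<close> the cardinal \<open>\<kappa>\<^sup>+\<close> is \<open>cardSuc \<kappa>\<close>.
\<close>

definition seg :: "'o rel \<Rightarrow> 'o \<Rightarrow> 'o rel" where
  "seg r a = Restr r (underS r a)"

definition cofinal_map :: "('b \<Rightarrow> 'o) \<Rightarrow> 'b set \<Rightarrow> 'o rel \<Rightarrow> bool" where
  "cofinal_map f A r \<longleftrightarrow> f ` A \<subseteq> Field r \<and> (\<forall>b\<in>Field r. \<exists>a\<in>A. (b, f a) \<in> r)"

text \<open>\<open>has_cof r s\<close> says \<open>cf(r) = s\<close>: \<open>s\<close> is the least ordinal with a cofinal map into \<open>r\<close>.\<close>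

definition has_cof :: "'o rel \<Rightarrow> 'b rel \<Rightarrow> bool" where
  "has_cof r s \<longleftrightarrow> (\<exists>f. cofinal_map f (Field s) r) \<and>
     (\<forall>b\<in>Field s. \<not> (\<exists>f. cofinal_map f (underS s b) r))"

definition CF :: "'a rel \<Rightarrow> 'a set set" where
  "CF \<kappa> = {\<alpha> \<in> Field (cardSuc \<kappa>). has_cof (seg (cardSuc \<kappa>) \<alpha>) \<kappa>}"

definition club :: "'o rel \<Rightarrow> 'o set \<Rightarrow> bool" where
  "club r C \<longleftrightarrow> C \<subseteq> Field r \<and> (\<forall>a\<in>Field r. \<exists>c\<in>C. (a, c) \<in> r \<and> a \<noteq> c) \<and>
     (\<forall>d\<in>Field r. underS r d \<noteq> {} \<and> (\<forall>a\<in>underS r d. \<exists>c\<in>C \<inter> underS r d. (a, c) \<in> r \<and> a \<noteq> c)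
        \<longrightarrow> d \<in> C)"

definition stationary :: "'o rel \<Rightarrow> 'o set \<Rightarrow> bool" where
  "stationary r S \<longleftrightarrow> S \<subseteq> Field r \<and> (\<forall>C. club r C \<longrightarrow> S \<inter> C \<noteq> {})"

definition diamond :: "'o rel \<Rightarrow> 'o set \<Rightarrow> bool" where
  "diamond r S \<longleftrightarrow> (\<exists>D. \<forall>A. A \<subseteq> Field r \<longrightarrow>
     stationary r {\<alpha> \<in> S. A \<inter> underS r \<alpha> = D \<alpha>})"

text \<open>\<open>2\<^bsup><\<kappa>\<^esup>\<close>, as the number of binary sequences of length less than \<open>\<kappa>\<close>.\<close>

definition two_less :: "'a rel \<Rightarrow> ('a \<times> ('a \<Rightarrow> bool)) rel" where
  "two_less \<kappa> = |SIGMA \<alpha>:Field \<kappa>. Func (underS \<kappa> \<alpha>) (UNIV :: bool set)|"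

section \<open>Souslin trees\<close>

text \<open>A tree is its reflexive order relation; its nodes are the elements of the field.\<close>

definition tree :: "'x rel \<Rightarrow> bool" where
  "tree T \<longleftrightarrow> Partial_order T \<and> (\<forall>x\<in>Field T. Well_order (seg T x))"

definition order_iso :: "('x \<Rightarrow> 'y) \<Rightarrow> 'x rel \<Rightarrow> 'y rel \<Rightarrow> bool" where
  "order_iso f S T \<longleftrightarrow> bij_betw f (Field S) (Field T) \<and>
     (\<forall>x\<in>Field S. \<forall>y\<in>Field S. (x, y) \<in> S \<longleftrightarrow> (f x, f y) \<in> T)"

definition isomorphic :: "'x rel \<Rightarrow> 'y rel \<Rightarrow> bool" where
  "isomorphic S T \<longleftrightarrow> (\<exists>f. order_iso f S T)"

definition rigid :: "'x rel \<Rightarrow> bool" where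
  "rigid T \<longleftrightarrow> (\<forall>f. order_iso f T T \<longrightarrow> (\<forall>x\<in>Field T. f x = x))"

definition has_height :: "'x rel \<Rightarrow> 'o rel \<Rightarrow> bool" where
  "has_height T r \<longleftrightarrow>
     (\<forall>x\<in>Field T. \<exists>\<alpha>\<in>Field r. isomorphic (seg T x) (seg r \<alpha>)) \<and>
     (\<forall>\<alpha>\<in>Field r. \<exists>x\<in>Field T. isomorphic (seg T x) (seg r \<alpha>))"

definition antichain :: "'x rel \<Rightarrow> 'x set \<Rightarrow> bool" where
  "antichain T A \<longleftrightarrow> A \<subseteq> Field T \<and>
     (\<forall>x\<in>A. \<forall>y\<in>A. x \<noteq> y \<longrightarrow> (x, y) \<notin> T \<and> (y, x) \<notin> T)"

definition branch :: "'x rel \<Rightarrow> 'x set \<Rightarrow> bool" where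
  "branch T B \<longleftrightarrow> B \<subseteq> Field T \<and> (\<forall>x\<in>B. \<forall>y\<in>B. (x, y) \<in> T \<or> (y, x) \<in> T) \<and>
     (\<forall>x\<in>Field T. (\<forall>y\<in>B. (x, y) \<in> T \<or> (y, x) \<in> T) \<longrightarrow> x \<in> B)"

definition souslin_tree :: "'o rel \<Rightarrow> 'x rel \<Rightarrow> bool" where
  "souslin_tree r T \<longleftrightarrow> tree T \<and> has_height T r \<and>
     \<not> (\<exists>B g. branch T B \<and> bij_betw g (Field r) B) \<and>
     \<not> (\<exists>A g. antichain T A \<and> bij_betw g (Field r) A)"

section \<open>Forcing\<close>

text \<open>\<open>(q, p) \<in> P\<close> means that \<open>q\<close> is stronger than \<open>p\<close>, so that \<open>under P p\<close> is the set of extensions of \<open>p\<close>.\<close>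

definition forcing_notion :: "'p rel \<Rightarrow> bool" where
  "forcing_notion P \<longleftrightarrow> Preorder P \<and> Field P \<noteq> {}"

text \<open>
  A statement about the generic extension is represented by the set of conditions forcing it; the
  clauses below are the usual recursion for the forcing relation. Quantifiers range over elements
  of ground model sets and over subsets, in the extension, of ground model sets. Every such subset
  of \<open>X\<close> has a name which is a set of pairs of (the canonical name of) an element of \<open>X\<close> and a
  condition, so quantifying over the type of these names is quantifying over all subsets in the
  extension. Relations and functions are subsets of products.
\<close>

type_synonym ('x, 'p) name = "('x \<times> 'p) set"

definition f_and :: "'p set \<Rightarrow> 'p set \<Rightarrow> 'p set" (infixr \<open>\<^bold>\<and>\<close> 35) where
  "(\<phi> \<^bold>\<and> \<psi>) = \<phi> \<inter> \<psi>"

context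
  fixes P :: "'p rel"
begin

definition ground :: "bool \<Rightarrow> 'p set" where
  "ground b = {p \<in> Field P. b}"

definition f_in :: "'x \<Rightarrow> ('x, 'p) name \<Rightarrow> 'p set" (infix \<open>\<^bold>\<in>\<close> 50) where
  "(x \<^bold>\<in> A) = {p \<in> Field P. \<forall>q\<in>under P p. \<exists>t\<in>under P q. \<exists>s. (x, s) \<in> A \<and> (t, s) \<in> P}"

definition f_not :: "'p set \<Rightarrow> 'p set" (\<open>\<^bold>\<not> _\<close> [40] 40) where
  "(\<^bold>\<not> \<phi>) = {p \<in> Field P. \<forall>q\<in>under P p. q \<notin> \<phi>}"

definition f_all :: "('x \<Rightarrow> 'p set) \<Rightarrow> 'p set" (binder \<open>\<^bold>\<forall>\<close> 10) where
  "f_all \<Phi> = {p \<in> Field P. \<forall>x. p \<in> \<Phi> x}"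

definition f_imp :: "'p set \<Rightarrow> 'p set \<Rightarrow> 'p set" (infixr \<open>\<^bold>\<longrightarrow>\<close> 25) where
  "(\<phi> \<^bold>\<longrightarrow> \<psi>) = (\<^bold>\<not> (\<phi> \<^bold>\<and> \<^bold>\<not> \<psi>))"

definition f_iff :: "'p set \<Rightarrow> 'p set \<Rightarrow> 'p set" (infixr \<open>\<^bold>\<longleftrightarrow>\<close> 25) where
  "(\<phi> \<^bold>\<longleftrightarrow> \<psi>) = ((\<phi> \<^bold>\<longrightarrow> \<psi>) \<^bold>\<and> (\<psi> \<^bold>\<longrightarrow> \<phi>))"

definition f_ex :: "('x \<Rightarrow> 'p set) \<Rightarrow> 'p set" (binder \<open>\<^bold>\<exists>\<close> 10) where
  "f_ex \<Phi> = (\<^bold>\<not> (\<^bold>\<forall>x. \<^bold>\<not> \<Phi> x))"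

definition f_ball :: "'x set \<Rightarrow> ('x \<Rightarrow> 'p set) \<Rightarrow> 'p set" where
  "f_ball X \<Phi> = (\<^bold>\<forall>x. ground (x \<in> X) \<^bold>\<longrightarrow> \<Phi> x)"

definition f_bex :: "'x set \<Rightarrow> ('x \<Rightarrow> 'p set) \<Rightarrow> 'p set" where
  "f_bex X \<Phi> = (\<^bold>\<exists>x. ground (x \<in> X) \<^bold>\<and> \<Phi> x)"

definition forced :: "'p set \<Rightarrow> bool" where
  "forced \<phi> \<longleftrightarrow> Field P \<subseteq> \<phi>"

text \<open>
  The notions of the previous sections, evaluated in the generic extension. Domains and codomains
  are given by predicates, so that they can be ground model sets or names.
\<close>

definition f_fun :: "('x \<times> 'y, 'p) name \<Rightarrow> ('x \<Rightarrow> 'p set) \<Rightarrow> ('y \<Rightarrow> 'p set) \<Rightarrow> 'p set" where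
  "f_fun F A B =
     ((\<^bold>\<forall>x. \<^bold>\<forall>y. (x, y) \<^bold>\<in> F \<^bold>\<longrightarrow> A x \<^bold>\<and> B y) \<^bold>\<and>
      (\<^bold>\<forall>x. A x \<^bold>\<longrightarrow> (\<^bold>\<exists>y. (x, y) \<^bold>\<in> F)) \<^bold>\<and>
      (\<^bold>\<forall>x. \<^bold>\<forall>y. \<^bold>\<forall>y'. (x, y) \<^bold>\<in> F \<^bold>\<and> (x, y') \<^bold>\<in> F \<^bold>\<longrightarrow> ground (y = y')))"

definition f_bij :: "('x \<times> 'y, 'p) name \<Rightarrow> ('x \<Rightarrow> 'p set) \<Rightarrow> ('y \<Rightarrow> 'p set) \<Rightarrow> 'p set" where
  "f_bij F A B =
     (f_fun F A B \<^bold>\<and>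
      (\<^bold>\<forall>x. \<^bold>\<forall>x'. \<^bold>\<forall>y. (x, y) \<^bold>\<in> F \<^bold>\<and> (x', y) \<^bold>\<in> F \<^bold>\<longrightarrow> ground (x = x')) \<^bold>\<and>
      (\<^bold>\<forall>y. B y \<^bold>\<longrightarrow> (\<^bold>\<exists>x. (x, y) \<^bold>\<in> F)))"

definition f_cofinal_map :: "('b \<times> 'o, 'p) name \<Rightarrow> 'b set \<Rightarrow> 'o rel \<Rightarrow> 'p set" where
  "f_cofinal_map F A r =
     (f_fun F (\<lambda>a. ground (a \<in> A)) (\<lambda>c. ground (c \<in> Field r)) \<^bold>\<and>
      f_ball (Field r) (\<lambda>b. \<^bold>\<exists>a. \<^bold>\<exists>c. (a, c) \<^bold>\<in> F \<^bold>\<and> ground ((b, c) \<in> r)))"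

definition f_has_cof :: "'o rel \<Rightarrow> 'b rel \<Rightarrow> 'p set" where
  "f_has_cof r s =
     ((\<^bold>\<exists>F. f_cofinal_map F (Field s) r) \<^bold>\<and>
      f_ball (Field s) (\<lambda>b. \<^bold>\<not> (\<^bold>\<exists>F. f_cofinal_map F (underS s b) r)))"

text \<open>
  Being a partial or linear order is a bounded first-order property of the ground model relation
  and hence absolute; well-foundedness is spelled out.
\<close>

definition f_wf :: "'x rel \<Rightarrow> 'p set" where
  "f_wf R = (\<^bold>\<forall>A. (\<^bold>\<exists>x. x \<^bold>\<in> A) \<^bold>\<longrightarrow> (\<^bold>\<exists>x. x \<^bold>\<in> A \<^bold>\<and> (\<^bold>\<forall>y. ground ((y, x) \<in> R) \<^bold>\<longrightarrow> \<^bold>\<not> y \<^bold>\<in> A)))"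

definition f_tree :: "'x rel \<Rightarrow> 'p set" where
  "f_tree T = (ground (Partial_order T) \<^bold>\<and>
     f_ball (Field T) (\<lambda>x. ground (Linear_order (seg T x)) \<^bold>\<and> f_wf (seg T x - Id)))"

definition f_order_iso :: "('x \<times> 'y, 'p) name \<Rightarrow> 'x rel \<Rightarrow> 'y rel \<Rightarrow> 'p set" where
  "f_order_iso F S T =
     (f_bij F (\<lambda>x. ground (x \<in> Field S)) (\<lambda>y. ground (y \<in> Field T)) \<^bold>\<and>
      (\<^bold>\<forall>x. \<^bold>\<forall>y. \<^bold>\<forall>u. \<^bold>\<forall>v. (x, u) \<^bold>\<in> F \<^bold>\<and> (y, v) \<^bold>\<in> F \<^bold>\<longrightarrow> ground ((x, y) \<in> S \<longleftrightarrow> (u, v) \<in> T)))"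

definition f_isomorphic :: "'x rel \<Rightarrow> 'y rel \<Rightarrow> 'p set" where
  "f_isomorphic S T = (\<^bold>\<exists>F. f_order_iso F S T)"

definition f_rigid :: "'x rel \<Rightarrow> 'p set" where
  "f_rigid T = (\<^bold>\<forall>F. f_order_iso F T T \<^bold>\<longrightarrow> (\<^bold>\<forall>x. \<^bold>\<forall>y. (x, y) \<^bold>\<in> F \<^bold>\<longrightarrow> ground (y = x)))"

definition f_has_height :: "'x rel \<Rightarrow> 'o rel \<Rightarrow> 'p set" where
  "f_has_height T r =
     (f_ball (Field T) (\<lambda>x. f_bex (Field r) (\<lambda>\<alpha>. f_isomorphic (seg T x) (seg r \<alpha>))) \<^bold>\<and>
      f_ball (Field r) (\<lambda>\<alpha>. f_bex (Field T) (\<lambda>x. f_isomorphic (seg T x) (seg r \<alpha>))))"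

definition f_antichain :: "'x rel \<Rightarrow> ('x, 'p) name \<Rightarrow> 'p set" where
  "f_antichain T A =
     ((\<^bold>\<forall>x. x \<^bold>\<in> A \<^bold>\<longrightarrow> ground (x \<in> Field T)) \<^bold>\<and>
      (\<^bold>\<forall>x. \<^bold>\<forall>y. x \<^bold>\<in> A \<^bold>\<and> y \<^bold>\<in> A \<^bold>\<longrightarrow> ground (x \<noteq> y \<longrightarrow> (x, y) \<notin> T \<and> (y, x) \<notin> T)))"

definition f_branch :: "'x rel \<Rightarrow> ('x, 'p) name \<Rightarrow> 'p set" where
  "f_branch T B =
     ((\<^bold>\<forall>x. x \<^bold>\<in> B \<^bold>\<longrightarrow> ground (x \<in> Field T)) \<^bold>\<and>
      (\<^bold>\<forall>x. \<^bold>\<forall>y. x \<^bold>\<in> B \<^bold>\<and> y \<^bold>\<in> B \<^bold>\<longrightarrow> ground ((x, y) \<in> T \<or> (y, x) \<in> T)) \<^bold>\<and>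
      f_ball (Field T) (\<lambda>x. (\<^bold>\<forall>y. y \<^bold>\<in> B \<^bold>\<longrightarrow> ground ((x, y) \<in> T \<or> (y, x) \<in> T)) \<^bold>\<longrightarrow> x \<^bold>\<in> B))"

definition f_souslin_tree :: "'o rel \<Rightarrow> 'x rel \<Rightarrow> 'p set" where
  "f_souslin_tree r T =
     (f_tree T \<^bold>\<and> f_has_height T r \<^bold>\<and>
      \<^bold>\<not> (\<^bold>\<exists>B. \<^bold>\<exists>G. f_branch T B \<^bold>\<and> f_bij G (\<lambda>\<alpha>. ground (\<alpha> \<in> Field r)) (\<lambda>x. x \<^bold>\<in> B)) \<^bold>\<and>
      \<^bold>\<not> (\<^bold>\<exists>A. \<^bold>\<exists>G. f_antichain T A \<^bold>\<and> f_bij G (\<lambda>\<alpha>. ground (\<alpha> \<in> Field r)) (\<lambda>x. x \<^bold>\<in> A)))"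

definition f_realizes :: "'i set \<Rightarrow> ('i \<Rightarrow> 'x rel) \<Rightarrow> 'i rel \<Rightarrow> 'p set" where
  "f_realizes I T E =
     f_ball I (\<lambda>\<alpha>. f_ball I (\<lambda>\<beta>. ground ((\<alpha>, \<beta>) \<in> E) \<^bold>\<longleftrightarrow> f_isomorphic (T \<alpha>) (T \<beta>)))"

end

text \<open>
  Only ordinals represented on the type of conditions are mentioned. This is no restriction:
  cofinalities greater than the size of \<open>P\<close> are preserved by every \<open>P\<close>, and smaller ones are
  represented on that type; \<open>cofinality_preserving_all_ordinals\<close> below covers ordinals of any type.
\<close>

definition cofinality_preserving :: "'p rel \<Rightarrow> bool" where
  "cofinality_preserving P \<longleftrightarrow>
     (\<forall>(r :: 'p rel) (s :: 'p rel). Well_order r \<and> Well_order s \<and> has_cof r s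
        \<longrightarrow> forced P (f_has_cof P r s))"

text \<open>Regular open sets of conditions; all statements above denote such sets.\<close>

definition f_reg :: "'p rel \<Rightarrow> 'p set \<Rightarrow> bool" where
  "f_reg P \<phi> \<longleftrightarrow> \<phi> \<subseteq> Field P \<and> (\<forall>p q. p \<in> \<phi> \<and> (q, p) \<in> P \<longrightarrow> q \<in> \<phi>) \<and>
     (\<forall>p\<in>Field P. (\<forall>q\<in>under P p. \<exists>t\<in>under P q. t \<in> \<phi>) \<longrightarrow> p \<in> \<phi>)"

context
  fixes P :: "'p rel"
  assumes P: "Preorder P"
begin

lemma P_refl: "p \<in> Field P \<Longrightarrow> (p, p) \<in> P"
  using P by (auto simp: preorder_on_def refl_on_def)

lemma P_trans: "(p, q) \<in> P \<Longrightarrow> (q, t) \<in> P \<Longrightarrow> (p, t) \<in> P"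
  using P by (auto simp: preorder_on_def dest: transD)

lemma under_mono: "(q, p) \<in> P \<Longrightarrow> under P q \<subseteq> under P p"
  by (auto simp: under_def dest: P_trans)

lemma P_Field: "(p, q) \<in> P \<Longrightarrow> p \<in> Field P" "(p, q) \<in> P \<Longrightarrow> q \<in> Field P"
  by (auto simp: Field_def)

lemma f_reg_down: "f_reg P \<phi> \<Longrightarrow> p \<in> \<phi> \<Longrightarrow> (q, p) \<in> P \<Longrightarrow> q \<in> \<phi>"
  by (auto simp: f_reg_def)

lemma f_reg_dense:
  assumes "f_reg P \<phi>" "p \<in> Field P" "\<forall>q\<in>under P p. \<exists>t\<in>under P q. t \<in> \<phi>"
  shows "p \<in> \<phi>"
proof -
  have "\<forall>p\<in>Field P. (\<forall>q\<in>under P p. \<exists>t\<in>under P q. t \<in> \<phi>) \<longrightarrow> p \<in> \<phi>"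
    using assms(1) unfolding f_reg_def by (elim conjE)
  from bspec[OF this assms(2)] assms(3) show ?thesis by (rule mp)
qed

lemma f_reg_ground: "f_reg P (ground P b)"
proof (cases b)
  case True
  then show ?thesis using P_Field(1) by (auto simp: f_reg_def ground_def)
next
  case False
  have "under P p \<noteq> {}" if "p \<in> Field P" for p using P_refl[OF that] by (auto simp: under_def)
  then show ?thesis using False by (simp add: f_reg_def ground_def)
qed

lemma f_reg_in: "f_reg P (f_in P x A)"
  unfolding f_reg_def
proof (intro conjI allI impI ballI)
  show "f_in P x A \<subseteq> Field P" by (auto simp: f_in_def)
  fix p q assume "p \<in> f_in P x A \<and> (q, p) \<in> P"
  then have "(q, p) \<in> P" "q \<in> Field P" "p \<in> f_in P x A" by (blast dest: P_Field)+
  then show "q \<in> f_in P x A" using under_mono[of q p] unfolding f_in_def by blast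
next
  fix p assume p: "p \<in> Field P" and d: "\<forall>q\<in>under P p. \<exists>t\<in>under P q. t \<in> f_in P x A"
  have "\<exists>t\<in>under P q. \<exists>s. (x, s) \<in> A \<and> (t, s) \<in> P" if qp: "q \<in> under P p" for q
  proof -
    obtain t where t': "t \<in> under P q" "t \<in> f_in P x A" using bspec[OF d qp] by blast
    then have t: "(t, q) \<in> P" "t \<in> under P t" using P_refl[OF P_Field(1)] by (auto simp: under_def)
    obtain u s where "(u, t) \<in> P" "(x, s) \<in> A" "(u, s) \<in> P"
      using t'(2) t(2) unfolding f_in_def by (auto simp: under_def)
    then show ?thesis using P_trans[OF \<open>(u, t) \<in> P\<close> t(1)] unfolding under_def by blast
  qed
  then show "p \<in> f_in P x A" using p by (auto simp: f_in_def)
qed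

lemma f_reg_and: "f_reg P \<phi> \<Longrightarrow> f_reg P \<psi> \<Longrightarrow> f_reg P (\<phi> \<^bold>\<and> \<psi>)"
proof -
  assume r: "f_reg P \<phi>" "f_reg P \<psi>"
  show ?thesis
    unfolding f_and_def f_reg_def[of P "\<phi> \<inter> \<psi>"]
  proof (intro conjI allI impI ballI)
    show "\<phi> \<inter> \<psi> \<subseteq> Field P" using r by (auto simp: f_reg_def)
    fix p q assume "p \<in> \<phi> \<inter> \<psi> \<and> (q, p) \<in> P"
    then show "q \<in> \<phi> \<inter> \<psi>" using r f_reg_down by blast
  next
    fix p assume p: "p \<in> Field P" and d: "\<forall>q\<in>under P p. \<exists>t\<in>under P q. t \<in> \<phi> \<inter> \<psi>"
    have "\<forall>q\<in>under P p. \<exists>t\<in>under P q. t \<in> \<phi>" "\<forall>q\<in>under P p. \<exists>t\<in>under P q. t \<in> \<psi>" using d by simp_all meson+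
    then show "p \<in> \<phi> \<inter> \<psi>" using f_reg_dense[OF r(1) p] f_reg_dense[OF r(2) p] by simp
  qed
qed

lemma f_reg_not:
  assumes "f_reg P \<phi>" shows "f_reg P (f_not P \<phi>)"
  unfolding f_reg_def
proof (intro conjI allI impI ballI)
  show "f_not P \<phi> \<subseteq> Field P" by (auto simp: f_not_def)
  fix p q assume "p \<in> f_not P \<phi> \<and> (q, p) \<in> P"
  then have "(q, p) \<in> P" "q \<in> Field P" "p \<in> f_not P \<phi>" by (blast dest: P_Field)+
  then show "q \<in> f_not P \<phi>" using under_mono[of q p] unfolding f_not_def by blast
next
  fix p assume p: "p \<in> Field P" and d: "\<forall>q\<in>under P p. \<exists>t\<in>under P q. t \<in> f_not P \<phi>"
  have "q \<notin> \<phi>" if "(q, p) \<in> P" for q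
  proof
    assume q: "q \<in> \<phi>"
    obtain t where t: "(t, q) \<in> P" "t \<in> f_not P \<phi>" using d \<open>(q, p) \<in> P\<close> by (auto simp: under_def)
    then have "t \<in> \<phi>" using assms q by (auto simp: f_reg_def)
    then show False using t P_refl[of t] by (auto simp: f_not_def under_def)
  qed
  then show "p \<in> f_not P \<phi>" using p by (auto simp: f_not_def under_def)
qed

lemma f_reg_all: "(\<And>x. f_reg P (\<Phi> x)) \<Longrightarrow> f_reg P (f_all P \<Phi>)"
  unfolding f_reg_def[of P "f_all P \<Phi>"]
proof (intro conjI allI impI ballI)
  assume reg: "\<And>x. f_reg P (\<Phi> x)"
  show "f_all P \<Phi> \<subseteq> Field P" by (auto simp: f_all_def)
  {
    fix p q assume "p \<in> f_all P \<Phi> \<and> (q, p) \<in> P"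
    then show "q \<in> f_all P \<Phi>" using f_reg_down[OF reg] P_Field(1)[of q p] by (auto simp: f_all_def)
  }
  fix p assume p: "p \<in> Field P" and d: "\<forall>q\<in>under P p. \<exists>t\<in>under P q. t \<in> f_all P \<Phi>"
  have "p \<in> \<Phi> x" for x
  proof -
    have "\<forall>q\<in>under P p. \<exists>t\<in>under P q. t \<in> \<Phi> x" using d by (simp add: f_all_def) meson
    then show ?thesis by (rule f_reg_dense[OF reg p])
  qed
  then show "p \<in> f_all P \<Phi>" using p by (simp add: f_all_def)
qed

lemma f_reg_imp: "f_reg P \<phi> \<Longrightarrow> f_reg P \<psi> \<Longrightarrow> f_reg P (f_imp P \<phi> \<psi>)"
  unfolding f_imp_def by (intro f_reg_not f_reg_and)

lemma f_reg_ex: "(\<And>x. f_reg P (\<Phi> x)) \<Longrightarrow> f_reg P (f_ex P \<Phi>)"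
  unfolding f_ex_def by (intro f_reg_not f_reg_all)

lemmas f_regs = f_reg_ground f_reg_in f_reg_and f_reg_not f_reg_all f_reg_imp f_reg_ex

lemma in_f_not: "p \<in> Field P \<Longrightarrow> p \<in> f_not P \<phi> \<longleftrightarrow> (\<forall>q. (q, p) \<in> P \<longrightarrow> q \<notin> \<phi>)"
  by (auto simp: f_not_def under_def)

lemma in_f_imp:
  assumes "f_reg P \<phi>" "f_reg P \<psi>" "p \<in> Field P"
  shows "p \<in> f_imp P \<phi> \<psi> \<longleftrightarrow> (\<forall>q. (q, p) \<in> P \<longrightarrow> q \<in> \<phi> \<longrightarrow> q \<in> \<psi>)"
proof
  assume L: "p \<in> f_imp P \<phi> \<psi>"
  show "\<forall>q. (q, p) \<in> P \<longrightarrow> q \<in> \<phi> \<longrightarrow> q \<in> \<psi>"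
  proof (intro allI impI)
    fix q assume q: "(q, p) \<in> P" "q \<in> \<phi>"
    have "\<exists>u\<in>under P t. u \<in> \<psi>" if t: "t \<in> under P q" for t
    proof -
      have t': "(t, q) \<in> P" using t by (simp add: under_def)
      have "t \<in> \<phi>" using assms(1) q(2) t' unfolding f_reg_def by blast
      moreover have "t \<notin> \<phi> \<inter> f_not P \<psi>"
        using L P_trans[OF t' q(1)] in_f_not[OF assms(3), of "\<phi> \<inter> f_not P \<psi>"]
        unfolding f_imp_def f_and_def by simp
      ultimately have "t \<notin> f_not P \<psi>" by simp
      then show ?thesis using P_Field(1)[OF t'] by (simp add: f_not_def)
    qed
    then show "q \<in> \<psi>" by (intro f_reg_dense[OF assms(2) P_Field(1)[OF q(1)]]) simp
  qed
next
  assume R: "\<forall>q. (q, p) \<in> P \<longrightarrow> q \<in> \<phi> \<longrightarrow> q \<in> \<psi>"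
  have "q \<notin> \<phi> \<inter> f_not P \<psi>" if q: "(q, p) \<in> P" for q
    using R q P_refl[OF P_Field(1)[OF q]] in_f_not[OF P_Field(1)[OF q], of \<psi>] by blast
  then show "p \<in> f_imp P \<phi> \<psi>"
    using in_f_not[OF assms(3), of "\<phi> \<inter> f_not P \<psi>"] by (simp add: f_imp_def f_and_def)
qed

lemma in_f_ex:
  assumes "p \<in> Field P"
  shows "p \<in> f_ex P \<Phi> \<longleftrightarrow> (\<forall>q. (q, p) \<in> P \<longrightarrow> (\<exists>t x. (t, q) \<in> P \<and> t \<in> \<Phi> x))"
proof -
  have "q \<in> f_all P (\<lambda>x. f_not P (\<Phi> x)) \<longleftrightarrow> \<not> (\<exists>t x. (t, q) \<in> P \<and> t \<in> \<Phi> x)" if "q \<in> Field P" for q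
    using that by (auto simp: f_not_def f_all_def under_def)
  then show ?thesis using assms P_Field(1) by (auto simp: f_ex_def f_not_def under_def)
qed

lemma in_f_all: "p \<in> Field P \<Longrightarrow> p \<in> f_all P \<Phi> \<longleftrightarrow> (\<forall>x. p \<in> \<Phi> x)"
  by (auto simp: f_all_def)

lemma in_ground: "p \<in> Field P \<Longrightarrow> p \<in> ground P b \<longleftrightarrow> b"
  by (auto simp: ground_def)

lemma in_f_and: "p \<in> (\<phi> \<^bold>\<and> \<psi>) \<longleftrightarrow> p \<in> \<phi> \<and> p \<in> \<psi>"
  by (auto simp: f_and_def)

lemma in_f_ball:
  assumes "\<And>x. f_reg P (\<Phi> x)" "p \<in> Field P"
  shows "p \<in> f_ball P X \<Phi> \<longleftrightarrow> (\<forall>x\<in>X. p \<in> \<Phi> x)"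
proof -
  have "p \<in> f_ball P X \<Phi> \<longleftrightarrow> (\<forall>x. \<forall>q. (q, p) \<in> P \<longrightarrow> x \<in> X \<longrightarrow> q \<in> \<Phi> x)"
    by (auto simp: f_ball_def in_f_all in_f_imp assms f_regs in_ground P_Field)
  then show ?thesis using assms P_refl[OF assms(2)] unfolding f_reg_def by blast
qed

text \<open>
  \<open>V t a y\<close> is to be read as: \<open>t\<close> extends \<open>q\<close> and forces a given cofinal map to send \<open>a\<close> to \<open>y\<close>.
\<close>

definition vcof :: "'p \<Rightarrow> 'b set \<Rightarrow> 'o rel \<Rightarrow> ('p \<Rightarrow> 'b \<Rightarrow> 'o \<Rightarrow> bool) \<Rightarrow> bool" where
  "vcof q A r V \<longleftrightarrow>
     (\<forall>t u a y. V t a y \<and> (u, t) \<in> P \<longrightarrow> V u a y) \<and>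
     (\<forall>t a y. V t a y \<longrightarrow> a \<in> A \<and> y \<in> Field r \<and> (t, q) \<in> P) \<and>
     (\<forall>a t. a \<in> A \<and> (t, q) \<in> P \<longrightarrow> (\<exists>u y. (u, t) \<in> P \<and> V u a y)) \<and>
     (\<forall>t a y y'. V t a y \<and> V t a y' \<longrightarrow> y = y') \<and>
     (\<forall>z t. z \<in> Field r \<and> (t, q) \<in> P \<longrightarrow> (\<exists>u a c. (u, t) \<in> P \<and> V u a c \<and> (z, c) \<in> r))"

lemma in_f_cofinal_map:
  assumes q: "q \<in> Field P"
  shows "q \<in> f_cofinal_map P F A r \<longleftrightarrow>
    (\<forall>x y t. (t, q) \<in> P \<and> t \<in> f_in P (x, y) F \<longrightarrow> x \<in> A \<and> y \<in> Field r) \<and>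
    (\<forall>x t. x \<in> A \<and> (t, q) \<in> P \<longrightarrow> (\<exists>u y. (u, t) \<in> P \<and> u \<in> f_in P (x, y) F)) \<and>
    (\<forall>x y y' t. (t, q) \<in> P \<and> t \<in> f_in P (x, y) F \<and> t \<in> f_in P (x, y') F \<longrightarrow> y = y') \<and>
    (\<forall>z t. z \<in> Field r \<and> (t, q) \<in> P \<longrightarrow> (\<exists>u a c. (u, t) \<in> P \<and> u \<in> f_in P (a, c) F \<and> (z, c) \<in> r))"
    (is "_ \<longleftrightarrow> ?a \<and> ?b \<and> ?c \<and> ?d")
proof -
  have a: "q \<in> (f_all P (\<lambda>x. f_all P (\<lambda>y. f_imp P (f_in P (x, y) F)
      (ground P (x \<in> A) \<^bold>\<and> ground P (y \<in> Field r))))) \<longleftrightarrow> ?a"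
    by (auto simp: q in_f_all in_f_imp f_regs in_f_and in_ground P_Field)
  have b0: "q \<in> f_all P (\<lambda>x. f_imp P (ground P (x \<in> A)) (f_ex P (\<lambda>y. f_in P (x, y) F)))
     \<longleftrightarrow> (\<forall>x t. x \<in> A \<and> (t, q) \<in> P \<longrightarrow> t \<in> f_ex P (\<lambda>y. f_in P (x, y) F))"
    by (auto simp: q in_f_all in_f_imp f_regs in_ground P_Field)
  also have "\<dots> \<longleftrightarrow> ?b"
  proof
    assume L: "\<forall>x t. x \<in> A \<and> (t, q) \<in> P \<longrightarrow> t \<in> f_ex P (\<lambda>y. f_in P (x, y) F)"
    show ?b
    proof (intro allI impI)
      fix x t assume h: "x \<in> A \<and> (t, q) \<in> P"
      then have "t \<in> Field P" by (blast dest: P_Field)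
      then show "\<exists>u y. (u, t) \<in> P \<and> u \<in> f_in P (x, y) F" using L h in_f_ex[of t "\<lambda>y. f_in P (x, y) F"] P_refl[of t] by simp
    qed
  next
    assume b: ?b
    show "\<forall>x t. x \<in> A \<and> (t, q) \<in> P \<longrightarrow> t \<in> f_ex P (\<lambda>y. f_in P (x, y) F)"
    proof (intro allI impI)
      fix x t assume h: "x \<in> A \<and> (t, q) \<in> P"
      then have "\<exists>v y. (v, u) \<in> P \<and> v \<in> f_in P (x, y) F" if "(u, t) \<in> P" for u
        using b P_trans[OF that, of q] by simp
      then show "t \<in> f_ex P (\<lambda>y. f_in P (x, y) F)" using in_f_ex[of t "\<lambda>y. f_in P (x, y) F"] P_Field(1)[of t q] h by simp
    qed
  qed
  finally have b: "q \<in> f_all P (\<lambda>x. f_imp P (ground P (x \<in> A)) (f_ex P (\<lambda>y. f_in P (x, y) F))) \<longleftrightarrow> ?b" .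
  have c: "q \<in> f_all P (\<lambda>x. f_all P (\<lambda>y. f_all P (\<lambda>y'. f_imp P (f_in P (x, y) F \<^bold>\<and> f_in P (x, y') F)
      (ground P (y = y'))))) \<longleftrightarrow> ?c"
    by (auto simp: q in_f_all in_f_imp f_regs in_f_and in_ground P_Field)
  have "q \<in> f_ball P (Field r) (\<lambda>b. f_ex P (\<lambda>a. f_ex P (\<lambda>c. f_in P (a, c) F \<^bold>\<and> ground P ((b, c) \<in> r))))
     \<longleftrightarrow> (\<forall>z\<in>Field r. q \<in> f_ex P (\<lambda>a. f_ex P (\<lambda>c. f_in P (a, c) F \<^bold>\<and> ground P ((z, c) \<in> r))))"
    by (rule in_f_ball) (auto intro!: f_regs q)
  also have "\<dots> \<longleftrightarrow> ?d"
  proof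
    assume L: "\<forall>z\<in>Field r. q \<in> f_ex P (\<lambda>a. f_ex P (\<lambda>c. f_in P (a, c) F \<^bold>\<and> ground P ((z, c) \<in> r)))"
    show ?d
    proof (intro allI impI)
      fix z t assume h: "z \<in> Field r \<and> (t, q) \<in> P"
      then obtain u a where u: "(u, t) \<in> P" "u \<in> f_ex P (\<lambda>c. f_in P (a, c) F \<^bold>\<and> ground P ((z, c) \<in> r))"
        using L in_f_ex[OF q] by meson
      then obtain v c where v: "(v, u) \<in> P" "v \<in> (f_in P (a, c) F \<^bold>\<and> ground P ((z, c) \<in> r))"
        using in_f_ex[OF P_Field(1)[OF u(1)]] P_refl[OF P_Field(1)[OF u(1)]] by meson
      then show "\<exists>u a c. (u, t) \<in> P \<and> u \<in> f_in P (a, c) F \<and> (z, c) \<in> r"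
        using P_trans[OF v(1) u(1)] by (auto simp: in_f_and ground_def)
    qed
  next
    assume d: ?d
    show "\<forall>z\<in>Field r. q \<in> f_ex P (\<lambda>a. f_ex P (\<lambda>c. f_in P (a, c) F \<^bold>\<and> ground P ((z, c) \<in> r)))"
    proof
      fix z assume z: "z \<in> Field r"
      have "\<exists>u a. (u, t) \<in> P \<and> u \<in> f_ex P (\<lambda>c. f_in P (a, c) F \<^bold>\<and> ground P ((z, c) \<in> r))"
        if t: "(t, q) \<in> P" for t
      proof -
        obtain u a c where u: "(u, t) \<in> P" "u \<in> f_in P (a, c) F" "(z, c) \<in> r" using d z t by blast
        have "v \<in> (f_in P (a, c) F \<^bold>\<and> ground P ((z, c) \<in> r))" if "(v, u) \<in> P" for v
          using f_reg_down[OF f_reg_in u(2) that] u(3) P_Field(1)[OF that] by (simp add: in_f_and in_ground)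
        then have "u \<in> f_ex P (\<lambda>c. f_in P (a, c) F \<^bold>\<and> ground P ((z, c) \<in> r))"
          using in_f_ex[OF P_Field(1)[OF u(1)]] P_refl[OF P_Field(1)] by meson
        then show ?thesis using u by blast
      qed
      then show "q \<in> f_ex P (\<lambda>a. f_ex P (\<lambda>c. f_in P (a, c) F \<^bold>\<and> ground P ((z, c) \<in> r)))"
        unfolding in_f_ex[OF q] by simp
    qed
  qed
  finally show ?thesis
    unfolding f_cofinal_map_def f_fun_def in_f_and a b c by (simp only: conj_assoc)
qed

lemma vcofI:
  assumes q: "q \<in> Field P" and F: "q \<in> f_cofinal_map P F A r"
  shows "vcof q A r (\<lambda>t a y. (t, q) \<in> P \<and> t \<in> f_in P (a, y) F)"
proof -
  have d: "u \<in> f_in P (a, y) F" if "t \<in> f_in P (a, y) F" "(u, t) \<in> P" for t u a y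
    using f_reg_down[OF f_reg_in] that .
  note F' = F[unfolded in_f_cofinal_map[OF q]]
  show ?thesis
    unfolding vcof_def
  proof (intro conjI allI impI)
    fix a t assume "a \<in> A \<and> (t, q) \<in> P"
    then obtain u y where "(u, t) \<in> P" "u \<in> f_in P (a, y) F" "(t, q) \<in> P" using F' by meson
    then show "\<exists>u y. (u, t) \<in> P \<and> (u, q) \<in> P \<and> u \<in> f_in P (a, y) F" using P_trans by meson
  next
    fix z t assume "z \<in> Field r \<and> (t, q) \<in> P"
    then obtain u a c where "(u, t) \<in> P" "u \<in> f_in P (a, c) F" "(z, c) \<in> r" "(t, q) \<in> P" using F' by meson
    then show "\<exists>u a c. (u, t) \<in> P \<and> ((u, q) \<in> P \<and> u \<in> f_in P (a, c) F) \<and> (z, c) \<in> r" using P_trans by meson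
  next
    fix t u a y assume "((t, q) \<in> P \<and> t \<in> f_in P (a, y) F) \<and> (u, t) \<in> P"
    then show "(u, q) \<in> P" "u \<in> f_in P (a, y) F" using d P_trans by meson+
  qed (use F' in meson)+
qed

lemma vcofD:
  assumes q: "q \<in> Field P" and V: "vcof q A r V"
  shows "q \<in> f_cofinal_map P {((a, y), t). V t a y} A r"
proof -
  let ?F = "{((a, y), t). V t a y}"
  have V1: "V t a y \<Longrightarrow> (u, t) \<in> P \<Longrightarrow> V u a y"
    and V2: "V t a y \<Longrightarrow> a \<in> A \<and> y \<in> Field r \<and> (t, q) \<in> P"
    and V3: "a \<in> A \<Longrightarrow> (t, q) \<in> P \<Longrightarrow> \<exists>u y. (u, t) \<in> P \<and> V u a y"
    and V4: "V t a y \<Longrightarrow> V t a y' \<Longrightarrow> y = y'"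
    and V5: "z \<in> Field r \<Longrightarrow> (t, q) \<in> P \<Longrightarrow> \<exists>u a c. (u, t) \<in> P \<and> V u a c \<and> (z, c) \<in> r"
    for t u a y y' z using V unfolding vcof_def by meson+
  have i: "t \<in> f_in P (a, y) ?F" if "V t a y" for t a y
  proof -
    have "t \<in> Field P" using V2[OF that] P_Field(1) by meson
    moreover have "\<exists>w\<in>under P v. \<exists>s. ((a, y), s) \<in> ?F \<and> (w, s) \<in> P" if "(v, t) \<in> P" for v
      using V1[OF \<open>V t a y\<close> that] P_refl[OF P_Field(1)[OF that]]
      by (intro bexI[of _ v] exI[of _ v]) (simp_all add: under_def)
    ultimately show ?thesis unfolding f_in_def by (simp add: under_def)
  qed
  have e: "\<exists>v. (v, t) \<in> P \<and> V v a y" if "t \<in> f_in P (a, y) ?F" for t a y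
  proof -
    have "t \<in> under P t" using that P_refl[of t] by (simp add: f_in_def under_def)
    moreover have "\<forall>u\<in>under P t. \<exists>v\<in>under P u. \<exists>s. V s a y \<and> (v, s) \<in> P" using that by (simp add: f_in_def)
    ultimately obtain v s where "v \<in> under P t" "V s a y" "(v, s) \<in> P" by meson
    then have "(v, t) \<in> P" "V s a y" "(v, s) \<in> P" by (simp_all add: under_def)
    then show ?thesis using V1 by meson
  qed
  have d: "u \<in> f_in P (a, y) ?F" if "t \<in> f_in P (a, y) ?F" "(u, t) \<in> P" for t u a y
    using f_reg_down[OF f_reg_in] that .
  show ?thesis
    unfolding in_f_cofinal_map[OF q]
  proof (intro conjI allI impI)
    fix x y y' t assume "(t, q) \<in> P \<and> t \<in> f_in P (x, y) ?F \<and> t \<in> f_in P (x, y') ?F"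
    then obtain v w where "(v, t) \<in> P" "V v x y" "(w, v) \<in> P" "V w x y'" using e d by meson
    then show "y = y'" using V1 V4 by blast
  next
    fix x y t assume "(t, q) \<in> P \<and> t \<in> f_in P (x, y) ?F"
    then show "x \<in> A" "y \<in> Field r" using e V2 by meson+
  next
    fix x t assume "x \<in> A \<and> (t, q) \<in> P"
    then show "\<exists>u y. (u, t) \<in> P \<and> u \<in> f_in P (x, y) ?F" using V3 i by meson
  next
    fix z t assume "z \<in> Field r \<and> (t, q) \<in> P"
    then show "\<exists>u a c. (u, t) \<in> P \<and> u \<in> f_in P (a, c) ?F \<and> (z, c) \<in> r" using V5 i by meson
  qed
qed

lemma has_cof_forced_iff:
  fixes r :: "'o rel" and s :: "'b rel"
  shows "forced P (f_has_cof P r s) \<longleftrightarrow>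
     (\<forall>q\<in>Field P. \<forall>p. (p, q) \<in> P \<longrightarrow> (\<exists>u V. (u, p) \<in> P \<and> vcof u (Field s) r V)) \<and>
     (\<forall>q\<in>Field P. \<forall>b\<in>Field s. \<forall>V. \<not> vcof q (underS s b) r V)" (is "_ \<longleftrightarrow> ?R")
proof -
  have reg: "f_reg P (f_cofinal_map P F A r)" for F :: "(('b \<times> 'o) \<times> 'p) set" and A
    unfolding f_cofinal_map_def f_fun_def f_ball_def by (intro f_regs)
  have vc: "(\<exists>F. q \<in> f_cofinal_map P F A r) \<longleftrightarrow> (\<exists>V. vcof q A r V)" if "q \<in> Field P" for q and A :: "'b set"
    using vcofI[OF that] vcofD[OF that] by blast
  have 1: "q \<in> f_ex P (\<lambda>F. f_cofinal_map P F A r) \<longleftrightarrow> (\<forall>p. (p, q) \<in> P \<longrightarrow> (\<exists>u V. (u, p) \<in> P \<and> vcof u A r V))"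
    if "q \<in> Field P" for q and A :: "'b set"
    unfolding in_f_ex[OF that]
  proof -
    have "(\<exists>F. (u, p) \<in> P \<and> u \<in> f_cofinal_map P F A r) \<longleftrightarrow> (\<exists>V. (u, p) \<in> P \<and> vcof u A r V)" for u p
      using vc[of u A] P_Field(1)[of u p] by auto
    then show "(\<forall>p. (p, q) \<in> P \<longrightarrow> (\<exists>u F. (u, p) \<in> P \<and> u \<in> f_cofinal_map P F A r)) \<longleftrightarrow>
        (\<forall>p. (p, q) \<in> P \<longrightarrow> (\<exists>u V. (u, p) \<in> P \<and> vcof u A r V))" by simp
  qed
  have 2: "(\<forall>q\<in>Field P. q \<in> f_ball P (Field s) (\<lambda>b. f_not P (f_ex P (\<lambda>F. f_cofinal_map P F (underS s b) r))))
     \<longleftrightarrow> (\<forall>q\<in>Field P. \<forall>b\<in>Field s. \<forall>V. \<not> vcof q (underS s b) r V)"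
  proof -
    have "q \<in> f_ball P (Field s) (\<lambda>b. f_not P (f_ex P (\<lambda>F. f_cofinal_map P F (underS s b) r)))
       \<longleftrightarrow> (\<forall>b\<in>Field s. \<forall>p. (p, q) \<in> P \<longrightarrow> p \<notin> f_ex P (\<lambda>F. f_cofinal_map P F (underS s b) r))"
      if "q \<in> Field P" for q
      using in_f_ball[of "\<lambda>b. f_not P (f_ex P (\<lambda>F. f_cofinal_map P F (underS s b) r))", OF _ that]
        in_f_not[OF that] by (simp add: f_regs reg)
    moreover have "p \<in> f_ex P (\<lambda>F. f_cofinal_map P F A r)" if vp: "vcof p A r V" and pF: "p \<in> Field P" for p V and A :: "'b set"
    proof -
      obtain F where "p \<in> f_cofinal_map P F A r" using vc[OF pF] vp by meson
      then have "u \<in> f_cofinal_map P F A r" if "(u, p) \<in> P" for u using f_reg_down[OF reg _ that] by simp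
      then show ?thesis unfolding in_f_ex[OF pF] using P_refl[OF P_Field(1)] by meson
    qed
    moreover have "\<exists>u V. u \<in> Field P \<and> vcof u A r V"
      if "p \<in> f_ex P (\<lambda>F. f_cofinal_map P F A r)" "p \<in> Field P" for p and A :: "'b set"
      using that(1) P_refl[OF that(2)] P_Field(1) unfolding 1[OF that(2)] by meson
    ultimately show ?thesis using P_refl P_Field(1) by meson
  qed
  have "forced P (f_has_cof P r s) \<longleftrightarrow> (\<forall>q\<in>Field P. q \<in> f_ex P (\<lambda>F. f_cofinal_map P F (Field s) r)) \<and>
    (\<forall>q\<in>Field P. q \<in> f_ball P (Field s) (\<lambda>b. f_not P (f_ex P (\<lambda>F. f_cofinal_map P F (underS s b) r))))"
    unfolding forced_def f_has_cof_def in_f_and subset_iff by blast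
  then show ?thesis using 1 2 by simp
qed

end

lemma cofinality_preserving_all_ordinals:
  fixes P :: "'p rel" and r :: "'o rel" and s :: "'b rel"
  assumes P: "Preorder P" and cp: "cofinality_preserving P"
    and r: "Well_order r" and s: "Well_order s" and rs: "has_cof r s"
  shows "forced P (f_has_cof P r s)"
  unfolding has_cof_forced_iff[OF P]
proof (intro conjI ballI allI impI notI)
  obtain h where h: "cofinal_map h (Field s) r" using rs by (auto simp: has_cof_def)
  have nc: "\<not> cofinal_map g (underS s b) r" if "b \<in> Field s" for g b
    using rs that by (auto simp: has_cof_def)
  have r_lin: "(x, y) \<in> r \<or> (y, x) \<in> r" if "x \<in> Field r" "y \<in> Field r" for x y
    using r that by (cases "x = y") (auto simp: order_on_defs refl_on_def total_on_def)
  have r_trans: "(x, z) \<in> r" if "(x, y) \<in> r" "(y, z) \<in> r" for x y z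
    using r that by (auto simp: order_on_defs dest: transD)
  have s_lin: "a \<in> underS s b \<or> (b, a) \<in> s" if "a \<in> Field s" "b \<in> Field s" for a b
    using s that by (cases "a = b") (auto simp: order_on_defs refl_on_def total_on_def underS_def)
  have s_refl: "(a, a) \<in> s" if "a \<in> Field s" for a
    using s that by (auto simp: order_on_defs refl_on_def)
  have s_sub: "underS s b \<subseteq> Field s" for b by (auto simp: underS_def Field_def)
  {
    fix q p assume "q \<in> Field P" "(p, q) \<in> P"
    then have p: "p \<in> Field P" "(p, p) \<in> P" using P_Field P_refl[OF P] by (metis P)+
    have "vcof P p (Field s) r (\<lambda>t a y. (t, p) \<in> P \<and> a \<in> Field s \<and> y = h a)"
      unfolding vcof_def[OF P]
    proof (intro conjI allI impI)
      fix t a y u assume "((t, p) \<in> P \<and> a \<in> Field s \<and> y = h a) \<and> (u, t) \<in> P"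
      then show "(u, p) \<in> P" "a \<in> Field s" "y = h a" using P_trans[OF P, of u t p] by simp_all
    next
      fix a t assume "a \<in> Field s \<and> (t, p) \<in> P"
      then show "\<exists>u y. (u, t) \<in> P \<and> (u, p) \<in> P \<and> a \<in> Field s \<and> y = h a"
        using P_refl[OF P P_Field(1)[OF P, of t p]] by auto
    next
      fix z t assume zt: "z \<in> Field r \<and> (t, p) \<in> P"
      then obtain a where "a \<in> Field s" "(z, h a) \<in> r" using h by (auto simp: cofinal_map_def)
      then show "\<exists>u a c. (u, t) \<in> P \<and> ((u, p) \<in> P \<and> a \<in> Field s \<and> c = h a) \<and> (z, c) \<in> r"
        using zt P_refl[OF P P_Field(1)[OF P, of t p]] by auto
    qed (use h in \<open>auto simp: cofinal_map_def\<close>)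
    then show "\<exists>u V. (u, p) \<in> P \<and> vcof P u (Field s) r V" using p by blast
  }
  fix q b V assume q: "q \<in> Field P" and b: "b \<in> Field s" and V: "vcof P q (underS s b) r V"
  have V1: "V t a y \<Longrightarrow> (u, t) \<in> P \<Longrightarrow> V u a y"
    and V2: "V t a y \<Longrightarrow> a \<in> underS s b \<and> y \<in> Field r \<and> (t, q) \<in> P"
    and V3: "a \<in> underS s b \<Longrightarrow> (t, q) \<in> P \<Longrightarrow> \<exists>u y. (u, t) \<in> P \<and> V u a y"
    and V4: "V t a y \<Longrightarrow> V t a y' \<Longrightarrow> y = y'"
    and V5: "z \<in> Field r \<Longrightarrow> (t, q) \<in> P \<Longrightarrow> \<exists>u a c. (u, t) \<in> P \<and> V u a c \<and> (z, c) \<in> r"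
    for t u a y y' z using V unfolding vcof_def[OF P] by meson+
  show False
  proof (cases "|Field s| \<le>o |UNIV :: 'p set|")
    case True
    then obtain e :: "'b \<Rightarrow> 'p" where e: "inj_on e (Field s)" by (auto simp flip: card_of_ordLeq)
    define s' where "s' = dir_image s e"
    have s': "Well_order s'" "Field s' = e ` Field s"
      using Well_order_dir_image[OF s e] by (simp_all add: s'_def dir_image_Field)
    have s'_in: "(e a, e c) \<in> s' \<longleftrightarrow> (a, c) \<in> s" if "a \<in> Field s" "c \<in> Field s" for a c
    proof
      assume "(e a, e c) \<in> s'"
      then obtain a' c' where ac: "e a = e a'" "e c = e c'" "(a', c') \<in> s"
        by (auto simp: s'_def dir_image_def)
      then have "a' \<in> Field s" "c' \<in> Field s" by (auto simp: Field_def)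
      then have "a = a'" "c = c'" using ac that inj_onD[OF e] by simp_all
      then show "(a, c) \<in> s" using ac by simp
    next
      assume "(a, c) \<in> s"
      then show "(e a, e c) \<in> s'" by (auto simp: s'_def dir_image_def)
    qed
    have us': "underS s' (e a) = e ` underS s a" if "a \<in> Field s" for a
    proof (intro set_eqI iffI)
      fix x assume x: "x \<in> underS s' (e a)"
      then have "x \<in> Field s'" by (auto simp: underS_def Field_def)
      then obtain c where "x = e c" "c \<in> Field s" using s' by auto
      then show "x \<in> e ` underS s a" using x that s'_in by (auto simp: underS_def)
    next
      fix x assume "x \<in> e ` underS s a"
      then obtain c where "x = e c" "c \<in> Field s" "(c, a) \<in> s" "c \<noteq> a"
        using s_sub by (auto simp: underS_def)
      then show "x \<in> underS s' (e a)" using that s'_in e by (auto simp: underS_def inj_on_def)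
    qed
    have bound: "\<exists>z\<in>Field r. \<forall>c\<in>underS s c0. (z, h c) \<notin> r" if "c0 \<in> Field s" for c0
      using nc[OF that, of h] h s_sub[of c0] by (auto simp: cofinal_map_def)
    have ub: "\<exists>z\<in>Field r. \<forall>c. (c, c0) \<in> s \<longrightarrow> (h c, z) \<in> r" if c0: "c0 \<in> Field s" for c0
    proof -
      have hF: "h c \<in> Field r" if "c \<in> Field s" for c using h that by (auto simp: cofinal_map_def)
      obtain z where z: "z \<in> Field r" "\<forall>c\<in>underS s c0. (z, h c) \<notin> r" using bound[OF c0] by blast
      have z': "(h c, z) \<in> r" if "c \<in> underS s c0" for c
        using z that r_lin[OF z(1) hF] s_sub by blast
      show ?thesis
      proof (cases "(z, h c0) \<in> r")
        case True
        have "(h c, h c0) \<in> r" if "(c, c0) \<in> s" for c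
        proof (cases "c = c0")
          case False
          then have "(h c, z) \<in> r" using z' that by (simp add: underS_def)
          then show ?thesis using True by (rule r_trans)
        qed (use r_lin[OF hF hF, OF c0 c0] in simp)
        then show ?thesis using hF[OF c0] by blast
      next
        case False
        then have "(h c0, z) \<in> r" using r_lin[OF z(1) hF[OF c0]] by blast
        then have "(h c, z) \<in> r" if "(c, c0) \<in> s" for c
          using z'[of c] that by (cases "c = c0") (simp_all add: underS_def)
        then show ?thesis using z(1) by blast
      qed
    qed
    then obtain h2 where h2: "\<And>c0. c0 \<in> Field s \<Longrightarrow> h2 c0 \<in> Field r \<and> (\<forall>c. (c, c0) \<in> s \<longrightarrow> (h c, h2 c0) \<in> r)"
      by metis
    have "has_cof s' s'"
      unfolding has_cof_def
    proof (intro conjI ballI notI)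
      show "\<exists>f. cofinal_map f (Field s') s'"
        using s'(1) by (intro exI[of _ id]) (auto simp: cofinal_map_def order_on_defs refl_on_def)
      fix b' assume "b' \<in> Field s'" and "\<exists>f. cofinal_map f (underS s' b') s'"
      then obtain a g where a: "a \<in> Field s" and g: "cofinal_map g (e ` underS s a) s'"
        using s' us' by auto
      define k where "k = (\<lambda>c. inv_into (Field s) e (g (e c)))"
      have k: "k c \<in> Field s" "e (k c) = g (e c)" if "c \<in> underS s a" for c
        using g that s'(2) by (auto simp: k_def cofinal_map_def image_subset_iff inv_into_into f_inv_into_f)
      have "cofinal_map (h2 \<circ> k) (underS s a) r"
        unfolding cofinal_map_def
      proof (intro conjI ballI)
        show "(h2 \<circ> k) ` underS s a \<subseteq> Field r" using k h2 by auto
        fix x assume "x \<in> Field r"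
        then obtain c where c: "c \<in> Field s" "(x, h c) \<in> r" using h by (auto simp: cofinal_map_def)
        then obtain d where d: "d \<in> underS s a" "(e c, g (e d)) \<in> s'"
          using g s'(2) by (auto simp: cofinal_map_def)
        then have "(c, k d) \<in> s" using k[OF d(1)] s'_in c by metis
        then have "(h c, h2 (k d)) \<in> r" using h2 k(1)[OF d(1)] by blast
        with c(2) have "(x, h2 (k d)) \<in> r" by (rule r_trans)
        then show "\<exists>d\<in>underS s a. (x, (h2 \<circ> k) d) \<in> r" using d(1) by auto
      qed
      then show False using nc a by blast
    qed
    then have "forced P (f_has_cof P s' s')" using cp s'(1) by (simp add: cofinality_preserving_def)
    then have "\<forall>q\<in>Field P. \<forall>b\<in>Field s'. \<forall>V. \<not> vcof P q (underS s' b) s' V"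
      unfolding has_cof_forced_iff[OF P] by (rule conjunct2)
    then have no: "\<not> vcof P q (underS s' (e b)) s' V'" for V' using q b s'(2) by simp
    have "\<exists>c. c \<in> Field s \<and> (y, h c) \<in> r" if "y \<in> Field r" for y
      using h that by (auto simp: cofinal_map_def)
    then obtain L where L: "\<And>y. y \<in> Field r \<Longrightarrow> L y \<in> Field s \<and> (y, h (L y)) \<in> r" by metis
    define V' where "V' = (\<lambda>t a' c'. \<exists>a y. V t a y \<and> a' = e a \<and> c' = e (L y))"
    have "vcof P q (underS s' (e b)) s' V'"
      unfolding vcof_def[OF P]
    proof (intro conjI allI impI)
      fix t u a y assume "V' t a y \<and> (u, t) \<in> P"
      then show "V' u a y" using V1 unfolding V'_def by blast
    next
      fix t a y assume "V' t a y"
      then show "a \<in> underS s' (e b)" "y \<in> Field s'" "(t, q) \<in> P"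
        using V2 L b us' s' unfolding V'_def by blast+
    next
      fix a t assume "a \<in> underS s' (e b) \<and> (t, q) \<in> P"
      then show "\<exists>u y. (u, t) \<in> P \<and> V' u a y" using V3 us'[OF b] unfolding V'_def by blast
    next
      fix t a y y' assume "V' t a y \<and> V' t a y'"
      then show "y = y'" using V4 V2 e s_sub unfolding V'_def inj_on_def by (metis subsetD)
    next
      fix z t assume zt: "z \<in> Field s' \<and> (t, q) \<in> P"
      then obtain c0 where c0: "z = e c0" "c0 \<in> Field s" using s' by auto
      obtain x where x: "x \<in> Field r" "\<forall>c\<in>underS s c0. (x, h c) \<notin> r" using bound[OF c0(2)] by blast
      obtain u a c where u: "(u, t) \<in> P" "V u a c" "(x, c) \<in> r" using V5 x zt by blast
      have Lc: "L c \<in> Field s" "(c, h (L c)) \<in> r" using L V2[OF u(2)] by auto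
      then have "L c \<notin> underS s c0" using x r_trans u(3) by blast
      then have "(c0, L c) \<in> s" using s_lin Lc c0 by blast
      then have "(z, e (L c)) \<in> s'" using s'_in c0 Lc by blast
      then show "\<exists>u a c. (u, t) \<in> P \<and> V' u a c \<and> (z, c) \<in> s'" using u unfolding V'_def by blast
    qed
    then show False using no by blast
  next
    case False
    then have big: "|UNIV :: 'p set| <o |Field s|" by (simp add: not_ordLeq_iff_ordLess card_of_Well_order)
    have small: False if Y: "Y \<subseteq> Field r" "\<forall>z\<in>Field r. \<exists>c\<in>Y. (z, c) \<in> r" "|Y| <o |Field s|" for Y
    proof -
      have "|Y| <o s" using Y(3) card_of_least[OF s] by (rule ordLess_ordLeq_trans)
      then obtain d where d: "d \<in> Field s" "|Y| =o Restr s (underS s d)"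
        using ordLess_iff_ordIso_Restr[OF s card_of_Well_order] by blast
      have "Field (Restr s (underS s d)) = underS s d"
      proof
        show "Field (Restr s (underS s d)) \<subseteq> underS s d" by (auto simp: Field_def)
        show "underS s d \<subseteq> Field (Restr s (underS s d))"
        proof
          fix x assume "x \<in> underS s d"
          then have "(x, x) \<in> Restr s (underS s d)" using s_refl s_sub by blast
          then show "x \<in> Field (Restr s (underS s d))" by (rule FieldI1)
        qed
      qed
      then obtain g where "bij_betw g (underS s d) Y"
        using d(2)[THEN ordIso_symmetric] unfolding ordIso_def iso_def by (auto simp: Field_card_of)
      then have "cofinal_map g (underS s d) r" using Y by (auto simp: cofinal_map_def bij_betw_def)
      then show False using nc d by blast
    qed
    have bs: "|underS s b| <o |Field s|"
    proof (rule ccontr)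
      assume "\<not> ?thesis"
      then have "|Field s| \<le>o |underS s b|" by (simp add: not_ordLess_iff_ordLeq card_of_Well_order)
      then obtain g where "g ` underS s b = Field s" using card_of_ordLeq2[of "Field s" "underS s b"] b by blast
      then have "cofinal_map (h \<circ> g) (underS s b) r"
        using h unfolding cofinal_map_def image_comp[symmetric] by (auto; metis imageE)
      then show False using nc b by blast
    qed
    have inf: "infinite (Field s)"
    proof
      assume fin: "finite (Field s)"
      have ne: "h ` Field s \<noteq> {}" using b by auto
      have "\<exists>m\<in>X. \<forall>x\<in>X. (x, m) \<in> r" if "finite X" "X \<noteq> {}" "X \<subseteq> Field r" for X
        using that
      proof (induction X rule: finite_ne_induct)
        case (singleton x) then show ?case using r_lin by auto
      next
        case (insert x X)
        then obtain m where "m \<in> X" "\<forall>x\<in>X. (x, m) \<in> r" by auto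
        then show ?case using insert.prems r_lin[of x m] r_lin[of x x] r_trans by (metis insert_iff insert_subset subsetD)
      qed
      then obtain m where m: "m \<in> h ` Field s" "\<forall>x\<in>h ` Field s. (x, m) \<in> r"
        using fin ne h by (metis cofinal_map_def finite_imageI)
      have "|{m}| <o |Field s|"
      proof -
        have "|{m}| \<le>o |UNIV :: 'p set|" by (rule card_of_singl_ordLeq) simp
        then show ?thesis using big ordLeq_ordLess_trans by blast
      qed
      moreover have "(z, m) \<in> r" if z: "z \<in> Field r" for z
      proof -
        obtain a where "a \<in> Field s" "(z, h a) \<in> r" using h z by (auto simp: cofinal_map_def)
        then show ?thesis using m(2) r_trans[of z "h a" m] by simp
      qed
      moreover have "m \<in> Field r" using m(1) h by (auto simp: cofinal_map_def)
      ultimately show False using small[of "{m}"] by simp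
    qed
    define Y where "Y = {y. \<exists>t a. V t a y}"
    have "Y \<subseteq> (\<lambda>(t, a). SOME y. V t a y) ` (UNIV \<times> underS s b)"
    proof
      fix y assume "y \<in> Y"
      then obtain t a where ta: "V t a y" by (auto simp: Y_def)
      then have "(SOME y. V t a y) = y" using V4 by (metis someI_ex)
      then show "y \<in> (\<lambda>(t, a). SOME y. V t a y) ` (UNIV \<times> underS s b)" using V2[OF ta] by force
    qed
    then have "|Y| \<le>o |(UNIV :: 'p set) \<times> underS s b|" by (rule surj_imp_ordLeq)
    moreover have "|(UNIV :: 'p set) \<times> underS s b| <o |Field s|"
    proof (cases "finite ((UNIV :: 'p set) <+> underS s b)")
      case True
      then have "finite ((UNIV :: 'p set) \<times> underS s b)" by simp
      then show ?thesis 
        using inf finite_ordLess_infinite[OF card_of_Well_order card_of_Well_order]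
        by (metis Field_card_of)
    next
      case False
      have "|(UNIV :: 'p set) \<times> underS s b| \<le>o |(UNIV :: 'p set) <+> underS s b|"
        by (rule card_of_Times_ordLeq_infinite_Field)
          (use False in \<open>simp_all add: Field_card_of card_of_Plus1 card_of_Plus2 card_of_card_order_on\<close>)
      then show ?thesis using card_of_Plus_ordLess_infinite[OF inf big bs] by (rule ordLeq_ordLess_trans)
    qed
    ultimately have "|Y| <o |Field s|" by (rule ordLeq_ordLess_trans)
    moreover have "Y \<subseteq> Field r" using V2 by (auto simp: Y_def)
    moreover have "\<forall>z\<in>Field r. \<exists>c\<in>Y. (z, c) \<in> r" 
    proof
      fix z assume "z \<in> Field r"
      then obtain u a c where "V u a c" "(z, c) \<in> r" using V5[OF _ P_refl[OF P q]] by meson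
      then show "\<exists>c\<in>Y. (z, c) \<in> r" by (auto simp: Y_def)
    qed
    ultimately show False using small by blast
  qed
qed

text \<open>
  \<open>r\<close> stands for \<open>\<kappa>\<^sup>+\<close>, which keeps its meaning in the extension since cofinalities are preserved;
  \<open>'p\<close> is the type of conditions.
\<close>

definition weakly_able_to_realize ::
    "'p itself \<Rightarrow> 'o rel \<Rightarrow> 'i set \<Rightarrow> ('i \<Rightarrow> 'x rel) \<Rightarrow> 'i rel \<Rightarrow> bool" where
  "weakly_able_to_realize _ r I T E \<longleftrightarrow>
     (\<forall>\<alpha>\<in>I. souslin_tree r (T \<alpha>) \<and> rigid (T \<alpha>)) \<and>
     (\<exists>P :: 'p rel. forcing_notion P \<and> cofinality_preserving P \<and>
        forced P (f_ball P I (\<lambda>\<alpha>. f_souslin_tree P r (T \<alpha>) \<^bold>\<and> f_rigid P (T \<alpha>))) \<and>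
        forced P (f_realizes P I T E))"

end

theory Submission
  imports Defs "HOL-Library.Z2" "HOL-Library.Function_Algebras" "HOL-Library.Product_Plus" HOL.Vector_Spaces
begin

text \<open>
  All trees are cut out of one tree \<open>W\<close> of groups of exponent two. The level \<open>W \<gamma>\<close> consists of pairs of a
  \<^emph>\<open>type\<close> (a finite subset of \<open>\<gamma>\<close>, added by symmetric difference) and a function from \<open>\<gamma>\<close> to two elements; the
  nodes of \<open>T\<^sub>\<alpha>\<close> on level \<open>\<gamma>\<close> are the functions whose type is \<open>{\<alpha>} \<inter> \<gamma>\<close>. At levels of cofinality \<open>< \<kappa>\<close> all branches
  are continued, and at levels of cofinality \<open>\<kappa>\<close> one continues a group that is generic enough to meet, along every
  linearly independent family of fewer than \<open>\<kappa>\<close> branches, the dense set of conditions guessed by the diamond sequence.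

  Given \<open>E\<close> with representatives \<open>m\<close>, one forces with fewer than \<open>\<kappa>\<close> coordinates at a time cofinal branches \<open>c\<^sub>\<xi>\<close> of \<open>W\<close> of
  type \<open>{\<xi>, m \<xi>}\<close> (for \<open>m \<xi> \<noteq> \<xi>\<close>); adding \<open>c\<^sub>\<xi>\<close> is an isomorphism between \<open>T\<^sub>\<xi>\<close> and the tree of \<open>m \<xi>\<close>. The forcing is
  \<open>< \<kappa>\<close>-closed, and sealing its antichains at generic levels gives the \<open>\<kappa>\<^sup>+\<close>-chain condition. The types of the
  \<open>c\<^sub>\<xi>\<close> together with the types \<open>{\<alpha>}\<close> and \<open>{\<beta>}\<close> are linearly independent unless \<open>\<alpha> E \<beta>\<close>, and for \<open>\<alpha> = \<beta>\<close> two different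
  nodes on one level stay independent over the \<open>c\<^sub>\<xi>\<close>. Hence forced chains and antichains are bounded by a generic level; and
  for a forced isomorphism between inequivalent trees, or a forced nontrivial automorphism, a generic level decides that it
  matches two independent nodes, although either of them can be extended in two incompatible ways without changing the other.
\<close>

text \<open>The levels are built without knowledge of \<open>E\<close>, whereas the forcing depends
  on \<open>E\<close>. A generic level therefore has to treat all independent families of fewer than
  \<open>\<kappa>\<close> branches alike, and slots are mere labels for the members of such a
  family. Independence is the exact limit of genericity: a sum of branches that vanishes in the
  group vanishes for ever, so no extension can move one of its terms and keep the others. Types make
  independence checkable, because a sum of nonzero type cannot vanish.

  Guessing only at cofinality \<open>\<kappa>\<close> serves both ends of the construction. A level
  of smaller cofinality can take all branches, since \<open>2^(<\<kappa>) = \<kappa>\<close> leaves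
  only \<open>\<kappa>\<close> many, and this provides lower bounds for short chains of conditions.
  At a level of cofinality \<open>\<kappa>\<close>, a chain of length \<open>\<kappa>\<close> that
  meets \<open>\<kappa>\<close> many requirements has all its proper initial parts bounded strictly
  below the level, so the recursion never gets stuck.\<close>

unbundle cardinal_syntax

section \<open>The combinatorial setting\<close>

text \<open>
  \<open>K\<close> is \<open>\<kappa>\<^sup>+\<close> as a well-order, \<open>S\<close> the set of ordinals of cofinality \<open>\<kappa>\<close>, and \<open>D\<close> the diamond sequence on \<open>S\<close>.
\<close>

locale diamond_setting =
  fixes \<kappa> :: "'k rel" and K :: "'o rel" and S :: "'o set" and D :: "'o \<Rightarrow> 'o set"
  assumes kappa: "Cinfinite \<kappa>" and stable: "stable \<kappa>" and K: "Well_order K"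
    and small: "\<And>\<delta>. |underS K \<delta>| \<le>o \<kappa>"
    and large: "\<not> |Field K| \<le>o \<kappa>"
    and bounded: "\<And>X. X \<subseteq> Field K \<Longrightarrow> |X| \<le>o \<kappa> \<Longrightarrow> \<exists>\<delta>\<in>Field K. X \<subseteq> underS K \<delta>"
    and few: "\<And>X :: 'o set. |X| \<le>o \<kappa> \<Longrightarrow> |{Y. Y \<subseteq> X \<and> |Y| <o \<kappa>}| \<le>o \<kappa>"
    and S_bounded: "\<And>\<delta> X. \<delta> \<in> S \<Longrightarrow> X \<subseteq> underS K \<delta> \<Longrightarrow> |X| <o \<kappa> \<Longrightarrow>
        \<exists>b\<in>underS K \<delta>. X \<subseteq> underS K b"
    and not_S: "\<And>\<delta>. \<delta> \<in> Field K \<Longrightarrow> \<delta> \<notin> S \<Longrightarrow>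
        \<exists>X\<subseteq>underS K \<delta>. |X| <o \<kappa> \<and> (\<forall>b\<in>underS K \<delta>. \<exists>s\<in>X. (b, s) \<in> K)"
    and guess: "\<And>A. A \<subseteq> Field K \<Longrightarrow> stationary K {\<alpha> \<in> S. A \<inter> underS K \<alpha> = D \<alpha>}"

section \<open>Cofinality and small sets below a successor cardinal\<close>

lemma Well_order_linear:
  assumes "Well_order r" "a \<in> Field r" "b \<in> Field r"
  shows "(a, b) \<in> r \<or> b \<in> underS r a"
proof (cases "a = b")
  case True
  then show ?thesis using assms by (simp add: order_on_defs refl_on_def)
next
  case False
  then show ?thesis using assms unfolding order_on_defs total_on_def underS_def by blast
qed

lemma Well_order_le_underS:
  assumes "Well_order r" "(a, b) \<in> r" "b \<in> underS r c"
  shows "a \<in> underS r c"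
proof -
  have "trans r" "antisym r" using assms(1) by (simp_all add: order_on_defs)
  then show ?thesis using assms(2,3) unfolding underS_def by (blast dest: transD antisymD)
qed

lemma underS_subset_Field: "underS r a \<subseteq> Field r"
  by (auto simp: underS_def Field_def)

lemma Field_seg:
  assumes "Well_order r" shows "Field (seg r a) = underS r a"
proof
  show "Field (seg r a) \<subseteq> underS r a" by (auto simp: seg_def Field_def)
  show "underS r a \<subseteq> Field (seg r a)"
  proof
    fix x assume x: "x \<in> underS r a"
    then have "(x, x) \<in> r" using assms by (auto simp: order_on_defs refl_on_def underS_def Field_def)
    then have "(x, x) \<in> seg r a" using x by (simp add: seg_def)
    then show "x \<in> Field (seg r a)" by (rule FieldI1)
  qed
qed

lemma well_order_less_imp_image_underS:
  assumes wo: "Well_order r" and "|X| <o r"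
  shows "\<exists>b\<in>Field r. \<exists>f. f ` underS r b = X"
proof -
  obtain b where b: "b \<in> Field r" "|X| =o Restr r (underS r b)"
    using assms(2) ordLess_iff_ordIso_Restr[OF wo card_of_Well_order] by blast
  have "Field (Restr r (underS r b)) = underS r b"
    using Field_seg[OF wo] by (simp add: seg_def)
  then obtain g where "bij_betw g (underS r b) X"
    using b(2)[THEN ordIso_symmetric] unfolding ordIso_def iso_def by (auto simp: Field_card_of)
  then show ?thesis using b(1) by (auto simp: bij_betw_def)
qed

text \<open>A set of size less than \<kappa> is the image of a proper initial segment of \<kappa>,
  and the minimality clause of \<open>has_cof\<close> says that such an image is never
  cofinal.\<close>

lemma CF_bounded:
  fixes \<kappa> :: "'a rel"
  assumes \<kappa>: "Cinfinite \<kappa>" and \<delta>: "\<delta> \<in> CF \<kappa>" and X: "X \<subseteq> underS (cardSuc \<kappa>) \<delta>" "|X| <o \<kappa>"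
  shows "\<exists>b\<in>underS (cardSuc \<kappa>) \<delta>. X \<subseteq> underS (cardSuc \<kappa>) b"
proof -
  let ?K = "cardSuc \<kappa>"
  have wo: "Well_order ?K" using \<kappa> by (simp add: cardSuc_Well_order)
  have "Well_order \<kappa>" using \<kappa> by (simp add: card_order_on_def)
  then obtain b f where b: "b \<in> Field \<kappa>" "f ` underS \<kappa> b = X"
    using well_order_less_imp_image_underS[OF _ X(2)] by blast
  have "\<not> cofinal_map f (underS \<kappa> b) (seg ?K \<delta>)"
    using \<delta> b by (auto simp: CF_def has_cof_def)
  then obtain c where c: "c \<in> underS ?K \<delta>" "\<forall>x\<in>X. (c, x) \<notin> seg ?K \<delta>"
    using b X(1) by (auto simp: cofinal_map_def Field_seg[OF wo])
  have "x \<in> underS ?K c" if x: "x \<in> X" for x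
  proof -
    have "(c, x) \<notin> ?K" using c x X(1) by (auto simp: seg_def)
    moreover have "c \<in> Field ?K" "x \<in> Field ?K" using c x X(1) by (auto simp: underS_def Field_def)
    ultimately show ?thesis using Well_order_linear[OF wo] by blast
  qed
  then show ?thesis using c by blast
qed

text \<open>A nonempty ordinal below the successor is an image of \<kappa>, so the first clause of
  \<open>has_cof\<close> always holds there. Outside \<open>CF \<kappa>\<close> it is the second
  clause that fails, and it yields a cofinal map on a proper initial segment of \<kappa>.\<close>

lemma not_CF_cofinal:
  fixes \<kappa> :: "'a rel"
  assumes \<kappa>: "Cinfinite \<kappa>" and \<delta>: "\<delta> \<in> Field (cardSuc \<kappa>)" "\<delta> \<notin> CF \<kappa>"
  shows "\<exists>X\<subseteq>underS (cardSuc \<kappa>) \<delta>. |X| <o \<kappa> \<and>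
    (\<forall>b\<in>underS (cardSuc \<kappa>) \<delta>. \<exists>s\<in>X. (b, s) \<in> cardSuc \<kappa>)"
proof (cases "underS (cardSuc \<kappa>) \<delta> = {}")
  case True
  have "|{} :: 'a set set| <o \<kappa>"
    using finite_ordLess_infinite[OF card_of_Well_order, of \<kappa> "{} :: 'a set set"] \<kappa>
    by (simp add: card_order_on_def Field_card_of cinfinite_def)
  then show ?thesis using True by auto
next
  case False
  let ?K = "cardSuc \<kappa>"
  have wo: "Well_order ?K" using \<kappa> by (simp add: cardSuc_Well_order)
  have Ck: "Card_order \<kappa>" using \<kappa> by simp
  have "|underS ?K \<delta>| <o ?K" using card_of_underS[OF cardSuc_Card_order[OF Ck] \<delta>(1)] .
  then have "|underS ?K \<delta>| \<le>o \<kappa>" using cardSuc_ordLeq_ordLess[OF Ck card_of_Card_order] by blast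
  then have "|underS ?K \<delta>| \<le>o |Field \<kappa>|"
    using card_of_Field_ordIso[OF Ck] ordLeq_ordIso_trans ordIso_symmetric by blast
  then have "\<exists>f. f ` Field \<kappa> = underS ?K \<delta>" using card_of_ordLeq2[OF False, of "Field \<kappa>"] by simp
  then obtain f where f: "f ` Field \<kappa> = underS ?K \<delta>" ..
  have refl: "(x, x) \<in> seg ?K \<delta>" if "x \<in> underS ?K \<delta>" for x
    using that wo by (auto simp: seg_def order_on_defs refl_on_def underS_def Field_def)
  have "cofinal_map f (Field \<kappa>) (seg ?K \<delta>)"
    unfolding cofinal_map_def Field_seg[OF wo]
  proof (intro conjI ballI)
    fix b assume b: "b \<in> underS ?K \<delta>"
    then obtain a where "a \<in> Field \<kappa>" "b = f a" using f by (metis imageE)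
    then show "\<exists>a\<in>Field \<kappa>. (b, f a) \<in> seg ?K \<delta>" using refl[OF b] by metis
  qed (use f in simp)
  then obtain b g where b: "b \<in> Field \<kappa>" "cofinal_map g (underS \<kappa> b) (seg ?K \<delta>)"
    using \<delta> by (auto simp: CF_def has_cof_def)
  have "|g ` underS \<kappa> b| <o \<kappa>"
    using card_of_image card_of_underS[OF Ck b(1)] ordLeq_ordLess_trans by blast
  moreover have "g ` underS \<kappa> b \<subseteq> underS ?K \<delta>" using b(2) by (simp add: cofinal_map_def Field_seg[OF wo])
  moreover have "\<forall>x\<in>underS ?K \<delta>. \<exists>s\<in>g ` underS \<kappa> b. (x, s) \<in> ?K"
    using b(2) unfolding cofinal_map_def Field_seg[OF wo] by (auto simp: seg_def)
  ultimately show ?thesis by blast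
qed

text \<open>A small cofinal subset of \<kappa> would cut a cofinal map on \<kappa> into few pieces,
  each of small size and hence bounded; by \<open>CF_bounded\<close> the bounds would be bounded as
  well. Regularity of \<kappa> is thus obtained from one ordinal of cofinality \<kappa>.\<close>

lemma regularCard_if_CF:
  fixes \<kappa> :: "'a rel"
  assumes \<kappa>: "Cinfinite \<kappa>" and \<delta>: "\<delta> \<in> CF \<kappa>"
  shows "regularCard \<kappa>"
  unfolding regularCard_def
proof (intro allI impI, elim conjE)
  fix X assume X: "X \<subseteq> Field \<kappa>" "cofinal X \<kappa>"
  let ?K = "cardSuc \<kappa>"
  have wo: "Well_order ?K" using \<kappa> by (simp add: cardSuc_Well_order)
  have Ck: "Card_order \<kappa>" using \<kappa> by simp
  obtain f where f: "cofinal_map f (Field \<kappa>) (seg ?K \<delta>)" using \<delta> by (auto simp: CF_def has_cof_def)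
  show "|X| =o \<kappa>"
  proof (rule ccontr)
    assume ne: "\<not> |X| =o \<kappa>"
    have "|X| \<le>o \<kappa>" using card_of_mono1[OF X(1)] card_of_Field_ordIso[OF Ck] ordLeq_ordIso_trans by blast
    then have less: "|X| <o \<kappa>" using ne by (simp add: ordLeq_iff_ordLess_or_ordIso)
    have "\<exists>b\<in>underS ?K \<delta>. f ` underS \<kappa> s \<subseteq> underS ?K b" if "s \<in> X" for s
    proof (rule CF_bounded[OF \<kappa> \<delta>])
      show "f ` underS \<kappa> s \<subseteq> underS ?K \<delta>"
        using f underS_subset_Field[of \<kappa> s] unfolding cofinal_map_def Field_seg[OF wo] by blast
      show "|f ` underS \<kappa> s| <o \<kappa>" using X that card_of_image card_of_underS[OF Ck] ordLeq_ordLess_trans by blast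
    qed
    then obtain g where g: "\<And>s. s \<in> X \<Longrightarrow> g s \<in> underS ?K \<delta> \<and> f ` underS \<kappa> s \<subseteq> underS ?K (g s)" by metis
    have "|g ` X| <o \<kappa>" using card_of_image less ordLeq_ordLess_trans by blast
    then obtain b where b: "b \<in> underS ?K \<delta>" "g ` X \<subseteq> underS ?K b"
      using CF_bounded[OF \<kappa> \<delta>, of "g ` X"] g by blast
    then obtain a where a: "a \<in> Field \<kappa>" "(b, f a) \<in> ?K"
      using f unfolding cofinal_map_def Field_seg[OF wo] by (auto simp: seg_def)
    obtain s where s: "s \<in> X" "a \<in> underS \<kappa> s" using X(2) a(1) by (auto simp: cofinal_def underS_def)
    have "f a \<in> underS ?K (g s)" "g s \<in> underS ?K b" using g[OF s(1)] s b by blast+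
    then have "f a \<in> underS ?K b" using Well_order_le_underS[OF wo, of "f a" "g s" b] by (simp add: underS_def)
    then have "b \<in> underS ?K b" using Well_order_le_underS[OF wo a(2)] by simp
    then show False by (simp add: underS_def)
  qed
qed

text \<open>After an injection into \<kappa>, regularity places a small subset inside a proper
  initial segment, where it is a binary sequence of length less than \<kappa>.\<close>

lemma few_small_subsets:
  fixes \<kappa> :: "'a rel" and X :: "'b set"
  assumes \<kappa>: "Cinfinite \<kappa>" and reg: "regularCard \<kappa>" and two: "two_less \<kappa> =o \<kappa>" and X: "|X| \<le>o \<kappa>"
  shows "|{Y. Y \<subseteq> X \<and> |Y| <o \<kappa>}| \<le>o \<kappa>"
proof -
  have Ck: "Card_order \<kappa>" using \<kappa> by simp
  have wo: "Well_order \<kappa>" using Ck by (simp add: card_order_on_def)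
  have "|X| \<le>o |Field \<kappa>|" using X card_of_Field_ordIso[OF Ck] ordLeq_ordIso_trans ordIso_symmetric by blast
  then obtain e where e: "inj_on e X" "e ` X \<subseteq> Field \<kappa>" by (auto simp flip: card_of_ordLeq)
  have "\<exists>a\<in>Field \<kappa>. e ` Y \<subseteq> underS \<kappa> a" if YX: "Y \<subseteq> X \<and> |Y| <o \<kappa>" for Y
  proof -
    have "|e ` Y| <o \<kappa>" using YX card_of_image ordLeq_ordLess_trans by blast
    then have "\<not> |e ` Y| =o \<kappa>" using not_ordLess_ordIso by blast
    moreover have "e ` Y \<subseteq> Field \<kappa>" using YX e(2) by (meson image_mono subset_trans)
    ultimately have "\<not> cofinal (e ` Y) \<kappa>" using reg[unfolded regularCard_def, rule_format, of "e ` Y"] by auto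
    then obtain a where a: "a \<in> Field \<kappa>" "\<forall>b\<in>e ` Y. a = b \<or> (a, b) \<notin> \<kappa>" by (auto simp: cofinal_def)
    obtain a' where a': "a' \<in> Field \<kappa>" "a \<noteq> a'" "(a, a') \<in> \<kappa>"
      using infinite_Card_order_limit[OF Ck _ a(1)] \<kappa> by (auto simp: cinfinite_def)
    have "b \<in> underS \<kappa> a'" if b: "b \<in> e ` Y" for b
    proof -
      have "b \<in> Field \<kappa>" using b e(2) YX by blast
      then have "(b, a) \<in> \<kappa>" using a b Well_order_linear[OF wo, of b a] by (auto simp: underS_def)
      then show ?thesis using a' Well_order_le_underS[OF wo, of b a a'] by (simp add: underS_def)
    qed
    then show ?thesis using a' by blast
  qed
  then obtain h where h: "\<And>Y. Y \<subseteq> X \<and> |Y| <o \<kappa> \<Longrightarrow> h Y \<in> Field \<kappa> \<and> e ` Y \<subseteq> underS \<kappa> (h Y)" by metis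
  \<comment> \<open>The value \<open>undefined\<close> outside the segment is what membership in
    \<open>Func\<close> demands.\<close>
  let ?c = "\<lambda>Y. (h Y, \<lambda>a. if a \<in> underS \<kappa> (h Y) then a \<in> e ` Y else undefined)"
  have "|{Y. Y \<subseteq> X \<and> |Y| <o \<kappa>}| \<le>o |SIGMA \<alpha>:Field \<kappa>. Func (underS \<kappa> \<alpha>) (UNIV :: bool set)|"
  proof (rule card_of_ordLeqI)
    show "inj_on ?c {Y. Y \<subseteq> X \<and> |Y| <o \<kappa>}"
    proof (rule inj_onI)
      fix Y Z assume Y: "Y \<in> {Y. Y \<subseteq> X \<and> |Y| <o \<kappa>}" and Z: "Z \<in> {Y. Y \<subseteq> X \<and> |Y| <o \<kappa>}" and eq: "?c Y = ?c Z"
      have hh: "h Y = h Z" using eq by simp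
      have "a \<in> e ` Y \<longleftrightarrow> a \<in> e ` Z" if "a \<in> underS \<kappa> (h Y)" for a
      proof -
        have "(if a \<in> underS \<kappa> (h Y) then a \<in> e ` Y else undefined) = (if a \<in> underS \<kappa> (h Z) then a \<in> e ` Z else undefined)"
          using eq by (metis (no_types, lifting) prod.inject)
        then show ?thesis using that hh by simp
      qed
      moreover have "e ` Y \<subseteq> underS \<kappa> (h Y)" "e ` Z \<subseteq> underS \<kappa> (h Y)" using h[of Y] h[of Z] Y Z hh by simp_all
      ultimately have "e ` Y = e ` Z" by blast
      then show "Y = Z" using e(1) Y Z by (simp add: inj_on_image_eq_iff)
    qed
    fix Y assume "Y \<in> {Y. Y \<subseteq> X \<and> |Y| <o \<kappa>}"
    then show "?c Y \<in> (SIGMA \<alpha>:Field \<kappa>. Func (underS \<kappa> \<alpha>) UNIV)" using h by (auto simp: Func_def)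
  qed
  then show ?thesis using two unfolding two_less_def by (rule ordLeq_ordIso_trans)
qed

lemma club_Field:
  assumes "Cinfinite K"
  shows "club K (Field K)"
  unfolding club_def using infinite_Card_order_limit[of K] assms by (auto simp: cinfinite_def)

lemma diamond_settingI:
  fixes \<kappa> :: "'a rel"
  assumes \<kappa>: "Cinfinite \<kappa>" and two: "two_less \<kappa> =o \<kappa>" and dia: "diamond (cardSuc \<kappa>) (CF \<kappa>)"
  shows "\<exists>D. diamond_setting \<kappa> (cardSuc \<kappa>) (CF \<kappa>) D"
proof -
  let ?K = "cardSuc \<kappa>"
  have Ck: "Card_order \<kappa>" and inf: "\<not> finite (Field \<kappa>)" using \<kappa> by (simp_all add: cinfinite_def)
  have CK: "Card_order ?K" using Ck by (rule cardSuc_Card_order)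
  have infK: "\<not> finite (Field ?K)" using cardSuc_finite[OF Ck] inf by simp
  obtain D where D: "\<And>A. A \<subseteq> Field ?K \<Longrightarrow> stationary ?K {\<alpha> \<in> CF \<kappa>. A \<inter> underS ?K \<alpha> = D \<alpha>}"
    using dia by (auto simp: diamond_def)
  \<comment> \<open>Guessing the empty set on the largest club yields a member of
    \<open>CF \<kappa>\<close>, and with it the regularity of \<kappa>.\<close>
  have "club ?K (Field ?K)" using CK infK by (intro club_Field) (simp add: cinfinite_def)
  then obtain \<delta> where \<delta>: "\<delta> \<in> CF \<kappa>" using D[of "{}"] by (fastforce simp: stationary_def)
  have reg: "regularCard \<kappa>" using regularCard_if_CF[OF \<kappa> \<delta>] .
  have regK: "regularCard ?K" using infinite_cardSuc_regularCard[OF inf Ck] .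
  have woK: "Well_order ?K" using CK by (simp add: card_order_on_def)
  show ?thesis
  proof (intro exI[of _ D] diamond_setting.intro)
    show "stable \<kappa>" using regularCard_stable[OF Ck inf reg] .
    show "|underS ?K \<delta>| \<le>o \<kappa>" for \<delta>
    proof (cases "\<delta> \<in> Field ?K")
      case True
      then show ?thesis using card_of_underS[OF CK] cardSuc_ordLeq_ordLess[OF Ck card_of_Card_order] by blast
    next
      case False
      then have "underS ?K \<delta> = {}" by (auto simp: underS_def Field_def)
      then show ?thesis using Card_order_empty[OF Ck] by simp
    qed
    show "\<not> |Field ?K| \<le>o \<kappa>"
    proof
      assume "|Field ?K| \<le>o \<kappa>"
      moreover have "|Field ?K| =o ?K" using CK by (rule card_of_Field_ordIso)
      ultimately have "?K \<le>o \<kappa>" using ordIso_ordLeq_trans ordIso_symmetric by blast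
      then show False using cardSuc_greater[OF Ck] not_ordLess_ordLeq by blast
    qed
    show "\<exists>\<delta>\<in>Field ?K. X \<subseteq> underS ?K \<delta>" if X: "X \<subseteq> Field ?K" "|X| \<le>o \<kappa>" for X
    proof -
      have "|X| <o ?K" using X(2) cardSuc_ordLeq_ordLess[OF Ck card_of_Card_order] by blast
      then have "\<not> |X| =o ?K" using not_ordLess_ordIso by blast
      then have "\<not> cofinal X ?K" using regK X(1) unfolding regularCard_def by blast
      then obtain a where a: "a \<in> Field ?K" "\<forall>b\<in>X. a = b \<or> (a, b) \<notin> ?K" by (auto simp: cofinal_def)
      obtain a' where a': "a' \<in> Field ?K" "a \<noteq> a'" "(a, a') \<in> ?K"
        using infinite_Card_order_limit[OF CK infK a(1)] by blast
      have "b \<in> underS ?K a'" if b: "b \<in> X" for b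
      proof -
        have "(b, a) \<in> ?K" using a b X Well_order_linear[OF woK, of b a] by (auto simp: underS_def)
        then show ?thesis using a' Well_order_le_underS[OF woK, of b a a'] by (simp add: underS_def)
      qed
      then show ?thesis using a' by blast
    qed
  qed (rule \<kappa> woK few_small_subsets[OF \<kappa> reg two] CF_bounded[OF \<kappa>] not_CF_cofinal[OF \<kappa>] D; assumption)+
qed

section \<open>Linear algebra over the field with two elements, and generic filters\<close>

lemma fun_bit_add_self [simp]: "(x :: 'o \<Rightarrow> bit) + x = 0"
  by (rule ext) (simp add: plus_fun_def)

lemma fun_bit_add_eq_0: "(x :: 'o \<Rightarrow> bit) + y = 0 \<longleftrightarrow> x = y"
  by (metis add.assoc add.left_neutral add.right_neutral fun_bit_add_self)

lemma fun_bit_add_cancel [simp]: "(x :: 'o \<Rightarrow> bit) + (x + y) = y"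
  by (simp flip: add.assoc)

lemma sum_fun_apply: "(\<Sum>i\<in>A. f i) x = (\<Sum>i\<in>A. f i (x :: 'o) :: 'b :: comm_monoid_add)"
  by (induction A rule: infinite_finite_induct) (auto simp: plus_fun_def zero_fun_def)

lemma fst_sum_prod: "fst (\<Sum>i\<in>A. f i) = (\<Sum>i\<in>A. fst (f i))"
  and snd_sum_prod: "snd (\<Sum>i\<in>A. f i) = (\<Sum>i\<in>A. snd (f i))"
  by (induction A rule: infinite_finite_induct) auto

text \<open>Independent characteristic functions can be sent to arbitrary values by a linear map,
  and \<psi> consists of the images of the unit vectors. Over the field with two elements a subgroup
  is a subspace. The lemma is used to correct generators so that given sums of them become given
  nodes.\<close>

lemma solve_independent_system:
  fixes F :: "'j \<Rightarrow> 'i set" and k :: "'j \<Rightarrow> 'o \<Rightarrow> bit"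
  assumes fin: "\<And>j. j \<in> d \<Longrightarrow> finite (F j)"
    and indep: "\<And>A. finite A \<Longrightarrow> A \<subseteq> d \<Longrightarrow> A \<noteq> {} \<Longrightarrow> (\<Sum>j\<in>A. (\<lambda>i. of_bool (i \<in> F j) :: bit)) \<noteq> 0"
    and G: "0 \<in> G" "\<And>x y. x \<in> G \<Longrightarrow> y \<in> G \<Longrightarrow> x + y \<in> G" and k: "\<And>j. j \<in> d \<Longrightarrow> k j \<in> G"
  shows "\<exists>\<psi>. (\<forall>i. \<psi> i \<in> G) \<and> (\<forall>j\<in>d. (\<Sum>i\<in>F j. \<psi> i) = k j)"
proof -
  let ?s1 = "\<lambda>(c::bit) (f::'i \<Rightarrow> bit) i. c * f i"
  let ?s2 = "\<lambda>(c::bit) (f::'o \<Rightarrow> bit) i. c * f i"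
  interpret vector_space_pair ?s1 ?s2
    by unfold_locales (auto simp: plus_fun_def zero_fun_def fun_eq_iff algebra_simps)
  let ?\<chi> = "\<lambda>j. (\<lambda>i. of_bool (i \<in> F j) :: bit)"
  have inj: "inj_on ?\<chi> d"
  proof (rule inj_onI, rule ccontr)
    fix j j' assume j: "j \<in> d" "j' \<in> d" "?\<chi> j = ?\<chi> j'" "j \<noteq> j'"
    have "(\<Sum>j\<in>{j, j'}. ?\<chi> j) = ?\<chi> j + ?\<chi> j'" using j(4) by simp
    also have "\<dots> = 0" using j(3) unfolding fun_bit_add_eq_0 .
    finally show False using indep[of "{j, j'}"] j by simp
  qed
  have ind: "vs1.independent (?\<chi> ` d)"
    unfolding vs1.independent_explicit_module
  proof (intro allI impI)
    fix t u v assume t: "finite t" "t \<subseteq> ?\<chi> ` d" and z: "(\<Sum>v\<in>t. ?s1 (u v) v) = 0" and v: "v \<in> t"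
    obtain A where A: "A \<subseteq> d" "t = ?\<chi> ` A" using t(2) by (auto simp: subset_image_iff)
    have injA: "inj_on ?\<chi> A" using inj A(1) by (rule inj_on_subset)
    have finA: "finite A" using t(1) A(2) injA by (simp add: finite_image_iff)
    let ?B = "{j \<in> A. u (?\<chi> j) = 1}"
    have "(\<Sum>v\<in>t. ?s1 (u v) v) = (\<Sum>j\<in>A. ?s1 (u (?\<chi> j)) (?\<chi> j))"
      unfolding A(2) by (subst sum.reindex[OF injA]) simp
    also have "\<dots> = (\<Sum>j\<in>?B. ?\<chi> j)"
    proof (rule sum.mono_neutral_cong_right)
      show "\<forall>i\<in>A - ?B. ?s1 (u (?\<chi> i)) (?\<chi> i) = 0"
        by (auto simp: zero_fun_def fun_eq_iff)
      show "?s1 (u (?\<chi> j)) (?\<chi> j) = ?\<chi> j" if "j \<in> ?B" for j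
        using that by auto
    qed (use finA in auto)
    finally have "(\<Sum>j\<in>?B. ?\<chi> j) = 0" using z by simp
    moreover have "finite ?B" using finA by simp
    moreover have "?B \<subseteq> d" using A(1) by blast
    ultimately have "?B = {}" using indep[of ?B] by metis
    moreover obtain j where "j \<in> A" "v = ?\<chi> j" using v A(2) by blast
    ultimately have "u v \<noteq> 1" by blast
    then show "u v = 0" by simp
  qed
  \<comment> \<open>The extension whose range is the span of the prescribed values is taken, so that
    every \<open>\<psi> i\<close>, and not only the sums, lies in \<open>G\<close>.\<close>
  obtain g where g: "Vector_Spaces.linear ?s1 ?s2 g" "\<forall>x\<in>?\<chi> ` d. g x = k (inv_into d ?\<chi> x)"
    "range g = vs2.span ((\<lambda>x. k (inv_into d ?\<chi> x)) ` ?\<chi> ` d)"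
    using linear_independent_extend_subspace[OF ind, of "\<lambda>x. k (inv_into d ?\<chi> x)"] by blast
  have sub: "vs2.subspace G"
  proof (rule vs2.subspaceI)
    show "?s2 c x \<in> G" if "x \<in> G" for c x
    proof (cases "c = 1")
      case True
      then show ?thesis using that by (simp only: mult_1_left)
    next
      case False
      then have "c = 0" by simp
      then show ?thesis using G(1) by (simp only: mult_zero_left zero_fun_def)
    qed
  qed (use G in auto)
  have "(\<lambda>x. k (inv_into d ?\<chi> x)) ` ?\<chi> ` d \<subseteq> G" using k by (auto intro!: k inv_into_into)
  then have "range g \<subseteq> G" unfolding g(3) by (rule vs2.span_minimal[OF _ sub])
  then have gG: "g x \<in> G" for x by (rule subsetD) simp
  have "(\<Sum>i\<in>F j. g (\<lambda>i'. of_bool (i' = i))) = k j" if j: "j \<in> d" for j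
  proof -
    have "(\<Sum>i\<in>F j. g (\<lambda>i'. of_bool (i' = i))) = g (\<Sum>i\<in>F j. (\<lambda>i'. of_bool (i' = i)))"
      by (rule linear_sum[OF g(1), symmetric])
    also have "(\<Sum>i\<in>F j. (\<lambda>i'. of_bool (i' = i) :: bit)) = ?\<chi> j"
      using fin[OF j] by (auto simp: fun_eq_iff sum_fun_apply of_bool_def)
    also have "g (?\<chi> j) = k j" using g(2) j by (simp add: inv_into_f_f[OF inj j])
    finally show ?thesis .
  qed
  then show ?thesis using gG by (intro exI[of _ "\<lambda>i. g (\<lambda>i'. of_bool (i' = i))"]) simp
qed

text \<open>Recursion along \<kappa>: at stage \<open>a\<close> fewer than \<kappa> conditions have
  been chosen, so \<open>closed\<close> bounds them and \<open>dense\<close> then enters the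
  requirement \<open>e a\<close>. The whole chain can have length \<kappa> and need not have a lower
  bound.\<close>

lemma generic_chain:
  fixes R :: "'c \<Rightarrow> 'c \<Rightarrow> bool" and \<kappa> :: "'k rel"
  assumes \<kappa>: "Card_order \<kappa>"
    and trans: "\<And>p q t. R p q \<Longrightarrow> R q t \<Longrightarrow> R p t"
    and refl: "\<And>p. p \<in> X \<Longrightarrow> R p p"
    and closed: "\<And>C. C \<subseteq> X \<Longrightarrow> |C| <o \<kappa> \<Longrightarrow> (\<And>p q. p \<in> C \<Longrightarrow> q \<in> C \<Longrightarrow> R p q \<or> R q p) \<Longrightarrow>
       \<exists>q\<in>X. \<forall>p\<in>C. R q p"
    and card: "|\<D>| \<le>o \<kappa>"
    and dense: "\<And>\<Delta> p. \<Delta> \<in> \<D> \<Longrightarrow> p \<in> X \<Longrightarrow> \<exists>q\<in>X. q \<in> \<Delta> \<and> R q p"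
  shows "\<exists>G\<subseteq>X. (\<forall>p\<in>G. \<forall>q\<in>G. R p q \<or> R q p) \<and> (\<forall>\<Delta>\<in>\<D>. G \<inter> \<Delta> \<noteq> {})"
proof (cases "\<D> = {}")
  case True
  then show ?thesis by blast
next
  case False
  have wo: "Well_order \<kappa>" using \<kappa> by (simp add: card_order_on_def)
  have "|\<D>| \<le>o |Field \<kappa>|" using card card_of_Field_ordIso[OF \<kappa>] ordLeq_ordIso_trans ordIso_symmetric by blast
  then have "\<exists>e. e ` Field \<kappa> = \<D>" using card_of_ordLeq2[OF False, of "Field \<kappa>"] by simp
  then obtain e where e: "e ` Field \<kappa> = \<D>" ..
  define H where "H = (\<lambda>f a. SOME q. q \<in> X \<and> q \<in> e a \<and> (\<forall>b\<in>underS \<kappa> a. R q (f b)))"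
  define f where "f = wo_rel.worec \<kappa> H"
  have wr: "wo_rel \<kappa>" using wo by (simp add: wo_rel_def)
  have adm: "wo_rel.adm_wo \<kappa> H"
    unfolding wo_rel.adm_wo_def[OF wr] H_def by (auto intro!: arg_cong[where f = Eps])
  have f: "f = H f" unfolding f_def by (rule wo_rel.worec_fixpoint[OF wr adm])
  have main: "f a \<in> X \<and> f a \<in> e a \<and> (\<forall>b\<in>underS \<kappa> a. R (f a) (f b))" if "a \<in> Field \<kappa>" for a
    using that
  proof (induction a rule: wo_rel.well_order_induct[OF wr])
    case (1 a)
    have IH: "f b \<in> X \<and> f b \<in> e b \<and> (\<forall>c\<in>underS \<kappa> b. R (f b) (f c))" if "b \<in> underS \<kappa> a" for b
      using 1 that by (auto simp: underS_def Field_def)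
    have "\<exists>q\<in>X. \<forall>p\<in>f ` underS \<kappa> a. R q p"
    proof (rule closed)
      show "f ` underS \<kappa> a \<subseteq> X" using IH by auto
      show "|f ` underS \<kappa> a| <o \<kappa>" using card_of_image card_of_underS[OF \<kappa> 1(2)] by (rule ordLeq_ordLess_trans)
      fix p q assume "p \<in> f ` underS \<kappa> a" "q \<in> f ` underS \<kappa> a"
      then obtain b c where b: "b \<in> underS \<kappa> a" "p = f b" and c: "c \<in> underS \<kappa> a" "q = f c" by auto
      then have "b \<in> Field \<kappa>" "c \<in> Field \<kappa>" using underS_subset_Field by fastforce+
      then consider "b = c" | "b \<in> underS \<kappa> c" | "c \<in> underS \<kappa> b"
        using Well_order_linear[OF wo, of b c] by (auto simp: underS_def)
      then show "R p q \<or> R q p"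
        using IH[OF b(1)] IH[OF c(1)] b(2) c(2) refl by cases auto
    qed
    then obtain q where q: "q \<in> X" "\<forall>p\<in>f ` underS \<kappa> a. R q p" by blast
    obtain t where t: "t \<in> X" "t \<in> e a" "R t q" using dense[of "e a" q] e 1(2) q(1) by blast
    then have "t \<in> X \<and> t \<in> e a \<and> (\<forall>b\<in>underS \<kappa> a. R t (f b))" using q trans by auto
    then have "H f a \<in> X \<and> H f a \<in> e a \<and> (\<forall>b\<in>underS \<kappa> a. R (H f a) (f b))"
      unfolding H_def by (rule someI)
    then show ?case using f by metis
  qed
  show ?thesis
  proof (intro exI[of _ "f ` Field \<kappa>"] conjI ballI)
    show "f ` Field \<kappa> \<subseteq> X" using main by auto
    fix p q assume "p \<in> f ` Field \<kappa>" "q \<in> f ` Field \<kappa>"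
    then obtain b c where b: "b \<in> Field \<kappa>" "p = f b" and c: "c \<in> Field \<kappa>" "q = f c" by auto
    then consider "b = c" | "b \<in> underS \<kappa> c" | "c \<in> underS \<kappa> b"
      using Well_order_linear[OF wo, of b c] by (auto simp: underS_def)
    then show "R p q \<or> R q p" using main b c refl by cases auto
  next
    fix \<Delta> assume "\<Delta> \<in> \<D>"
    then obtain a where "a \<in> Field \<kappa>" "e a = \<Delta>" using e by auto
    then show "f ` Field \<kappa> \<inter> \<Delta> \<noteq> {}" using main by blast
  qed
qed

text \<open>One condition picked from the generic chain for each requirement makes fewer than
  \<kappa> conditions in all, and \<open>closed\<close> bounds these. This form serves at levels of
  small cofinality and for the distributivity of the forcing.\<close>

lemma generic_bound:
  fixes R :: "'c \<Rightarrow> 'c \<Rightarrow> bool" and \<kappa> :: "'k rel"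
  assumes \<kappa>: "Card_order \<kappa>"
    and trans: "\<And>p q t. R p q \<Longrightarrow> R q t \<Longrightarrow> R p t"
    and refl: "\<And>p. p \<in> X \<Longrightarrow> R p p"
    and closed: "\<And>C. C \<subseteq> X \<Longrightarrow> |C| <o \<kappa> \<Longrightarrow> (\<And>p q. p \<in> C \<Longrightarrow> q \<in> C \<Longrightarrow> R p q \<or> R q p) \<Longrightarrow>
       \<exists>q\<in>X. \<forall>p\<in>C. R q p"
    and card: "|\<D>| <o \<kappa>"
    and dense: "\<And>\<Delta> p. \<Delta> \<in> \<D> \<Longrightarrow> p \<in> X \<Longrightarrow> \<exists>q\<in>X. q \<in> \<Delta> \<and> R q p"
  shows "\<exists>q\<in>X. \<forall>\<Delta>\<in>\<D>. \<exists>p\<in>X. p \<in> \<Delta> \<and> R q p"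
proof -
  have "\<exists>G\<subseteq>X. (\<forall>p\<in>G. \<forall>q\<in>G. R p q \<or> R q p) \<and> (\<forall>\<Delta>\<in>\<D>. G \<inter> \<Delta> \<noteq> {})"
    by (rule generic_chain[OF \<kappa> trans refl closed ordLess_imp_ordLeq[OF card] dense])
  then obtain G where G: "G \<subseteq> X" "\<And>p q. p \<in> G \<Longrightarrow> q \<in> G \<Longrightarrow> R p q \<or> R q p" "\<And>\<Delta>. \<Delta> \<in> \<D> \<Longrightarrow> \<exists>p. p \<in> G \<and> p \<in> \<Delta>"
    by (metis disjoint_iff)
  obtain h where h: "\<And>\<Delta>. \<Delta> \<in> \<D> \<Longrightarrow> h \<Delta> \<in> G \<and> h \<Delta> \<in> \<Delta>" using G(3) by metis
  have "\<exists>q\<in>X. \<forall>p\<in>h ` \<D>. R q p"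
  proof (rule closed)
    show "h ` \<D> \<subseteq> X" using h G(1) by blast
    show "|h ` \<D>| <o \<kappa>" using card_of_image card by (rule ordLeq_ordLess_trans)
    fix p q assume "p \<in> h ` \<D>" "q \<in> h ` \<D>"
    then show "R p q \<or> R q p" using h G(2) by (metis imageE)
  qed
  then obtain q where q: "q \<in> X" "\<forall>p\<in>h ` \<D>. R q p" by metis
  show ?thesis
  proof (rule bexI[OF _ q(1)], rule ballI)
    fix \<Delta> assume "\<Delta> \<in> \<D>"
    then show "\<exists>p\<in>X. p \<in> \<Delta> \<and> R q p" using h[of \<Delta>] q(2) G(1) by (intro bexI[of _ "h \<Delta>"]) auto
  qed
qed

section \<open>Nodes and conditions\<close>

text \<open>
  A node is a pair of a type and a value. A condition is a level together with a partial assignment of nodes to slots;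
  the type of an assigned node is not truncated to the level, but its value is. Each ordinal has countably many slots,
  so that there is room for generators (number 0) as well as for nodes to be compared with them.
\<close>

type_synonym 'o node = "('o \<Rightarrow> bit) \<times> ('o \<Rightarrow> bit)"
datatype 'o slot = Slot (ord: 'o) (num: nat)
type_synonym 'o cond = "'o \<times> ('o slot \<Rightarrow> 'o node option)"

context diamond_setting
begin

section \<open>Ordinals below the successor, small sets, and clubs\<close>

abbreviation Ord :: "'o set" where "Ord \<equiv> Field K"
abbreviation lt (infix \<open>\<prec>\<close> 50) where "a \<prec> b \<equiv> a \<in> underS K b"
abbreviation le (infix \<open>\<preceq>\<close> 50) where "a \<preceq> b \<equiv> (a, b) \<in> K"

lemma Ck: "Card_order \<kappa>" and inf\<kappa>: "\<not> finite (Field \<kappa>)"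
  using kappa by (simp_all add: cinfinite_def)

lemma lt_Ord: "a \<prec> b \<Longrightarrow> a \<in> Ord" "a \<prec> b \<Longrightarrow> b \<in> Ord"
  by (auto simp: underS_def Field_def)

lemma le_Ord: "a \<preceq> b \<Longrightarrow> a \<in> Ord" "a \<preceq> b \<Longrightarrow> b \<in> Ord"
  by (auto simp: Field_def)

lemma lt_le: "a \<prec> b \<Longrightarrow> a \<preceq> b"
  by (simp add: underS_def)

lemma le_refl: "a \<in> Ord \<Longrightarrow> a \<preceq> a"
  using K by (simp add: order_on_defs refl_on_def)

lemma le_trans: "a \<preceq> b \<Longrightarrow> b \<preceq> c \<Longrightarrow> a \<preceq> c"
  using K unfolding order_on_defs by (blast dest: transD)

lemma le_antisym: "a \<preceq> b \<Longrightarrow> b \<preceq> a \<Longrightarrow> a = b"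
  using K unfolding order_on_defs by (blast dest: antisymD)

lemma lt_irrefl: "\<not> a \<prec> a"
  by (simp add: underS_def)

lemma le_lt_trans: "a \<preceq> b \<Longrightarrow> b \<prec> c \<Longrightarrow> a \<prec> c"
  by (rule Well_order_le_underS[OF K])

lemma lt_le_trans: "a \<prec> b \<Longrightarrow> b \<preceq> c \<Longrightarrow> a \<prec> c"
  using le_trans le_antisym by (auto simp: underS_def)

lemma lt_trans: "a \<prec> b \<Longrightarrow> b \<prec> c \<Longrightarrow> a \<prec> c"
  using le_lt_trans lt_le by metis

lemma not_le: "a \<prec> b \<Longrightarrow> \<not> b \<preceq> a"
  using le_lt_trans lt_irrefl by metis

lemma linear: "a \<in> Ord \<Longrightarrow> b \<in> Ord \<Longrightarrow> a \<preceq> b \<or> b \<prec> a"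
  using Well_order_linear[OF K] .

lemma le_cases: "a \<preceq> b \<Longrightarrow> a \<prec> b \<or> a = b"
  by (auto simp: underS_def)

lemma least_Ord:
  assumes "X \<subseteq> Ord" "X \<noteq> {}"
  shows "\<exists>m\<in>X. \<forall>b\<in>X. m \<preceq> b"
proof -
  have "wf (K - Id)" using K by (simp add: order_on_defs)
  then obtain m where m: "m \<in> X" "\<And>y. (y, m) \<in> K - Id \<Longrightarrow> y \<notin> X" using assms(2) by (metis wfE_min ex_in_conv)
  then have "m \<preceq> b" if "b \<in> X" for b using linear[of m b] assms(1) that by (auto simp: underS_def)
  then show ?thesis using m(1) by blast
qed

lemma Ord_induct [consumes 1, case_names step]:
  assumes "\<delta> \<in> Ord" and "\<And>\<delta>. \<delta> \<in> Ord \<Longrightarrow> (\<And>\<gamma>. \<gamma> \<prec> \<delta> \<Longrightarrow> P \<gamma>) \<Longrightarrow> P \<delta>"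
  shows "P \<delta>"
proof -
  have "\<delta> \<in> Ord \<longrightarrow> P \<delta>"
  proof (induction \<delta> rule: wo_rel.well_order_induct[of K])
    show "wo_rel K" using K by (simp add: wo_rel_def)
    fix x assume IH: "\<forall>y. y \<noteq> x \<and> (y, x) \<in> K \<longrightarrow> y \<in> Ord \<longrightarrow> P y"
    show "x \<in> Ord \<longrightarrow> P x" using assms(2)[of x] IH lt_Ord(1) by (auto simp: underS_def)
  qed
  then show ?thesis using assms(1) by simp
qed

lemma small_finite: "finite X \<Longrightarrow> |X| <o \<kappa>"
  using finite_ordLess_infinite[OF card_of_Well_order, of \<kappa> X] Ck inf\<kappa>
  by (simp add: card_order_on_def Field_card_of)

lemma small_le: "|X| <o \<kappa> \<Longrightarrow> |X| \<le>o \<kappa>"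
  by (rule ordLess_imp_ordLeq)

lemma small_subset: "X \<subseteq> Y \<Longrightarrow> |Y| <o \<kappa> \<Longrightarrow> |X| <o \<kappa>"
  using card_of_mono1 by (rule ordLeq_ordLess_trans)

lemma small_image: "|X| <o \<kappa> \<Longrightarrow> |f ` X| <o \<kappa>"
  using card_of_image by (rule ordLeq_ordLess_trans)

lemma small_Un: "|X| <o \<kappa> \<Longrightarrow> |Y| <o \<kappa> \<Longrightarrow> |X \<union> Y| <o \<kappa>"
  by (rule card_of_Un_ordLess_infinite_Field[OF inf\<kappa> Ck])

lemma small_UN: "|X| <o \<kappa> \<Longrightarrow> (\<And>x. x \<in> X \<Longrightarrow> |F x| <o \<kappa>) \<Longrightarrow> |\<Union>x\<in>X. F x| <o \<kappa>"
  by (rule stable_UNION[OF stable])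

lemma few_subset: "X \<subseteq> Y \<Longrightarrow> |Y| \<le>o \<kappa> \<Longrightarrow> |X| \<le>o \<kappa>"
  using card_of_mono1 by (rule ordLeq_transitive)

lemma few_image: "|X| \<le>o \<kappa> \<Longrightarrow> |f ` X| \<le>o \<kappa>"
  using card_of_image by (rule ordLeq_transitive)

lemma few_Un: "|X| \<le>o \<kappa> \<Longrightarrow> |Y| \<le>o \<kappa> \<Longrightarrow> |X \<union> Y| \<le>o \<kappa>"
  by (rule card_of_Un_ordLeq_infinite_Field[OF inf\<kappa> _ _ Ck])

lemma few_UN: "|X| \<le>o \<kappa> \<Longrightarrow> (\<And>x. x \<in> X \<Longrightarrow> |F x| \<le>o \<kappa>) \<Longrightarrow> |\<Union>x\<in>X. F x| \<le>o \<kappa>"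
  by (rule card_of_UNION_ordLeq_infinite_Field[OF inf\<kappa> Ck]) auto

lemma few_Times: "|X| \<le>o \<kappa> \<Longrightarrow> |Y| \<le>o \<kappa> \<Longrightarrow> |X \<times> Y| \<le>o \<kappa>"
  by (rule card_of_Times_ordLeq_infinite_Field[OF inf\<kappa> _ _ Ck])

lemma few_finite: "finite X \<Longrightarrow> |X| \<le>o \<kappa>"
  using small_finite small_le by blast

lemma few_nat: "|X :: nat set| \<le>o \<kappa>"
proof -
  have "|X| \<le>o |UNIV :: nat set|" by (rule card_of_mono1) simp
  also have "|UNIV :: nat set| \<le>o |Field \<kappa>|" using inf\<kappa> infinite_iff_card_of_nat by blast
  also have "|Field \<kappa>| =o \<kappa>" by (rule card_of_Field_ordIso[OF Ck])
  finally show ?thesis .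
qed

lemma few_small_subsets_of:
  fixes X :: "'c set"
  assumes "|X| \<le>o \<kappa>"
  shows "|{Y. Y \<subseteq> X \<and> |Y| <o \<kappa>}| \<le>o \<kappa>"
proof -
  have "\<kappa> \<le>o |Ord|" using large ordLeq_total[of "|Ord|" \<kappa>] Ck by (simp add: card_order_on_def card_of_Well_order)
  then have "|X| \<le>o |Ord|" using assms ordLeq_transitive by blast
  then obtain e where e: "inj_on e X" "e ` X \<subseteq> Ord" by (auto simp flip: card_of_ordLeq)
  have "|{Y. Y \<subseteq> X \<and> |Y| <o \<kappa>}| \<le>o |{Y. Y \<subseteq> e ` X \<and> |Y| <o \<kappa>}|"
  proof (rule card_of_ordLeqI[of "image e"])
    show "inj_on ((`) e) {Y. Y \<subseteq> X \<and> |Y| <o \<kappa>}"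
      using e(1) by (auto intro!: inj_onI simp: inj_on_image_eq_iff)
    show "e ` Y \<in> {Y. Y \<subseteq> e ` X \<and> |Y| <o \<kappa>}" if "Y \<in> {Y. Y \<subseteq> X \<and> |Y| <o \<kappa>}" for Y
      using that small_image by auto
  qed
  then show ?thesis using few[OF few_image[OF assms]] by (rule ordLeq_transitive)
qed

lemma lub_Ord:
  assumes "X \<subseteq> Ord" "|X| \<le>o \<kappa>"
  shows "\<exists>b\<in>Ord. (\<forall>x\<in>X. x \<preceq> b) \<and> (\<forall>c. c \<in> Ord \<longrightarrow> (\<forall>x\<in>X. x \<preceq> c) \<longrightarrow> b \<preceq> c)"
proof -
  obtain \<delta> where \<delta>: "\<delta> \<in> Ord" "X \<subseteq> underS K \<delta>" using bounded[OF assms] by blast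
  let ?B = "{b \<in> Ord. \<forall>x\<in>X. x \<preceq> b}"
  have "\<delta> \<in> ?B" using \<delta> lt_le by blast
  then have "\<exists>m\<in>?B. \<forall>b\<in>?B. m \<preceq> b" by (intro least_Ord) auto
  then show ?thesis by auto
qed

text \<open>Bounding \<open>g\<close> on the initial segment reached so far, \<omega> times above
  any given point, has a closure point as its supremum. Levels with a correct guess are always
  looked for inside a club of this form.\<close>

lemma club_closure:
  assumes g: "g ` Ord \<subseteq> Ord" and a0: "a0 \<in> Ord"
  shows "club K {\<delta> \<in> Ord. a0 \<prec> \<delta> \<and> (\<forall>\<eta>. \<eta> \<prec> \<delta> \<longrightarrow> g \<eta> \<prec> \<delta>)}" (is "club K ?C")
  unfolding club_def
proof (intro conjI ballI impI)
  show "?C \<subseteq> Ord" by auto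
  fix a assume a: "a \<in> Ord"
  have "\<exists>b. b \<in> Ord \<and> c \<prec> b \<and> (\<forall>\<eta>. \<eta> \<preceq> c \<longrightarrow> g \<eta> \<prec> b)" if c: "c \<in> Ord" for c
  proof -
    let ?X = "insert c (underS K c)"
    have "|?X| \<le>o \<kappa>" using few_Un[OF few_finite[of "{c}"] small[of c]] by simp
    then have "|?X \<union> g ` ?X| \<le>o \<kappa>" by (intro few_Un few_image)
    moreover have "?X \<union> g ` ?X \<subseteq> Ord" using c g lt_Ord(1) by blast
    ultimately obtain b where "b \<in> Ord" "?X \<union> g ` ?X \<subseteq> underS K b" using bounded by metis
    then show ?thesis using le_cases by (intro exI[of _ b]) blast
  qed
  then obtain nx where nx: "\<And>c. c \<in> Ord \<Longrightarrow> nx c \<in> Ord \<and> c \<prec> nx c \<and> (\<forall>\<eta>. \<eta> \<preceq> c \<longrightarrow> g \<eta> \<prec> nx c)"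
    by metis
  obtain c0 where c0: "c0 \<in> Ord" "a \<prec> c0" "a0 \<prec> c0"
    using bounded[of "{a, a0}"] a a0 few_finite[of "{a, a0}"] by auto
  define s where "s = rec_nat c0 (\<lambda>_. nx)"
  have s: "s 0 = c0" "s (Suc n) = nx (s n)" for n by (simp_all add: s_def)
  have sO: "s n \<in> Ord" for n by (induction n) (use c0 nx s in auto)
  have "|range s| \<le>o \<kappa>" using few_image[OF few_nat] .
  then obtain d where d: "d \<in> Ord" "\<And>n. s n \<preceq> d" "\<And>c. c \<in> Ord \<Longrightarrow> (\<And>n. s n \<preceq> c) \<Longrightarrow> d \<preceq> c"
    using lub_Ord[of "range s"] sO by auto
  have sd: "s n \<prec> d" for n using nx[OF sO[of n]] d(2)[of "Suc n"] s(2) lt_le_trans by metis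
  have "g \<eta> \<prec> d" if \<eta>: "\<eta> \<prec> d" for \<eta>
  proof -
    obtain n where "\<not> s n \<preceq> \<eta>" using d(3)[OF lt_Ord(1)[OF \<eta>]] not_le[OF \<eta>] by metis
    then have "\<eta> \<preceq> s n" using linear[OF sO lt_Ord(1)[OF \<eta>]] lt_le by blast
    then have "g \<eta> \<prec> s (Suc n)" using nx[OF sO] s(2) by metis
    then show ?thesis using sd lt_trans by blast
  qed
  moreover have "a0 \<prec> d" "a \<prec> d" using c0 sd[of 0] s(1) lt_trans by metis+
  ultimately show "\<exists>c\<in>?C. (a, c) \<in> K \<and> a \<noteq> c" using d(1) by (intro bexI[of _ d]) (auto simp: underS_def)
next
  fix d assume d: "d \<in> Ord" and lim: "underS K d \<noteq> {} \<and> (\<forall>a\<in>underS K d. \<exists>c\<in>?C \<inter> underS K d. (a, c) \<in> K \<and> a \<noteq> c)"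
  have "\<exists>c. c \<in> ?C \<and> c \<prec> d \<and> a \<prec> c" if "a \<prec> d" for a using lim that by (fastforce simp: underS_def)
  moreover obtain a where "a \<prec> d" using lim by blast
  ultimately show "d \<in> ?C" using d lt_trans by blast
qed

section \<open>Truncation, types, conditions and their limits\<close>

definition rs :: "'o \<Rightarrow> ('o \<Rightarrow> bit) \<Rightarrow> 'o \<Rightarrow> bit" where
  "rs \<gamma> x = (\<lambda>\<xi>. if \<xi> \<prec> \<gamma> then x \<xi> else 0)"

lemma rs_rs: "\<gamma> \<preceq> \<delta> \<Longrightarrow> rs \<gamma> (rs \<delta> x) = rs \<gamma> x" "\<gamma> \<preceq> \<delta> \<Longrightarrow> rs \<delta> (rs \<gamma> x) = rs \<gamma> x"
  using lt_le_trans by (auto simp: rs_def fun_eq_iff)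

lemma rs_idem [simp]: "rs \<gamma> (rs \<gamma> x) = rs \<gamma> x"
  by (simp add: rs_def fun_eq_iff)

text \<open>Nodes are total functions that vanish from their level on, not partial functions; this
  is why truncation is additive and a level can be a group under pointwise addition.\<close>

lemma rs_add: "rs \<gamma> (x + y) = rs \<gamma> x + rs \<gamma> y"
  by (simp add: rs_def fun_eq_iff plus_fun_def)

lemma rs_0 [simp]: "rs \<gamma> 0 = 0"
  by (simp add: rs_def fun_eq_iff zero_fun_def)

lemma rs_sum: "rs \<gamma> (\<Sum>i\<in>A. f i) = (\<Sum>i\<in>A. rs \<gamma> (f i))"
  by (rule ext) (simp add: rs_def sum_fun_apply)

lemma rs_up: "rs \<gamma> x = x \<Longrightarrow> \<gamma> \<preceq> \<delta> \<Longrightarrow> rs \<delta> x = x"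
  using rs_rs(2) by metis

definition fsup :: "('o \<Rightarrow> bit) \<Rightarrow> bool" where
  "fsup \<tau> \<longleftrightarrow> finite {\<xi>. \<tau> \<xi> \<noteq> 0} \<and> {\<xi>. \<tau> \<xi> \<noteq> 0} \<subseteq> Ord"

lemma fsup_0 [simp]: "fsup 0"
  by (simp add: fsup_def zero_fun_def)

lemma fsup_add:
  assumes "fsup \<tau>" "fsup \<sigma>" shows "fsup (\<tau> + \<sigma>)"
proof -
  have "{\<xi>. (\<tau> + \<sigma>) \<xi> \<noteq> 0} \<subseteq> {\<xi>. \<tau> \<xi> \<noteq> 0} \<union> {\<xi>. \<sigma> \<xi> \<noteq> 0}" by (auto simp: plus_fun_def)
  then show ?thesis using assms unfolding fsup_def by (meson Un_least finite_UnI finite_subset subset_trans)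
qed

lemma fsup_sum: "(\<And>i. i \<in> A \<Longrightarrow> fsup (f i)) \<Longrightarrow> fsup (\<Sum>i\<in>A. f i)"
  by (induction A rule: infinite_finite_induct) (auto intro: fsup_add)

lemma fsup_rs: "fsup \<tau> \<Longrightarrow> fsup (rs \<gamma> \<tau>)"
  unfolding fsup_def rs_def by (auto elim: finite_subset[rotated])

text \<open>Only levels strictly below \<delta> are consulted. At a limit this gives all branches;
  at the successor of \<gamma> the bits at \<gamma> are free, and this is where nodes split.\<close>

definition full :: "('o \<Rightarrow> 'o node set) \<Rightarrow> 'o \<Rightarrow> 'o node set" where
  "full W \<delta> = {(\<tau>, x). fsup \<tau> \<and> rs \<delta> \<tau> = \<tau> \<and> rs \<delta> x = x \<and> (\<forall>\<gamma>. \<gamma> \<prec> \<delta> \<longrightarrow> (rs \<gamma> \<tau>, rs \<gamma> x) \<in> W \<gamma>)}"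

definition Q :: "('o \<Rightarrow> 'o node set) \<Rightarrow> 'o cond set" where
  "Q W = {(\<gamma>, f). \<gamma> \<in> Ord \<and> |dom f| <o \<kappa> \<and> ord ` dom f \<subseteq> Ord \<and>
     (\<forall>j \<tau> x. f j = Some (\<tau>, x) \<longrightarrow> fsup \<tau> \<and> (rs \<gamma> \<tau>, x) \<in> W \<gamma>)}"

text \<open>
  Types are kept and values are end-extended.
\<close>

definition stronger :: "'o cond \<Rightarrow> 'o cond \<Rightarrow> bool" (infix \<open>\<sqsubseteq>\<close> 50) where
  "p \<sqsubseteq> q \<longleftrightarrow> fst q \<preceq> fst p \<and>
     (\<forall>j \<tau> x. snd q j = Some (\<tau>, x) \<longrightarrow> (\<exists>x'. snd p j = Some (\<tau>, x') \<and> rs (fst q) x' = x))"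

lemma stronger_lev: "p \<sqsubseteq> q \<Longrightarrow> fst q \<preceq> fst p"
  by (simp add: stronger_def)

lemma stronger_val:
  "p \<sqsubseteq> q \<Longrightarrow> snd q j = Some (\<tau>, x) \<Longrightarrow> \<exists>x'. snd p j = Some (\<tau>, x') \<and> rs (fst q) x' = x"
  unfolding stronger_def by blast

lemma stronger_trans:
  assumes "p \<sqsubseteq> q" "q \<sqsubseteq> t" shows "p \<sqsubseteq> t"
  unfolding stronger_def
proof (intro conjI allI impI)
  show "fst t \<preceq> fst p" using assms le_trans by (auto simp: stronger_def)
  fix j \<tau> x assume "snd t j = Some (\<tau>, x)"
  then obtain y where y: "snd q j = Some (\<tau>, y)" "rs (fst t) y = x" using stronger_val[OF assms(2)] by blast
  then obtain z where "snd p j = Some (\<tau>, z)" "rs (fst q) z = y" using stronger_val[OF assms(1)] by blast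
  moreover then have "rs (fst t) z = x" using y rs_rs(1)[of "fst t" "fst q"] assms(2) by (auto simp: stronger_def)
  ultimately show "\<exists>x'. snd p j = Some (\<tau>, x') \<and> rs (fst t) x' = x" by blast
qed

lemma stronger_dom: "p \<sqsubseteq> q \<Longrightarrow> dom (snd q) \<subseteq> dom (snd p)"
  unfolding stronger_def dom_def by fastforce

lemma stronger_refl:
  assumes "p \<in> Q W" "W (fst p) \<subseteq> full W (fst p)"
  shows "p \<sqsubseteq> p"
  unfolding stronger_def
proof (intro conjI allI impI)
  show "fst p \<preceq> fst p" using assms(1) le_refl by (auto simp: Q_def)
  fix j \<tau> x assume j: "snd p j = Some (\<tau>, x)"
  then have "(rs (fst p) \<tau>, x) \<in> full W (fst p)" using assms by (auto simp: Q_def)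
  then show "\<exists>x'. snd p j = Some (\<tau>, x') \<and> rs (fst p) x' = x" using j by (auto simp: full_def)
qed

lemma QI:
  assumes "\<gamma> \<in> Ord" "|dom f| <o \<kappa>" "ord ` dom f \<subseteq> Ord"
    "\<And>j \<tau> x. f j = Some (\<tau>, x) \<Longrightarrow> fsup \<tau> \<and> (rs \<gamma> \<tau>, x) \<in> W \<gamma>"
  shows "(\<gamma>, f) \<in> Q W"
  using assms by (auto simp: Q_def)

lemma QD:
  assumes "p \<in> Q W"
  shows "fst p \<in> Ord" "|dom (snd p)| <o \<kappa>" "ord ` dom (snd p) \<subseteq> Ord"
    "snd p j = Some (\<tau>, x) \<Longrightarrow> fsup \<tau>" "snd p j = Some (\<tau>, x) \<Longrightarrow> (rs (fst p) \<tau>, x) \<in> W (fst p)"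
  using assms by (auto simp: Q_def split_beta)

text \<open>The union of a chain as one type and one value for each slot, with the bit 0 where no
  member reaches. Neither length nor level of the chain is bounded, so the lemma applies both to
  short chains and to generic chains that are cofinal in a level.\<close>

lemma chain_limit:
  assumes C: "C \<subseteq> Q W"
    and chain: "\<And>p q. p \<in> C \<Longrightarrow> q \<in> C \<Longrightarrow> p \<sqsubseteq> q \<or> q \<sqsubseteq> p"
    and sub: "\<And>p. p \<in> C \<Longrightarrow> W (fst p) \<subseteq> full W (fst p)"
  shows "\<exists>T X. (\<forall>p\<in>C. \<forall>j \<tau> x. snd p j = Some (\<tau>, x) \<longrightarrow> \<tau> = T j \<and> rs (fst p) (X j) = x) \<and>
     (\<forall>j \<xi>. (\<forall>p\<in>C. \<not> \<xi> \<prec> fst p) \<longrightarrow> X j \<xi> = 0)"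
proof -
  define X where "X = (\<lambda>j \<xi>. of_bool (\<exists>p\<in>C. \<exists>\<tau> x. snd p j = Some (\<tau>, x) \<and> \<xi> \<prec> fst p \<and> x \<xi> = 1) :: bit)"
  have supp: "rs (fst p) x = x" if "p \<in> C" "snd p j = Some (\<tau>, x)" for p j \<tau> x
    using QD(5)[of p W j \<tau> x] sub[OF that(1)] C that by (auto simp: full_def)
  have same: "x \<xi> = y \<xi>" "\<tau> = \<sigma>" if st: "p \<in> C" "q \<in> C" "snd p j = Some (\<tau>, x)" "snd q j = Some (\<sigma>, y)"
    "\<xi> \<prec> fst p" "\<xi> \<prec> fst q" for p q j \<tau> x \<sigma> y \<xi>
  proof -
    consider "p \<sqsubseteq> q" | "q \<sqsubseteq> p" using chain[OF st(1,2)] by blast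
    then have "x \<xi> = y \<xi> \<and> \<tau> = \<sigma>"
    proof cases
      case 1
      then obtain x' where "snd p j = Some (\<sigma>, x')" "rs (fst q) x' = y" using stronger_val[OF 1 st(4)] by blast
      then show ?thesis using st by (auto simp: rs_def)
    next
      case 2
      then obtain x' where "snd q j = Some (\<tau>, x')" "rs (fst p) x' = x" using stronger_val[OF 2 st(3)] by blast
      then show ?thesis using st by (auto simp: rs_def)
    qed
    then show "x \<xi> = y \<xi>" "\<tau> = \<sigma>" by auto
  qed
  have type: "\<tau> = \<sigma>" if "p \<in> C" "q \<in> C" "snd p j = Some (\<tau>, x)" "snd q j = Some (\<sigma>, y)" for p q j \<tau> x \<sigma> y
    using chain[OF that(1,2)] stronger_val[of p q j \<sigma> y] stronger_val[of q p j \<tau> x] that by auto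
  have rsX: "rs (fst p) (X j) = x" if p: "p \<in> C" "snd p j = Some (\<tau>, x)" for p j \<tau> x
  proof
    fix \<xi>
    show "rs (fst p) (X j) \<xi> = x \<xi>"
    proof (cases "\<xi> \<prec> fst p")
      case True
      have "X j \<xi> = x \<xi>"
      proof (cases "x \<xi> = 1")
        case t: True
        then have "X j \<xi> = 1" using p True unfolding X_def by auto
        then show ?thesis using t by simp
      next
        case False
        then have "\<not> (\<exists>p\<in>C. \<exists>\<tau> x. snd p j = Some (\<tau>, x) \<and> \<xi> \<prec> fst p \<and> x \<xi> = 1)"
          using same(1)[OF p(1) _ p(2) _ True] by metis
        then have "X j \<xi> = 0" unfolding X_def by simp
        then show ?thesis using False by simp
      qed
      then show ?thesis using True by (simp add: rs_def)
    next
      case False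
      then have "x \<xi> = 0" using supp[OF p] by (metis rs_def)
      then show ?thesis using False by (simp add: rs_def)
    qed
  qed
  define T where "T = (\<lambda>j. SOME \<tau>. \<exists>p\<in>C. \<exists>x. snd p j = Some (\<tau>, x))"
  have T: "\<tau> = T j" if p: "p \<in> C" "snd p j = Some (\<tau>, x)" for p j \<tau> x
  proof -
    have "\<exists>p\<in>C. \<exists>x. snd p j = Some (T j, x)" unfolding T_def by (rule someI[of _ \<tau>]) (use p in blast)
    then show ?thesis using type p by meson
  qed
  have "X j \<xi> = 0" if "\<forall>p\<in>C. \<not> \<xi> \<prec> fst p" for j \<xi> using that unfolding X_def by simp
  then show ?thesis using T rsX by (intro exI[of _ T] exI[of _ X]) simp
qed

text \<open>The bound sits at the supremum of the levels. If some member has this level, the nodes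
  are already there; otherwise the supremum is a limit of fewer than \<kappa> smaller ordinals,
  hence outside \<open>S\<close>, and a \<open>full\<close> level contains all unions of nodes.
  Least level and absence of new slots or types let the bound stay inside \<open>Qb\<close> and
  \<open>PE\<close>.\<close>

lemma chain_bound:
  assumes C: "C \<subseteq> Q W" "C \<noteq> {}" "|C| <o \<kappa>"
    and chain: "\<And>p q. p \<in> C \<Longrightarrow> q \<in> C \<Longrightarrow> p \<sqsubseteq> q \<or> q \<sqsubseteq> p"
    and sub: "\<And>p. p \<in> C \<Longrightarrow> W (fst p) \<subseteq> full W (fst p)"
    and full: "\<And>\<gamma>. \<gamma> \<in> Ord \<Longrightarrow> \<gamma> \<notin> S \<Longrightarrow> W \<gamma> = full W \<gamma>"
  shows "\<exists>q\<in>Q W. (\<forall>p\<in>C. q \<sqsubseteq> p) \<and> (\<forall>b. b \<in> Ord \<longrightarrow> (\<forall>p\<in>C. fst p \<preceq> b) \<longrightarrow> fst q \<preceq> b) \<and>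
     (\<forall>j \<tau> x. snd q j = Some (\<tau>, x) \<longrightarrow> (\<exists>p\<in>C. \<exists>y. snd p j = Some (\<tau>, y)))"
proof -
  have L: "fst ` C \<subseteq> Ord" using C(1) QD(1) by blast
  have Lk: "|fst ` C| <o \<kappa>" using C(3) by (rule small_image)
  obtain \<gamma> where \<gamma>: "\<gamma> \<in> Ord" "\<And>p. p \<in> C \<Longrightarrow> fst p \<preceq> \<gamma>" "\<And>b. b \<in> Ord \<Longrightarrow> (\<And>p. p \<in> C \<Longrightarrow> fst p \<preceq> b) \<Longrightarrow> \<gamma> \<preceq> b"
  proof -
    obtain \<gamma> where \<gamma>: "\<gamma> \<in> Ord" "\<forall>x\<in>fst ` C. x \<preceq> \<gamma>" "\<forall>c. c \<in> Ord \<longrightarrow> (\<forall>x\<in>fst ` C. x \<preceq> c) \<longrightarrow> \<gamma> \<preceq> c"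
      using lub_Ord[OF L small_le[OF Lk]] by meson
    show thesis by (rule that[of \<gamma>]) (use \<gamma> in simp_all)
  qed
  define d where "d = (\<Union>p\<in>C. dom (snd p))"
  obtain T X where TX: "\<And>p j \<tau> x. p \<in> C \<Longrightarrow> snd p j = Some (\<tau>, x) \<Longrightarrow> \<tau> = T j \<and> rs (fst p) (X j) = x"
    and X0: "\<And>j \<xi>. \<forall>p\<in>C. \<not> \<xi> \<prec> fst p \<Longrightarrow> X j \<xi> = 0"
    using chain_limit[OF C(1) chain sub] by metis
  have rsX: "rs (fst p) (X j) = x" if "p \<in> C" "snd p j = Some (\<tau>, x)" for p j \<tau> x using TX[OF that] by simp
  have X\<gamma>: "rs \<gamma> (X j) = X j" for j
  proof
    fix \<xi>
    have "X j \<xi> = 0" if "\<not> \<xi> \<prec> \<gamma>" using X0[of \<xi>] \<gamma>(2) lt_le_trans that by meson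
    then show "rs \<gamma> (X j) \<xi> = X j \<xi>" by (auto simp: rs_def)
  qed
  have T: "\<exists>p\<in>C. \<exists>x. snd p j = Some (T j, x)" if "j \<in> d" for j
  proof -
    obtain p \<tau> x where p: "p \<in> C" "snd p j = Some (\<tau>, x)" using \<open>j \<in> d\<close> by (auto simp: d_def)
    then show ?thesis using TX[OF p] by auto
  qed
  have T': "\<tau> = T j" if "p \<in> C" "snd p j = Some (\<tau>, x)" for p j \<tau> x using TX[OF that] by simp
  have W: "(rs \<gamma> (T j), X j) \<in> W \<gamma>" if j: "j \<in> d" for j
  proof -
    obtain p x where p: "p \<in> C" "snd p j = Some (T j, x)" using T[OF j] by blast
    \<comment> \<open>A slot may enter the chain late, so a given member need not mention
      \<open>j\<close>; some member of at least the same level does, with the same type.\<close>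
    have up: "\<exists>p'\<in>C. \<exists>x'. snd p' j = Some (T j, x') \<and> fst q \<preceq> fst p'" if q: "q \<in> C" for q
    proof -
      consider "p \<sqsubseteq> q" | "q \<sqsubseteq> p" using chain p(1) q by blast
      then show ?thesis
      proof cases
        case 1 then show ?thesis using p stronger_lev by blast
      next
        case 2
        then obtain x' where "snd q j = Some (T j, x')" using stronger_val[OF 2 p(2)] by blast
        then show ?thesis using q le_refl L by blast
      qed
    qed
    show ?thesis
    proof (cases "\<exists>q\<in>C. fst q = \<gamma>")
      case True
      then obtain q where q: "q \<in> C" "fst q = \<gamma>" by blast
      obtain p' x' where p': "p' \<in> C" "snd p' j = Some (T j, x')" "fst q \<preceq> fst p'" using up[OF q(1)] by meson
      have p'\<gamma>: "fst p' = \<gamma>" using \<gamma>(2)[OF p'(1)] p'(3) q(2) le_antisym by simp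
      have "x' = X j" using rsX[OF p'(1,2)] X\<gamma> p'\<gamma> by simp
      then show ?thesis using QD(5)[OF subsetD[OF C(1) p'(1)] p'(2)] p'\<gamma> by simp
    next
      case False
      then have lt: "fst q \<prec> \<gamma>" if "q \<in> C" for q using le_cases[OF \<gamma>(2)[OF that]] that by blast
      have "\<gamma> \<notin> S"
      proof
        assume "\<gamma> \<in> S"
        then obtain b where b: "b \<prec> \<gamma>" "fst ` C \<subseteq> underS K b" using S_bounded[OF _ _ Lk] lt by (meson image_subsetI)
        have "\<gamma> \<preceq> b" using \<gamma>(3)[OF lt_Ord(1)[OF b(1)]] lt_le b(2) by auto
        then show False using b not_le by metis
      qed
      then have Wf: "W \<gamma> = full W \<gamma>" using full \<gamma>(1) by blast
      have "(rs \<eta> (rs \<gamma> (T j)), rs \<eta> (X j)) \<in> W \<eta>" if \<eta>: "\<eta> \<prec> \<gamma>" for \<eta>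
      proof -
        have \<eta>O: "\<eta> \<in> Ord" using lt_Ord(1)[OF \<eta>] .
        obtain q where q: "q \<in> C" "\<not> fst q \<preceq> \<eta>" using \<gamma>(3)[OF \<eta>O] not_le[OF \<eta>] by metis
        then have "\<eta> \<prec> fst q" using linear[of "fst q" \<eta>] L \<eta>O by auto
        then obtain p' x' where p': "p' \<in> C" "snd p' j = Some (T j, x')" "\<eta> \<prec> fst p'"
          using up[OF q(1)] lt_le_trans by meson
        have "(rs (fst p') (T j), x') \<in> full W (fst p')" using QD(5)[OF subsetD[OF C(1) p'(1)] p'(2)] sub[OF p'(1)] by (rule subsetD[rotated])
        then have "(rs \<eta> (rs (fst p') (T j)), rs \<eta> x') \<in> W \<eta>" using p'(3) by (auto simp: full_def)
        moreover have "rs \<eta> x' = rs \<eta> (X j)" using rsX[OF p'(1,2)] rs_rs(1)[OF lt_le[OF p'(3)]] by metis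
        ultimately show ?thesis using rs_rs(1)[OF lt_le[OF p'(3)]] rs_rs(1)[OF lt_le[OF \<eta>]] by simp
      qed
      moreover have "fsup (T j)" using QD(4)[OF subsetD[OF C(1) p(1)] p(2)] .
      ultimately show ?thesis unfolding Wf by (simp add: full_def fsup_rs X\<gamma>)
    qed
  qed
  define f where "f = (\<lambda>j. if j \<in> d then Some (T j, X j) else None)"
  have domf: "dom f = d" by (auto simp: f_def split: if_splits)
  have q: "(\<gamma>, f) \<in> Q W"
  proof (rule QI)
    show "|dom f| <o \<kappa>" unfolding domf d_def using C QD(2) by (intro small_UN) auto
    show "ord ` dom f \<subseteq> Ord" unfolding domf d_def using C(1) QD(3) by blast
    fix j \<tau> x assume "f j = Some (\<tau>, x)"
    then have j: "j \<in> d" "\<tau> = T j" "x = X j" by (auto simp: f_def split: if_splits)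
    then obtain p y where p: "p \<in> C" "snd p j = Some (T j, y)" using T by meson
    then show "fsup \<tau> \<and> (rs \<gamma> \<tau>, x) \<in> W \<gamma>" using QD(4)[OF subsetD[OF C(1) p(1)] p(2)] W[OF j(1)] j by simp
  qed (rule \<gamma>(1))
  have "(\<gamma>, f) \<sqsubseteq> p" if p: "p \<in> C" for p
    unfolding stronger_def
  proof (intro conjI allI impI)
    fix j \<tau> x assume j: "snd p j = Some (\<tau>, x)"
    then have "j \<in> d" using p by (auto simp: d_def)
    then show "\<exists>x'. snd (\<gamma>, f) j = Some (\<tau>, x') \<and> rs (fst p) x' = x"
      using rsX[OF p j] T'[OF p j] by (simp add: f_def)
  qed (use \<gamma>(2) p in simp)
  moreover have "\<exists>p\<in>C. \<exists>y. snd p j = Some (\<tau>, y)" if "f j = Some (\<tau>, x)" for j \<tau> x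
    using that T[of j] by (auto simp: f_def split: if_splits)
  ultimately show ?thesis using q \<gamma>(3) by (intro bexI[OF _ q]) auto
qed

text \<open>A universe of conditions that does not mention the tree, so that the coding can be fixed
  before \<open>W\<close> is constructed from it; \<open>Q_U\<close> places the actual conditions
  inside.\<close>

definition U :: "'o cond set" where
  "U = {(\<gamma>, f). \<gamma> \<in> Ord \<and> |dom f| <o \<kappa> \<and> ord ` dom f \<subseteq> Ord \<and>
     (\<forall>j \<tau> x. f j = Some (\<tau>, x) \<longrightarrow> fsup \<tau> \<and> rs \<gamma> x = x)}"

text \<open>A set of at most \<kappa> ordinals is bounded, and a correct guess beyond the bound is
  the whole set. This is the familiar consequence \<open>2^\<kappa> = \<kappa>\<^sup>+\<close> of
  diamond.\<close>

lemma guess_all_few: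
  assumes A: "A \<subseteq> Ord" "|A| \<le>o \<kappa>"
  shows "\<exists>\<delta>\<in>Ord. D \<delta> = A"
proof -
  obtain \<eta> where \<eta>: "\<eta> \<in> Ord" "A \<subseteq> underS K \<eta>" using bounded[OF A] by blast
  have "club K {\<delta> \<in> Ord. \<eta> \<prec> \<delta> \<and> (\<forall>\<xi>. \<xi> \<prec> \<delta> \<longrightarrow> id \<xi> \<prec> \<delta>)}" by (rule club_closure) (use \<eta>(1) in auto)
  then obtain \<delta> where \<delta>: "\<delta> \<in> Ord" "\<eta> \<prec> \<delta>" "A \<inter> underS K \<delta> = D \<delta>"
    using guess[OF A(1)] unfolding stationary_def by blast
  have "A \<subseteq> underS K \<delta>" using \<eta>(2) \<delta>(2) lt_trans by blast
  then show ?thesis using \<delta> by blast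
qed

text \<open>A condition becomes a set of at most \<kappa> tuples and then a set of at most \<kappa>
  ordinals; its code is an index at which the diamond sequence has exactly this value, so the
  condition can be read off from the code.\<close>

lemma ex_code: "\<exists>code. inj_on code U \<and> code ` U \<subseteq> Ord"
proof -
  let ?Z = "Ord \<times> (UNIV :: nat set) \<times> Ord \<times> (UNIV :: nat set)"
  have infO: "\<not> finite Ord" using large few_finite by blast
  have "|UNIV :: nat set| \<le>o |Ord|" using infO infinite_iff_card_of_nat by blast
  then have "|Ord \<times> (UNIV :: nat set)| \<le>o |Ord|"
    by (intro card_of_Sigma_ordLeq_infinite[OF infO]) (auto intro: card_of_mono1)
  then have "|(UNIV :: nat set) \<times> Ord \<times> (UNIV :: nat set)| \<le>o |Ord|"
    using \<open>|UNIV :: nat set| \<le>o |Ord|\<close> by (intro card_of_Sigma_ordLeq_infinite[OF infO]) auto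
  then have "|?Z| \<le>o |Ord|" by (intro card_of_Sigma_ordLeq_infinite[OF infO]) (auto intro: card_of_mono1)
  then obtain \<pi> where \<pi>: "inj_on \<pi> ?Z" "\<pi> ` ?Z \<subseteq> Ord" by (auto simp flip: card_of_ordLeq)
  \<comment> \<open>The last component tags the kind of information: level, presence of a slot,
    type, value. Presence has its own tag because a node with type 0 and value 0 contributes to
    neither of the last two.\<close>
  define enc where "enc = (\<lambda>q :: 'o cond. {(fst q, 0 :: nat, fst q, 0 :: nat)} \<union>
     {(ord j, num j, ord j, 1) |j. j \<in> dom (snd q)} \<union>
     {(ord j, num j, \<xi>, 2) |j \<xi> \<tau> x. snd q j = Some (\<tau>, x) \<and> \<tau> \<xi> = 1} \<union>
     {(ord j, num j, \<xi>, 3) |j \<xi> \<tau> x. snd q j = Some (\<tau>, x) \<and> x \<xi> = 1})"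
  have encZ: "enc q \<subseteq> ?Z" "|enc q| \<le>o \<kappa>" if q: "q \<in> U" for q
  proof -
    have U: "fst q \<in> Ord" "|dom (snd q)| <o \<kappa>" "ord ` dom (snd q) \<subseteq> Ord"
      "\<And>j \<tau> x. snd q j = Some (\<tau>, x) \<Longrightarrow> fsup \<tau> \<and> rs (fst q) x = x" using q by (auto simp: U_def split_beta)
    define A where "A = insert (fst q) (ord ` dom (snd q))"
    define B where "B = A \<union> underS K (fst q) \<union> (\<Union>j\<in>dom (snd q). {\<xi>. fst (the (snd q j)) \<xi> \<noteq> 0})"
    have A: "A \<subseteq> Ord" "|A| \<le>o \<kappa>"
    proof -
      have "|{fst q} \<union> ord ` dom (snd q)| \<le>o \<kappa>"
        using U(2) by (intro few_Un few_image few_finite small_le) auto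
      then show "A \<subseteq> Ord" "|A| \<le>o \<kappa>" using U by (auto simp: A_def)
    qed
    have fin: "finite {\<xi>. fst (the (snd q j)) \<xi> \<noteq> 0}" "{\<xi>. fst (the (snd q j)) \<xi> \<noteq> 0} \<subseteq> Ord" if jd: "j \<in> dom (snd q)" for j
    proof -
      obtain \<tau> x where j: "snd q j = Some (\<tau>, x)" using jd by auto
      then show "finite {\<xi>. fst (the (snd q j)) \<xi> \<noteq> 0}" "{\<xi>. fst (the (snd q j)) \<xi> \<noteq> 0} \<subseteq> Ord"
        using U(4)[OF j] unfolding fsup_def by simp_all
    qed
    have "|\<Union>j\<in>dom (snd q). {\<xi>. fst (the (snd q j)) \<xi> \<noteq> 0}| \<le>o \<kappa>"
      using U(2) fin(1) by (intro few_UN few_finite small_le)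
    then have B: "B \<subseteq> Ord" "|B| \<le>o \<kappa>"
      using A fin(2) small[of "fst q"] few_Un underS_subset_Field[of K] unfolding B_def by (simp_all add: few_Un) blast+
    have x: "\<xi> \<prec> fst q" if "snd q j = Some (\<tau>, x)" "x \<xi> = 1" for j \<tau> x \<xi>
    proof (rule ccontr)
      assume "\<not> \<xi> \<prec> fst q"
      then have "rs (fst q) x \<xi> = 0" by (simp add: rs_def)
      then show False using U(4)[OF that(1)] that(2) by simp
    qed
    have "enc q \<subseteq> A \<times> UNIV \<times> B \<times> UNIV"
    proof
      fix z assume "z \<in> enc q"
      then consider "z = (fst q, 0, fst q, 0)" | j where "z = (ord j, num j, ord j, 1)" "j \<in> dom (snd q)"
        | j \<xi> \<tau> x where "z = (ord j, num j, \<xi>, 2)" "snd q j = Some (\<tau>, x)" "\<tau> \<xi> = 1"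
        | j \<xi> \<tau> x where "z = (ord j, num j, \<xi>, 3)" "snd q j = Some (\<tau>, x)" "x \<xi> = 1"
        unfolding enc_def by blast
      then show "z \<in> A \<times> UNIV \<times> B \<times> UNIV"
      proof cases
        case 3
        then have "\<xi> \<in> B" unfolding B_def by (auto intro!: bexI[of _ j])
        then show ?thesis using 3 by (auto simp: A_def)
      next
        case 4
        then have "\<xi> \<in> B" using x unfolding B_def by auto
        then show ?thesis using 4 by (auto simp: A_def)
      qed (auto simp: A_def B_def)
    qed
    moreover have "|A \<times> (UNIV :: nat set) \<times> B \<times> (UNIV :: nat set)| \<le>o \<kappa>"
      by (intro few_Times few_nat A B)
    ultimately show "|enc q| \<le>o \<kappa>" by (rule few_subset)
    show "enc q \<subseteq> ?Z" using \<open>enc q \<subseteq> _\<close> A B by blast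
  qed
  have inj: "inj_on enc U"
  proof (rule inj_onI)
    fix p q assume p: "p \<in> U" and q: "q \<in> U" and eq: "enc p = enc q"
    have 0: "(a, 0, a, 0) \<in> enc p \<longleftrightarrow> a = fst p" for a p by (auto simp: enc_def)
    have 1: "(ord j, num j, ord j, 1) \<in> enc p \<longleftrightarrow> j \<in> dom (snd p)" for j p
      by (auto simp: enc_def) (metis slot.expand)+
    have 2: "(ord j, num j, \<xi>, 2) \<in> enc p \<longleftrightarrow> (\<exists>\<tau> x. snd p j = Some (\<tau>, x) \<and> \<tau> \<xi> = 1)" for j \<xi> p
      by (auto simp: enc_def) (metis slot.expand)+
    have 3: "(ord j, num j, \<xi>, 3) \<in> enc p \<longleftrightarrow> (\<exists>\<tau> x. snd p j = Some (\<tau>, x) \<and> x \<xi> = 1)" for j \<xi> p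
      by (auto simp: enc_def) (metis slot.expand)+
    have "fst p = fst q" using 0 eq by metis
    moreover have "snd p j = snd q j" for j
    proof (cases "j \<in> dom (snd p)")
      case True
      then have "j \<in> dom (snd q)" using 1 eq by metis
      then obtain \<tau> x \<sigma> y where e: "snd p j = Some (\<tau>, x)" "snd q j = Some (\<sigma>, y)" using True by auto
      have "(\<tau> \<xi> = 1) = (\<sigma> \<xi> = 1)" for \<xi> using 2[of j \<xi> p] 2[of j \<xi> q] eq e by auto
      moreover have "(x \<xi> = 1) = (y \<xi> = 1)" for \<xi> using 3[of j \<xi> p] 3[of j \<xi> q] eq e by auto
      ultimately have "\<tau> = \<sigma>" "x = y" by (metis (full_types) bit_not_one_iff ext)+
      then show ?thesis using e by simp
    next
      case False
      then have "j \<notin> dom (snd q)" using 1 eq by metis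
      then show ?thesis using False by (metis domIff)
    qed
    ultimately show "p = q" by (auto intro: prod_eqI)
  qed
  have "\<exists>\<delta>. \<delta> \<in> Ord \<and> D \<delta> = \<pi> ` enc q" if q: "q \<in> U" for q
  proof -
    have "\<pi> ` enc q \<subseteq> Ord" using encZ(1)[OF q] \<pi>(2) by blast
    then have "\<exists>\<delta>\<in>Ord. D \<delta> = \<pi> ` enc q" by (rule guess_all_few[OF _ few_image[OF encZ(2)[OF q]]])
    then show ?thesis by metis
  qed
  then obtain code where code: "\<And>q. q \<in> U \<Longrightarrow> code q \<in> Ord \<and> D (code q) = \<pi> ` enc q" by metis
  have "inj_on code U"
  proof (rule inj_onI)
    fix p q assume pq: "p \<in> U" "q \<in> U" "code p = code q"
    then have "\<pi> ` enc p = \<pi> ` enc q" using code by metis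
    then have "enc p = enc q" using inj_on_image_eq_iff[OF \<pi>(1)] encZ(1) pq by metis
    then show "p = q" using inj pq by (simp add: inj_on_def)
  qed
  moreover have "code ` U \<subseteq> Ord" using code by auto
  ultimately show ?thesis by metis
qed

end

section \<open>The tree of groups\<close>

text \<open>
  Through \<open>code\<close> the diamond sequence guesses sets of conditions.
\<close>

locale coded_diamond = diamond_setting \<kappa> K S D
  for \<kappa> :: "'k rel" and K :: "'o rel" and S D +
  fixes code :: "'o cond \<Rightarrow> 'o"
  assumes code_inj: "inj_on code U" and code_Ord: "code ` U \<subseteq> Ord"
begin

text \<open>The conditions a guess at \<delta> can speak about. Level, slots and types all have to
  lie below \<delta>; the values do so through the level. By \<open>card_Qb\<close> there are at
  most \<kappa> of them.\<close>

definition Qb :: "('o \<Rightarrow> 'o node set) \<Rightarrow> 'o \<Rightarrow> 'o cond set" where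
  "Qb W \<delta> = {p \<in> Q W. fst p \<prec> \<delta> \<and> ord ` dom (snd p) \<subseteq> underS K \<delta> \<and>
     (\<forall>j \<tau> x. snd p j = Some (\<tau>, x) \<longrightarrow> rs \<delta> \<tau> = \<tau>)}"

definition Gs :: "('o \<Rightarrow> 'o node set) \<Rightarrow> 'o \<Rightarrow> 'o cond set" where
  "Gs W \<delta> = {q \<in> Qb W \<delta>. code q \<in> D \<delta>}"

definition cut :: "'o \<Rightarrow> ('o slot \<Rightarrow> 'o node option) \<Rightarrow> 'o cond" where
  "cut \<gamma> f = (\<gamma>, \<lambda>j. map_option (\<lambda>w. (fst w, rs \<gamma> (snd w))) (f j))"

text \<open>Linear independence over the field with two elements, where a combination is a sum over
  a finite set. As \<open>A\<close> ranges over sets of slots, two slots with the same node already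
  violate it.\<close>

definition indep :: "('o slot \<Rightarrow> 'o node option) \<Rightarrow> bool" where
  "indep f \<longleftrightarrow> (\<forall>A. finite A \<longrightarrow> A \<subseteq> dom f \<longrightarrow> A \<noteq> {} \<longrightarrow> (\<Sum>j\<in>A. the (f j)) \<noteq> 0)"

text \<open>
  Genericity of the group \<open>V\<close> of branches below \<open>\<delta>\<close>: along every independent family \<open>f\<close> from \<open>V\<close>, the guessed set is
  met by an extension of \<open>f\<close> within \<open>V\<close>, or else no guessed condition extends some restriction of \<open>f\<close>.
\<close>

definition gen :: "('o \<Rightarrow> 'o node set) \<Rightarrow> 'o node set \<Rightarrow> 'o \<Rightarrow> bool" where
  "gen W V \<delta> \<longleftrightarrow> (\<forall>f. |dom f| <o \<kappa> \<longrightarrow> ord ` dom f \<subseteq> underS K \<delta> \<longrightarrow> ran f \<subseteq> V \<longrightarrow> indep f \<longrightarrow>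
     (\<exists>\<gamma>. \<gamma> \<prec> \<delta> \<and> ((\<exists>f'. f \<subseteq>\<^sub>m f' \<and> ran f' \<subseteq> V \<and> cut \<gamma> f' \<in> Gs W \<delta>) \<or> \<not> (\<exists>q\<in>Gs W \<delta>. q \<sqsubseteq> cut \<gamma> f))))"

text \<open>The invariant of the recursion on levels. In the extension clause the type on all of
  \<delta> is given in advance and only its truncation occurs at level \<gamma>, because the type a
  node must have higher up is dictated by the tree or generator that it belongs to.\<close>

definition good :: "('o \<Rightarrow> 'o node set) \<Rightarrow> 'o node set \<Rightarrow> 'o \<Rightarrow> bool" where
  "good W V \<delta> \<longleftrightarrow> V \<subseteq> full W \<delta> \<and> 0 \<in> V \<and> (\<forall>w\<in>V. \<forall>w'\<in>V. w + w' \<in> V) \<and>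
     (\<forall>\<gamma> \<tau> x. \<gamma> \<prec> \<delta> \<longrightarrow> fsup \<tau> \<longrightarrow> rs \<delta> \<tau> = \<tau> \<longrightarrow> (rs \<gamma> \<tau>, x) \<in> W \<gamma> \<longrightarrow>
        (\<exists>y. rs \<gamma> y = x \<and> (\<tau>, y) \<in> V)) \<and>
     |V| \<le>o \<kappa> \<and> (\<delta> \<notin> S \<longrightarrow> V = full W \<delta>) \<and> (\<delta> \<in> S \<longrightarrow> gen W V \<delta>)"

text \<open>Emptying \<open>W\<close> from \<delta> on makes the step depend on earlier levels only,
  as \<open>adm_wo\<close> demands; \<open>good_cong\<close> and \<open>full_cong\<close> remove the
  cut afterwards.\<close>

definition step :: "('o \<Rightarrow> 'o node set) \<Rightarrow> 'o \<Rightarrow> 'o node set" where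
  "step W \<delta> = (let W' = (\<lambda>\<gamma>. if \<gamma> \<prec> \<delta> then W \<gamma> else {}) in
     if \<delta> \<in> S then (SOME V. good W' V \<delta>) else full W' \<delta>)"

definition W :: "'o \<Rightarrow> 'o node set" where
  "W = wo_rel.worec K step"

lemma full_cong: "(\<And>\<gamma>. \<gamma> \<prec> \<delta> \<Longrightarrow> V \<gamma> = V' \<gamma>) \<Longrightarrow> full V \<delta> = full V' \<delta>"
  by (auto simp: full_def)

lemma Qb_cong:
  assumes "\<And>\<gamma>. \<gamma> \<prec> \<delta> \<Longrightarrow> V \<gamma> = V' \<gamma>" shows "Qb V \<delta> = Qb V' \<delta>"
  using assms by (auto simp: Qb_def Q_def)

lemma good_cong:
  assumes "\<And>\<gamma>. \<gamma> \<prec> \<delta> \<Longrightarrow> V \<gamma> = V' \<gamma>" shows "good V X \<delta> = good V' X \<delta>"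
proof -
  have 1: "full V \<delta> = full V' \<delta>" using full_cong[of \<delta> V V'] assms by blast
  have "Gs V \<delta> = Gs V' \<delta>" using Qb_cong[of \<delta> V V'] assms by (auto simp: Gs_def)
  then have 2: "gen V X \<delta> = gen V' X \<delta>" by (simp add: gen_def)
  have 3: "(\<gamma> \<prec> \<delta> \<longrightarrow> fsup \<tau> \<longrightarrow> rs \<delta> \<tau> = \<tau> \<longrightarrow> (rs \<gamma> \<tau>, x) \<in> V \<gamma> \<longrightarrow> Y) \<longleftrightarrow>
    (\<gamma> \<prec> \<delta> \<longrightarrow> fsup \<tau> \<longrightarrow> rs \<delta> \<tau> = \<tau> \<longrightarrow> (rs \<gamma> \<tau>, x) \<in> V' \<gamma> \<longrightarrow> Y)" for \<gamma> \<tau> x Y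
    using assms by auto
  show ?thesis unfolding good_def 1 2 3 ..
qed

lemma W_rec: "W \<delta> = (if \<delta> \<in> S then (SOME V. good W V \<delta>) else full W \<delta>)"
proof -
  have wr: "wo_rel K" using K by (simp add: wo_rel_def)
  have "wo_rel.adm_wo K step"
    unfolding wo_rel.adm_wo_def[OF wr]
  proof (intro allI impI)
    fix f g :: "'o \<Rightarrow> 'o node set" and x assume "\<forall>y\<in>underS K x. f y = g y"
    then have "(\<lambda>\<gamma>. if \<gamma> \<prec> x then f \<gamma> else {}) = (\<lambda>\<gamma>. if \<gamma> \<prec> x then g \<gamma> else {})" by (intro ext) simp
    then show "step f x = step g x" by (simp add: step_def)
  qed
  then have eq: "W = step W" unfolding W_def by (rule wo_rel.worec_fixpoint[OF wr])
  let ?W = "\<lambda>\<gamma>. if \<gamma> \<prec> \<delta> then W \<gamma> else {}"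
  have "good ?W V \<delta> = good W V \<delta>" for V by (rule good_cong) simp
  moreover have "full ?W \<delta> = full W \<delta>" by (rule full_cong) simp
  moreover have "W \<delta> = step W \<delta>" using eq by metis
  ultimately show ?thesis by (simp add: step_def Let_def)
qed

end

section \<open>Sums over finite sets in characteristic two\<close>

lemma char2_sum_sym_diff:
  fixes g :: "'i \<Rightarrow> 'b :: comm_monoid_add"
  assumes "\<And>i. g i + g i = 0" "finite A" "finite B"
  shows "sum g A + sum g B = sum g ((A - B) \<union> (B - A))"
proof -
  have "sum g A = sum g (A - B) + sum g (A \<inter> B)" using assms(2) by (metis add.commute sum.Int_Diff)
  moreover have "sum g B = sum g (B - A) + sum g (A \<inter> B)" using assms(3) by (metis Int_commute add.commute sum.Int_Diff)
  moreover have "sum g (A \<inter> B) + sum g (A \<inter> B) = 0" using assms(1) by (simp flip: sum.distrib)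
  moreover have "sum g ((A - B) \<union> (B - A)) = sum g (A - B) + sum g (B - A)" using assms by (intro sum.union_disjoint) auto
  ultimately show ?thesis by (metis (no_types, lifting) add.assoc add.commute add.right_neutral)
qed

lemma char2_sum_parity:
  fixes a :: "'b :: comm_monoid_add"
  assumes "a + a = 0" "finite A"
  shows "(\<Sum>j\<in>A. if P j then a else 0) = (if (\<Sum>j\<in>A. of_bool (P j) :: bit) = 1 then a else 0)"
  using assms(2)
proof (induction A rule: finite_induct)
  case (insert j A)
  then show ?case using assms(1) by (cases "P j"; cases "(\<Sum>j\<in>A. of_bool (P j) :: bit) = 1") auto
qed simp

text \<open>After the order of summation is exchanged, each \<open>g i\<close> is counted as often
  as \<open>i\<close> occurs among the sets \<open>F j\<close>, which is an even number of
  times.\<close>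

lemma char2_double_sum:
  fixes g :: "'i \<Rightarrow> 'b :: comm_monoid_add"
  assumes "\<And>i. g i + g i = 0" "finite A" "\<And>j. j \<in> A \<Longrightarrow> finite (F j)"
    and "(\<Sum>j\<in>A. (\<lambda>i. of_bool (i \<in> F j) :: bit)) = 0"
  shows "(\<Sum>j\<in>A. \<Sum>i\<in>F j. g i) = 0"
proof -
  let ?B = "\<Union>j\<in>A. F j"
  have fin: "finite ?B" using assms by simp
  have "(\<Sum>i\<in>F j. g i) = (\<Sum>i\<in>?B. if i \<in> F j then g i else 0)" if "j \<in> A" for j
    using fin that by (subst sum.inter_restrict[symmetric]) (auto intro!: sum.cong)
  then have "(\<Sum>j\<in>A. \<Sum>i\<in>F j. g i) = (\<Sum>i\<in>?B. \<Sum>j\<in>A. if i \<in> F j then g i else 0)"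
    by (simp add: sum.swap[of _ _ A])
  also have "\<dots> = (\<Sum>i\<in>?B. 0)"
  proof (rule sum.cong[OF refl])
    fix i
    have "(\<Sum>j\<in>A. of_bool (i \<in> F j) :: bit) = (\<Sum>j\<in>A. (\<lambda>i. of_bool (i \<in> F j) :: bit)) i" by (simp only: sum_fun_apply)
    also have "\<dots> = 0" unfolding assms(4) by simp
    finally show "(\<Sum>j\<in>A. if i \<in> F j then g i else 0) = 0"
      using char2_sum_parity[OF assms(1,2), of "\<lambda>j. i \<in> F j"] by simp
  qed
  finally show ?thesis by simp
qed

lemma node_add_self [simp]: "(w :: 'o node) + w = 0"
  by (cases w) (simp add: plus_prod_def zero_prod_def)

context coded_diamond
begin

section \<open>Levels that satisfy the invariant, and levels outside \<open>S\<close>\<close>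

abbreviation gd :: "'o \<Rightarrow> bool" where "gd \<gamma> \<equiv> good W (W \<gamma>) \<gamma>"

lemma rs_outside:
  assumes "rs \<delta> x = x" "\<not> \<xi> \<prec> \<delta>" shows "x \<xi> = 0"
proof -
  have "rs \<delta> x \<xi> = 0" using assms(2) by (simp add: rs_def)
  then show ?thesis using assms(1) by simp
qed

lemma W_full: "\<delta> \<notin> S \<Longrightarrow> W \<delta> = full W \<delta>"
  using W_rec[of \<delta>] by simp

lemma gd_full: "gd \<gamma> \<Longrightarrow> W \<gamma> \<subseteq> full W \<gamma>"
  by (simp add: good_def)

lemma gd_0: "gd \<gamma> \<Longrightarrow> (0, 0) \<in> W \<gamma>"
  by (simp add: good_def flip: zero_prod_def)

lemma gd_add: "gd \<gamma> \<Longrightarrow> (\<tau>, x) \<in> W \<gamma> \<Longrightarrow> (\<sigma>, y) \<in> W \<gamma> \<Longrightarrow> (\<tau> + \<sigma>, x + y) \<in> W \<gamma>"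
  unfolding good_def plus_prod_def by fastforce

lemma gd_sum: "gd \<gamma> \<Longrightarrow> (\<And>i. i \<in> A \<Longrightarrow> (f i, g i) \<in> W \<gamma>) \<Longrightarrow> (\<Sum>i\<in>A. f i, \<Sum>i\<in>A. g i) \<in> W \<gamma>"
  by (induction A rule: infinite_finite_induct) (auto simp: gd_0 gd_add)

lemma gd_supp: "gd \<gamma> \<Longrightarrow> (\<tau>, x) \<in> W \<gamma> \<Longrightarrow> rs \<gamma> x = x" "gd \<gamma> \<Longrightarrow> (\<tau>, x) \<in> W \<gamma> \<Longrightarrow> rs \<gamma> \<tau> = \<tau>"
  using gd_full by (auto simp: full_def)

lemma gd_restrict: "gd \<gamma> \<Longrightarrow> (\<tau>, x) \<in> W \<gamma> \<Longrightarrow> \<eta> \<preceq> \<gamma> \<Longrightarrow> (rs \<eta> \<tau>, rs \<eta> x) \<in> W \<eta>"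
  using le_cases[of \<eta> \<gamma>] gd_supp[of \<gamma> \<tau> x] gd_full[of \<gamma>] by (auto simp: full_def)

lemma gd_extend:
  assumes "gd \<delta>" "\<gamma> \<preceq> \<delta>" "fsup \<tau>" "(rs \<gamma> \<tau>, x) \<in> W \<gamma>"
  shows "\<exists>y. rs \<gamma> y = x \<and> (rs \<delta> \<tau>, y) \<in> W \<delta>"
proof (cases "\<gamma> = \<delta>")
  case True
  then show ?thesis using assms gd_supp(1) by blast
next
  case False
  then have "\<gamma> \<prec> \<delta>" using assms(2) le_cases by blast
  moreover have "rs \<gamma> (rs \<delta> \<tau>) = rs \<gamma> \<tau>" using rs_rs(1)[OF assms(2)] .
  ultimately show ?thesis using assms(1,3,4) fsup_rs[of \<tau> \<delta>] rs_idem[of \<delta> \<tau>] unfolding good_def by metis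
qed

text \<open>Slots impose nothing on one another, so each node is extended separately by
  \<open>gd_extend\<close>.\<close>

lemma level_up:
  assumes p: "p \<in> Q W" and \<gamma>: "fst p \<preceq> \<gamma>" and gd: "gd \<gamma>" "gd (fst p)"
  shows "\<exists>p'\<in>Q W. p' \<sqsubseteq> p \<and> fst p' = \<gamma> \<and> dom (snd p') = dom (snd p)"
proof -
  define e where "e = (\<lambda>w. (fst w, SOME y. rs (fst p) y = snd w \<and> (rs \<gamma> (fst w), y) \<in> W \<gamma>) :: 'o node)"
  have e: "\<exists>y. e (\<tau>, x) = (\<tau>, y) \<and> rs (fst p) y = x \<and> (rs \<gamma> \<tau>, y) \<in> W \<gamma>" if "snd p j = Some (\<tau>, x)" for j \<tau> x
    using someI_ex[OF gd_extend[OF gd(1) \<gamma> QD(4)[OF p that] QD(5)[OF p that]]] by (simp add: e_def)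
  let ?f = "\<lambda>j. map_option e (snd p j)"
  have dom: "dom ?f = dom (snd p)" by (auto simp: dom_def)
  have "(\<gamma>, ?f) \<in> Q W"
  proof (rule QI)
    show "\<gamma> \<in> Ord" using \<gamma> le_Ord by blast
    fix j \<tau> y assume "?f j = Some (\<tau>, y)"
    then obtain w where w: "snd p j = Some w" "e w = (\<tau>, y)" by auto
    then have j: "snd p j = Some (\<tau>, snd w)" by (cases w) (simp add: e_def)
    then have "e (\<tau>, snd w) = (\<tau>, y)" using w by simp
    then show "fsup \<tau> \<and> (rs \<gamma> \<tau>, y) \<in> W \<gamma>" using e[OF j] QD(4)[OF p j] by auto
  qed (use QD(2,3)[OF p] dom in simp_all)
  moreover have "(\<gamma>, ?f) \<sqsubseteq> p"
    unfolding stronger_def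
  proof (intro conjI allI impI)
    fix j \<tau> x assume j: "snd p j = Some (\<tau>, x)"
    then show "\<exists>x'. snd (\<gamma>, ?f) j = Some (\<tau>, x') \<and> rs (fst p) x' = x" using e[OF j] by auto
  qed (use \<gamma> in simp)
  ultimately show ?thesis using dom by (intro bexI[of _ "(\<gamma>, ?f)"]) auto
qed

text \<open>A node has to be carried through cofinally many levels, and every limit on the way needs
  a continuation. Both are handled by \<open>generic_bound\<close> for conditions with a single
  slot: the requirements ask for level at least \<open>s\<close>, with \<open>s\<close> in a cofinal
  set of fewer than \<kappa> ordinals.\<close>

lemma extend_not_S:
  assumes \<delta>: "\<delta> \<in> Ord" "\<delta> \<notin> S" and IH: "\<And>\<gamma>. \<gamma> \<prec> \<delta> \<Longrightarrow> gd \<gamma>"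
    and \<gamma>: "\<gamma> \<prec> \<delta>" and \<tau>: "fsup \<tau>" "rs \<delta> \<tau> = \<tau>" and x: "(rs \<gamma> \<tau>, x) \<in> W \<gamma>"
  shows "\<exists>y. rs \<gamma> y = x \<and> (\<tau>, y) \<in> full W \<delta>"
proof -
  have sub: "W \<eta> \<subseteq> full W \<eta>" if "\<eta> \<preceq> \<delta>" for \<eta>
    using le_cases[OF that] gd_full[OF IH] W_full[OF \<delta>(2)] by auto
  obtain Y where Y: "Y \<subseteq> underS K \<delta>" "|Y| <o \<kappa>" "\<And>b. b \<prec> \<delta> \<Longrightarrow> \<exists>s\<in>Y. b \<preceq> s" using not_S[OF \<delta>] by metis
  define j where "j = Slot \<delta> 0"
  define X where "X = {p \<in> Q W. fst p \<preceq> \<delta> \<and> \<gamma> \<preceq> fst p \<and> (\<exists>y. snd p = [j \<mapsto> (\<tau>, y)] \<and> rs \<gamma> y = x)}"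
  have jO: "ord j \<in> Ord" using \<delta> by (simp add: j_def)
  have XI: "(\<eta>, [j \<mapsto> (\<tau>, y)]) \<in> X" if "\<eta> \<preceq> \<delta>" "\<gamma> \<preceq> \<eta>" "(rs \<eta> \<tau>, y) \<in> W \<eta>" "rs \<gamma> y = x" for \<eta> y
    unfolding X_def using that \<tau> jO small_finite[of "{j}"] le_Ord(1)[OF that(1)]
    by (auto intro!: QI split: if_splits)
  have Xne: "(\<gamma>, [j \<mapsto> (\<tau>, x)]) \<in> X"
    using XI[OF lt_le[OF \<gamma>] le_refl[OF lt_Ord(1)[OF \<gamma>]] x] gd_supp(1)[OF IH[OF \<gamma>] x] by simp
  have "\<exists>q\<in>X. \<forall>\<Delta>\<in>(\<lambda>s. {p :: 'o cond. s \<preceq> fst p}) ` Y. \<exists>p\<in>X. p \<in> \<Delta> \<and> q \<sqsubseteq> p"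
  proof (rule generic_bound[OF Ck stronger_trans])
    show "p \<sqsubseteq> p" if "p \<in> X" for p using that stronger_refl[of p W] sub by (auto simp: X_def)
    show "|(\<lambda>s. {p :: 'o cond. s \<preceq> fst p}) ` Y| <o \<kappa>" using Y(2) by (rule small_image)
  next
    fix C assume C: "C \<subseteq> X" "|C| <o \<kappa>" and ch: "\<And>p q. p \<in> C \<Longrightarrow> q \<in> C \<Longrightarrow> p \<sqsubseteq> q \<or> q \<sqsubseteq> p"
    show "\<exists>q\<in>X. \<forall>p\<in>C. q \<sqsubseteq> p"
    proof (cases "C = {}")
      case True
      then show ?thesis using Xne by blast
    next
      case False
      then obtain p where p: "p \<in> C" by blast
      have "\<exists>q\<in>Q W. (\<forall>p\<in>C. q \<sqsubseteq> p) \<and> (\<forall>b. b \<in> Ord \<longrightarrow> (\<forall>p\<in>C. fst p \<preceq> b) \<longrightarrow> fst q \<preceq> b) \<and>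
         (\<forall>j \<tau> x. snd q j = Some (\<tau>, x) \<longrightarrow> (\<exists>p\<in>C. \<exists>y. snd p j = Some (\<tau>, y)))"
        by (rule chain_bound[OF _ False C(2) ch]) (use C(1) sub W_full in \<open>auto simp: X_def\<close>)
      then obtain q where q: "q \<in> Q W" "\<forall>p\<in>C. q \<sqsubseteq> p" "\<forall>b. b \<in> Ord \<longrightarrow> (\<forall>p\<in>C. fst p \<preceq> b) \<longrightarrow> fst q \<preceq> b"
        "\<forall>j \<tau> x. snd q j = Some (\<tau>, x) \<longrightarrow> (\<exists>p\<in>C. \<exists>y. snd p j = Some (\<tau>, y))" by blast
      obtain y where y: "snd p = [j \<mapsto> (\<tau>, y)]" "rs \<gamma> y = x" "\<gamma> \<preceq> fst p" using p C(1) by (auto simp: X_def)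
      have qp: "q \<sqsubseteq> p" using q(2) p by blast
      then obtain z where z: "snd q j = Some (\<tau>, z)" "rs (fst p) z = y" using stronger_val[of q p j \<tau> y] y(1) by auto
      have "snd q i = None" if "i \<noteq> j" for i
      proof (rule ccontr)
        assume "snd q i \<noteq> None"
        then obtain \<sigma> a where "snd q i = Some (\<sigma>, a)" by auto
        then obtain p' b where "p' \<in> C" "snd p' i = Some (\<sigma>, b)" using q(4) by meson
        then show False using C(1) that by (auto simp: X_def split: if_splits)
      qed
      then have "snd q = [j \<mapsto> (\<tau>, z)]" using z(1) by (auto simp: fun_eq_iff)
      moreover have "fst q \<preceq> \<delta>" using q(3) \<delta>(1) C(1) by (auto simp: X_def)
      moreover have "\<gamma> \<preceq> fst q" using y(3) stronger_lev[OF qp] le_trans by blast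
      moreover have "rs \<gamma> z = x" using z(2) y(2,3) rs_rs(1) by metis
      ultimately have "q \<in> X" using q(1) by (auto simp: X_def)
      then show ?thesis using q(2) by blast
    qed
  next
    fix \<Delta> p assume "\<Delta> \<in> (\<lambda>s. {p :: 'o cond. s \<preceq> fst p}) ` Y" and p: "p \<in> X"
    then obtain s where s: "s \<in> Y" "\<Delta> = {p. s \<preceq> fst p}" by blast
    have s\<delta>: "s \<prec> \<delta>" using s Y(1) by blast
    obtain y where y: "snd p = [j \<mapsto> (\<tau>, y)]" "rs \<gamma> y = x" "\<gamma> \<preceq> fst p" "p \<in> Q W" using p by (auto simp: X_def)
    show "\<exists>q\<in>X. q \<in> \<Delta> \<and> q \<sqsubseteq> p"
    proof (cases "s \<preceq> fst p")
      case True
      moreover have "p \<sqsubseteq> p" using stronger_refl[OF y(4)] sub p by (simp add: X_def)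
      ultimately show ?thesis using p s(2) by blast
    next
      case False
      then have ps: "fst p \<prec> s" using linear[OF lt_Ord(1)[OF s\<delta>] QD(1)[OF y(4)]] by blast
      have "(rs (fst p) \<tau>, y) \<in> W (fst p)" using QD(5)[OF y(4), of j] y(1) by simp
      then obtain z where z: "rs (fst p) z = y" "(rs s \<tau>, z) \<in> W s"
        using gd_extend[OF IH[OF s\<delta>] lt_le[OF ps] \<tau>(1)] by blast
      have "rs \<gamma> z = x" using z(1) y(2,3) rs_rs(1) by metis
      then have "(s, [j \<mapsto> (\<tau>, z)]) \<in> X" using XI lt_le[OF s\<delta>] y(3) lt_le[OF ps] le_trans z(2) by metis
      moreover have "(s, [j \<mapsto> (\<tau>, z)]) \<sqsubseteq> p" unfolding stronger_def using y(1) z(1) lt_le[OF ps] by (auto split: if_splits)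
      ultimately show ?thesis using s(2) le_refl lt_Ord(1)[OF s\<delta>] by (intro bexI[of _ "(s, [j \<mapsto> (\<tau>, z)])"]) auto
    qed
  qed
  then obtain q where q: "q \<in> X" "\<And>s. s \<in> Y \<Longrightarrow> \<exists>p\<in>X. s \<preceq> fst p \<and> q \<sqsubseteq> p" by auto
  have qY: "s \<preceq> fst q" if "s \<in> Y" for s using q(2)[OF that] stronger_lev le_trans by blast
  obtain y where y: "snd q = [j \<mapsto> (\<tau>, y)]" "rs \<gamma> y = x" "q \<in> Q W" "fst q \<preceq> \<delta>" using q(1) by (auto simp: X_def)
  have yW: "(rs (fst q) \<tau>, y) \<in> W (fst q)" using QD(5)[OF y(3), of j] y(1) by simp
  \<comment> \<open>Either the bound has reached level \<delta>, or \<open>fst q\<close> is the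
    largest ordinal below \<delta>; in that successor case the node extended by the bit 0 is already
    in \<open>full W \<delta>\<close>.\<close>
  show ?thesis
  proof (cases "fst q = \<delta>")
    case True
    then show ?thesis using yW y(2) \<tau>(2) W_full[OF \<delta>(2)] by auto
  next
    case False
    then have q\<delta>: "fst q \<prec> \<delta>" using y(4) le_cases by blast
    have "(rs b \<tau>, rs b y) \<in> W b" if b: "b \<prec> \<delta>" for b
    proof -
      have bq: "b \<preceq> fst q" using Y(3)[OF b] qY le_trans by blast
      show ?thesis using gd_restrict[OF IH[OF q\<delta>] yW bq] rs_rs(1)[OF bq] by simp
    qed
    moreover have "rs \<delta> y = y" using rs_up[OF gd_supp(1)[OF IH[OF q\<delta>] yW] y(4)] .
    ultimately show ?thesis using \<tau> y(2) by (auto simp: full_def)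
  qed
qed

text \<open>A branch is determined by its restrictions along a cofinal set of fewer than \<kappa>
  levels, so it is coded by a small subset of a set of size at most \<kappa>. This is where
  \<open>2^(<\<kappa>) = \<kappa>\<close> limits the number of branches.\<close>

lemma card_full_not_S:
  assumes \<delta>: "\<delta> \<in> Ord" "\<delta> \<notin> S" and IH: "\<And>\<gamma>. \<gamma> \<prec> \<delta> \<Longrightarrow> gd \<gamma>"
  shows "|full W \<delta>| \<le>o \<kappa>"
proof -
  obtain Y where Y: "Y \<subseteq> underS K \<delta>" "|Y| <o \<kappa>" "\<And>b. b \<prec> \<delta> \<Longrightarrow> \<exists>s\<in>Y. b \<preceq> s" using not_S[OF \<delta>] by metis
  let ?Z = "underS K \<delta> \<times> (\<Union>s\<in>underS K \<delta>. W s) \<times> (UNIV :: bool set) \<times> (UNIV :: bool set)"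
  have Wk: "|W s| \<le>o \<kappa>" if "s \<prec> \<delta>" for s using IH[OF that] by (simp add: good_def)
  have Z: "|?Z| \<le>o \<kappa>" by (intro few_Times few_UN small few_finite Wk) simp_all
  \<comment> \<open>Truncation to \<open>s\<close> forgets the bits at \<open>s\<close>. They are
    recorded separately because \<open>s\<close> may be the largest ordinal below \<delta>.\<close>
  define c where "c = (\<lambda>(\<tau>, x). (\<lambda>s. (s, (rs s \<tau>, rs s x), \<tau> s = 1, x s = 1)) ` Y)"
  have "|full W \<delta>| \<le>o |{A. A \<subseteq> ?Z \<and> |A| <o \<kappa>}|"
  proof (rule card_of_ordLeqI[of c])
    show "c w \<in> {A. A \<subseteq> ?Z \<and> |A| <o \<kappa>}" if "w \<in> full W \<delta>" for w
      using that small_image[OF Y(2)] Y(1) by (auto simp: c_def full_def split: prod.splits)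
    show "inj_on c (full W \<delta>)"
    proof (rule inj_onI)
      fix w v assume wv: "w \<in> full W \<delta>" "v \<in> full W \<delta>" "c w = c v"
      obtain \<tau> x \<sigma> y where w: "w = (\<tau>, x)" and v: "v = (\<sigma>, y)" by fastforce
      have s: "rs s \<tau> = rs s \<sigma> \<and> rs s x = rs s y \<and> (\<tau> s = 1) = (\<sigma> s = 1) \<and> (x s = 1) = (y s = 1)" if "s \<in> Y" for s
      proof -
        have "(s, (rs s \<tau>, rs s x), \<tau> s = 1, x s = 1) \<in> c w" using that unfolding w c_def by auto
        then have "(s, (rs s \<tau>, rs s x), \<tau> s = 1, x s = 1) \<in> c v" using wv(3) by simp
        then show ?thesis unfolding v c_def by auto
      qed
      have "\<tau> \<xi> = \<sigma> \<xi> \<and> x \<xi> = y \<xi>" for \<xi>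
      proof (cases "\<xi> \<prec> \<delta>")
        case True
        then obtain t where t: "t \<in> Y" "\<xi> \<preceq> t" using Y(3) by blast
        show ?thesis
        proof (cases "\<xi> = t")
          case True
          then show ?thesis using s[OF t(1)] by (metis bit_not_one_iff)
        next
          case False
          then have "\<xi> \<prec> t" using t(2) le_cases by blast
          then show ?thesis using s[OF t(1)] unfolding rs_def by metis
        qed
      next
        case False
        have "rs \<delta> \<tau> = \<tau>" "rs \<delta> \<sigma> = \<sigma>" "rs \<delta> x = x" "rs \<delta> y = y" using wv w v by (auto simp: full_def)
        then show ?thesis using rs_outside[OF _ False] by metis
      qed
      then show "w = v" using w v by auto
    qed
  qed
  then show ?thesis using few_small_subsets_of[OF Z] by (rule ordLeq_transitive)
qed

lemma good_not_S:
  assumes \<delta>: "\<delta> \<in> Ord" "\<delta> \<notin> S" and IH: "\<And>\<gamma>. \<gamma> \<prec> \<delta> \<Longrightarrow> gd \<gamma>"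
  shows "gd \<delta>"
  unfolding good_def W_full[OF \<delta>(2)]
proof (intro conjI allI impI ballI)
  show "0 \<in> full W \<delta>" using gd_0[OF IH] by (auto simp: full_def zero_prod_def)
  fix w w' assume w: "w \<in> full W \<delta>" "w' \<in> full W \<delta>"
  obtain \<tau> x \<sigma> y where e: "w = (\<tau>, x)" "w' = (\<sigma>, y)" by fastforce
  have "(rs \<gamma> \<tau> + rs \<gamma> \<sigma>, rs \<gamma> x + rs \<gamma> y) \<in> W \<gamma>" if "\<gamma> \<prec> \<delta>" for \<gamma>
    using gd_add[OF IH[OF that]] w e that by (auto simp: full_def)
  then show "w + w' \<in> full W \<delta>" using w unfolding e full_def by (auto simp: rs_add fsup_add)
qed (use extend_not_S[OF \<delta> IH] card_full_not_S[OF \<delta> IH] \<delta> in auto)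

section \<open>Existence of generic levels\<close>

lemma small_empty: "|{}| <o \<kappa>"
  by (rule small_finite) simp

lemma QbI:
  assumes "\<gamma> \<prec> \<delta>" "|dom f| <o \<kappa>" "ord ` dom f \<subseteq> underS K \<delta>"
    "\<And>j \<tau> x. f j = Some (\<tau>, x) \<Longrightarrow> fsup \<tau> \<and> rs \<delta> \<tau> = \<tau> \<and> (rs \<gamma> \<tau>, x) \<in> W \<gamma>"
  shows "(\<gamma>, f) \<in> Qb W \<delta>"
  unfolding Qb_def mem_Collect_eq
proof (intro conjI allI impI)
  show "(\<gamma>, f) \<in> Q W"
  proof (rule QI[OF lt_Ord(1)[OF assms(1)] assms(2)])
    show "ord ` dom f \<subseteq> Ord" using assms(3) underS_subset_Field by (rule subset_trans)
  qed (use assms(4) in simp)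
qed (use assms in auto)

lemma Qb_Q: "p \<in> Qb W \<delta> \<Longrightarrow> p \<in> Q W" and Qb_lev: "p \<in> Qb W \<delta> \<Longrightarrow> fst p \<prec> \<delta>"
  and Qb_ord: "p \<in> Qb W \<delta> \<Longrightarrow> ord ` dom (snd p) \<subseteq> underS K \<delta>"
  by (simp_all add: Qb_def)

lemma Qb_typ: "p \<in> Qb W \<delta> \<Longrightarrow> snd p j = Some (\<tau>, x) \<Longrightarrow> rs \<delta> \<tau> = \<tau>"
  unfolding Qb_def by blast

definition Ix :: "'o \<Rightarrow> 'o slot set" where "Ix \<delta> = {j. ord j \<prec> \<delta>}"

text \<open>
  For \<open>\<delta> \<in> S\<close>, a sufficiently generic chain of conditions below \<open>\<delta>\<close> yields one branch per slot, and \<open>W \<delta>\<close> is the group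
  they generate. \<open>meets_node\<close> makes every earlier node extend into \<open>W \<delta>\<close>. \<open>meets_guess\<close> gives genericity: an independent family in
  \<open>W \<delta>\<close> is described by the finite sets \<open>\<phi> j\<close> of generators whose sums are its members.
\<close>

definition meets_node :: "'o \<times> ('o \<Rightarrow> bit) \<times> ('o \<Rightarrow> bit) \<Rightarrow> 'o cond set" where
  "meets_node = (\<lambda>(\<gamma>, \<tau>, x). {p. \<gamma> \<preceq> fst p \<and> (\<exists>j y. snd p j = Some (\<tau>, y) \<and> rs \<gamma> y = x)})"

definition node_reqs :: "'o \<Rightarrow> ('o \<times> ('o \<Rightarrow> bit) \<times> ('o \<Rightarrow> bit)) set" where
  "node_reqs \<delta> = {(\<gamma>, \<tau>, x). \<gamma> \<prec> \<delta> \<and> fsup \<tau> \<and> rs \<delta> \<tau> = \<tau> \<and> (rs \<gamma> \<tau>, x) \<in> W \<gamma>}"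

text \<open>What \<open>p\<close> knows about the family whose member at \<open>j\<close> is the sum
  of the generators in \<open>\<phi> j\<close>.\<close>

definition app :: "'o cond \<Rightarrow> ('o slot \<Rightarrow> 'o slot set option) \<Rightarrow> 'o cond" where
  "app p \<phi> = (fst p, \<lambda>j. map_option (\<lambda>F. \<Sum>i\<in>F. the (snd p i)) (\<phi> j))"

definition guess_reqs :: "'o \<Rightarrow> ('o slot \<Rightarrow> 'o slot set option) set" where
  "guess_reqs \<delta> = {\<phi>. |dom \<phi>| <o \<kappa> \<and> dom \<phi> \<subseteq> Ix \<delta> \<and> (\<forall>F\<in>ran \<phi>. finite F \<and> F \<subseteq> Ix \<delta>) \<and>
     (\<forall>A. finite A \<longrightarrow> A \<subseteq> dom \<phi> \<longrightarrow> A \<noteq> {} \<longrightarrow> (\<Sum>j\<in>A. (\<lambda>i. of_bool (i \<in> the (\<phi> j)) :: bit)) \<noteq> 0)}"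

definition meets_guess :: "'o \<Rightarrow> ('o slot \<Rightarrow> 'o slot set option) \<Rightarrow> 'o cond set" where
  "meets_guess \<delta> \<phi> = {p. \<Union>(ran \<phi>) \<subseteq> dom (snd p) \<and>
     ((\<exists>\<phi>'. \<phi> \<subseteq>\<^sub>m \<phi>' \<and> (\<forall>F\<in>ran \<phi>'. finite F \<and> F \<subseteq> dom (snd p)) \<and> app p \<phi>' \<in> Gs W \<delta>) \<or>
      \<not> (\<exists>q\<in>Gs W \<delta>. q \<sqsubseteq> app p \<phi>))}"

lemma card_Ix: "|Ix \<delta>| \<le>o \<kappa>"
proof -
  have "Ix \<delta> \<subseteq> (\<lambda>(a, n). Slot a n) ` (underS K \<delta> \<times> UNIV)"
  proof
    fix j assume "j \<in> Ix \<delta>"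
    then show "j \<in> (\<lambda>(a, n). Slot a n) ` (underS K \<delta> \<times> UNIV)"
      by (cases j) (auto simp: Ix_def)
  qed
  then show ?thesis by (rule few_subset) (intro few_image few_Times small few_nat)
qed

lemma card_Fin_Ix: "|{F. finite F \<and> F \<subseteq> Ix \<delta>}| \<le>o \<kappa>"
  by (rule few_subset[OF _ few_small_subsets_of[OF card_Ix]]) (use small_finite in auto)

lemma card_fsup: "|{\<tau>. fsup \<tau> \<and> rs \<delta> \<tau> = \<tau>}| \<le>o \<kappa>"
proof -
  let ?T = "{\<tau>. fsup \<tau> \<and> rs \<delta> \<tau> = \<tau>}"
  have "|?T| \<le>o |{A. A \<subseteq> underS K \<delta> \<and> |A| <o \<kappa>}|"
  proof (rule card_of_ordLeqI[of "\<lambda>\<tau>. {\<xi>. \<tau> \<xi> \<noteq> 0}"])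
    show "inj_on (\<lambda>\<tau>. {\<xi>. \<tau> \<xi> \<noteq> 0}) ?T"
    proof (rule inj_onI, rule ext)
      fix \<tau> \<sigma> :: "'o \<Rightarrow> bit" and \<xi> assume "{\<xi>. \<tau> \<xi> \<noteq> 0} = {\<xi>. \<sigma> \<xi> \<noteq> 0}"
      then have "(\<tau> \<xi> \<noteq> 0) = (\<sigma> \<xi> \<noteq> 0)" by (simp add: set_eq_iff)
      then show "\<tau> \<xi> = \<sigma> \<xi>" by (cases "\<tau> \<xi> = 0") simp_all
    qed
    show "{\<xi>. \<tau> \<xi> \<noteq> 0} \<in> {A. A \<subseteq> underS K \<delta> \<and> |A| <o \<kappa>}" if "\<tau> \<in> ?T" for \<tau>
    proof -
      have "|{\<xi>. \<tau> \<xi> \<noteq> 0}| <o \<kappa>" using that by (intro small_finite) (simp add: fsup_def)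
      moreover have "{\<xi>. \<tau> \<xi> \<noteq> 0} \<subseteq> underS K \<delta>" using that rs_outside[of \<delta> \<tau>] by blast
      ultimately show ?thesis by simp
    qed
  qed
  then show ?thesis using few_small_subsets_of[OF small] by (rule ordLeq_transitive)
qed

section \<open>Meeting the requirements at a level of cofinality \<kappa>\<close>

context
  fixes \<delta> :: 'o
  assumes \<delta>S: "\<delta> \<in> S" and IH: "\<And>\<gamma>. \<gamma> \<prec> \<delta> \<Longrightarrow> gd \<gamma>"
begin

lemma Qb_refl: "p \<in> Qb W \<delta> \<Longrightarrow> p \<sqsubseteq> p"
  by (rule stronger_refl[OF Qb_Q gd_full[OF IH[OF Qb_lev]]])

text \<open>As \<delta> lies in \<open>S\<close>, the levels of a short chain are bounded strictly
  below \<delta>, and the least-level clause of \<open>chain_bound\<close> keeps the lower bound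
  there.\<close>

lemma Qb_closed:
  assumes C: "C \<subseteq> Qb W \<delta>" "|C| <o \<kappa>" and ch: "\<And>p q. p \<in> C \<Longrightarrow> q \<in> C \<Longrightarrow> p \<sqsubseteq> q \<or> q \<sqsubseteq> p"
  shows "\<exists>q\<in>Qb W \<delta>. \<forall>p\<in>C. q \<sqsubseteq> p"
proof (cases "C = {}")
  case True
  obtain b where "b \<prec> \<delta>" using S_bounded[OF \<delta>S empty_subsetI small_empty] by blast
  then have "(b, Map.empty) \<in> Qb W \<delta>" using small_empty by (intro QbI) auto
  then show ?thesis using True by blast
next
  case False
  have "\<exists>q\<in>Q W. (\<forall>p\<in>C. q \<sqsubseteq> p) \<and> (\<forall>b. b \<in> Ord \<longrightarrow> (\<forall>p\<in>C. fst p \<preceq> b) \<longrightarrow> fst q \<preceq> b) \<and>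
     (\<forall>j \<tau> x. snd q j = Some (\<tau>, x) \<longrightarrow> (\<exists>p\<in>C. \<exists>y. snd p j = Some (\<tau>, y)))"
  proof (rule chain_bound[OF _ False C(2) ch])
    show "C \<subseteq> Q W" using C(1) Qb_Q by blast
    show "W (fst p) \<subseteq> full W (fst p)" if "p \<in> C" for p using gd_full[OF IH[OF Qb_lev]] C(1) that by blast
  qed (use W_full in auto)
  then obtain q where q: "q \<in> Q W" "\<forall>p\<in>C. q \<sqsubseteq> p" "\<forall>b. b \<in> Ord \<longrightarrow> (\<forall>p\<in>C. fst p \<preceq> b) \<longrightarrow> fst q \<preceq> b"
    "\<forall>j \<tau> x. snd q j = Some (\<tau>, x) \<longrightarrow> (\<exists>p\<in>C. \<exists>y. snd p j = Some (\<tau>, y))" by blast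
  have "fst ` C \<subseteq> underS K \<delta>" using C(1) Qb_lev by auto
  then obtain b where b: "b \<prec> \<delta>" "fst ` C \<subseteq> underS K b" using S_bounded[OF \<delta>S _ small_image[OF C(2)]] by metis
  then have "fst q \<preceq> b" using q(3) lt_Ord(1)[OF b(1)] lt_le by (metis image_subset_iff)
  then have lev: "fst q \<prec> \<delta>" using b(1) le_lt_trans by blast
  have "ord j \<prec> \<delta> \<and> rs \<delta> \<tau> = \<tau>" if j: "snd q j = Some (\<tau>, x)" for j \<tau> x
  proof -
    obtain p y where p: "p \<in> C" "snd p j = Some (\<tau>, y)" using q(4) j by meson
    then have "p \<in> Qb W \<delta>" using C(1) by blast
    then show ?thesis using Qb_typ[OF _ p(2)] Qb_ord[of p] p(2) by blast
  qed
  then have "q \<in> Qb W \<delta>" using q(1) lev unfolding Qb_def by auto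
  then show ?thesis using q(2) by blast
qed

lemma Qb_level_up:
  assumes p: "p \<in> Qb W \<delta>" and \<gamma>: "fst p \<preceq> \<gamma>" "\<gamma> \<prec> \<delta>"
  shows "\<exists>p'\<in>Qb W \<delta>. p' \<sqsubseteq> p \<and> fst p' = \<gamma> \<and> dom (snd p') = dom (snd p)"
proof -
  obtain p' where p': "p' \<in> Q W" "p' \<sqsubseteq> p" "fst p' = \<gamma>" "dom (snd p') = dom (snd p)"
    using level_up[OF Qb_Q[OF p] \<gamma>(1) IH[OF \<gamma>(2)] IH[OF Qb_lev[OF p]]] by blast
  have "rs \<delta> \<tau> = \<tau>" if j: "snd p' j = Some (\<tau>, x)" for j \<tau> x
  proof -
    obtain \<sigma> y where "snd p j = Some (\<sigma>, y)" using p'(4) j by fastforce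
    moreover then have "\<sigma> = \<tau>" using stronger_val[OF p'(2)] j by fastforce
    ultimately show ?thesis using Qb_typ[OF p] by blast
  qed
  then have "p' \<in> Qb W \<delta>" using p' \<gamma>(2) Qb_ord[OF p] by (auto simp: Qb_def)
  then show ?thesis using p' by blast
qed

text \<open>If fewer than \<kappa> slots were available below \<delta>, the set of all ordinals
  below \<delta> would be small and, by \<open>S_bounded\<close>, bounded by one of its own
  elements.\<close>

lemma fresh_slots:
  assumes "|Y| <o \<kappa>" "|d| <o \<kappa>"
  shows "\<exists>h. inj_on h Y \<and> h ` Y \<subseteq> Ix \<delta> - d"
proof (rule ccontr)
  assume "\<not> ?thesis"
  then have "|Ix \<delta> - d| <o |Y|" using card_of_ordLess[of Y "Ix \<delta> - d"] by blast
  then have "|Ix \<delta> - d| <o \<kappa>" using assms(1) ordLess_transitive by blast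
  then have "|(Ix \<delta> - d) \<union> d| <o \<kappa>" using assms(2) by (rule small_Un)
  then have "|Ix \<delta>| <o \<kappa>" by (rule small_subset[rotated]) blast
  then have "|ord ` Ix \<delta>| <o \<kappa>" by (rule small_image)
  moreover have "ord ` Ix \<delta> = underS K \<delta>" by (force simp: Ix_def intro: image_eqI[of _ _ "Slot _ 0"])
  ultimately obtain b where "b \<prec> \<delta>" "underS K \<delta> \<subseteq> underS K b" using S_bounded[OF \<delta>S, of "underS K \<delta>"] by auto
  then show False using lt_irrefl by blast
qed

lemma card_node_reqs: "|node_reqs \<delta>| \<le>o \<kappa>"
proof -
  let ?T = "{\<tau>. fsup \<tau> \<and> rs \<delta> \<tau> = \<tau>}"
  have "|?T| \<le>o \<kappa>" by (rule card_fsup)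
  moreover have "|W \<gamma>| \<le>o \<kappa>" if "\<gamma> \<prec> \<delta>" for \<gamma> using IH[OF that] by (simp add: good_def)
  ultimately have "|underS K \<delta> \<times> ?T \<times> (\<Union>\<gamma>\<in>underS K \<delta>. snd ` W \<gamma>)| \<le>o \<kappa>"
    by (intro few_Times few_UN few_image small)
  moreover have "node_reqs \<delta> \<subseteq> underS K \<delta> \<times> ?T \<times> (\<Union>\<gamma>\<in>underS K \<delta>. snd ` W \<gamma>)" by (force simp: node_reqs_def)
  ultimately show ?thesis by (rule few_subset[rotated])
qed

lemma meets_node_dense:
  assumes z: "z \<in> node_reqs \<delta>" and p: "p \<in> Qb W \<delta>"
  shows "\<exists>q\<in>Qb W \<delta>. q \<in> meets_node z \<and> q \<sqsubseteq> p"
proof -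
  obtain \<gamma> \<tau> x where z': "z = (\<gamma>, \<tau>, x)" "\<gamma> \<prec> \<delta>" "fsup \<tau>" "rs \<delta> \<tau> = \<tau>" "(rs \<gamma> \<tau>, x) \<in> W \<gamma>"
    using z by (auto simp: node_reqs_def)
  obtain \<eta> where \<eta>: "\<eta> \<prec> \<delta>" "\<gamma> \<preceq> \<eta>" "fst p \<preceq> \<eta>"
    using linear[OF lt_Ord(1)[OF z'(2)] lt_Ord(1)[OF Qb_lev[OF p]]] z'(2) Qb_lev[OF p] lt_le le_refl lt_Ord(1) by metis
  obtain p' where p': "p' \<in> Qb W \<delta>" "p' \<sqsubseteq> p" "fst p' = \<eta>" using Qb_level_up[OF p \<eta>(3,1)] by blast
  obtain y where y: "rs \<gamma> y = x" "(rs \<eta> \<tau>, y) \<in> W \<eta>" using gd_extend[OF IH[OF \<eta>(1)] \<eta>(2) z'(3,5)] by blast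
  obtain h where h: "h ` {()} \<subseteq> Ix \<delta> - dom (snd p')"
    using fresh_slots[OF small_finite[of "{()}"] QD(2)[OF Qb_Q[OF p'(1)]]] by blast
  define j where "j = h ()"
  have j: "ord j \<prec> \<delta>" "snd p' j = None" using h by (auto simp: j_def Ix_def)
  define q where "q = (\<eta>, (snd p')(j \<mapsto> (\<tau>, y)))"
  have "q \<in> Qb W \<delta>"
    unfolding q_def
  proof (rule QbI[OF \<eta>(1)])
    have "|{j} \<union> dom (snd p')| <o \<kappa>" by (intro small_Un small_finite QD(2)[OF Qb_Q[OF p'(1)]]) simp
    then show "|dom ((snd p')(j \<mapsto> (\<tau>, y)))| <o \<kappa>" by simp
    show "ord ` dom ((snd p')(j \<mapsto> (\<tau>, y))) \<subseteq> underS K \<delta>" using Qb_ord[OF p'(1)] j by auto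
    fix i \<sigma> w assume i: "((snd p')(j \<mapsto> (\<tau>, y))) i = Some (\<sigma>, w)"
    show "fsup \<sigma> \<and> rs \<delta> \<sigma> = \<sigma> \<and> (rs \<eta> \<sigma>, w) \<in> W \<eta>"
    proof (cases "i = j")
      case True
      then show ?thesis using i z' y by auto
    next
      case False
      then have "snd p' i = Some (\<sigma>, w)" using i by simp
      then show ?thesis using QD(4,5)[OF Qb_Q[OF p'(1)]] Qb_typ[OF p'(1)] p'(3) by metis
    qed
  qed
  moreover have "q \<sqsubseteq> p'"
    unfolding stronger_def
  proof (intro conjI allI impI)
    show "fst p' \<preceq> fst q" using p'(3) le_refl[OF lt_Ord(1)[OF \<eta>(1)]] by (simp add: q_def)
    fix i \<sigma> w assume i: "snd p' i = Some (\<sigma>, w)"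
    then have "rs (fst p') w = w" using stronger_val[OF Qb_refl[OF p'(1)] i] by auto
    then show "\<exists>x'. snd q i = Some (\<sigma>, x') \<and> rs (fst p') x' = w" using i j by (auto simp: q_def)
  qed
  then have "q \<sqsubseteq> p" using p'(2) stronger_trans by blast
  moreover have "q \<in> meets_node z" using \<eta>(2) y(1) unfolding meets_node_def z'(1) q_def by auto
  ultimately show ?thesis by blast
qed

lemma card_guess_reqs: "|guess_reqs \<delta>| \<le>o \<kappa>"
proof -
  let ?Z = "Ix \<delta> \<times> {F. finite F \<and> F \<subseteq> Ix \<delta>}"
  have Z: "|?Z| \<le>o \<kappa>" using card_Ix card_Fin_Ix by (rule few_Times)
  have "|guess_reqs \<delta>| \<le>o |{A. A \<subseteq> ?Z \<and> |A| <o \<kappa>}|"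
  proof (rule card_of_ordLeqI[of "\<lambda>\<phi>. (\<lambda>j. (j, the (\<phi> j))) ` dom \<phi>"])
    show "inj_on (\<lambda>\<phi>. (\<lambda>j. (j, the (\<phi> j))) ` dom \<phi>) (guess_reqs \<delta>)"
    proof (rule inj_onI)
      fix \<phi> \<psi> :: "'o slot \<Rightarrow> 'o slot set option"
      assume eq: "(\<lambda>j. (j, the (\<phi> j))) ` dom \<phi> = (\<lambda>j. (j, the (\<psi> j))) ` dom \<psi>"
      have "(\<phi> j = Some F) = (\<psi> j = Some F)" for j F
      proof -
        have *: "(f j = Some F) = ((j, F) \<in> (\<lambda>j. (j, the (f j))) ` dom f)" for f :: "'o slot \<Rightarrow> 'o slot set option"
          by force
        show ?thesis unfolding *[of \<phi>] *[of \<psi>] eq ..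
      qed
      then show "\<phi> = \<psi>" by (intro ext) (metis not_None_eq)
    qed
    show "(\<lambda>j. (j, the (\<phi> j))) ` dom \<phi> \<in> {A. A \<subseteq> ?Z \<and> |A| <o \<kappa>}" if \<phi>: "\<phi> \<in> guess_reqs \<delta>" for \<phi>
    proof -
      have "|(\<lambda>j. (j, the (\<phi> j))) ` dom \<phi>| <o \<kappa>" using \<phi> by (intro small_image) (simp add: guess_reqs_def)
      moreover have "(j, the (\<phi> j)) \<in> ?Z" if "j \<in> dom \<phi>" for j
      proof -
        have "the (\<phi> j) \<in> ran \<phi>" using that by (auto simp: ran_def)
        then show ?thesis using \<phi> that by (auto simp: guess_reqs_def)
      qed
      ultimately show ?thesis by auto
    qed
  qed
  then show ?thesis using few_small_subsets_of[OF Z] by (rule ordLeq_transitive)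
qed

text \<open>The guessed condition \<open>q\<close> prescribes sums of generators rather than
  generators. Once \<open>p\<close> is raised to the level of \<open>q\<close>, its sums differ from
  the prescribed nodes by elements of type 0 that vanish below the old level. As the index sets are
  independent, these discrepancies can be spread over the generators without changing what
  \<open>p\<close> has said about them.\<close>

lemma meets_guess_dense_step:
  assumes \<phi>: "\<phi> \<in> guess_reqs \<delta>" and p: "p \<in> Qb W \<delta>" and dom: "\<Union>(ran \<phi>) \<subseteq> dom (snd p)"
    and q: "q \<in> Gs W \<delta>" "q \<sqsubseteq> app p \<phi>"
  shows "\<exists>p'\<in>Qb W \<delta>. p' \<in> meets_guess \<delta> \<phi> \<and> p' \<sqsubseteq> p"
proof -
  have qb: "q \<in> Qb W \<delta>" using q(1) by (simp add: Gs_def)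
  define \<gamma> where "\<gamma> = fst p"
  define \<gamma>' where "\<gamma>' = fst q"
  have \<gamma>: "\<gamma> \<preceq> \<gamma>'" "\<gamma>' \<prec> \<delta>" using stronger_lev[OF q(2)] Qb_lev[OF qb] by (simp_all add: app_def \<gamma>_def \<gamma>'_def)
  obtain r where r: "r \<in> Qb W \<delta>" "r \<sqsubseteq> p" "fst r = \<gamma>'" "dom (snd r) = dom (snd p)"
    using Qb_level_up[OF p, of \<gamma>'] \<gamma> by (auto simp: \<gamma>_def)
  define T where "T = (\<lambda>i. fst (the (snd p i)))"
  define x where "x = (\<lambda>i. snd (the (snd p i)))"
  define y where "y = (\<lambda>i. snd (the (snd r i)))"
  have pi: "snd p i = Some (T i, x i)" and ri: "snd r i = Some (T i, y i)" and rsy: "rs \<gamma> (y i) = x i"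
    and yW: "(rs \<gamma>' (T i), y i) \<in> W \<gamma>'" and Tf: "fsup (T i)" "rs \<delta> (T i) = T i"
    if i: "i \<in> dom (snd p)" for i
  proof -
    show pi: "snd p i = Some (T i, x i)" using i by (auto simp: T_def x_def)
    obtain z where z: "snd r i = Some (T i, z)" "rs \<gamma> z = x i" using stronger_val[OF r(2) pi] by (auto simp: \<gamma>_def)
    have "y i = z" using z by (simp add: y_def)
    then show ri: "snd r i = Some (T i, y i)" and "rs \<gamma> (y i) = x i" using z by simp_all
    show "(rs \<gamma>' (T i), y i) \<in> W \<gamma>'" using QD(5)[OF Qb_Q[OF r(1)] ri] r(3) by simp
    show "fsup (T i)" using QD(4)[OF Qb_Q[OF p] pi] .
    show "rs \<delta> (T i) = T i" using Qb_typ[OF p pi] .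
  qed
  define d where "d = dom \<phi>"
  define F where "F = (\<lambda>j. the (\<phi> j))"
  have F: "\<phi> j = Some (F j)" "finite (F j)" "F j \<subseteq> dom (snd p)" "F j \<subseteq> Ix \<delta>" if j: "j \<in> d" for j
  proof -
    show e: "\<phi> j = Some (F j)" using j by (auto simp: F_def d_def)
    then have ran: "F j \<in> ran \<phi>" by (auto simp: ran_def)
    show "finite (F j)" "F j \<subseteq> Ix \<delta>" using \<phi> ran by (auto simp: guess_reqs_def)
    show "F j \<subseteq> dom (snd p)" using dom ran by blast
  qed
  have app_p: "snd (app p \<phi>) j = Some (\<Sum>i\<in>F j. T i, \<Sum>i\<in>F j. x i)" if j: "j \<in> d" for j
  proof -
    have "(\<Sum>i\<in>F j. the (snd p i)) = (\<Sum>i\<in>F j. T i, \<Sum>i\<in>F j. x i)"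
      by (rule prod_eqI) (simp_all add: fst_sum_prod snd_sum_prod T_def x_def)
    then show ?thesis using F(1)[OF j] by (simp add: app_def)
  qed
  define z where "z = (\<lambda>j. snd (the (snd q j)))"
  have qj: "snd q j = Some (\<Sum>i\<in>F j. T i, z j)" "rs \<gamma> (z j) = (\<Sum>i\<in>F j. x i)" if j: "j \<in> d" for j
  proof -
    obtain u where u: "snd q j = Some (\<Sum>i\<in>F j. T i, u)" "rs (fst (app p \<phi>)) u = (\<Sum>i\<in>F j. x i)"
      using stronger_val[OF q(2) app_p[OF j]] by blast
    then have "z j = u" by (simp add: z_def)
    then show "snd q j = Some (\<Sum>i\<in>F j. T i, z j)" "rs \<gamma> (z j) = (\<Sum>i\<in>F j. x i)" using u by (simp_all add: app_def \<gamma>_def)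
  qed
  have zW: "(rs \<gamma>' (\<Sum>i\<in>F j. T i), z j) \<in> W \<gamma>'" if j: "j \<in> d" for j
    using QD(5)[OF Qb_Q[OF qb] qj(1)[OF j]] by (simp add: \<gamma>'_def)
  note gd' = IH[OF \<gamma>(2)]
  \<comment> \<open>The admissible corrections: adding one to a generator alters neither its type
    nor its values below the level of \<open>p\<close>. The discrepancy \<open>k j\<close> lies in
    \<open>G\<close> because the types of the two nodes and their truncations agree.\<close>
  define G where "G = {u. rs \<gamma> u = 0 \<and> (0, u) \<in> W \<gamma>'}"
  define k where "k = (\<lambda>j. z j + (\<Sum>i\<in>F j. y i))"
  have "\<exists>\<psi>. (\<forall>i. \<psi> i \<in> G) \<and> (\<forall>j\<in>d. (\<Sum>i\<in>F j. \<psi> i) = k j)"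
  proof (rule solve_independent_system)
    show "finite (F j)" if "j \<in> d" for j using F(2)[OF that] .
    show "(\<Sum>j\<in>A. (\<lambda>i. of_bool (i \<in> F j) :: bit)) \<noteq> 0" if "finite A" "A \<subseteq> d" "A \<noteq> {}" for A
      using \<phi> that unfolding guess_reqs_def F_def d_def by blast
    show "0 \<in> G" using gd_0[OF gd'] by (simp add: G_def)
    show "u + v \<in> G" if "u \<in> G" "v \<in> G" for u v using that gd_add[OF gd', of 0 u 0 v] by (simp add: G_def rs_add)
    show "k j \<in> G" if j: "j \<in> d" for j
    proof -
      have "(\<Sum>i\<in>F j. rs \<gamma>' (T i), \<Sum>i\<in>F j. y i) \<in> W \<gamma>'"
        by (rule gd_sum[OF gd']) (use yW F(3)[OF j] in blast)
      then have "(rs \<gamma>' (\<Sum>i\<in>F j. T i) + rs \<gamma>' (\<Sum>i\<in>F j. T i), k j) \<in> W \<gamma>'"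
        using gd_add[OF gd' zW[OF j]] unfolding rs_sum k_def by blast
      then have "(0, k j) \<in> W \<gamma>'" unfolding fun_bit_add_self .
      moreover have "rs \<gamma> (k j) = 0"
      proof -
        have "(\<Sum>i\<in>F j. rs \<gamma> (y i)) = (\<Sum>i\<in>F j. x i)" by (rule sum.cong[OF HOL.refl]) (use rsy F(3)[OF j] in blast)
        then have "rs \<gamma> (k j) = (\<Sum>i\<in>F j. x i) + (\<Sum>i\<in>F j. x i)" using qj(2)[OF j] by (simp only: k_def rs_add rs_sum)
        then show ?thesis unfolding fun_bit_add_self .
      qed
      ultimately show ?thesis by (simp add: G_def)
    qed
  qed
  then obtain \<psi> where \<psi>: "\<And>i. rs \<gamma> (\<psi> i) = 0" "\<And>i. (0, \<psi> i) \<in> W \<gamma>'" "\<And>j. j \<in> d \<Longrightarrow> (\<Sum>i\<in>F j. \<psi> i) = k j"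
    by (auto simp: G_def)
  \<comment> \<open>Slots of \<open>q\<close> outside the domain of \<phi> become new generators.
    They are renamed by \<open>h\<close>, because slots of the guessed family and slots of the
    generators are unrelated labels.\<close>
  define N where "N = dom (snd q) - d"
  have dq: "d \<subseteq> dom (snd q)" using qj(1) by blast
  have Nk: "|N| <o \<kappa>" unfolding N_def by (rule small_subset[OF Diff_subset QD(2)[OF Qb_Q[OF qb]]])
  obtain h where h: "inj_on h N" "h ` N \<subseteq> Ix \<delta> - dom (snd p)"
    using fresh_slots[OF Nk QD(2)[OF Qb_Q[OF p]]] by blast
  define f where "f = (\<lambda>i. if i \<in> dom (snd p) then Some (T i, y i + \<psi> i)
     else if i \<in> h ` N then snd q (inv_into N h i) else None)"
  have fp: "f i = Some (T i, y i + \<psi> i)" if "i \<in> dom (snd p)" for i using that by (simp add: f_def)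
  have fh: "f (h j) = snd q j" if "j \<in> N" for j
    using that h by (auto simp: f_def inv_into_f_f)
  have domf: "dom f = dom (snd p) \<union> h ` N"
  proof -
    have "i \<in> dom f" if i: "i \<in> h ` N" for i
    proof -
      obtain j where j: "j \<in> N" "i = h j" using i by blast
      have "j \<in> dom (snd q)" using j(1) by (simp add: N_def)
      then show ?thesis using fh[OF j(1)] j(2) by (simp add: domIff)
    qed
    moreover have "i \<in> dom f" if "i \<in> dom (snd p)" for i using fp[OF that] by blast
    moreover have "i \<in> dom (snd p) \<union> h ` N" if "i \<in> dom f" for i
      using that unfolding f_def by (auto split: if_splits)
    ultimately show ?thesis by blast
  qed
  have qk: "|dom f| <o \<kappa>" unfolding domf by (intro small_Un small_image Nk QD(2)[OF Qb_Q[OF p]])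
  define p' where "p' = (\<gamma>', f)"
  have p'b: "p' \<in> Qb W \<delta>"
    unfolding p'_def
  proof (rule QbI[OF \<gamma>(2) qk])
    show "ord ` dom f \<subseteq> underS K \<delta>" unfolding domf using h(2) Qb_ord[OF p] unfolding Ix_def by blast
    fix i \<tau> u assume i: "f i = Some (\<tau>, u)"
    show "fsup \<tau> \<and> rs \<delta> \<tau> = \<tau> \<and> (rs \<gamma>' \<tau>, u) \<in> W \<gamma>'"
    proof (cases "i \<in> dom (snd p)")
      case True
      then have "\<tau> = T i" "u = y i + \<psi> i" using i fp by auto
      then show ?thesis using Tf[OF True] gd_add[OF gd' yW[OF True] \<psi>(2)[of i]] by simp
    next
      case False
      then obtain j where j: "j \<in> N" "i = h j" using i domf by blast
      then have "snd q j = Some (\<tau>, u)" using i fh by simp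
      then show ?thesis using QD(4,5)[OF Qb_Q[OF qb]] Qb_typ[OF qb] unfolding \<gamma>'_def by blast
    qed
  qed
  have p'p: "p' \<sqsubseteq> p"
    unfolding stronger_def
  proof (intro conjI allI impI)
    show "fst p \<preceq> fst p'" using \<gamma>(1) by (simp add: \<gamma>_def p'_def)
    fix i \<tau> u assume i: "snd p i = Some (\<tau>, u)"
    then have id: "i \<in> dom (snd p)" by blast
    then show "\<exists>u'. snd p' i = Some (\<tau>, u') \<and> rs (fst p) u' = u"
      using fp[OF id] pi[OF id] rsy[OF id] \<psi>(1)[of i] i by (simp add: p'_def rs_add flip: \<gamma>_def)
  qed
  define \<phi>' where "\<phi>' = (\<lambda>j. if j \<in> d then Some (F j) else if j \<in> N then Some {h j} else None)"
  have "\<phi> \<subseteq>\<^sub>m \<phi>'" using F(1) by (auto simp: map_le_def \<phi>'_def d_def)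
  moreover have "\<forall>A\<in>ran \<phi>'. finite A \<and> A \<subseteq> dom (snd p')"
  proof
    fix A assume "A \<in> ran \<phi>'"
    then obtain j where "\<phi>' j = Some A" by (auto simp: ran_def)
    then consider "j \<in> d" "A = F j" | "j \<in> N" "A = {h j}" by (auto simp: \<phi>'_def split: if_splits)
    then show "finite A \<and> A \<subseteq> dom (snd p')"
      by cases (use F(2,3) domf in \<open>auto simp: p'_def\<close>)
  qed
  moreover have "app p' \<phi>' = q"
  proof (rule prod_eqI)
    show "fst (app p' \<phi>') = fst q" by (simp add: app_def p'_def \<gamma>'_def)
    show "snd (app p' \<phi>') = snd q"
    proof
      fix j
      consider "j \<in> d" | "j \<in> N" | "j \<notin> dom (snd q)" using dq by (auto simp: N_def)
      then show "snd (app p' \<phi>') j = snd q j"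
      proof cases
        case 1
        have "(\<Sum>i\<in>F j. the (f i)) = (\<Sum>i\<in>F j. (T i, y i + \<psi> i))"
        proof (rule sum.cong[OF HOL.refl])
          fix i assume "i \<in> F j"
          then have "i \<in> dom (snd p)" using F(3)[OF 1] by blast
          then show "the (f i) = (T i, y i + \<psi> i)" using fp by simp
        qed
        also have "\<dots> = (\<Sum>i\<in>F j. T i, z j)"
        proof (rule prod_eqI)
          have "(\<Sum>i\<in>F j. y i + \<psi> i) = (\<Sum>i\<in>F j. y i) + k j" using \<psi>(3)[OF 1] by (simp add: sum.distrib)
          also have "\<dots> = (\<Sum>i\<in>F j. y i) + ((\<Sum>i\<in>F j. y i) + z j)" by (simp only: k_def add.commute)
          also have "\<dots> = z j" by (rule fun_bit_add_cancel)
          finally show "snd (\<Sum>i\<in>F j. (T i, y i + \<psi> i)) = snd (\<Sum>i\<in>F j. T i, z j)" by (simp add: snd_sum_prod)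
        qed (simp add: fst_sum_prod)
        finally show ?thesis using 1 qj(1)[OF 1] by (simp add: app_def \<phi>'_def p'_def)
      next
        case 2
        then have "j \<notin> d" "j \<in> dom (snd q)" by (auto simp: N_def)
        then show ?thesis using 2 fh[OF 2] by (auto simp: app_def \<phi>'_def p'_def)
      next
        case 3
        then have "j \<notin> d" "j \<notin> N" using dq by (auto simp: N_def)
        moreover have "snd q j = None" using 3 by (meson domI not_None_eq)
        ultimately show ?thesis by (simp add: app_def \<phi>'_def)
      qed
    qed
  qed
  moreover have "\<Union>(ran \<phi>) \<subseteq> dom (snd p')" using dom domf by (auto simp: p'_def)
  ultimately have "p' \<in> meets_guess \<delta> \<phi>" using q(1) unfolding meets_guess_def by blast
  then show ?thesis using p'b p'p by blast
qed

text \<open>The generators named by \<phi> have to be present before the question can be put, and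
  missing ones are started as zero nodes. Then either a guessed condition lies below, or the second
  alternative of \<open>meets_guess\<close> holds as it stands.\<close>

lemma meets_guess_dense:
  assumes \<phi>: "\<phi> \<in> guess_reqs \<delta>" and p: "p \<in> Qb W \<delta>"
  shows "\<exists>p'\<in>Qb W \<delta>. p' \<in> meets_guess \<delta> \<phi> \<and> p' \<sqsubseteq> p"
proof -
  let ?B = "\<Union>(ran \<phi>)"
  have ran: "ran \<phi> = (\<lambda>j. the (\<phi> j)) ` dom \<phi>" by (force simp: ran_def)
  have "|\<Union>F\<in>ran \<phi>. F| <o \<kappa>"
  proof (rule small_UN)
    show "|ran \<phi>| <o \<kappa>" unfolding ran by (rule small_image) (use \<phi> in \<open>simp add: guess_reqs_def\<close>)
    show "|F| <o \<kappa>" if "F \<in> ran \<phi>" for F by (rule small_finite) (use \<phi> that in \<open>simp add: guess_reqs_def\<close>)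
  qed
  then have Bk: "|?B| <o \<kappa>" by simp
  have BI: "?B \<subseteq> Ix \<delta>" using \<phi> by (auto simp: guess_reqs_def)
  define f where "f = (\<lambda>i. if i \<in> dom (snd p) then snd p i else if i \<in> ?B then Some (0, 0) else None)"
  have domf: "dom f = dom (snd p) \<union> ?B" by (auto simp: f_def split: if_splits)
  let ?p = "(fst p, f)"
  have pb: "?p \<in> Qb W \<delta>"
  proof (rule QbI[OF Qb_lev[OF p]])
    show "|dom f| <o \<kappa>" unfolding domf by (intro small_Un Bk QD(2)[OF Qb_Q[OF p]])
    show "ord ` dom f \<subseteq> underS K \<delta>" unfolding domf using BI Qb_ord[OF p] unfolding Ix_def by blast
    fix i \<tau> u assume i: "f i = Some (\<tau>, u)"
    show "fsup \<tau> \<and> rs \<delta> \<tau> = \<tau> \<and> (rs (fst p) \<tau>, u) \<in> W (fst p)"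
    proof (cases "i \<in> dom (snd p)")
      case True
      then have "snd p i = Some (\<tau>, u)" using i by (simp add: f_def)
      then show ?thesis using QD(4,5)[OF Qb_Q[OF p]] Qb_typ[OF p] by blast
    next
      case False
      then have "\<tau> = 0" "u = 0" using i by (auto simp: f_def split: if_splits)
      then show ?thesis using gd_0[OF IH[OF Qb_lev[OF p]]] by simp
    qed
  qed
  have pp: "?p \<sqsubseteq> p"
    unfolding stronger_def
  proof (intro conjI allI impI)
    show "fst p \<preceq> fst ?p" using le_refl lt_Ord(1)[OF Qb_lev[OF p]] by simp
    fix i \<tau> u assume i: "snd p i = Some (\<tau>, u)"
    then have "rs (fst p) u = u" using stronger_val[OF Qb_refl[OF p] i] by auto
    then show "\<exists>u'. snd ?p i = Some (\<tau>, u') \<and> rs (fst p) u' = u" using i by (auto simp: f_def)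
  qed
  have dom: "?B \<subseteq> dom (snd ?p)" using domf by simp
  show ?thesis
  proof (cases "\<exists>q\<in>Gs W \<delta>. q \<sqsubseteq> app ?p \<phi>")
    case True
    then obtain q where "q \<in> Gs W \<delta>" "q \<sqsubseteq> app ?p \<phi>" by blast
    then show ?thesis using meets_guess_dense_step[OF \<phi> pb dom] stronger_trans[OF _ pp] by meson
  next
    case False
    then have "?p \<in> meets_guess \<delta> \<phi>" using dom unfolding meets_guess_def by blast
    then show ?thesis using pb pp by blast
  qed
qed

lemma ex_good: "\<exists>V. good W V \<delta>"
proof -
  have "\<exists>G\<subseteq>Qb W \<delta>. (\<forall>p\<in>G. \<forall>q\<in>G. p \<sqsubseteq> q \<or> q \<sqsubseteq> p) \<and> (\<forall>\<Delta>\<in>meets_node ` node_reqs \<delta> \<union> meets_guess \<delta> ` guess_reqs \<delta>. G \<inter> \<Delta> \<noteq> {})"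
  proof (rule generic_chain[OF Ck stronger_trans Qb_refl Qb_closed])
    show "|meets_node ` node_reqs \<delta> \<union> meets_guess \<delta> ` guess_reqs \<delta>| \<le>o \<kappa>"
      by (intro few_Un few_image card_node_reqs card_guess_reqs)
    show "\<exists>q\<in>Qb W \<delta>. q \<in> \<Delta> \<and> q \<sqsubseteq> p" if "\<Delta> \<in> meets_node ` node_reqs \<delta> \<union> meets_guess \<delta> ` guess_reqs \<delta>" "p \<in> Qb W \<delta>" for \<Delta> p
      using that meets_node_dense[OF _ that(2)] meets_guess_dense[OF _ that(2)] by auto
  qed
  then obtain G where G: "G \<subseteq> Qb W \<delta>" and G2: "\<forall>p\<in>G. \<forall>q\<in>G. p \<sqsubseteq> q \<or> q \<sqsubseteq> p"
    and meets: "\<forall>\<Delta>\<in>meets_node ` node_reqs \<delta> \<union> meets_guess \<delta> ` guess_reqs \<delta>. G \<inter> \<Delta> \<noteq> {}" by meson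
  have ch: "p \<sqsubseteq> q \<or> q \<sqsubseteq> p" if "p \<in> G" "q \<in> G" for p q using G2 that by simp
  have G3: "\<exists>p\<in>G. p \<in> meets_node z" if "z \<in> node_reqs \<delta>" for z using bspec[OF meets, of "meets_node z"] that by auto
  have G4: "\<exists>p\<in>G. p \<in> meets_guess \<delta> \<phi>" if "\<phi> \<in> guess_reqs \<delta>" for \<phi> using bspec[OF meets, of "meets_guess \<delta> \<phi>"] that by auto
  have GQ: "p \<in> Q W" "fst p \<prec> \<delta>" "gd (fst p)" if "p \<in> G" for p
    using that G Qb_Q Qb_lev IH by blast+
  have "G \<subseteq> Q W" using GQ(1) by blast
  then obtain T X where TX: "\<And>p j \<tau> x. p \<in> G \<Longrightarrow> snd p j = Some (\<tau>, x) \<Longrightarrow> \<tau> = T j \<and> rs (fst p) (X j) = x"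
    and X0: "\<And>j \<xi>. \<forall>p\<in>G. \<not> \<xi> \<prec> fst p \<Longrightarrow> X j \<xi> = 0"
    using chain_limit[of G W, OF _ ch gd_full[OF GQ(3)]] by metis
  define dG where "dG = (\<Union>p\<in>G. dom (snd p))"
  define g where "g = (\<lambda>i. (T i, X i))"
  have Gi: "snd p i = Some (T i, rs (fst p) (X i))" if "p \<in> G" "i \<in> dom (snd p)" for p i
  proof -
    obtain \<tau> x where e: "snd p i = Some (\<tau>, x)" using \<open>i \<in> dom (snd p)\<close> by auto
    then show ?thesis using TX[OF that(1) e] by simp
  qed
  have dGI: "dG \<subseteq> Ix \<delta>" using G Qb_ord unfolding dG_def Ix_def by blast
  have X\<delta>: "rs \<delta> (X i) = X i" for i
  proof
    fix \<xi>
    have "X i \<xi> = 0" if "\<not> \<xi> \<prec> \<delta>" using X0[of \<xi>] GQ(2) lt_trans that by metis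
    then show "rs \<delta> (X i) \<xi> = X i \<xi>" by (auto simp: rs_def)
  qed
  have T\<delta>: "rs \<delta> (T i) = T i" "fsup (T i)" if i: "i \<in> dG" for i
  proof -
    obtain p where p: "p \<in> G" "i \<in> dom (snd p)" using i by (auto simp: dG_def)
    show "rs \<delta> (T i) = T i" using Qb_typ[OF _ Gi[OF p]] p(1) G by blast
    show "fsup (T i)" using QD(4)[OF GQ(1)[OF p(1)] Gi[OF p]] .
  qed
  \<comment> \<open>Meeting the requirement of the zero node at \<gamma> puts a condition of level
    at least \<gamma> into \<open>G\<close>; hence the levels of \<open>G\<close> are cofinal in
    \<delta>.\<close>
  have zero: "(\<gamma>, 0, 0) \<in> node_reqs \<delta>" if "\<gamma> \<prec> \<delta>" for \<gamma> using gd_0[OF IH[OF that]] that by (simp add: node_reqs_def)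
  have high: "\<exists>p\<in>G. F \<subseteq> dom (snd p) \<and> \<gamma> \<preceq> fst p" if F: "finite F" "F \<subseteq> dG" and \<gamma>: "\<gamma> \<prec> \<delta>" for F \<gamma>
    using F
  proof (induction F rule: finite_induct)
    case empty
    then show ?case using G3[OF zero[OF \<gamma>]] by (auto simp: meets_node_def)
  next
    case (insert i F)
    then obtain p where p: "p \<in> G" "F \<subseteq> dom (snd p)" "\<gamma> \<preceq> fst p" by auto
    obtain q where q: "q \<in> G" "i \<in> dom (snd q)" using insert.prems by (auto simp: dG_def)
    show ?case
    proof (cases "p \<sqsubseteq> q")
      case True
      then show ?thesis using p q stronger_dom[OF True] by (intro bexI[OF _ p(1)]) blast
    next
      case False
      then have qp: "q \<sqsubseteq> p" using ch p(1) q(1) by blast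
      have "\<gamma> \<preceq> fst q" using p(3) stronger_lev[OF qp] by (rule le_trans)
      then show ?thesis using p q stronger_dom[OF qp] by (intro bexI[OF _ q(1)]) blast
    qed
  qed
  define V where "V = {\<Sum>i\<in>F. g i |F. finite F \<and> F \<subseteq> dG}"
  have Vfull: "V \<subseteq> full W \<delta>"
  proof
    fix w assume "w \<in> V"
    then obtain F where F: "finite F" "F \<subseteq> dG" "w = (\<Sum>i\<in>F. g i)" by (auto simp: V_def)
    have w: "w = (\<Sum>i\<in>F. T i, \<Sum>i\<in>F. X i)"
      unfolding F(3) by (rule prod_eqI) (simp_all add: fst_sum_prod snd_sum_prod g_def)
    have "(rs \<gamma> (\<Sum>i\<in>F. T i), rs \<gamma> (\<Sum>i\<in>F. X i)) \<in> W \<gamma>" if \<gamma>: "\<gamma> \<prec> \<delta>" for \<gamma>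
    proof -
      obtain p where p: "p \<in> G" "F \<subseteq> dom (snd p)" "\<gamma> \<preceq> fst p" using high[OF F(1,2) \<gamma>] by blast
      have "(rs \<gamma> (T i), rs \<gamma> (X i)) \<in> W \<gamma>" if "i \<in> F" for i
      proof -
        have "(rs (fst p) (T i), rs (fst p) (X i)) \<in> W (fst p)"
          using QD(5)[OF GQ(1)[OF p(1)] Gi[OF p(1)]] p(2) that by blast
        then show ?thesis using gd_restrict[OF GQ(3)[OF p(1)] _ p(3)] rs_rs(1)[OF p(3)] by metis
      qed
      then show ?thesis using gd_sum[OF IH[OF \<gamma>], of F] by (simp only: rs_sum)
    qed
    moreover have "(\<Sum>i\<in>F. rs \<delta> (T i)) = (\<Sum>i\<in>F. T i)"
      by (rule sum.cong[OF HOL.refl]) (use T\<delta>(1) F(2) in blast)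
    moreover have "fsup (\<Sum>i\<in>F. T i)" by (rule fsup_sum) (use T\<delta>(2) F(2) in blast)
    ultimately show "w \<in> full W \<delta>" unfolding w full_def by (simp add: rs_sum X\<delta>)
  qed
  have V0: "0 \<in> V" unfolding V_def by (intro CollectI exI[of _ "{}"]) simp
  have Vadd: "w + w' \<in> V" if w: "w \<in> V" "w' \<in> V" for w w'
  proof -
    obtain F F' where F: "finite F" "F \<subseteq> dG" "w = (\<Sum>i\<in>F. g i)" "finite F'" "F' \<subseteq> dG" "w' = (\<Sum>i\<in>F'. g i)"
      using w by (auto simp: V_def)
    have "w + w' = (\<Sum>i\<in>(F - F') \<union> (F' - F). g i)"
      unfolding F(3,6) by (rule char2_sum_sym_diff[OF node_add_self F(1,4)])
    moreover have "finite ((F - F') \<union> (F' - F))" "(F - F') \<union> (F' - F) \<subseteq> dG" using F by auto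
    ultimately show ?thesis unfolding V_def by blast
  qed
  have Vext: "\<exists>y. rs \<gamma> y = x \<and> (\<tau>, y) \<in> V"
    if z: "\<gamma> \<prec> \<delta>" "fsup \<tau>" "rs \<delta> \<tau> = \<tau>" "(rs \<gamma> \<tau>, x) \<in> W \<gamma>" for \<gamma> \<tau> x
  proof -
    have "(\<gamma>, \<tau>, x) \<in> node_reqs \<delta>" using z by (simp add: node_reqs_def)
    then obtain p j y where p: "p \<in> G" "\<gamma> \<preceq> fst p" "snd p j = Some (\<tau>, y)" "rs \<gamma> y = x"
      using G3 unfolding meets_node_def by force
    have "\<tau> = T j" "rs (fst p) (X j) = y" using TX[OF p(1,3)] by auto
    then have "rs \<gamma> (X j) = x" "g j = (\<tau>, X j)" using p(4) rs_rs(1)[OF p(2)] by (auto simp: g_def)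
    moreover have "g j \<in> V" unfolding V_def
    proof (intro CollectI exI conjI)
      show "g j = (\<Sum>i\<in>{j}. g i)" by simp
      show "{j} \<subseteq> dG" using p(1,3) by (auto simp: dG_def)
    qed simp
    ultimately show ?thesis by auto
  qed
  have Vk: "|V| \<le>o \<kappa>"
  proof -
    have "V \<subseteq> (\<lambda>F. \<Sum>i\<in>F. g i) ` {F. finite F \<and> F \<subseteq> Ix \<delta>}" using dGI unfolding V_def by blast
    then show ?thesis by (rule few_subset) (intro few_image card_Fin_Ix)
  qed
  have "gen W V \<delta>"
    unfolding gen_def
  proof (intro allI impI)
    fix f :: "'o slot \<Rightarrow> 'o node option"
    assume f: "|dom f| <o \<kappa>" "ord ` dom f \<subseteq> underS K \<delta>" "ran f \<subseteq> V" "indep f"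
    have "\<exists>F. finite F \<and> F \<subseteq> dG \<and> the (f j) = (\<Sum>i\<in>F. g i)" if "j \<in> dom f" for j
    proof -
      have "the (f j) \<in> V" using f(3) that by (auto simp: ran_def)
      then show ?thesis by (auto simp: V_def)
    qed
    then obtain F where F: "\<And>j. j \<in> dom f \<Longrightarrow> finite (F j) \<and> F j \<subseteq> dG \<and> the (f j) = (\<Sum>i\<in>F j. g i)" by metis
    \<comment> \<open>Each member of \<open>f\<close> is written as a sum of generators. A relation
      among the index sets would, by \<open>char2_double_sum\<close>, be one among the members of
      \<open>f\<close>, so \<phi> is a legitimate requirement.\<close>
    define \<phi> where "\<phi> = (\<lambda>j. if j \<in> dom f then Some (F j) else None)"
    have dom\<phi>: "dom \<phi> = dom f" by (auto simp: \<phi>_def split: if_splits)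
    have "\<phi> \<in> guess_reqs \<delta>"
      unfolding guess_reqs_def mem_Collect_eq
    proof (intro conjI ballI allI impI)
      show "|dom \<phi>| <o \<kappa>" using f(1) dom\<phi> by simp
      show "dom \<phi> \<subseteq> Ix \<delta>" using f(2) dom\<phi> unfolding Ix_def by blast
      fix B assume "B \<in> ran \<phi>"
      then obtain j where "j \<in> dom f" "B = F j" by (auto simp: ran_def \<phi>_def split: if_splits)
      then show "finite B" "B \<subseteq> Ix \<delta>" using F dGI by blast+
    next
      fix A assume A: "finite A" "A \<subseteq> dom \<phi>" "A \<noteq> {}"
      have FA: "the (\<phi> j) = F j" "finite (F j)" "the (f j) = (\<Sum>i\<in>F j. g i)" if "j \<in> A" for j
        using that A(2) F[of j] dom\<phi> by (auto simp: \<phi>_def)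
      show "(\<Sum>j\<in>A. (\<lambda>i. of_bool (i \<in> the (\<phi> j)) :: bit)) \<noteq> 0"
      proof
        assume "(\<Sum>j\<in>A. (\<lambda>i. of_bool (i \<in> the (\<phi> j)) :: bit)) = 0"
        then have "(\<Sum>j\<in>A. (\<lambda>i. of_bool (i \<in> F j) :: bit)) = 0" using FA(1) by (simp cong: sum.cong)
        then have "(\<Sum>j\<in>A. \<Sum>i\<in>F j. g i) = 0" by (intro char2_double_sum node_add_self A(1) FA(2))
        then have "(\<Sum>j\<in>A. the (f j)) = 0" using FA(3) by (simp cong: sum.cong)
        moreover have "(\<Sum>j\<in>A. the (f j)) \<noteq> 0"
          using f(4)[unfolded indep_def, rule_format, OF A(1) _ A(3)] A(2) dom\<phi> by simp
        ultimately show False by simp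
      qed
    qed
    then obtain p where p: "p \<in> G" "p \<in> meets_guess \<delta> \<phi>" using G4 by blast
    \<comment> \<open>Index sets are evaluated at the finished generators. Truncated to the level of
      \<open>p\<close>, this agrees with \<open>app p\<close>, which carries the two alternatives of
      \<open>meets_guess\<close> over to those of \<open>gen\<close>.\<close>
    define ev where "ev = (\<lambda>(\<phi>' :: 'o slot \<Rightarrow> 'o slot set option) j. map_option (\<lambda>F. \<Sum>i\<in>F. g i) (\<phi>' j))"
    have ev: "app p \<phi>' = cut (fst p) (ev \<phi>')" if \<phi>': "\<forall>F\<in>ran \<phi>'. F \<subseteq> dom (snd p)" for \<phi>'
      unfolding app_def cut_def ev_def
    proof (rule arg_cong[of _ _ "Pair (fst p)"], rule ext)
      fix j
      show "map_option (\<lambda>F. \<Sum>i\<in>F. the (snd p i)) (\<phi>' j) =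
        map_option (\<lambda>w. (fst w, rs (fst p) (snd w))) (map_option (\<lambda>F. \<Sum>i\<in>F. g i) (\<phi>' j))"
      proof (cases "\<phi>' j")
        case (Some B)
        then have B: "B \<subseteq> dom (snd p)" using \<phi>' by (auto simp: ran_def)
        have "(\<Sum>i\<in>B. the (snd p i)) = (\<Sum>i\<in>B. (T i, rs (fst p) (X i)))"
        proof (rule sum.cong[OF HOL.refl])
          fix i assume "i \<in> B"
          then have "i \<in> dom (snd p)" using B by blast
          then show "the (snd p i) = (T i, rs (fst p) (X i))" using Gi[OF p(1)] by simp
        qed
        also have "\<dots> = (fst (\<Sum>i\<in>B. g i), rs (fst p) (snd (\<Sum>i\<in>B. g i)))"
          by (rule prod_eqI) (simp_all add: fst_sum_prod snd_sum_prod g_def rs_sum)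
        finally show ?thesis using Some by simp
      qed simp
    qed
    have ev\<phi>: "ev \<phi> = f"
    proof
      fix j
      show "ev \<phi> j = f j"
      proof (cases "j \<in> dom f")
        case True
        then have "f j = Some (the (f j))" by auto
        then show ?thesis using F[OF True] True by (simp add: ev_def \<phi>_def)
      next
        case False
        then have "f j = None" by (meson domI not_None_eq)
        then show ?thesis using False by (simp add: ev_def \<phi>_def)
      qed
    qed
    have \<phi>p: "\<forall>F\<in>ran \<phi>. F \<subseteq> dom (snd p)" using p(2) by (auto simp: meets_guess_def)
    show "\<exists>\<gamma>. \<gamma> \<prec> \<delta> \<and> ((\<exists>f'. f \<subseteq>\<^sub>m f' \<and> ran f' \<subseteq> V \<and> cut \<gamma> f' \<in> Gs W \<delta>) \<or> \<not> (\<exists>q\<in>Gs W \<delta>. q \<sqsubseteq> cut \<gamma> f))"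
    proof (intro exI[of _ "fst p"] conjI GQ(2)[OF p(1)])
      consider \<phi>' where "\<phi> \<subseteq>\<^sub>m \<phi>'" "\<forall>F\<in>ran \<phi>'. finite F \<and> F \<subseteq> dom (snd p)" "app p \<phi>' \<in> Gs W \<delta>"
        | "\<not> (\<exists>q\<in>Gs W \<delta>. q \<sqsubseteq> app p \<phi>)" using p(2) unfolding meets_guess_def by blast
      then show "(\<exists>f'. f \<subseteq>\<^sub>m f' \<and> ran f' \<subseteq> V \<and> cut (fst p) f' \<in> Gs W \<delta>) \<or> \<not> (\<exists>q\<in>Gs W \<delta>. q \<sqsubseteq> cut (fst p) f)"
      proof cases
        case 1
        have "f \<subseteq>\<^sub>m ev \<phi>'"
          unfolding map_le_def
        proof
          fix j assume j: "j \<in> dom f"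
          then have "\<phi>' j = \<phi> j" using 1(1) dom\<phi> unfolding map_le_def by metis
          then show "f j = ev \<phi>' j" using ev\<phi> unfolding ev_def by metis
        qed
        moreover have "ran (ev \<phi>') \<subseteq> V"
        proof
          fix w assume "w \<in> ran (ev \<phi>')"
          then obtain j B where B: "\<phi>' j = Some B" "w = (\<Sum>i\<in>B. g i)" by (auto simp: ran_def ev_def)
          then have "B \<in> ran \<phi>'" by (auto simp: ran_def)
          then have "finite B" "B \<subseteq> dG" using 1(2) p(1) unfolding dG_def by (blast, blast)
          then show "w \<in> V" using B(2) unfolding V_def by blast
        qed
        moreover have "cut (fst p) (ev \<phi>') \<in> Gs W \<delta>" using 1(2,3) ev[of \<phi>'] by auto
        ultimately show ?thesis by blast
      next
        case 2
        then show ?thesis using ev[OF \<phi>p] ev\<phi> by simp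
      qed
    qed
  qed
  then have "good W V \<delta>" unfolding good_def using Vfull V0 Vadd Vext Vk \<delta>S by simp
  then show ?thesis ..
qed

end

lemma gd_all: "\<delta> \<in> Ord \<Longrightarrow> gd \<delta>"
proof (induction \<delta> rule: Ord_induct)
  case (step \<delta>)
  show ?case
  proof (cases "\<delta> \<in> S")
    case True
    have "good W (SOME V. good W V \<delta>) \<delta>" using someI_ex[OF ex_good[OF True step(2)]] .
    then show ?thesis using W_rec[of \<delta>] True by simp
  next
    case False
    then show ?thesis using good_not_S[OF step(1) False step(2)] by simp
  qed
qed

section \<open>Sealing\<close>

lemma Q_refl: "p \<in> Q W \<Longrightarrow> p \<sqsubseteq> p"
  by (rule stronger_refl[OF _ gd_full[OF gd_all[OF QD(1)]]])

lemma rs_eq_iff: "rs b \<tau> = \<tau> \<longleftrightarrow> {\<xi>. \<tau> \<xi> \<noteq> 0} \<subseteq> underS K b"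
proof
  show "rs b \<tau> = \<tau> \<Longrightarrow> {\<xi>. \<tau> \<xi> \<noteq> 0} \<subseteq> underS K b" using rs_outside by blast
  assume *: "{\<xi>. \<tau> \<xi> \<noteq> 0} \<subseteq> underS K b"
  show "rs b \<tau> = \<tau>"
  proof
    fix \<xi> show "rs b \<tau> \<xi> = \<tau> \<xi>" using * by (cases "\<tau> \<xi> = 0") (auto simp: rs_def)
  qed
qed

text \<open>All ordinals that \<open>Qb\<close> has to bound, gathered in one set of fewer than
  \<kappa> elements: a condition bounded by a member of \<open>S\<close> is then bounded by a
  smaller ordinal.\<close>

definition trace :: "'o cond \<Rightarrow> 'o set" where
  "trace p = insert (fst p) (ord ` dom (snd p) \<union> (\<Union>j\<in>dom (snd p). {\<xi>. fst (the (snd p j)) \<xi> \<noteq> 0}))"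

lemma small_trace:
  assumes p: "p \<in> Q W" shows "|trace p| <o \<kappa>" "trace p \<subseteq> Ord"
proof -
  have fin: "finite {\<xi>. fst (the (snd p j)) \<xi> \<noteq> 0}" "{\<xi>. fst (the (snd p j)) \<xi> \<noteq> 0} \<subseteq> Ord" if j: "j \<in> dom (snd p)" for j
  proof -
    obtain \<tau> x where e: "snd p j = Some (\<tau>, x)" using j by auto
    show "finite {\<xi>. fst (the (snd p j)) \<xi> \<noteq> 0}" "{\<xi>. fst (the (snd p j)) \<xi> \<noteq> 0} \<subseteq> Ord"
      using QD(4)[OF p e] e unfolding fsup_def by simp_all
  qed
  have "|{fst p} \<union> (ord ` dom (snd p) \<union> (\<Union>j\<in>dom (snd p). {\<xi>. fst (the (snd p j)) \<xi> \<noteq> 0}))| <o \<kappa>"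
    by (intro small_Un small_UN small_image small_finite fin(1) QD(2)[OF p]) auto
  then show "|trace p| <o \<kappa>" by (simp add: trace_def)
  show "trace p \<subseteq> Ord" unfolding trace_def using QD(1,3)[OF p] fin(2) by blast
qed

lemma Qb_iff_trace:
  assumes p: "p \<in> Q W" shows "p \<in> Qb W \<eta> \<longleftrightarrow> trace p \<subseteq> underS K \<eta>"
proof -
  have "(\<forall>j \<tau> x. snd p j = Some (\<tau>, x) \<longrightarrow> rs \<eta> \<tau> = \<tau>) \<longleftrightarrow>
    (\<forall>j\<in>dom (snd p). {\<xi>. fst (the (snd p j)) \<xi> \<noteq> 0} \<subseteq> underS K \<eta>)"
    unfolding rs_eq_iff by (fastforce simp: dom_def)
  then show ?thesis using p unfolding Qb_def trace_def by auto
qed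

lemma ex_Qb: "p \<in> Q W \<Longrightarrow> \<exists>\<eta>\<in>Ord. p \<in> Qb W \<eta>"
  using bounded[OF small_trace(2) small_le[OF small_trace(1)]] Qb_iff_trace by metis

lemma Qb_mono: "p \<in> Qb W \<eta> \<Longrightarrow> \<eta> \<preceq> \<eta>' \<Longrightarrow> p \<in> Qb W \<eta>'"
  using Qb_iff_trace[OF Qb_Q] lt_le_trans by blast

lemma Qb_S:
  assumes "\<delta> \<in> S" "p \<in> Qb W \<delta>" shows "\<exists>b. b \<prec> \<delta> \<and> p \<in> Qb W b"
  using S_bounded[OF assms(1) _ small_trace(1)[OF Qb_Q[OF assms(2)]]] Qb_iff_trace[OF Qb_Q[OF assms(2)]] assms(2) by metis

lemma card_Qb: "|Qb W \<eta>| \<le>o \<kappa>"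
proof -
  let ?Z = "Ix \<eta> \<times> {\<tau>. fsup \<tau> \<and> rs \<eta> \<tau> = \<tau>} \<times> (\<Union>\<gamma>\<in>underS K \<eta>. snd ` W \<gamma>)"
  have "|W \<gamma>| \<le>o \<kappa>" if "\<gamma> \<prec> \<eta>" for \<gamma> using gd_all[OF lt_Ord(1)[OF that]] by (simp add: good_def)
  then have Z: "|?Z| \<le>o \<kappa>" by (intro few_Times few_UN few_image card_Ix card_fsup small)
  have Y: "|underS K \<eta> \<times> {A. A \<subseteq> ?Z \<and> |A| <o \<kappa>}| \<le>o \<kappa>" by (intro few_Times small few_small_subsets_of Z)
  let ?c = "\<lambda>p :: 'o cond. (fst p, (\<lambda>j. (j, the (snd p j))) ` dom (snd p))"
  have "|Qb W \<eta>| \<le>o |underS K \<eta> \<times> {A. A \<subseteq> ?Z \<and> |A| <o \<kappa>}|"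
  proof (rule card_of_ordLeqI[of ?c])
    show "inj_on ?c (Qb W \<eta>)"
    proof (rule inj_onI)
      fix p q :: "'o cond" assume eq: "?c p = ?c q"
      have *: "(f j = Some w) = ((j, w) \<in> (\<lambda>j. (j, the (f j))) ` dom f)" for f :: "'o slot \<Rightarrow> 'o node option" and j w
        by force
      have "(snd p j = Some w) = (snd q j = Some w)" for j w
        unfolding *[of "snd p"] *[of "snd q"] using eq by simp
      then have "snd p = snd q" by (intro ext) (metis not_None_eq)
      then show "p = q" using eq by (auto intro: prod_eqI)
    qed
    fix p assume p: "p \<in> Qb W \<eta>"
    have "(j, the (snd p j)) \<in> ?Z" if j: "j \<in> dom (snd p)" for j
    proof -
      obtain \<tau> x where e: "snd p j = Some (\<tau>, x)" using j by auto
      have "x \<in> snd ` W (fst p)" using QD(5)[OF Qb_Q[OF p] e] by force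
      then have "x \<in> (\<Union>\<gamma>\<in>underS K \<eta>. snd ` W \<gamma>)" using Qb_lev[OF p] by blast
      moreover have "j \<in> Ix \<eta>" using Qb_ord[OF p] j unfolding Ix_def by blast
      ultimately show ?thesis using e QD(4)[OF Qb_Q[OF p] e] Qb_typ[OF p e] by simp
    qed
    then have "(\<lambda>j. (j, the (snd p j))) ` dom (snd p) \<subseteq> ?Z" by (rule image_subsetI)
    moreover have "|(\<lambda>j. (j, the (snd p j))) ` dom (snd p)| <o \<kappa>" by (rule small_image[OF QD(2)[OF Qb_Q[OF p]]])
    ultimately show "?c p \<in> underS K \<eta> \<times> {A. A \<subseteq> ?Z \<and> |A| <o \<kappa>}" using Qb_lev[OF p] by simp
  qed
  then show ?thesis using Y by (rule ordLeq_transitive)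
qed

lemma Q_U: "Q W \<subseteq> U"
proof
  fix p assume p: "p \<in> Q W"
  have "fsup \<tau> \<and> rs (fst p) x = x" if "snd p j = Some (\<tau>, x)" for j \<tau> x
    using QD(4)[OF p that] gd_supp(1)[OF gd_all[OF QD(1)[OF p]] QD(5)[OF p that]] by simp
  then show "p \<in> U" using QD(1,2,3)[OF p] unfolding U_def by (simp add: split_beta)
qed

text \<open>The forcing, alone or with auxiliary slots, is a set of this form; sealing is proved
  once for all of them.\<close>

definition QJ :: "'o slot set \<Rightarrow> ('o slot \<Rightarrow> 'o \<Rightarrow> bit) \<Rightarrow> 'o cond set" where
  "QJ J t = {p \<in> Q W. dom (snd p) \<subseteq> J \<and> (\<forall>j \<tau> x. snd p j = Some (\<tau>, x) \<longrightarrow> \<tau> = t j)}"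

lemma QJ_Q: "p \<in> QJ J t \<Longrightarrow> p \<in> Q W"
  and QJ_dom: "p \<in> QJ J t \<Longrightarrow> dom (snd p) \<subseteq> J"
  by (simp_all add: QJ_def)

lemma QJ_typ: "p \<in> QJ J t \<Longrightarrow> snd p j = Some (\<tau>, x) \<Longrightarrow> \<tau> = t j"
  unfolding QJ_def by blast

lemma QJ_refl: "p \<in> QJ J t \<Longrightarrow> p \<sqsubseteq> p"
  by (rule Q_refl[OF QJ_Q])

lemma QJ_level_up:
  assumes p: "p \<in> QJ J t" and \<gamma>: "fst p \<preceq> \<gamma>"
  shows "\<exists>p'\<in>QJ J t. p' \<sqsubseteq> p \<and> fst p' = \<gamma> \<and> dom (snd p') = dom (snd p)"
proof -
  obtain p' where p': "p' \<in> Q W" "p' \<sqsubseteq> p" "fst p' = \<gamma>" "dom (snd p') = dom (snd p)"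
    using level_up[OF QJ_Q[OF p] \<gamma> gd_all gd_all] le_Ord[OF \<gamma>] by blast
  have "\<tau> = t j" if j: "snd p' j = Some (\<tau>, x)" for j \<tau> x
  proof -
    obtain \<sigma> y where e: "snd p j = Some (\<sigma>, y)" using p'(4) j by fastforce
    then have "\<sigma> = \<tau>" using stronger_val[OF p'(2) e] j by auto
    then show ?thesis using QJ_typ[OF p e] by simp
  qed
  then have "p' \<in> QJ J t" using p' QJ_dom[OF p] unfolding QJ_def by auto
  then show ?thesis using p' by blast
qed

lemma cut_stronger: "\<gamma> \<preceq> \<eta> \<Longrightarrow> cut \<eta> f \<sqsubseteq> cut \<gamma> f"
  unfolding stronger_def cut_def using rs_rs(1)[of \<gamma> \<eta>] by auto

text \<open>\<open>Dn\<close> is guessed at a level \<delta> in \<open>S\<close>. A condition of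
  level at least \<delta>, restricted to slots below \<delta> and truncated, is a family in
  \<open>W \<delta>\<close>. If it is independent, \<open>gen\<close> extends it inside
  \<open>W \<delta>\<close> to meet \<open>Dn\<close>, because density rules out the other
  alternative; the slots added are not slots of the condition, so the two can be merged.
  Independence comes from \<open>sep\<close>: slots whose types cancel all belong to
  \<open>p0\<close>, where their values already fail to cancel.\<close>

theorem sealing:
  assumes t: "\<And>j. j \<in> J \<Longrightarrow> fsup (t j)" and p0: "p0 \<in> QJ J t" and Dn: "Dn \<subseteq> QJ J t"
    and sep: "\<And>A. finite A \<Longrightarrow> A \<subseteq> J \<Longrightarrow> A \<noteq> {} \<Longrightarrow> (\<Sum>j\<in>A. t j) = 0 \<Longrightarrow>
        A \<subseteq> dom (snd p0) \<and> (\<Sum>j\<in>A. snd (the (snd p0 j))) \<noteq> 0"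
    and dense: "\<And>q. q \<in> QJ J t \<Longrightarrow> q \<sqsubseteq> p0 \<Longrightarrow> \<exists>d\<in>Dn. d \<sqsubseteq> q"
  shows "\<exists>\<delta>\<in>Ord. \<forall>q\<in>QJ J t. q \<sqsubseteq> p0 \<longrightarrow> (\<exists>q'\<in>QJ J t. q' \<sqsubseteq> q \<and> (\<exists>d\<in>Dn \<inter> Qb W \<delta>. q' \<sqsubseteq> d))"
proof -
  define P where "P = {q \<in> QJ J t. q \<sqsubseteq> p0}"
  obtain h where h: "\<And>q. q \<in> P \<Longrightarrow> h q \<in> Dn \<and> h q \<sqsubseteq> q" using dense unfolding P_def by (metis (lifting) mem_Collect_eq)
  obtain rk where rk: "\<And>q. q \<in> Q W \<Longrightarrow> rk q \<in> Ord \<and> q \<in> Qb W (rk q)" using ex_Qb by metis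
  \<comment> \<open>Closure of \<delta> under bounds for \<open>Z\<close> puts below \<delta> the
    codes of conditions bounded below it, the extensions \<open>h\<close> chooses for them in
    \<open>Dn\<close>, and the types of slots below it.\<close>
  define Z where "Z = (\<lambda>\<eta>. insert \<eta> (code ` Qb W \<eta> \<union> (\<lambda>q. rk (h q)) ` (P \<inter> Qb W \<eta>) \<union>
     (\<Union>j\<in>J \<inter> Ix \<eta>. {\<xi>. t j \<xi> \<noteq> 0})))"
  have DQ: "d \<in> Q W" if "d \<in> Dn" for d using Dn that QJ_Q by blast
  have "\<exists>b. b \<in> Ord \<and> Z \<eta> \<subseteq> underS K b" if \<eta>: "\<eta> \<in> Ord" for \<eta>
  proof -
    have 1: "|(\<lambda>q. rk (h q)) ` (P \<inter> Qb W \<eta>)| \<le>o \<kappa>" by (rule few_image[OF few_subset[OF Int_lower2 card_Qb]])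
    have 2: "|\<Union>j\<in>J \<inter> Ix \<eta>. {\<xi>. t j \<xi> \<noteq> 0}| \<le>o \<kappa>"
    proof (rule few_UN[OF few_subset[OF Int_lower2 card_Ix]])
      show "|{\<xi>. t j \<xi> \<noteq> 0}| \<le>o \<kappa>" if "j \<in> J \<inter> Ix \<eta>" for j
        by (rule few_finite) (use t[of j] that in \<open>simp add: fsup_def\<close>)
    qed
    have "|{\<eta>} \<union> (code ` Qb W \<eta> \<union> (\<lambda>q. rk (h q)) ` (P \<inter> Qb W \<eta>) \<union> (\<Union>j\<in>J \<inter> Ix \<eta>. {\<xi>. t j \<xi> \<noteq> 0}))| \<le>o \<kappa>"
      by (rule few_Un[OF few_finite few_Un[OF few_Un[OF few_image[OF card_Qb] 1] 2]]) simp
    then have "|Z \<eta>| \<le>o \<kappa>" by (simp add: Z_def)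
    moreover have "Z \<eta> \<subseteq> Ord"
    proof -
      have "code ` Qb W \<eta> \<subseteq> Ord" using code_Ord Q_U Qb_Q by blast
      moreover have "(\<lambda>q. rk (h q)) ` (P \<inter> Qb W \<eta>) \<subseteq> Ord" using h rk DQ by blast
      moreover have "(\<Union>j\<in>J \<inter> Ix \<eta>. {\<xi>. t j \<xi> \<noteq> 0}) \<subseteq> Ord" using t unfolding fsup_def by blast
      ultimately show ?thesis unfolding Z_def using \<eta> by blast
    qed
    ultimately show ?thesis using bounded by metis
  qed
  then obtain g where g: "\<And>\<eta>. \<eta> \<in> Ord \<Longrightarrow> g \<eta> \<in> Ord \<and> Z \<eta> \<subseteq> underS K (g \<eta>)" by metis
  have rk0: "rk p0 \<in> Ord" "p0 \<in> Qb W (rk p0)" using rk[OF QJ_Q[OF p0]] by auto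
  have "club K {\<delta> \<in> Ord. rk p0 \<prec> \<delta> \<and> (\<forall>\<eta>. \<eta> \<prec> \<delta> \<longrightarrow> g \<eta> \<prec> \<delta>)}" by (rule club_closure) (use g rk0 in auto)
  moreover have "code ` Dn \<subseteq> Ord" using code_Ord Q_U DQ by blast
  ultimately obtain \<delta> where \<delta>: "\<delta> \<in> Ord" "\<delta> \<in> S" "rk p0 \<prec> \<delta>" "\<And>\<eta>. \<eta> \<prec> \<delta> \<Longrightarrow> g \<eta> \<prec> \<delta>"
    and guessed: "code ` Dn \<inter> underS K \<delta> = D \<delta>"
    using guess[of "code ` Dn"] unfolding stationary_def by blast
  have Z\<delta>: "Z b \<subseteq> underS K \<delta>" if "b \<prec> \<delta>" for b
    using g[OF lt_Ord(1)[OF that]] \<delta>(4)[OF that] lt_trans by blast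
  \<comment> \<open>Otherwise truncation to \<delta> could make independent types dependent.\<close>
  have t\<delta>: "rs \<delta> (t j) = t j" if j: "j \<in> J" "ord j \<prec> \<delta>" for j
  proof -
    have b: "g (ord j) \<prec> \<delta>" using \<delta>(4)[OF j(2)] .
    have "ord j \<prec> g (ord j)" using g[OF lt_Ord(1)[OF j(2)]] by (auto simp: Z_def)
    then have "{\<xi>. t j \<xi> \<noteq> 0} \<subseteq> Z (g (ord j))" using j(1) unfolding Z_def Ix_def by blast
    then show ?thesis unfolding rs_eq_iff using Z\<delta>[OF b] by blast
  qed
  have code\<delta>: "code q \<prec> \<delta>" if q: "q \<in> Qb W \<delta>" for q
  proof -
    obtain b where b: "b \<prec> \<delta>" "q \<in> Qb W b" using Qb_S[OF \<delta>(2) q] by blast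
    then have "code q \<in> Z b" by (simp add: Z_def)
    then show ?thesis using Z\<delta>[OF b(1)] by blast
  qed
  have Gs: "Gs W \<delta> = Dn \<inter> Qb W \<delta>"
  proof (intro set_eqI iffI)
    fix q assume "q \<in> Gs W \<delta>"
    then have q: "q \<in> Qb W \<delta>" "code q \<in> code ` Dn" using guessed by (auto simp: Gs_def)
    then obtain d where d: "d \<in> Dn" "code q = code d" by blast
    have "q = d" using inj_onD[OF code_inj d(2)] Q_U Qb_Q[OF q(1)] DQ[OF d(1)] by blast
    then show "q \<in> Dn \<inter> Qb W \<delta>" using q(1) d(1) by blast
  next
    fix q assume "q \<in> Dn \<inter> Qb W \<delta>"
    then show "q \<in> Gs W \<delta>" using code\<delta>[of q] guessed by (auto simp: Gs_def)
  qed
  have p0\<delta>: "p0 \<in> Qb W \<delta>" using Qb_mono[OF rk0(2) lt_le[OF \<delta>(3)]] .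
  note gd\<delta> = gd_all[OF \<delta>(1)]
  have "\<exists>q'\<in>QJ J t. q' \<sqsubseteq> q0 \<and> (\<exists>d\<in>Dn \<inter> Qb W \<delta>. q' \<sqsubseteq> d)" if q0: "q0 \<in> QJ J t" "q0 \<sqsubseteq> p0" for q0
  proof -
    obtain \<eta> where \<eta>: "\<delta> \<preceq> \<eta>" "fst q0 \<preceq> \<eta>"
      using linear[OF \<delta>(1) QD(1)[OF QJ_Q[OF q0(1)]]] lt_le le_refl[OF \<delta>(1)] le_refl[OF QD(1)[OF QJ_Q[OF q0(1)]]] by metis
    obtain q where q: "q \<in> QJ J t" "q \<sqsubseteq> q0" "fst q = \<eta>" using QJ_level_up[OF q0(1) \<eta>(2)] by blast
    have qp0: "q \<sqsubseteq> p0" using q(2) q0(2) by (rule stronger_trans)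
    have \<eta>O: "\<eta> \<in> Ord" using le_Ord(2)[OF \<eta>(1)] .
    define x where "x = (\<lambda>j. snd (the (snd q j)))"
    have qj: "snd q j = Some (t j, x j)" "(rs \<eta> (t j), x j) \<in> W \<eta>" "j \<in> J" if j: "j \<in> dom (snd q)" for j
    proof -
      obtain \<tau> y where e: "snd q j = Some (\<tau>, y)" using j by auto
      then show "snd q j = Some (t j, x j)" using QJ_typ[OF q(1) e] by (simp add: x_def)
      then show "(rs \<eta> (t j), x j) \<in> W \<eta>" using QD(5)[OF QJ_Q[OF q(1)]] q(3) by blast
      show "j \<in> J" using QJ_dom[OF q(1)] j by blast
    qed
    define f where "f = (\<lambda>j. if j \<in> dom (snd q) \<and> ord j \<prec> \<delta> then Some (t j, rs \<delta> (x j)) else None)"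
    have domf: "dom f = {j \<in> dom (snd q). ord j \<prec> \<delta>}" by (auto simp: f_def split: if_splits)
    have fW: "(t j, rs \<delta> (x j)) \<in> W \<delta>" if j: "j \<in> dom f" for j
    proof -
      have j': "j \<in> dom (snd q)" "ord j \<prec> \<delta>" using j domf by auto
      have "(rs \<delta> (rs \<eta> (t j)), rs \<delta> (x j)) \<in> W \<delta>" using gd_restrict[OF gd_all[OF \<eta>O] qj(2)[OF j'(1)] \<eta>(1)] .
      then show ?thesis using rs_rs(1)[OF \<eta>(1)] t\<delta>[OF qj(3)[OF j'(1)] j'(2)] by simp
    qed
    have fj: "f j = Some (t j, rs \<delta> (x j))" if "j \<in> dom f" for j using that domf by (auto simp: f_def)
    have p0j: "j \<in> dom f" "snd p0 j = Some (t j, rs (fst p0) (rs \<delta> (x j)))" if j: "j \<in> dom (snd p0)" for j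
    proof -
      have "ord j \<prec> \<delta>" using Qb_ord[OF p0\<delta>] j by blast
      moreover have jq: "j \<in> dom (snd q)" using stronger_dom[OF qp0] j by blast
      ultimately show "j \<in> dom f" using domf by blast
      obtain \<tau> y where e: "snd p0 j = Some (\<tau>, y)" using j by auto
      have "rs (fst p0) (x j) = y" using stronger_val[OF qp0 e] qj(1)[OF jq] by auto
      then show "snd p0 j = Some (t j, rs (fst p0) (rs \<delta> (x j)))"
        using e QJ_typ[OF p0 e] rs_rs(1)[OF lt_le[OF Qb_lev[OF p0\<delta>]]] by simp
    qed
    have "indep f"
      unfolding indep_def
    proof (intro allI impI notI)
      fix A assume A: "finite A" "A \<subseteq> dom f" "A \<noteq> {}" "(\<Sum>j\<in>A. the (f j)) = 0"
      have "(\<Sum>j\<in>A. the (f j)) = (\<Sum>j\<in>A. (t j, rs \<delta> (x j)))"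
      proof (rule sum.cong[OF HOL.refl])
        fix j assume "j \<in> A"
        then have "j \<in> dom f" using A(2) by blast
        then show "the (f j) = (t j, rs \<delta> (x j))" using fj by simp
      qed
      then have s: "(\<Sum>j\<in>A. (t j, rs \<delta> (x j))) = 0" using A(4) by simp
      have s1: "(\<Sum>j\<in>A. t j) = 0" using arg_cong[OF s, of fst] by (simp add: fst_sum_prod)
      have s2: "(\<Sum>j\<in>A. rs \<delta> (x j)) = 0" using arg_cong[OF s, of snd] by (simp add: snd_sum_prod)
      have "A \<subseteq> J" using A(2) domf qj(3) by blast
      then have sp: "A \<subseteq> dom (snd p0)" "(\<Sum>j\<in>A. snd (the (snd p0 j))) \<noteq> 0" using sep[OF A(1) _ A(3) s1] by auto
      have "(\<Sum>j\<in>A. snd (the (snd p0 j))) = (\<Sum>j\<in>A. rs (fst p0) (rs \<delta> (x j)))"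
      proof (rule sum.cong[OF HOL.refl])
        fix j assume "j \<in> A"
        then have "j \<in> dom (snd p0)" using sp(1) by blast
        then show "snd (the (snd p0 j)) = rs (fst p0) (rs \<delta> (x j))" using p0j(2) by simp
      qed
      also have "\<dots> = rs (fst p0) (\<Sum>j\<in>A. rs \<delta> (x j))" by (rule rs_sum[symmetric])
      also have "\<dots> = 0" unfolding s2 by simp
      finally show False using sp(2) by simp
    qed
    moreover have "|dom f| <o \<kappa>" by (rule small_subset[OF _ QD(2)[OF QJ_Q[OF q(1)]]]) (use domf in blast)
    moreover have "ord ` dom f \<subseteq> underS K \<delta>" using domf by blast
    moreover have "ran f \<subseteq> W \<delta>"
    proof
      fix w assume "w \<in> ran f"
      then obtain j where "f j = Some w" by (auto simp: ran_def)
      moreover then have "j \<in> dom f" by blast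
      ultimately show "w \<in> W \<delta>" using fj fW by fastforce
    qed
    moreover have "gen W (W \<delta>) \<delta>" using gd\<delta> \<delta>(2) by (simp add: good_def)
    ultimately obtain \<gamma> where \<gamma>: "\<gamma> \<prec> \<delta>" and cases: "(\<exists>f'. f \<subseteq>\<^sub>m f' \<and> ran f' \<subseteq> W \<delta> \<and> cut \<gamma> f' \<in> Gs W \<delta>) \<or> \<not> (\<exists>q\<in>Gs W \<delta>. q \<sqsubseteq> cut \<gamma> f)"
      unfolding gen_def by meson
    \<comment> \<open>This level is above both \<gamma> and that of \<open>p0\<close>. The
      truncation \<open>c\<close> to it extends \<open>p0\<close>, so \<open>h c\<close> is a member
      of \<open>Dn\<close> bounded by \<delta> that extends \<open>cut \<gamma> f\<close>, which
      excludes the second alternative.\<close>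
    obtain \<beta> where \<beta>: "\<beta> \<prec> \<delta>" "\<gamma> \<preceq> \<beta>" "fst p0 \<preceq> \<beta>"
      using linear[OF lt_Ord(1)[OF \<gamma>] QD(1)[OF QJ_Q[OF p0]]] \<gamma> Qb_lev[OF p0\<delta>] lt_le le_refl lt_Ord(1) by metis
    define c where "c = cut \<beta> f"
    have cj: "snd c j = Some (t j, rs \<beta> (x j))" if "j \<in> dom f" for j
      using fj[OF that] rs_rs(1)[OF lt_le[OF \<beta>(1)]] by (simp add: c_def cut_def)
    have domc: "dom (snd c) = dom f" by (auto simp: c_def cut_def dom_def)
    have cb: "c \<in> Qb W \<delta>"
    proof -
      have "(\<beta>, snd c) \<in> Qb W \<delta>"
      proof (rule QbI[OF \<beta>(1)])
        show "|dom (snd c)| <o \<kappa>" "ord ` dom (snd c) \<subseteq> underS K \<delta>" unfolding domc by fact+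
        fix j \<tau> y assume j: "snd c j = Some (\<tau>, y)"
        then have jf: "j \<in> dom f" using domc by blast
        then have jq: "j \<in> dom (snd q)" "ord j \<prec> \<delta>" using domf by auto
        have e: "\<tau> = t j" "y = rs \<beta> (x j)" using j cj[OF jf] by auto
        have "(rs \<beta> (t j), rs \<beta> (rs \<delta> (x j))) \<in> W \<beta>" using gd_restrict[OF gd\<delta> fW[OF jf] lt_le[OF \<beta>(1)]] .
        then show "fsup \<tau> \<and> rs \<delta> \<tau> = \<tau> \<and> (rs \<beta> \<tau>, y) \<in> W \<beta>"
          using e t[OF qj(3)[OF jq(1)]] t\<delta>[OF qj(3)[OF jq(1)] jq(2)] rs_rs(1)[OF lt_le[OF \<beta>(1)]] by simp
      qed
      moreover have "fst c = \<beta>" by (simp add: c_def cut_def)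
      ultimately show ?thesis by (metis prod.collapse)
    qed
    have cJ: "c \<in> QJ J t"
    proof -
      have "dom (snd c) \<subseteq> J" unfolding domc using domf qj(3) by blast
      moreover have "\<tau> = t j" if "snd c j = Some (\<tau>, y)" for j \<tau> y using that cj[of j] domc by fastforce
      ultimately show ?thesis using Qb_Q[OF cb] unfolding QJ_def by blast
    qed
    have cp0: "c \<sqsubseteq> p0"
      unfolding stronger_def
    proof (intro conjI allI impI)
      show "fst p0 \<preceq> fst c" using \<beta>(3) by (simp add: c_def cut_def)
      fix j \<tau> y assume j: "snd p0 j = Some (\<tau>, y)"
      then have jd: "j \<in> dom (snd p0)" by blast
      have "\<tau> = t j" "y = rs (fst p0) (rs \<delta> (x j))" using p0j(2)[OF jd] j by auto
      then show "\<exists>y'. snd c j = Some (\<tau>, y') \<and> rs (fst p0) y' = y"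
        using cj[OF p0j(1)[OF jd]] rs_rs(1)[OF \<beta>(3)] rs_rs(1)[OF lt_le[OF Qb_lev[OF p0\<delta>]]] by simp
    qed
    have "\<exists>q\<in>Gs W \<delta>. q \<sqsubseteq> cut \<gamma> f"
    proof -
      have cP: "c \<in> P" using cJ cp0 by (simp add: P_def)
      obtain b where b: "b \<prec> \<delta>" "c \<in> Qb W b" using Qb_S[OF \<delta>(2) cb] by blast
      then have "rk (h c) \<in> Z b" using cP by (simp add: Z_def)
      then have "rk (h c) \<prec> \<delta>" using Z\<delta>[OF b(1)] by blast
      then have "h c \<in> Gs W \<delta>" using Gs h[OF cP] rk[OF DQ] Qb_mono lt_le by blast
      moreover have "h c \<sqsubseteq> cut \<gamma> f" using h[OF cP] cut_stronger[OF \<beta>(2), of f] stronger_trans unfolding c_def by blast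
      ultimately show ?thesis by blast
    qed
    then obtain f' where f': "f \<subseteq>\<^sub>m f'" "ran f' \<subseteq> W \<delta>" "cut \<gamma> f' \<in> Gs W \<delta>" using cases by meson
    define d where "d = cut \<gamma> f'"
    have d: "d \<in> Dn" "d \<in> Qb W \<delta>" using f'(3) Gs by (auto simp: d_def)
    have domd: "dom (snd d) = dom f'" by (auto simp: d_def cut_def dom_def)
    have dJ: "dom f' \<subseteq> J" using QJ_dom[of d J t] Dn d(1) domd by blast
    have dord: "ord ` dom f' \<subseteq> underS K \<delta>" using Qb_ord[OF d(2)] domd by simp
    define y where "y = (\<lambda>j. snd (the (f' j)))"
    have f'j: "f' j = Some (t j, y j)" "(t j, y j) \<in> W \<delta>" "snd d j = Some (t j, rs \<gamma> (y j))" if j: "j \<in> dom f'" for j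
    proof -
      obtain \<tau> z where e: "f' j = Some (\<tau>, z)" using j by auto
      then have e': "snd d j = Some (\<tau>, rs \<gamma> z)" by (simp add: d_def cut_def)
      then have "\<tau> = t j" using QJ_typ[of d J t] Dn d(1) by blast
      then show "f' j = Some (t j, y j)" "snd d j = Some (t j, rs \<gamma> (y j))" using e e' by (simp_all add: y_def)
      then show "(t j, y j) \<in> W \<delta>" using f'(2) by (auto simp: ran_def)
    qed
    have "\<exists>z. rs \<delta> z = y j \<and> (rs \<eta> (t j), z) \<in> W \<eta>" if j: "j \<in> dom f'" for j
    proof -
      have jJ: "j \<in> J" "ord j \<prec> \<delta>" using j dJ dord by blast+
      show ?thesis using gd_extend[OF gd_all[OF \<eta>O] \<eta>(1) t[OF jJ(1)]] f'j(2)[OF j] t\<delta>[OF jJ] by simp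
    qed
    then obtain z where z: "\<And>j. j \<in> dom f' \<Longrightarrow> rs \<delta> (z j) = y j \<and> (rs \<eta> (t j), z j) \<in> W \<eta>" by metis
    \<comment> \<open>A slot common to \<open>q\<close> and \<open>f'\<close> has its ordinal below
      \<delta> and so belongs to \<open>f\<close>. There \<open>f'\<close> only repeats the
      truncation of \<open>q\<close>, and preferring \<open>q\<close> loses nothing.\<close>
    define F where "F = (\<lambda>j. if j \<in> dom (snd q) then snd q j else if j \<in> dom f' then Some (t j, z j) else None)"
    have domF: "dom F = dom (snd q) \<union> dom f'" by (auto simp: F_def split: if_splits)
    define q' where "q' = (\<eta>, F)"
    have d_small: "|dom f'| <o \<kappa>" using QD(2)[OF Qb_Q[OF d(2)]] domd by simp
    have FW: "\<tau> = t j \<and> (rs \<eta> \<tau>, u) \<in> W \<eta> \<and> j \<in> J" if j: "F j = Some (\<tau>, u)" for j \<tau> u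
    proof (cases "j \<in> dom (snd q)")
      case True
      then show ?thesis using j qj[OF True] by (simp add: F_def)
    next
      case False
      then have "j \<in> dom f'" using j domF by blast
      then show ?thesis using False j z[of j] dJ by (auto simp: F_def)
    qed
    have "q' \<in> Q W" unfolding q'_def
    proof (rule QI[OF \<eta>O])
      show "|dom F| <o \<kappa>" unfolding domF by (intro small_Un d_small QD(2)[OF QJ_Q[OF q(1)]])
      show "ord ` dom F \<subseteq> Ord" unfolding domF using QD(3)[OF QJ_Q[OF q(1)]] dord underS_subset_Field[of K \<delta>] by blast
      show "fsup \<tau> \<and> (rs \<eta> \<tau>, u) \<in> W \<eta>" if "F j = Some (\<tau>, u)" for j \<tau> u using FW[OF that] t by blast
    qed
    then have q'J: "q' \<in> QJ J t" using FW unfolding QJ_def q'_def by auto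
    have "q' \<sqsubseteq> q"
      unfolding stronger_def
    proof (intro conjI allI impI)
      show "fst q \<preceq> fst q'" using q(3) le_refl[OF \<eta>O] by (simp add: q'_def)
      fix j \<tau> u assume j: "snd q j = Some (\<tau>, u)"
      then show "\<exists>u'. snd q' j = Some (\<tau>, u') \<and> rs (fst q) u' = u"
        using stronger_val[OF QJ_refl[OF q(1)] j] by (auto simp: q'_def F_def)
    qed
    moreover have "q' \<sqsubseteq> d"
      unfolding stronger_def
    proof (intro conjI allI impI)
      show "fst d \<preceq> fst q'" using le_trans[OF lt_le[OF \<gamma>] \<eta>(1)] by (simp add: q'_def d_def cut_def)
      fix j \<tau> u assume j: "snd d j = Some (\<tau>, u)"
      then have jd: "j \<in> dom f'" using domd by blast
      have e: "\<tau> = t j" "u = rs \<gamma> (y j)" using j f'j(3)[OF jd] by auto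
      have fd: "fst d = \<gamma>" by (simp add: d_def cut_def)
      show "\<exists>u'. snd q' j = Some (\<tau>, u') \<and> rs (fst d) u' = u"
      proof (cases "j \<in> dom (snd q)")
        case True
        have "ord j \<prec> \<delta>" using dord jd by blast
        then have jf: "j \<in> dom f" using True domf by blast
        then have "f' j = f j" using f'(1) unfolding map_le_def by simp
        then have "y j = rs \<delta> (x j)" using fj[OF jf] f'j(1)[OF jd] by simp
        then have "rs \<gamma> (x j) = u" using e rs_rs(1)[OF lt_le[OF \<gamma>]] by simp
        then show ?thesis using qj(1)[OF True] True e fd by (simp add: q'_def F_def)
      next
        case False
        have "rs \<gamma> (z j) = u" using z[OF jd] e rs_rs(1)[OF lt_le[OF \<gamma>]] by metis
        then show ?thesis using False jd e fd by (simp add: q'_def F_def)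
      qed
    qed
    ultimately show ?thesis using q'J d stronger_trans[OF _ q(2)] by blast
  qed
  then show ?thesis using \<delta>(1) by blast
qed

section \<open>The trees and the forcing\<close>

definition unit :: "'o \<Rightarrow> 'o \<Rightarrow> bit" where
  "unit \<xi> = (\<lambda>\<eta>. if \<eta> = \<xi> then 1 else 0)"

lemma unit_self [simp]: "unit \<xi> \<xi> = 1" and unit_other [simp]: "\<eta> \<noteq> \<xi> \<Longrightarrow> unit \<xi> \<eta> = 0"
  by (simp_all add: unit_def)

lemma fsup_unit: "\<xi> \<in> Ord \<Longrightarrow> fsup (unit \<xi>)"
  unfolding fsup_def unit_def by (rule conjI, rule finite_subset[of _ "{\<xi>}"]) auto

definition bot :: 'o where "bot = (SOME a. a \<in> Ord \<and> (\<forall>b\<in>Ord. a \<preceq> b))"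

lemma bot: "bot \<in> Ord" "b \<in> Ord \<Longrightarrow> bot \<preceq> b" "\<not> b \<prec> bot"
proof -
  have "Ord \<noteq> {}" using large few_finite[of Ord] by auto
  then have "\<exists>a. a \<in> Ord \<and> (\<forall>b\<in>Ord. a \<preceq> b)" using least_Ord[of Ord] by blast
  then have *: "bot \<in> Ord \<and> (\<forall>b\<in>Ord. bot \<preceq> b)" unfolding bot_def by (rule someI_ex)
  then show "bot \<in> Ord" "b \<in> Ord \<Longrightarrow> bot \<preceq> b" by auto
  show "\<not> b \<prec> bot" using * not_le lt_Ord(1) by blast
qed

lemma rs_bot [simp]: "rs bot x = 0"
  using bot(3) by (simp add: rs_def fun_eq_iff)

text \<open>The type of a node is implicit, being determined by its level. It is 0 up to and
  including level \<alpha>, so the trees share their lower levels.\<close>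

definition Tn :: "'o \<Rightarrow> ('o \<times> ('o \<Rightarrow> bit)) set" where
  "Tn \<alpha> = {(\<gamma>, x). \<gamma> \<in> Ord \<and> (rs \<gamma> (unit \<alpha>), x) \<in> W \<gamma>}"

definition tle :: "'o \<times> ('o \<Rightarrow> bit) \<Rightarrow> 'o \<times> ('o \<Rightarrow> bit) \<Rightarrow> bool" (infix \<open>\<unlhd>\<close> 50) where
  "u \<unlhd> v \<longleftrightarrow> fst u \<preceq> fst v \<and> rs (fst u) (snd v) = snd u"

lemma TnD: "u \<in> Tn \<alpha> \<Longrightarrow> fst u \<in> Ord" "u \<in> Tn \<alpha> \<Longrightarrow> (rs (fst u) (unit \<alpha>), snd u) \<in> W (fst u)"
  by (auto simp: Tn_def)

lemma Tn_rs: "u \<in> Tn \<alpha> \<Longrightarrow> rs (fst u) (snd u) = snd u"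
  using gd_supp(1)[OF gd_all] TnD by blast

lemma root_Tn: "(bot, 0) \<in> Tn \<alpha>"
  using gd_0[OF gd_all[OF bot(1)]] bot(1) by (simp add: Tn_def)

lemma root_tle: "u \<in> Tn \<alpha> \<Longrightarrow> (bot, 0) \<unlhd> u"
  using bot(2)[OF TnD(1)] by (simp add: tle_def)

lemma tle_refl: "u \<in> Tn \<alpha> \<Longrightarrow> u \<unlhd> u"
  using Tn_rs TnD(1) le_refl by (simp add: tle_def)

lemma tle_trans: "u \<unlhd> v \<Longrightarrow> v \<unlhd> w \<Longrightarrow> u \<unlhd> w"
  unfolding tle_def using le_trans rs_rs(1) by metis

lemma tle_antisym: "u \<in> Tn \<alpha> \<Longrightarrow> v \<in> Tn \<beta> \<Longrightarrow> u \<unlhd> v \<Longrightarrow> v \<unlhd> u \<Longrightarrow> u = v"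
  unfolding tle_def using le_antisym Tn_rs by (metis prod_eqI)

lemma tle_eq_lev: "u \<in> Tn \<alpha> \<Longrightarrow> v \<in> Tn \<beta> \<Longrightarrow> u \<unlhd> v \<Longrightarrow> fst u = fst v \<Longrightarrow> u = v"
  unfolding tle_def using Tn_rs by (metis prod_eqI)

lemma tle_common: "u \<unlhd> w \<Longrightarrow> v \<unlhd> w \<Longrightarrow> fst u \<preceq> fst v \<Longrightarrow> u \<unlhd> v"
  unfolding tle_def using rs_rs(1) by metis

lemma tle_linear: "u \<unlhd> w \<Longrightarrow> v \<unlhd> w \<Longrightarrow> u \<unlhd> v \<or> v \<unlhd> u"
proof -
  assume *: "u \<unlhd> w" "v \<unlhd> w"
  then have "fst u \<in> Ord" "fst v \<in> Ord" using le_Ord(1) by (auto simp: tle_def)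
  then show ?thesis using linear[of "fst u" "fst v"] tle_common[OF *] tle_common[OF *(2,1)] lt_le by blast
qed

lemma Tn_restrict: "u \<in> Tn \<alpha> \<Longrightarrow> \<gamma> \<preceq> fst u \<Longrightarrow> (\<gamma>, rs \<gamma> (snd u)) \<in> Tn \<alpha> \<and> (\<gamma>, rs \<gamma> (snd u)) \<unlhd> u"
proof -
  assume u: "u \<in> Tn \<alpha>" and \<gamma>: "\<gamma> \<preceq> fst u"
  have "(rs \<gamma> (unit \<alpha>), rs \<gamma> (snd u)) \<in> W \<gamma>"
    using gd_restrict[OF gd_all[OF TnD(1)[OF u]] TnD(2)[OF u] \<gamma>] rs_rs(1)[OF \<gamma>] by simp
  then show ?thesis using \<gamma> le_Ord(1)[OF \<gamma>] by (simp add: Tn_def tle_def)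
qed

lemma Tn_extend:
  assumes u: "u \<in> Tn \<alpha>" "\<alpha> \<in> Ord" "fst u \<preceq> \<gamma>"
  shows "\<exists>v\<in>Tn \<alpha>. u \<unlhd> v \<and> fst v = \<gamma>"
proof -
  have g: "\<gamma> \<in> Ord" using le_Ord(2)[OF u(3)] .
  obtain y where "rs (fst u) y = snd u" "(rs \<gamma> (unit \<alpha>), y) \<in> W \<gamma>"
    using gd_extend[OF gd_all[OF g] u(3) fsup_unit[OF u(2)] TnD(2)[OF u(1)]] by blast
  then show ?thesis using u(3) g by (intro bexI[of _ "(\<gamma>, y)"]) (auto simp: Tn_def tle_def)
qed

text \<open>The successor \<open>s\<close> of \<gamma> is not in \<open>S\<close>, as the singleton
  of \<gamma> is not bounded below it. So \<open>W s\<close> is \<open>full\<close>, and the bit at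
  \<gamma> can be flipped freely.\<close>

lemma Tn_split:
  assumes z: "z \<in> Tn \<alpha>" "\<alpha> \<in> Ord" and \<gamma>: "\<gamma> \<prec> fst z"
  shows "\<exists>y\<in>Tn \<alpha>. (\<gamma>, rs \<gamma> (snd z)) \<unlhd> y \<and> \<gamma> \<prec> fst y \<and> snd y \<gamma> \<noteq> snd z \<gamma>"
proof -
  have gO: "\<gamma> \<in> Ord" using lt_Ord(1)[OF \<gamma>] .
  obtain s where s: "s \<in> {b \<in> Ord. \<gamma> \<prec> b}" "\<forall>b\<in>{b \<in> Ord. \<gamma> \<prec> b}. s \<preceq> b"
    using least_Ord[of "{b \<in> Ord. \<gamma> \<prec> b}"] \<gamma> lt_Ord(2)[OF \<gamma>] by blast
  have sb: "b \<preceq> \<gamma>" if b: "b \<prec> s" for b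
    using linear[OF lt_Ord(1)[OF b] gO] s(2) not_le[OF b] lt_Ord(1)[OF b] by blast
  have "s \<notin> S"
  proof
    assume "s \<in> S"
    then obtain b where "b \<prec> s" "{\<gamma>} \<subseteq> underS K b" using S_bounded[OF _ _ small_finite[of "{\<gamma>}"]] s(1) by blast
    then show False using sb not_le by blast
  qed
  then have Ws: "W s = full W s" by (rule W_full)
  define y where "y = (\<lambda>\<xi>. if \<xi> = \<gamma> then snd z \<gamma> + 1 else rs \<gamma> (snd z) \<xi>)"
  have rsy: "rs b y = rs b (snd z)" if "b \<preceq> \<gamma>" for b
    using lt_le_trans[OF _ that] lt_irrefl by (auto simp: rs_def y_def fun_eq_iff)
  have "rs s y = y"
    using s(1) lt_trans by (auto simp: rs_def y_def fun_eq_iff)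
  moreover have "(rs b (rs s (unit \<alpha>)), rs b y) \<in> W b" if b: "b \<prec> s" for b
  proof -
    have bz: "b \<preceq> fst z" using le_lt_trans[OF sb[OF b] \<gamma>] lt_le by blast
    have "(rs b (unit \<alpha>), rs b (snd z)) \<in> W b"
      using gd_restrict[OF gd_all[OF TnD(1)[OF z(1)]] TnD(2)[OF z(1)] bz] rs_rs(1)[OF bz] by simp
    then show ?thesis using rsy[OF sb[OF b]] rs_rs(1)[OF lt_le[OF b]] by simp
  qed
  ultimately have "(rs s (unit \<alpha>), y) \<in> W s"
    unfolding Ws using fsup_rs[OF fsup_unit[OF z(2)]] by (simp add: full_def)
  then have "(s, y) \<in> Tn \<alpha>" using s(1) by (simp add: Tn_def)
  moreover have "(\<gamma>, rs \<gamma> (snd z)) \<unlhd> (s, y)" using rsy[OF le_refl[OF gO]] s(1) lt_le by (simp add: tle_def)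
  moreover have "y \<gamma> \<noteq> snd z \<gamma>" by (simp add: y_def)
  ultimately show ?thesis using s(1) by (intro bexI[of _ "(s, y)"]) auto
qed

lemma tle_val:
  assumes "u \<unlhd> v" "\<gamma> \<prec> fst u" shows "snd v \<gamma> = snd u \<gamma>"
proof -
  have "snd u \<gamma> = rs (fst u) (snd v) \<gamma>" using assms(1) by (simp add: tle_def)
  then show ?thesis using assms(2) by (simp add: rs_def)
qed

lemma differ_incomparable:
  assumes "\<gamma> \<prec> fst y" "\<gamma> \<prec> fst z" "snd y \<gamma> \<noteq> snd z \<gamma>" "y \<unlhd> y'" "z \<unlhd> z'"
  shows "\<not> y' \<unlhd> z'" "\<not> z' \<unlhd> y'"
proof -
  have "snd y' \<gamma> = snd y \<gamma>" "snd z' \<gamma> = snd z \<gamma>" "\<gamma> \<prec> fst y'" "\<gamma> \<prec> fst z'"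
    using tle_val[OF assms(4,1)] tle_val[OF assms(5,2)] assms lt_le_trans by (auto simp: tle_def)
  then show "\<not> y' \<unlhd> z'" "\<not> z' \<unlhd> y'" using assms(3) tle_val[of y' z' \<gamma>] tle_val[of z' y' \<gamma>] by auto
qed

end

section \<open>The slots of the forcing and the relations between their types\<close>

locale realizing = coded_diamond \<kappa> K S D code
  for \<kappa> :: "'k rel" and K :: "'o rel" and S D code +
  fixes m :: "'o \<Rightarrow> 'o"
  assumes m_Ord: "\<xi> \<in> Ord \<Longrightarrow> m \<xi> \<in> Ord" and m_idem: "\<xi> \<in> Ord \<Longrightarrow> m (m \<xi>) = m \<xi>"
begin

definition JE :: "'o slot set" where
  "JE = {j. num j = 0 \<and> ord j \<in> Ord \<and> m (ord j) \<noteq> ord j}"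

text \<open>
  Two auxiliary slots, outside the forcing, which carry the nodes of \<open>T\<^sub>\<alpha>\<close> and \<open>T\<^sub>\<beta>\<close> under consideration.
\<close>

definition sx :: "'o slot" where "sx = Slot bot 1"
definition sy :: "'o slot" where "sy = Slot bot 2"

lemma slots [simp]: "sx \<noteq> sy" "sy \<noteq> sx" "sx \<notin> JE" "sy \<notin> JE" "ord sx = bot" "ord sy = bot"
  by (simp_all add: sx_def sy_def JE_def)

definition tt :: "'o \<Rightarrow> 'o \<Rightarrow> 'o slot \<Rightarrow> 'o \<Rightarrow> bit" where
  "tt \<alpha> \<beta> j = (if j = sx then unit \<alpha> else if j = sy then unit \<beta> else unit (ord j) + unit (m (ord j)))"

lemma tt_simps [simp]: "tt \<alpha> \<beta> sx = unit \<alpha>" "tt \<alpha> \<beta> sy = unit \<beta>"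
  by (simp_all add: tt_def)

lemma tt_JE: "j \<in> JE \<Longrightarrow> tt \<alpha> \<beta> j = unit (ord j) + unit (m (ord j))"
  using slots by (auto simp: tt_def)

text \<open>The ordinal of a slot in \<open>JE\<close> is not a representative, so this coordinate
  occurs in no other type of the family.\<close>

lemma JE_independent:
  assumes A: "finite A" "A \<subseteq> JE" "(\<Sum>j\<in>A. tt \<alpha> \<beta> j) = 0"
  shows "A = {}"
proof (rule ccontr)
  assume "A \<noteq> {}"
  then obtain j where j: "j \<in> A" by blast
  have "tt \<alpha> \<beta> i (ord j) = (if i = j then 1 else 0)" if i: "i \<in> A" for i
  proof -
    have iJ: "num i = 0" "ord i \<in> Ord" "m (ord i) \<noteq> ord i" and jJ: "num j = 0" "ord j \<in> Ord" "m (ord j) \<noteq> ord j"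
      using i j A(2) by (auto simp: JE_def)
    have "m (ord i) \<noteq> ord j" using m_idem[OF iJ(2)] jJ(3) by metis
    moreover have "ord i \<noteq> ord j" if "i \<noteq> j" using that iJ(1) jJ(1) by (metis slot.expand)
    moreover have "tt \<alpha> \<beta> i = unit (ord i) + unit (m (ord i))" using i A(2) by (intro tt_JE) blast
    ultimately show ?thesis using iJ(3) by (cases "i = j") auto
  qed
  then have "(\<Sum>i\<in>A. tt \<alpha> \<beta> i (ord j)) = (\<Sum>i\<in>A. if i = j then 1 else 0)" by (intro sum.cong) auto
  also have "\<dots> = 1" using A(1) j by simp
  finally have "(\<Sum>i\<in>A. tt \<alpha> \<beta> i) (ord j) = 1" by (simp only: sum_fun_apply)
  then show False using A(3) by simp
qed

text \<open>\<open>L c\<close> adds up the coordinates of a type over the class of \<open>c\<close>.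
  It kills every generator, whose type is a pair inside one class, so only the auxiliary slots are
  seen: a vanishing sum contains both or neither, and both only if their classes agree. The case of
  neither, and further generators when \<alpha> = \<beta>, are excluded by
  \<open>JE_independent\<close>.\<close>

lemma slots_separated:
  assumes A: "finite A" "A \<subseteq> JE \<union> {sx, sy}" "A \<noteq> {}" "(\<Sum>j\<in>A. tt \<alpha> \<beta> j) = 0" and ab: "\<alpha> \<in> Ord" "\<beta> \<in> Ord"
  shows "m \<alpha> = m \<beta> \<and> sx \<in> A \<and> sy \<in> A \<and> (\<alpha> = \<beta> \<longrightarrow> A = {sx, sy})"
proof -
  define A0 where "A0 = A \<inter> JE"
  have A0: "finite A0" "A0 \<subseteq> JE" using A(1) by (auto simp: A0_def)
  have Adec: "A = A0 \<union> (A \<inter> {sx, sy})" "A0 \<inter> (A \<inter> {sx, sy}) = {}" using A(2) slots by (auto simp: A0_def)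
  \<comment> \<open>Finitely many ordinals support all types in the sum, so \<open>L c\<close> can
    be a finite sum even if the class is infinite.\<close>
  define \<Xi> where "\<Xi> = ord ` A0 \<union> (\<lambda>j. m (ord j)) ` A0 \<union> {\<alpha>, \<beta>}"
  define L where "L = (\<lambda>c (\<tau> :: 'o \<Rightarrow> bit). \<Sum>\<xi>\<in>{\<xi> \<in> \<Xi>. m \<xi> = c}. \<tau> \<xi>)"
  have fin: "finite {\<xi> \<in> \<Xi>. m \<xi> = c}" for c using A0(1) by (simp add: \<Xi>_def)
  have L_add: "L c (\<tau> + \<sigma>) = L c \<tau> + L c \<sigma>" for c \<tau> \<sigma> by (simp add: L_def sum.distrib plus_fun_def del: add_bit_eq_xor)
  have L_0: "L c 0 = 0" for c by (simp add: L_def)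
  have L_sum: "L c (\<Sum>j\<in>B. f j) = (\<Sum>j\<in>B. L c (f j))" if "finite B" for c B and f :: "'o slot \<Rightarrow> 'o \<Rightarrow> bit"
    using that by (induction B rule: finite_induct) (simp_all only: sum.empty sum.insert L_0 L_add not_False_eq_True)
  have L_unit: "L c (unit \<xi>) = (if m \<xi> = c then 1 else 0)" if "\<xi> \<in> \<Xi>" for c \<xi>
  proof -
    have "L c (unit \<xi>) = (\<Sum>\<eta>\<in>{\<eta> \<in> \<Xi>. m \<eta> = c}. if \<eta> = \<xi> then 1 else 0)" by (simp add: L_def unit_def)
    also have "\<dots> = (if \<xi> \<in> {\<eta> \<in> \<Xi>. m \<eta> = c} then 1 else 0)" using fin[of c] by (subst sum.delta) auto
    finally show ?thesis using that by simp
  qed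
  have "L c (tt \<alpha> \<beta> j) = 0" if j: "j \<in> A0" for c j
  proof -
    have jJ: "j \<in> JE" "ord j \<in> Ord" using j A0(2) by (auto simp: JE_def)
    have "L c (tt \<alpha> \<beta> j) = L c (unit (ord j)) + L c (unit (m (ord j)))" unfolding tt_JE[OF jJ(1)] L_add ..
    also have "\<dots> = (if m (ord j) = c then 1 else 0) + (if m (m (ord j)) = c then 1 else 0)"
      using j by (subst (1 2) L_unit) (auto simp: \<Xi>_def)
    also have "\<dots> = 0" using m_idem[OF jJ(2)] by simp
    finally show ?thesis .
  qed
  then have "(\<Sum>j\<in>A0. L c (tt \<alpha> \<beta> j)) = 0" for c by (simp cong: sum.cong)
  moreover have "(\<Sum>j\<in>A. L c (tt \<alpha> \<beta> j)) = (\<Sum>j\<in>A0. L c (tt \<alpha> \<beta> j)) + (\<Sum>j\<in>A \<inter> {sx, sy}. L c (tt \<alpha> \<beta> j))" for c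
    using A(1) A0(1) Adec by (metis finite_Int sum.union_disjoint)
  ultimately have "L c (\<Sum>j\<in>A. tt \<alpha> \<beta> j) = (\<Sum>j\<in>A \<inter> {sx, sy}. L c (tt \<alpha> \<beta> j))" for c
    unfolding L_sum[OF A(1)] by simp
  then have s: "(\<Sum>j\<in>A \<inter> {sx, sy}. L c (tt \<alpha> \<beta> j)) = 0" for c using A(4) L_0 by metis
  have Lx: "L c (tt \<alpha> \<beta> sx) = (if m \<alpha> = c then 1 else 0)" "L c (tt \<alpha> \<beta> sy) = (if m \<beta> = c then 1 else 0)" for c
    using L_unit by (simp_all add: \<Xi>_def)
  have A0e: "A0 = {}" if "(\<Sum>j\<in>A \<inter> {sx, sy}. tt \<alpha> \<beta> j) = 0"
  proof -
    have "(\<Sum>j\<in>A. tt \<alpha> \<beta> j) = (\<Sum>j\<in>A0. tt \<alpha> \<beta> j) + (\<Sum>j\<in>A \<inter> {sx, sy}. tt \<alpha> \<beta> j)"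
      using A(1) A0(1) Adec by (metis finite_Int sum.union_disjoint)
    then have "(\<Sum>j\<in>A0. tt \<alpha> \<beta> j) = 0" using that A(4) by simp
    then show ?thesis using JE_independent A0 by blast
  qed
  consider "A \<inter> {sx, sy} = {}" | "A \<inter> {sx, sy} = {sx}" | "A \<inter> {sx, sy} = {sy}" | "A \<inter> {sx, sy} = {sx, sy}" by blast
  then show ?thesis
  proof cases
    case 1
    then show ?thesis using A0e Adec(1) A(3) by simp
  next
    case 2
    then show ?thesis using s[of "m \<alpha>"] Lx by simp
  next
    case 3
    then show ?thesis using s[of "m \<beta>"] Lx by simp
  next
    case 4
    then have "m \<alpha> = m \<beta>" using s[of "m \<alpha>"] Lx by (auto split: if_splits)
    moreover have "A = {sx, sy}" if "\<alpha> = \<beta>"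
    proof -
      have "(\<Sum>j\<in>A \<inter> {sx, sy}. tt \<alpha> \<beta> j) = unit \<alpha> + unit \<alpha>" unfolding 4 using that by (subst sum.insert) auto
      also have "\<dots> = 0" by (rule fun_bit_add_self)
      finally show ?thesis using A0e Adec(1) 4 by simp
    qed
    ultimately show ?thesis using 4 by blast
  qed
qed

section \<open>The forcing, and its conditions together with carried nodes\<close>

definition PE :: "'o cond set" where
  "PE = QJ JE (\<lambda>j. unit (ord j) + unit (m (ord j)))"

text \<open>An extended condition is read as a pair: \<open>cp\<close> is its part in the forcing,
  \<open>nd\<close> the node carried in an auxiliary slot. \<open>strongerI\<close> recovers the
  order from both parts.\<close>

definition cp :: "'o cond \<Rightarrow> 'o cond" where
  "cp q = (fst q, snd q |` JE)"

definition nd :: "'o slot \<Rightarrow> 'o cond \<Rightarrow> 'o \<times> ('o \<Rightarrow> bit)" where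
  "nd s q = (fst q, snd (the (snd q s)))"

lemma fst_cp [simp]: "fst (cp q) = fst q" and fst_nd [simp]: "fst (nd s q) = fst q"
  by (simp_all add: cp_def nd_def)

lemma fsup_tt: "\<alpha> \<in> Ord \<Longrightarrow> \<beta> \<in> Ord \<Longrightarrow> j \<in> JE \<union> {sx, sy} \<Longrightarrow> fsup (tt \<alpha> \<beta> j)"
  using tt_JE[of j \<alpha> \<beta>] fsup_add[OF fsup_unit fsup_unit, of "ord j" "m (ord j)"] fsup_unit m_Ord
  by (auto simp: JE_def)

lemma PE_eq: "PE = QJ JE (tt \<alpha> \<beta>)"
proof -
  have "QJ JE s \<subseteq> QJ JE s'" if "\<And>j. j \<in> JE \<Longrightarrow> s j = s' j" for s s'
  proof
    fix p assume p: "p \<in> QJ JE s"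
    have "\<tau> = s' j" if j: "snd p j = Some (\<tau>, x)" for j \<tau> x
    proof -
      have "j \<in> JE" using QJ_dom[OF p] j by blast
      then show ?thesis using QJ_typ[OF p j] \<open>\<And>j. j \<in> JE \<Longrightarrow> s j = s' j\<close> by simp
    qed
    then show "p \<in> QJ JE s'" using QJ_Q[OF p] QJ_dom[OF p] unfolding QJ_def by blast
  qed
  then show ?thesis unfolding PE_def using tt_JE by (intro equalityI) auto
qed

lemma PE_Q: "c \<in> PE \<Longrightarrow> c \<in> Q W"
  unfolding PE_def by (rule QJ_Q)

lemma PE_lev: "c \<in> PE \<Longrightarrow> fst c \<in> Ord"
  by (rule QD(1)[OF PE_Q])

lemma PE_refl: "c \<in> PE \<Longrightarrow> c \<sqsubseteq> c"
  by (rule Q_refl[OF PE_Q])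

lemma cp_PE:
  assumes q: "q \<in> QJ (JE \<union> N) (tt \<alpha> \<beta>)" shows "cp q \<in> PE"
  unfolding PE_eq[of \<alpha> \<beta>] QJ_def mem_Collect_eq
proof (intro conjI allI impI)
  show "cp q \<in> Q W"
    unfolding cp_def
  proof (rule QI[OF QD(1)[OF QJ_Q[OF q]]])
    show "|dom (snd q |` JE)| <o \<kappa>" by (rule small_subset[OF _ QD(2)[OF QJ_Q[OF q]]]) auto
    show "ord ` dom (snd q |` JE) \<subseteq> Ord" using QD(3)[OF QJ_Q[OF q]] by (auto simp: JE_def)
    fix j \<tau> x assume "(snd q |` JE) j = Some (\<tau>, x)"
    then have "snd q j = Some (\<tau>, x)" by (simp add: restrict_map_def split: if_splits)
    then show "fsup \<tau> \<and> (rs (fst q) \<tau>, x) \<in> W (fst q)" using QD(4,5)[OF QJ_Q[OF q]] by blast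
  qed
  show "dom (snd (cp q)) \<subseteq> JE" by (simp add: cp_def)
  fix j \<tau> x assume "snd (cp q) j = Some (\<tau>, x)"
  then have "snd q j = Some (\<tau>, x)" by (simp add: cp_def restrict_map_def split: if_splits)
  then show "\<tau> = tt \<alpha> \<beta> j" by (rule QJ_typ[OF q])
qed

lemma cp_mono:
  assumes "q' \<sqsubseteq> q" shows "cp q' \<sqsubseteq> cp q"
  unfolding stronger_def
proof (intro conjI allI impI)
  show "fst (cp q) \<preceq> fst (cp q')" using stronger_lev[OF assms] by simp
  fix j \<tau> x assume "snd (cp q) j = Some (\<tau>, x)"
  then have j: "snd q j = Some (\<tau>, x)" "j \<in> JE" by (simp_all add: cp_def restrict_map_def split: if_splits)
  show "\<exists>x'. snd (cp q') j = Some (\<tau>, x') \<and> rs (fst (cp q)) x' = x"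
    using stronger_val[OF assms j(1)] j(2) by (simp add: cp_def)
qed

lemma nd_mono:
  assumes q: "q' \<sqsubseteq> q" and s: "s \<in> dom (snd q)" shows "nd s q \<unlhd> nd s q'"
proof -
  obtain \<tau> x where e: "snd q s = Some (\<tau>, x)" using s by auto
  then show ?thesis using stronger_val[OF q e] stronger_lev[OF q] by (auto simp: tle_def nd_def)
qed

lemma nd_Tn:
  assumes q: "q \<in> QJ (JE \<union> N) (tt \<alpha> \<beta>)" and s: "s \<in> dom (snd q)"
  shows "s = sx \<Longrightarrow> nd s q \<in> Tn \<alpha>" "s = sy \<Longrightarrow> nd s q \<in> Tn \<beta>"
proof -
  obtain \<tau> x where e: "snd q s = Some (\<tau>, x)" using s by auto
  have "\<tau> = tt \<alpha> \<beta> s" using QJ_typ[OF q e] .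
  then show "s = sx \<Longrightarrow> nd s q \<in> Tn \<alpha>" "s = sy \<Longrightarrow> nd s q \<in> Tn \<beta>"
    using QD(1)[OF QJ_Q[OF q]] QD(5)[OF QJ_Q[OF q] e] e by (simp_all add: nd_def Tn_def)
qed

lemma strongerI:
  assumes q: "q \<in> QJ (JE \<union> N) (tt \<alpha> \<beta>)" "q' \<in> QJ (JE \<union> N) (tt \<alpha> \<beta>)" and c: "cp q' \<sqsubseteq> cp q"
    and n: "\<And>s. s \<in> N \<Longrightarrow> s \<in> dom (snd q) \<Longrightarrow> s \<in> dom (snd q') \<and> nd s q \<unlhd> nd s q'"
  shows "q' \<sqsubseteq> q"
  unfolding stronger_def
proof (intro conjI allI impI)
  show "fst q \<preceq> fst q'" using stronger_lev[OF c] by simp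
  fix j \<tau> x assume j: "snd q j = Some (\<tau>, x)"
  show "\<exists>x'. snd q' j = Some (\<tau>, x') \<and> rs (fst q) x' = x"
  proof (cases "j \<in> JE")
    case True
    then have "snd (cp q) j = Some (\<tau>, x)" using j by (simp add: cp_def)
    from stronger_val[OF c this] show ?thesis using True by (simp add: cp_def)
  next
    case False
    have "j \<in> dom (snd q)" using j by blast
    then have "j \<in> N" using QJ_dom[OF q(1)] False by blast
    then have d: "j \<in> dom (snd q')" "nd j q \<unlhd> nd j q'" using n[of j] j by auto
    obtain \<sigma> y where e: "snd q' j = Some (\<sigma>, y)" using d(1) by auto
    have "\<sigma> = \<tau>" using QJ_typ[OF q(1) j] QJ_typ[OF q(2) e] by simp
    then show ?thesis using e j d(2) by (simp add: tle_def nd_def)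
  qed
qed

lemma max_Ord: "a \<in> Ord \<Longrightarrow> b \<in> Ord \<Longrightarrow> \<exists>c. a \<preceq> c \<and> b \<preceq> c"
  using linear[of a b] lt_le le_refl by blast

text \<open>The nodes occupy slots that the forcing does not use; once all parts are raised to one
  level, nothing has to be reconciled.\<close>

lemma combine:
  assumes c: "c \<in> PE" and u: "u \<in> Tn \<alpha>" "\<alpha> \<in> Ord" and v: "v \<in> Tn \<beta>" "\<beta> \<in> Ord" and N: "N \<subseteq> {sx, sy}"
  shows "\<exists>q\<in>QJ (JE \<union> N) (tt \<alpha> \<beta>). cp q \<sqsubseteq> c \<and> N \<subseteq> dom (snd q) \<and> (sx \<in> N \<longrightarrow> u \<unlhd> nd sx q) \<and> (sy \<in> N \<longrightarrow> v \<unlhd> nd sy q)"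
proof -
  obtain \<gamma>0 where "fst c \<preceq> \<gamma>0" "fst u \<preceq> \<gamma>0" using max_Ord PE_lev[OF c] TnD(1)[OF u(1)] by blast
  then obtain \<gamma> where \<gamma>: "fst c \<preceq> \<gamma>" "fst u \<preceq> \<gamma>" "fst v \<preceq> \<gamma>"
    using max_Ord[of \<gamma>0 "fst v"] TnD(1)[OF v(1)] le_Ord(2) le_trans by blast
  have c': "c \<in> QJ JE (tt \<alpha> \<beta>)" using c PE_eq by simp
  obtain d where d: "d \<in> QJ JE (tt \<alpha> \<beta>)" "d \<sqsubseteq> c" "fst d = \<gamma>" using QJ_level_up[OF c' \<gamma>(1)] by blast
  obtain x where x: "x \<in> Tn \<alpha>" "u \<unlhd> x" "fst x = \<gamma>" using Tn_extend[OF u \<gamma>(2)] by blast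
  obtain y where y: "y \<in> Tn \<beta>" "v \<unlhd> y" "fst y = \<gamma>" using Tn_extend[OF v \<gamma>(3)] by blast
  define f where "f = (\<lambda>j. if j \<in> N then Some (tt \<alpha> \<beta> j, if j = sx then snd x else snd y) else snd d j)"
  have fN: "f j = Some (tt \<alpha> \<beta> j, if j = sx then snd x else snd y)" if "j \<in> N" for j using that by (simp add: f_def)
  have fd: "f j = snd d j" if "j \<notin> N" for j using that by (simp add: f_def)
  have dJ: "dom (snd d) \<subseteq> JE" using QJ_dom[OF d(1)] .
  have domf: "dom f = N \<union> dom (snd d)"
  proof
    show "dom f \<subseteq> N \<union> dom (snd d)" using fd by (auto simp: dom_def)
    show "N \<union> dom (snd d) \<subseteq> dom f" using fN by (auto simp: f_def)
  qed
  have val: "\<tau> = tt \<alpha> \<beta> j \<and> fsup \<tau> \<and> (rs \<gamma> \<tau>, z) \<in> W \<gamma>" if j: "f j = Some (\<tau>, z)" for j \<tau> z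
  proof (cases "j \<in> N")
    case True
    then have "j = sx \<or> j = sy" using N by blast
    then show ?thesis using j fN[OF True] TnD(2)[OF x(1)] TnD(2)[OF y(1)] x(3) y(3) fsup_unit u(2) v(2) by auto
  next
    case False
    then have e: "snd d j = Some (\<tau>, z)" using j fd by simp
    then show ?thesis using QJ_typ[OF d(1) e] QD(4,5)[OF QJ_Q[OF d(1)] e] d(3) by simp
  qed
  have q: "(\<gamma>, f) \<in> QJ (JE \<union> N) (tt \<alpha> \<beta>)"
    unfolding QJ_def mem_Collect_eq
  proof (intro conjI allI impI)
    show "(\<gamma>, f) \<in> Q W"
    proof (rule QI)
      show "\<gamma> \<in> Ord" using le_Ord(2)[OF \<gamma>(1)] .
      have "finite N" using N by (rule finite_subset) simp
      then show "|dom f| <o \<kappa>" unfolding domf by (intro small_Un small_finite QD(2)[OF QJ_Q[OF d(1)]])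
      show "ord ` dom f \<subseteq> Ord" unfolding domf using N QD(3)[OF QJ_Q[OF d(1)]] bot(1) by fastforce
    qed (use val in blast)
    show "dom (snd (\<gamma>, f)) \<subseteq> JE \<union> N" using domf dJ by auto
  qed (use val in auto)
  have "cp (\<gamma>, f) = d"
  proof (rule prod_eqI)
    show "fst (cp (\<gamma>, f)) = fst d" using d(3) by simp
    show "snd (cp (\<gamma>, f)) = snd d"
    proof
      fix j
      show "snd (cp (\<gamma>, f)) j = snd d j"
      proof (cases "j \<in> JE")
        case True
        then have "j \<notin> N" using N slots by blast
        then show ?thesis using True fd by (simp add: cp_def)
      next
        case False
        then have "snd d j = None" using dJ by (meson domI not_None_eq subsetD)
        then show ?thesis using False by (simp add: cp_def)
      qed
    qed
  qed
  moreover have "u \<unlhd> nd sx (\<gamma>, f)" if "sx \<in> N" using x(2,3) fN[OF that] by (simp add: nd_def tle_def)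
  moreover have "v \<unlhd> nd sy (\<gamma>, f)" if "sy \<in> N" using y(2,3) fN[OF that] by (simp add: nd_def tle_def)
  ultimately show ?thesis using q d(2) domf by (intro bexI[OF _ q]) auto
qed

text \<open>This is \<open>sealing\<close> with the given nodes as \<open>p0\<close>. Under
  \<open>N2\<close> the only relation between the types is the cancellation of the two auxiliary
  ones when \<alpha> = \<beta>, and then distinct nodes on one level have values that do not cancel.
  A condition has a single level, whence \<open>fst u = fst v\<close>.\<close>

lemma seal:
  assumes ab: "\<alpha> \<in> Ord" "\<beta> \<in> Ord" and N: "N \<subseteq> {sx, sy}"
    and u: "u \<in> Tn \<alpha>" and v: "v \<in> Tn \<beta>" "fst u = fst v"
    and N2: "N = {sx, sy} \<Longrightarrow> m \<alpha> \<noteq> m \<beta> \<or> \<alpha> = \<beta> \<and> u \<noteq> v"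
    and Dn: "Dn \<subseteq> QJ (JE \<union> N) (tt \<alpha> \<beta>)"
    and dense: "\<And>q. q \<in> QJ (JE \<union> N) (tt \<alpha> \<beta>) \<Longrightarrow> N \<subseteq> dom (snd q) \<Longrightarrow> \<exists>d\<in>Dn. d \<sqsubseteq> q"
  shows "\<exists>\<delta>\<in>Ord. \<forall>q\<in>QJ (JE \<union> N) (tt \<alpha> \<beta>). N \<subseteq> dom (snd q) \<longrightarrow> (sx \<in> N \<longrightarrow> u \<unlhd> nd sx q) \<longrightarrow> (sy \<in> N \<longrightarrow> v \<unlhd> nd sy q) \<longrightarrow>
    fst u \<preceq> fst q \<longrightarrow> (\<exists>q'\<in>QJ (JE \<union> N) (tt \<alpha> \<beta>). q' \<sqsubseteq> q \<and> (\<exists>d\<in>Dn \<inter> Qb W \<delta>. q' \<sqsubseteq> d))"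
proof -
  define f where "f = (\<lambda>j. if j \<in> N then Some (tt \<alpha> \<beta> j, if j = sx then snd u else snd v) else None)"
  define p0 where "p0 = (fst u, f)"
  have domf: "dom f = N" by (auto simp: f_def split: if_splits)
  have p0: "p0 \<in> QJ (JE \<union> N) (tt \<alpha> \<beta>)"
    unfolding QJ_def mem_Collect_eq
  proof (intro conjI allI impI)
    show "p0 \<in> Q W"
      unfolding p0_def
    proof (rule QI[OF TnD(1)[OF u]])
      have "finite N" using N by (rule finite_subset) simp
      then show "|dom f| <o \<kappa>" unfolding domf by (rule small_finite)
      show "ord ` dom f \<subseteq> Ord" unfolding domf using N bot(1) by fastforce
      fix j \<tau> x assume j: "f j = Some (\<tau>, x)"
      then have "j = sx \<or> j = sy" using N by (auto simp: f_def split: if_splits)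
      then show "fsup \<tau> \<and> (rs (fst u) \<tau>, x) \<in> W (fst u)"
        using j TnD(2)[OF u] TnD(2)[OF v(1)] v(2) fsup_unit ab by (auto simp: f_def split: if_splits)
    qed
  qed (auto simp: p0_def domf f_def split: if_splits)
  have "\<exists>\<delta>\<in>Ord. \<forall>q\<in>QJ (JE \<union> N) (tt \<alpha> \<beta>). q \<sqsubseteq> p0 \<longrightarrow> (\<exists>q'\<in>QJ (JE \<union> N) (tt \<alpha> \<beta>). q' \<sqsubseteq> q \<and> (\<exists>d\<in>Dn \<inter> Qb W \<delta>. q' \<sqsubseteq> d))"
  proof (rule sealing[OF _ p0 Dn])
    show "fsup (tt \<alpha> \<beta> j)" if "j \<in> JE \<union> N" for j using that N by (intro fsup_tt[OF ab]) blast
    show "\<exists>d\<in>Dn. d \<sqsubseteq> q" if "q \<in> QJ (JE \<union> N) (tt \<alpha> \<beta>)" "q \<sqsubseteq> p0" for q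
      using dense[OF that(1)] stronger_dom[OF that(2)] domf by (simp add: p0_def)
    fix A assume A: "finite A" "A \<subseteq> JE \<union> N" "A \<noteq> {}" "(\<Sum>j\<in>A. tt \<alpha> \<beta> j) = 0"
    have s: "m \<alpha> = m \<beta>" "sx \<in> A" "sy \<in> A" "\<alpha> = \<beta> \<longrightarrow> A = {sx, sy}"
      using slots_separated[OF A(1) _ A(3,4) ab] A(2) N by blast+
    have N': "N = {sx, sy}" using s(2,3) A(2) N slots by blast
    then have uv: "\<alpha> = \<beta>" "u \<noteq> v" using N2 s(1) by auto
    then have "snd u \<noteq> snd v" using v(2) by (auto simp: prod_eq_iff)
    moreover have "(\<Sum>j\<in>A. snd (the (snd p0 j))) = snd u + snd v"
      using s(4) uv(1) N' by (simp add: p0_def f_def)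
    ultimately show "A \<subseteq> dom (snd p0) \<and> (\<Sum>j\<in>A. snd (the (snd p0 j))) \<noteq> 0"
      using s(4) uv(1) N' domf by (simp add: p0_def fun_bit_add_eq_0)
  qed
  then obtain \<delta> where \<delta>: "\<delta> \<in> Ord" "\<And>q. q \<in> QJ (JE \<union> N) (tt \<alpha> \<beta>) \<Longrightarrow> q \<sqsubseteq> p0 \<Longrightarrow> \<exists>q'\<in>QJ (JE \<union> N) (tt \<alpha> \<beta>). q' \<sqsubseteq> q \<and> (\<exists>d\<in>Dn \<inter> Qb W \<delta>. q' \<sqsubseteq> d)"
    by meson
  have "q \<sqsubseteq> p0" if q: "q \<in> QJ (JE \<union> N) (tt \<alpha> \<beta>)" "N \<subseteq> dom (snd q)" "sx \<in> N \<longrightarrow> u \<unlhd> nd sx q" "sy \<in> N \<longrightarrow> v \<unlhd> nd sy q" "fst u \<preceq> fst q" for q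
    unfolding stronger_def
  proof (intro conjI allI impI)
    show "fst p0 \<preceq> fst q" using q(5) by (simp add: p0_def)
    fix j \<tau> x assume j: "snd p0 j = Some (\<tau>, x)"
    then have jN: "j \<in> N" and e: "\<tau> = tt \<alpha> \<beta> j" "x = (if j = sx then snd u else snd v)" by (auto simp: p0_def f_def split: if_splits)
    obtain \<sigma> y where y: "snd q j = Some (\<sigma>, y)" using jN q(2) by fastforce
    have "\<sigma> = \<tau>" using QJ_typ[OF q(1) y] e by simp
    moreover have "rs (fst u) y = x"
    proof (cases "j = sx")
      case True then show ?thesis using q(3) jN e y by (simp add: tle_def nd_def)
    next
      case False
      then have "j = sy" using N jN by blast
      then show ?thesis using q(4) jN e y v(2) by (simp add: tle_def nd_def)
    qed
    ultimately show "\<exists>x'. snd q j = Some (\<tau>, x') \<and> rs (fst p0) x' = x" using y by (simp add: p0_def)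
  qed
  then show ?thesis using \<delta> by (intro bexI[OF _ \<delta>(1)]) meson
qed

lemma PE_empty: "(bot, Map.empty) \<in> PE"
  unfolding PE_def QJ_def using bot(1) small_empty by (auto intro: QI)

text \<open>The \<open>\<kappa>\<^sup>+\<close>-chain condition in the form in which it is used: the
  members of \<open>Dn\<close> bounded by a sealing level are predense, and there are at most
  \<kappa> of them. No auxiliary slot takes part.\<close>

lemma PE_bounded_antichain:
  assumes Dn: "Dn \<subseteq> PE" and dense: "\<And>c. c \<in> PE \<Longrightarrow> \<exists>d\<in>Dn. d \<sqsubseteq> c"
  shows "\<exists>B\<subseteq>Dn. |B| \<le>o \<kappa> \<and> (\<forall>c\<in>PE. \<exists>c'\<in>PE. c' \<sqsubseteq> c \<and> (\<exists>d\<in>B. c' \<sqsubseteq> d))"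
proof -
  have e: "QJ (JE \<union> {}) (tt bot bot) = PE" using PE_eq by simp
  have "\<exists>\<delta>\<in>Ord. \<forall>q\<in>PE. {} \<subseteq> dom (snd q) \<longrightarrow> (sx \<in> {} \<longrightarrow> (bot, 0) \<unlhd> nd sx q) \<longrightarrow> (sy \<in> {} \<longrightarrow> (bot, 0) \<unlhd> nd sy q) \<longrightarrow>
    fst (bot, 0 :: 'o \<Rightarrow> bit) \<preceq> fst q \<longrightarrow> (\<exists>q'\<in>PE. q' \<sqsubseteq> q \<and> (\<exists>d\<in>Dn \<inter> Qb W \<delta>. q' \<sqsubseteq> d))"
    by (rule seal[OF bot(1) bot(1) empty_subsetI root_Tn root_Tn, unfolded e]) (use Dn dense in auto)
  then obtain \<delta> where \<delta>: "\<forall>q\<in>PE. \<exists>q'\<in>PE. q' \<sqsubseteq> q \<and> (\<exists>d\<in>Dn \<inter> Qb W \<delta>. q' \<sqsubseteq> d)" using bot(2) PE_lev by auto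
  moreover have "|Dn \<inter> Qb W \<delta>| \<le>o \<kappa>" by (rule few_subset[OF Int_lower2 card_Qb])
  ultimately show ?thesis by (intro exI[of _ "Dn \<inter> Qb W \<delta>"]) simp
qed

lemma PE_closed:
  assumes C: "C \<subseteq> PE" "C \<noteq> {}" "|C| <o \<kappa>" and ch: "\<And>p q. p \<in> C \<Longrightarrow> q \<in> C \<Longrightarrow> p \<sqsubseteq> q \<or> q \<sqsubseteq> p"
  shows "\<exists>q\<in>PE. \<forall>p\<in>C. q \<sqsubseteq> p"
proof -
  have "\<exists>q\<in>Q W. (\<forall>p\<in>C. q \<sqsubseteq> p) \<and> (\<forall>b. b \<in> Ord \<longrightarrow> (\<forall>p\<in>C. fst p \<preceq> b) \<longrightarrow> fst q \<preceq> b) \<and>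
     (\<forall>j \<tau> x. snd q j = Some (\<tau>, x) \<longrightarrow> (\<exists>p\<in>C. \<exists>y. snd p j = Some (\<tau>, y)))"
  proof (rule chain_bound[OF _ C(2,3) ch])
    show "C \<subseteq> Q W" using C(1) PE_Q by blast
    show "W (fst p) \<subseteq> full W (fst p)" if "p \<in> C" for p using gd_full[OF gd_all[OF PE_lev]] C(1) that by blast
  qed (use W_full in auto)
  then obtain q where q: "q \<in> Q W" "\<forall>p\<in>C. q \<sqsubseteq> p"
    "\<forall>j \<tau> x. snd q j = Some (\<tau>, x) \<longrightarrow> (\<exists>p\<in>C. \<exists>y. snd p j = Some (\<tau>, y))" by meson
  have "j \<in> JE \<and> \<tau> = unit (ord j) + unit (m (ord j))" if j: "snd q j = Some (\<tau>, x)" for j \<tau> x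
  proof -
    obtain p y where p: "p \<in> C" "snd p j = Some (\<tau>, y)" using q(3) j by meson
    then have pP: "p \<in> QJ JE (\<lambda>j. unit (ord j) + unit (m (ord j)))" using C(1) unfolding PE_def by blast
    show ?thesis using QJ_typ[OF pP p(2)] QJ_dom[OF pP] p(2) by blast
  qed
  then have "q \<in> PE" using q(1) unfolding PE_def QJ_def by auto
  then show ?thesis using q(2) by blast
qed

text \<open>Applied to the sets of conditions that decide single values of a name, this lets one
  condition decide a function on fewer than \<kappa> arguments.\<close>

lemma PE_meet:
  assumes c0: "c0 \<in> PE" and card: "|\<D>| <o \<kappa>"
    and dense: "\<And>\<Delta> c. \<Delta> \<in> \<D> \<Longrightarrow> c \<in> PE \<Longrightarrow> c \<sqsubseteq> c0 \<Longrightarrow> \<exists>d\<in>PE. d \<in> \<Delta> \<and> d \<sqsubseteq> c"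
  shows "\<exists>c\<in>PE. c \<sqsubseteq> c0 \<and> (\<forall>\<Delta>\<in>\<D>. \<exists>d\<in>PE. d \<in> \<Delta> \<and> c \<sqsubseteq> d)"
proof -
  let ?X = "{c \<in> PE. c \<sqsubseteq> c0}"
  have "\<exists>q\<in>?X. \<forall>\<Delta>\<in>\<D>. \<exists>p\<in>?X. p \<in> \<Delta> \<and> q \<sqsubseteq> p"
  proof (rule generic_bound[OF Ck stronger_trans])
    show "p \<sqsubseteq> p" if "p \<in> ?X" for p using that PE_refl by blast
    show "|\<D>| <o \<kappa>" by fact
  next
    fix C assume C: "C \<subseteq> ?X" "|C| <o \<kappa>" and ch: "\<And>p q. p \<in> C \<Longrightarrow> q \<in> C \<Longrightarrow> p \<sqsubseteq> q \<or> q \<sqsubseteq> p"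
    show "\<exists>q\<in>?X. \<forall>p\<in>C. q \<sqsubseteq> p"
    proof (cases "C = {}")
      case True
      then show ?thesis using c0 PE_refl[OF c0] by blast
    next
      case False
      have "C \<subseteq> PE" using C(1) by blast
      then obtain q where q: "q \<in> PE" "\<forall>p\<in>C. q \<sqsubseteq> p" using PE_closed[OF _ False C(2) ch] by meson
      obtain p where "p \<in> C" using False by blast
      then have "q \<sqsubseteq> c0" using q(2) C(1) stronger_trans by blast
      then show ?thesis using q by (intro bexI[of _ q]) auto
    qed
  next
    fix \<Delta> p assume "\<Delta> \<in> \<D>" "p \<in> ?X"
    then obtain d where "d \<in> PE" "d \<in> \<Delta>" "d \<sqsubseteq> p" "p \<sqsubseteq> c0" using dense[of \<Delta> p] by auto
    then show "\<exists>q\<in>?X. q \<in> \<Delta> \<and> q \<sqsubseteq> p" using stronger_trans[of d p c0] by (intro bexI[of _ d]) auto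
  qed
  then obtain q where q: "q \<in> ?X" "\<forall>\<Delta>\<in>\<D>. \<exists>p\<in>?X. p \<in> \<Delta> \<and> q \<sqsubseteq> p" by meson
  have "\<exists>d\<in>PE. d \<in> \<Delta> \<and> q \<sqsubseteq> d" if "\<Delta> \<in> \<D>" for \<Delta> using bspec[OF q(2) that] by blast
  moreover have "q \<in> PE" "q \<sqsubseteq> c0" using q(1) by blast+
  ultimately show ?thesis by meson
qed

section \<open>Forced antichains, chains and isomorphisms\<close>

lemma sx_subset: "{sx} \<subseteq> {sx, sy}" "{sx} = {sx, sy} \<longleftrightarrow> False"
  using slots(1) by auto

text \<open>Read \<open>N c z\<close> as: \<open>c\<close> forces \<open>z\<close> into an
  antichain. Extended conditions decide whether a forced member lies below the carried node, and
  these decisions are sealed at \<delta>. If a member \<open>z\<close> of level at least \<delta> is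
  carried, the decision found below \<delta> must be positive, and so a member of level less than
  \<delta> lies below \<open>z\<close>.\<close>

lemma antichain_bounded:
  assumes \<alpha>: "\<alpha> \<in> Ord"
    and N: "\<And>c z. N c z \<Longrightarrow> c \<in> PE \<and> z \<in> Tn \<alpha>"
    and mono: "\<And>c c' z. N c z \<Longrightarrow> c' \<in> PE \<Longrightarrow> c' \<sqsubseteq> c \<Longrightarrow> N c' z"
    and anti: "\<And>c z z'. N c z \<Longrightarrow> N c z' \<Longrightarrow> z \<unlhd> z' \<Longrightarrow> z = z'"
  shows "\<exists>\<delta>\<in>Ord. \<forall>c z. N c z \<longrightarrow> fst z \<prec> \<delta>"
proof -
  let ?Q = "QJ (JE \<union> {sx}) (tt \<alpha> \<alpha>)"
  define \<Phi> where "\<Phi> = (\<lambda>q. \<exists>z. N (cp q) z \<and> z \<unlhd> nd sx q)"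
  define Dn where "Dn = {q \<in> ?Q. sx \<in> dom (snd q) \<and> (\<Phi> q \<or> (\<forall>q'\<in>?Q. q' \<sqsubseteq> q \<longrightarrow> \<not> \<Phi> q'))}"
  have "\<exists>\<delta>\<in>Ord. \<forall>q\<in>?Q. {sx} \<subseteq> dom (snd q) \<longrightarrow> (sx \<in> {sx} \<longrightarrow> (bot, 0) \<unlhd> nd sx q) \<longrightarrow> (sy \<in> {sx} \<longrightarrow> (bot, 0) \<unlhd> nd sy q) \<longrightarrow>
    fst (bot, 0 :: 'o \<Rightarrow> bit) \<preceq> fst q \<longrightarrow> (\<exists>q'\<in>?Q. q' \<sqsubseteq> q \<and> (\<exists>d\<in>Dn \<inter> Qb W \<delta>. q' \<sqsubseteq> d))"
  proof (rule seal[OF \<alpha> \<alpha> sx_subset(1) root_Tn root_Tn HOL.refl])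
    show "Dn \<subseteq> ?Q" by (auto simp: Dn_def)
    fix q assume q: "q \<in> ?Q" "{sx} \<subseteq> dom (snd q)"
    show "\<exists>d\<in>Dn. d \<sqsubseteq> q"
    proof (cases "\<forall>q'\<in>?Q. q' \<sqsubseteq> q \<longrightarrow> \<not> \<Phi> q'")
      case True
      then have "q \<in> Dn" using q unfolding Dn_def by blast
      then show ?thesis using QJ_refl[OF q(1)] by blast
    next
      case False
      then obtain q' where q': "q' \<in> ?Q" "q' \<sqsubseteq> q" "\<Phi> q'" by blast
      then have "q' \<in> Dn" using stronger_dom[OF q'(2)] q(2) unfolding Dn_def by blast
      then show ?thesis using q'(2) by blast
    qed
  qed (use sx_subset(2) in simp)
  then obtain \<delta> where \<delta>: "\<delta> \<in> Ord" and seal: "\<And>q. q \<in> ?Q \<Longrightarrow> sx \<in> dom (snd q) \<Longrightarrow> \<exists>q'\<in>?Q. q' \<sqsubseteq> q \<and> (\<exists>d\<in>Dn \<inter> Qb W \<delta>. q' \<sqsubseteq> d)"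
    using root_tle nd_Tn(1) bot(2) QD(1)[OF QJ_Q] slots(2) by (metis (no_types, lifting) empty_iff empty_subsetI fst_conv insert_iff insert_subset)
  have "fst z \<prec> \<delta>" if Nz: "N c z" for c z
  proof (rule ccontr)
    assume "\<not> fst z \<prec> \<delta>"
    then have \<delta>z: "\<delta> \<preceq> fst z" using linear[OF \<delta> TnD(1)] N[OF Nz] by blast
    obtain q where q: "q \<in> ?Q" "cp q \<sqsubseteq> c" "sx \<in> dom (snd q)" "z \<unlhd> nd sx q"
      using combine[of c z \<alpha> z \<alpha> "{sx}"] N[OF Nz] \<alpha> by auto
    obtain q' d where q': "q' \<in> ?Q" "q' \<sqsubseteq> q" "d \<in> Dn" "d \<in> Qb W \<delta>" "q' \<sqsubseteq> d" using seal[OF q(1,3)] by blast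
    have dQ: "d \<in> ?Q" "sx \<in> dom (snd d)" using q'(3) by (auto simp: Dn_def)
    have zq': "z \<unlhd> nd sx q'" using tle_trans[OF q(4) nd_mono[OF q'(2) q(3)]] .
    have Nq': "N (cp q') z" using mono[OF Nz cp_PE[OF q'(1)] stronger_trans[OF cp_mono[OF q'(2)] q(2)]] .
    then have "\<Phi> q'" using zq' unfolding \<Phi>_def by blast
    then have "\<Phi> d" using q'(1,3,5) unfolding Dn_def by blast
    then obtain z' where z': "N (cp d) z'" "z' \<unlhd> nd sx d" unfolding \<Phi>_def by blast
    have z'q': "z' \<unlhd> nd sx q'" using tle_trans[OF z'(2) nd_mono[OF q'(5) dQ(2)]] .
    have "fst z' \<preceq> fst d" using z'(2) by (simp add: tle_def)
    then have lt: "fst z' \<prec> fst z" using Qb_lev[OF q'(4)] \<delta>z le_lt_trans lt_le_trans by blast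
    then have "z' \<unlhd> z" using tle_common[OF z'q' zq'] lt_le by blast
    moreover have "N (cp q') z'" using mono[OF z'(1) cp_PE[OF q'(1)] cp_mono[OF q'(5)]] .
    ultimately have "z' = z" using anti Nq' by blast
    then show False using lt lt_irrefl by blast
  qed
  then show ?thesis using \<delta> by blast
qed

text \<open>Read \<open>N c z\<close> as: \<open>c\<close> forces \<open>z\<close> into a chain.
  Since nodes split, the carried node can be moved so that no member of the chain is strictly above
  it, and this is sealed at \<delta>. A member of level at least \<delta> would lie above such a
  node.\<close>

lemma chain_bounded:
  assumes \<alpha>: "\<alpha> \<in> Ord"
    and N: "\<And>c z. N c z \<Longrightarrow> c \<in> PE \<and> z \<in> Tn \<alpha>"
    and mono: "\<And>c c' z. N c z \<Longrightarrow> c' \<in> PE \<Longrightarrow> c' \<sqsubseteq> c \<Longrightarrow> N c' z"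
    and chain: "\<And>c z z'. N c z \<Longrightarrow> N c z' \<Longrightarrow> z \<unlhd> z' \<or> z' \<unlhd> z"
  shows "\<exists>\<delta>\<in>Ord. \<forall>c z. N c z \<longrightarrow> fst z \<prec> \<delta>"
proof -
  let ?Q = "QJ (JE \<union> {sx}) (tt \<alpha> \<alpha>)"
  define Dn where "Dn = {q \<in> ?Q. sx \<in> dom (snd q) \<and> (\<forall>c z. c \<in> PE \<longrightarrow> c \<sqsubseteq> cp q \<longrightarrow> nd sx q \<unlhd> z \<longrightarrow> fst q \<prec> fst z \<longrightarrow> \<not> N c z)}"
  have "\<exists>\<delta>\<in>Ord. \<forall>q\<in>?Q. {sx} \<subseteq> dom (snd q) \<longrightarrow> (sx \<in> {sx} \<longrightarrow> (bot, 0) \<unlhd> nd sx q) \<longrightarrow> (sy \<in> {sx} \<longrightarrow> (bot, 0) \<unlhd> nd sy q) \<longrightarrow>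
    fst (bot, 0 :: 'o \<Rightarrow> bit) \<preceq> fst q \<longrightarrow> (\<exists>q'\<in>?Q. q' \<sqsubseteq> q \<and> (\<exists>d\<in>Dn \<inter> Qb W \<delta>. q' \<sqsubseteq> d))"
  proof (rule seal[OF \<alpha> \<alpha> sx_subset(1) root_Tn root_Tn HOL.refl])
    show "Dn \<subseteq> ?Q" by (auto simp: Dn_def)
    fix q assume q: "q \<in> ?Q" "{sx} \<subseteq> dom (snd q)"
    show "\<exists>d\<in>Dn. d \<sqsubseteq> q"
    proof (cases "q \<in> Dn")
      case True
      then show ?thesis using QJ_refl[OF q(1)] by blast
    next
      case False
      then obtain c z where cz: "c \<in> PE" "c \<sqsubseteq> cp q" "nd sx q \<unlhd> z" "fst q \<prec> fst z" "N c z" using q by (auto simp: Dn_def)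
      have zT: "z \<in> Tn \<alpha>" using N[OF cz(5)] by blast
      \<comment> \<open>As \<open>z\<close> is forced into the chain, no member of the chain can
        extend a node that disagrees with \<open>z\<close> at the bit \<open>fst q\<close>.\<close>
      obtain y where y: "y \<in> Tn \<alpha>" "(fst q, rs (fst q) (snd z)) \<unlhd> y" "fst q \<prec> fst y" "snd y (fst q) \<noteq> snd z (fst q)"
        using Tn_split[OF zT \<alpha> cz(4)] by blast
      have "nd sx q = (fst q, rs (fst q) (snd z))" using cz(3) by (simp add: tle_def prod_eq_iff)
      then have qy: "nd sx q \<unlhd> y" using y(2) by simp
      obtain q1 where q1: "q1 \<in> ?Q" "cp q1 \<sqsubseteq> c" "sx \<in> dom (snd q1)" "y \<unlhd> nd sx q1"
        using combine[of c y \<alpha> y \<alpha> "{sx}"] cz(1) y(1) \<alpha> by auto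
      have "q1 \<sqsubseteq> q"
        by (rule strongerI[OF q(1) q1(1) stronger_trans[OF q1(2) cz(2)]]) (use q1(3) tle_trans[OF qy q1(4)] in auto)
      moreover have "\<not> N c' z'" if c': "c' \<in> PE" "c' \<sqsubseteq> cp q1" "nd sx q1 \<unlhd> z'" for c' z'
      proof
        assume n: "N c' z'"
        have "N c' z" using mono[OF cz(5) c'(1) stronger_trans[OF c'(2) q1(2)]] .
        then have "z \<unlhd> z' \<or> z' \<unlhd> z" using chain n by blast
        moreover have "y \<unlhd> z'" using tle_trans[OF q1(4) c'(3)] .
        ultimately show False
          using differ_incomparable[OF y(3) cz(4) y(4) _ tle_refl[OF zT]] by blast
      qed
      then have "q1 \<in> Dn" using q1 by (auto simp: Dn_def)
      ultimately show ?thesis by blast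
    qed
  qed (use sx_subset(2) in simp)
  then obtain \<delta> where \<delta>: "\<delta> \<in> Ord" and seal: "\<And>q. q \<in> ?Q \<Longrightarrow> sx \<in> dom (snd q) \<Longrightarrow> \<exists>q'\<in>?Q. q' \<sqsubseteq> q \<and> (\<exists>d\<in>Dn \<inter> Qb W \<delta>. q' \<sqsubseteq> d)"
    using root_tle nd_Tn(1) bot(2) QD(1)[OF QJ_Q] slots(2) by (metis (no_types, lifting) empty_iff empty_subsetI fst_conv insert_iff insert_subset)
  have "fst z \<prec> \<delta>" if Nz: "N c z" for c z
  proof (rule ccontr)
    assume "\<not> fst z \<prec> \<delta>"
    then have \<delta>z: "\<delta> \<preceq> fst z" using linear[OF \<delta> TnD(1)] N[OF Nz] by blast
    obtain q where q: "q \<in> ?Q" "cp q \<sqsubseteq> c" "sx \<in> dom (snd q)" "z \<unlhd> nd sx q"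
      using combine[of c z \<alpha> z \<alpha> "{sx}"] N[OF Nz] \<alpha> by auto
    obtain q' d where q': "q' \<in> ?Q" "q' \<sqsubseteq> q" "d \<in> Dn" "d \<in> Qb W \<delta>" "q' \<sqsubseteq> d" using seal[OF q(1,3)] by blast
    have dQ: "d \<in> ?Q" "sx \<in> dom (snd d)" using q'(3) by (auto simp: Dn_def)
    have zq': "z \<unlhd> nd sx q'" using tle_trans[OF q(4) nd_mono[OF q'(2) q(3)]] .
    have Nq': "N (cp q') z" using mono[OF Nz cp_PE[OF q'(1)] stronger_trans[OF cp_mono[OF q'(2)] q(2)]] .
    have lt: "fst d \<prec> fst z" using Qb_lev[OF q'(4)] \<delta>z lt_le_trans by blast
    have "nd sx d \<unlhd> z" using tle_common[OF nd_mono[OF q'(5) dQ(2)] zq'] lt_le[OF lt] by simp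
    then show False using q'(3) cp_PE[OF q'(1)] cp_mono[OF q'(5)] lt Nq' unfolding Dn_def by blast
  qed
  then show ?thesis using \<delta> by blast
qed

text \<open>Read \<open>V c x y\<close> as: \<open>c\<close> forces an isomorphism to send
  \<open>x\<close> to \<open>y\<close>. Two incompatible extensions of the first carried node have
  incomparable images, so one can be chosen whose image is incomparable with some extension of the
  second carried node. This is sealed at \<delta>, and carrying a node of level at least \<delta>
  together with its image contradicts it.\<close>

lemma no_isomorphism:
  assumes ab: "\<alpha> \<in> Ord" "\<beta> \<in> Ord" and c0: "c0 \<in> PE"
    and V: "\<And>c x y. V c x y \<Longrightarrow> c \<in> PE \<and> x \<in> Tn \<alpha> \<and> y \<in> Tn \<beta>"
    and mono: "\<And>c c' x y. V c x y \<Longrightarrow> c' \<in> PE \<Longrightarrow> c' \<sqsubseteq> c \<Longrightarrow> V c' x y"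
    and total: "\<And>c x. c \<in> PE \<Longrightarrow> c \<sqsubseteq> c0 \<Longrightarrow> x \<in> Tn \<alpha> \<Longrightarrow> \<exists>c' y. c' \<in> PE \<and> c' \<sqsubseteq> c \<and> V c' x y"
    and emb: "\<And>c x y x' y'. V c x y \<Longrightarrow> V c x' y' \<Longrightarrow> x \<unlhd> x' \<longleftrightarrow> y \<unlhd> y'"
    and uv: "V c0 u v" "u0 \<in> Tn \<alpha>" "v0 \<in> Tn \<beta>" "u0 \<unlhd> u" "v0 \<unlhd> v" "fst u0 = fst v0"
    and ne: "m \<alpha> \<noteq> m \<beta> \<or> \<alpha> = \<beta> \<and> u0 \<noteq> v0"
  shows False
proof -
  let ?Q = "QJ (JE \<union> {sx, sy}) (tt \<alpha> \<beta>)"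
  have uT: "u \<in> Tn \<alpha>" "v \<in> Tn \<beta>" using V[OF uv(1)] by auto
  define \<Phi> where "\<Phi> = (\<lambda>q. \<exists>x w. x \<unlhd> nd sx q \<and> V (cp q) x w \<and> \<not> w \<unlhd> nd sy q \<and> \<not> nd sy q \<unlhd> w)"
  \<comment> \<open>Conditions incompatible with \<open>c0\<close> are included because
    \<open>seal\<close> asks for density everywhere, while \<open>total\<close> speaks only about
    conditions below \<open>c0\<close>.\<close>
  define Dn where "Dn = {q \<in> ?Q. {sx, sy} \<subseteq> dom (snd q) \<and> ((\<forall>c\<in>PE. c \<sqsubseteq> cp q \<longrightarrow> \<not> c \<sqsubseteq> c0) \<or> \<Phi> q)}"
  have "\<exists>\<delta>\<in>Ord. \<forall>q\<in>?Q. {sx, sy} \<subseteq> dom (snd q) \<longrightarrow> (sx \<in> {sx, sy} \<longrightarrow> u0 \<unlhd> nd sx q) \<longrightarrow> (sy \<in> {sx, sy} \<longrightarrow> v0 \<unlhd> nd sy q) \<longrightarrow>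
    fst u0 \<preceq> fst q \<longrightarrow> (\<exists>q'\<in>?Q. q' \<sqsubseteq> q \<and> (\<exists>d\<in>Dn \<inter> Qb W \<delta>. q' \<sqsubseteq> d))"
  proof (rule seal[OF ab subset_refl uv(2,3,6) ne])
    show "Dn \<subseteq> ?Q" by (auto simp: Dn_def)
    fix q assume q: "q \<in> ?Q" "{sx, sy} \<subseteq> dom (snd q)"
    have qs: "sx \<in> dom (snd q)" "sy \<in> dom (snd q)" using q(2) by auto
    show "\<exists>d\<in>Dn. d \<sqsubseteq> q"
    proof (cases "\<forall>c\<in>PE. c \<sqsubseteq> cp q \<longrightarrow> \<not> c \<sqsubseteq> c0")
      case True
      then have "q \<in> Dn" using q by (simp add: Dn_def)
      then show ?thesis using QJ_refl[OF q(1)] by blast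
    next
      case False
      then obtain c1 where c1: "c1 \<in> PE" "c1 \<sqsubseteq> cp q" "c1 \<sqsubseteq> c0" by blast
      have xT: "nd sx q \<in> Tn \<alpha>" and yT: "nd sy q \<in> Tn \<beta>" using nd_Tn[OF q(1)] qs by auto
      obtain s where s: "s \<in> Ord" "fst q \<prec> s" using bounded[of "{fst q}"] few_finite[of "{fst q}"] QD(1)[OF QJ_Q[OF q(1)]] by auto
      obtain x1 where x1: "x1 \<in> Tn \<alpha>" "nd sx q \<unlhd> x1" "fst x1 = s" using Tn_extend[OF xT ab(1), of s] lt_le[OF s(2)] by auto
      have lt: "fst q \<prec> fst x1" using s(2) x1(3) by simp
      obtain x2 where x2: "x2 \<in> Tn \<alpha>" "(fst q, rs (fst q) (snd x1)) \<unlhd> x2" "fst q \<prec> fst x2" "snd x2 (fst q) \<noteq> snd x1 (fst q)"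
        using Tn_split[OF x1(1) ab(1) lt] by blast
      have "nd sx q = (fst q, rs (fst q) (snd x1))" using x1(2) by (simp add: tle_def prod_eq_iff)
      then have x2': "nd sx q \<unlhd> x2" using x2(2) by simp
      have inc: "\<not> x1 \<unlhd> x2" "\<not> x2 \<unlhd> x1"
        using differ_incomparable[OF x2(3) lt x2(4) tle_refl[OF x2(1)] tle_refl[OF x1(1)]] by auto
      obtain c2 w1 where c2: "c2 \<in> PE" "c2 \<sqsubseteq> c1" "V c2 x1 w1" using total[OF c1(1,3) x1(1)] by blast
      obtain c3 w2 where c3: "c3 \<in> PE" "c3 \<sqsubseteq> c2" "V c3 x2 w2" using total[OF c2(1) stronger_trans[OF c2(2) c1(3)] x2(1)] by blast
      have V1: "V c3 x1 w1" using mono[OF c2(3) c3(1,2)] .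
      have w: "\<not> w1 \<unlhd> w2" "\<not> w2 \<unlhd> w1" using inc emb[OF V1 c3(3)] emb[OF c3(3) V1] by auto
      have wT: "w1 \<in> Tn \<beta>" "w2 \<in> Tn \<beta>" using V[OF V1] V[OF c3(3)] by auto
      obtain b where b: "fst q \<preceq> b" "fst w1 \<preceq> b" "fst w2 \<preceq> b"
      proof -
        obtain b1 where b1: "fst w1 \<preceq> b1" "fst w2 \<preceq> b1" using max_Ord TnD(1)[OF wT(1)] TnD(1)[OF wT(2)] by blast
        obtain b where "fst q \<preceq> b" "b1 \<preceq> b" using max_Ord[OF lt_Ord(1)[OF s(2)] le_Ord(2)[OF b1(1)]] by blast
        then show thesis using that b1 le_trans by blast
      qed
      obtain y where y: "y \<in> Tn \<beta>" "nd sy q \<unlhd> y" "fst y = b" using Tn_extend[OF yT ab(2), of b] b(1) by auto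
      \<comment> \<open>At most one of the incomparable images is below \<open>y\<close>. The level
        of \<open>y\<close> is above both, so the other one is incomparable with \<open>y\<close>,
        and remains so under extension.\<close>
      have "\<exists>x w. x \<in> Tn \<alpha> \<and> nd sx q \<unlhd> x \<and> V c3 x w \<and> w \<in> Tn \<beta> \<and> fst w \<preceq> b \<and> \<not> w \<unlhd> y"
        using V1 c3(3) x1(1,2) x2(1) x2' wT b(2,3) tle_linear[of w1 y w2] w by blast
      then obtain x w where xw: "x \<in> Tn \<alpha>" "nd sx q \<unlhd> x" "V c3 x w" "w \<in> Tn \<beta>" "fst w \<preceq> b" "\<not> w \<unlhd> y" by blast
      obtain q1 where q1: "q1 \<in> ?Q" "cp q1 \<sqsubseteq> c3" "{sx, sy} \<subseteq> dom (snd q1)" "x \<unlhd> nd sx q1" "y \<unlhd> nd sy q1"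
        using combine[OF c3(1) xw(1) ab(1) y(1) ab(2) subset_refl] by auto
      have "cp q1 \<sqsubseteq> cp q" using q1(2) c3(2) c2(2) c1(2) stronger_trans by blast
      then have "q1 \<sqsubseteq> q"
        by (rule strongerI[OF q(1) q1(1)]) (use q1(3) tle_trans[OF xw(2) q1(4)] tle_trans[OF y(2) q1(5)] in auto)
      moreover have "\<not> w \<unlhd> nd sy q1"
      proof
        assume "w \<unlhd> nd sy q1"
        then have "w \<unlhd> y" using tle_common[OF _ q1(5)] xw(5) y(3) by simp
        then show False using xw(6) by blast
      qed
      moreover have "\<not> nd sy q1 \<unlhd> w"
      proof
        assume *: "nd sy q1 \<unlhd> w"
        then have yw: "y \<unlhd> w" using tle_trans[OF q1(5)] by blast
        then have "fst y = fst w" using xw(5) y(3) le_antisym by (simp add: tle_def)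
        then have "y = w" using tle_eq_lev[OF y(1) xw(4) yw] by blast
        then show False using xw(6) tle_refl[OF y(1)] by blast
      qed
      moreover have "V (cp q1) x w" using mono[OF xw(3) cp_PE[OF q1(1)] q1(2)] .
      ultimately have "\<Phi> q1" "q1 \<sqsubseteq> q" using q1(4) unfolding \<Phi>_def by blast+
      then show ?thesis using q1(1,3) unfolding Dn_def by blast
    qed
  qed
  then obtain \<delta> where \<delta>: "\<delta> \<in> Ord" and seal: "\<And>q. q \<in> ?Q \<Longrightarrow> {sx, sy} \<subseteq> dom (snd q) \<Longrightarrow> u0 \<unlhd> nd sx q \<Longrightarrow> v0 \<unlhd> nd sy q \<Longrightarrow>
    \<exists>q'\<in>?Q. q' \<sqsubseteq> q \<and> (\<exists>d\<in>Dn \<inter> Qb W \<delta>. q' \<sqsubseteq> d)" unfolding tle_def by fastforce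
  \<comment> \<open>Only the node \<open>x\<close> is raised beyond \<delta>: the order relation
    needed between the images \<open>w0\<close> and \<open>w\<close> comes from \<open>emb\<close>
    and not from their levels.\<close>
  obtain b where b: "fst u \<preceq> b" "\<delta> \<preceq> b" using max_Ord[OF TnD(1)[OF uT(1)] \<delta>] by blast
  obtain x where x: "x \<in> Tn \<alpha>" "u \<unlhd> x" "fst x = b" using Tn_extend[OF uT(1) ab(1) b(1)] by blast
  obtain c w where c: "c \<in> PE" "c \<sqsubseteq> c0" "V c x w" using total[OF c0 PE_refl[OF c0] x(1)] by blast
  have wT: "w \<in> Tn \<beta>" using V[OF c(3)] by blast
  have "v \<unlhd> w" using emb[OF mono[OF uv(1) c(1,2)] c(3)] x(2) by blast
  then have v0w: "v0 \<unlhd> w" using tle_trans[OF uv(5)] by blast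
  have u0x: "u0 \<unlhd> x" using tle_trans[OF uv(4) x(2)] .
  obtain q where q: "q \<in> ?Q" "cp q \<sqsubseteq> c" "{sx, sy} \<subseteq> dom (snd q)" "x \<unlhd> nd sx q" "w \<unlhd> nd sy q"
    using combine[OF c(1) x(1) ab(1) wT ab(2) subset_refl] by auto
  obtain q' d where q': "q' \<in> ?Q" "q' \<sqsubseteq> q" "d \<in> Dn" "d \<in> Qb W \<delta>" "q' \<sqsubseteq> d"
    using seal[OF q(1,3) tle_trans[OF u0x q(4)] tle_trans[OF v0w q(5)]] by blast
  have ds: "sx \<in> dom (snd d)" "sy \<in> dom (snd d)" and qs: "sx \<in> dom (snd q)" "sy \<in> dom (snd q)" using q'(3) q(3) by (auto simp: Dn_def)
  have cq': "cp q' \<in> PE" "cp q' \<sqsubseteq> cp d" "cp q' \<sqsubseteq> c"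
    using cp_PE[OF q'(1)] cp_mono[OF q'(5)] stronger_trans[OF cp_mono[OF q'(2)] q(2)] by auto
  then have "cp q' \<sqsubseteq> c0" using c(2) stronger_trans by blast
  then have "\<Phi> d" using q'(3) cq' unfolding Dn_def by blast
  then obtain x0 w0 where x0: "x0 \<unlhd> nd sx d" "V (cp d) x0 w0" "\<not> w0 \<unlhd> nd sy d" "\<not> nd sy d \<unlhd> w0" unfolding \<Phi>_def by blast
  have xq': "x \<unlhd> nd sx q'" "w \<unlhd> nd sy q'"
    using tle_trans[OF q(4) nd_mono[OF q'(2) qs(1)]] tle_trans[OF q(5) nd_mono[OF q'(2) qs(2)]] by auto
  have "x0 \<unlhd> x"
  proof (rule tle_common[OF tle_trans[OF x0(1) nd_mono[OF q'(5) ds(1)]] xq'(1)])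
    have "fst x0 \<preceq> fst d" using x0(1) by (simp add: tle_def)
    then show "fst x0 \<preceq> fst x" using lt_le[OF Qb_lev[OF q'(4)]] b(2) x(3) le_trans by blast
  qed
  then have "w0 \<unlhd> w" using emb[OF mono[OF x0(2) cq'(1,2)] mono[OF c(3) cq'(1,3)]] by blast
  then have "w0 \<unlhd> nd sy q'" using tle_trans xq'(2) by blast
  then show False using tle_linear[OF _ nd_mono[OF q'(5) ds(2)]] x0(3,4) by blast
qed

end

section \<open>Forced statements\<close>

context
  fixes P :: "'p rel"
  assumes P: "Preorder P"
begin

section \<open>Regularity of the forced statements\<close>

lemma f_reg_ball: "(\<And>x. f_reg P (\<Phi> x)) \<Longrightarrow> f_reg P (f_ball P X \<Phi>)"
  unfolding f_ball_def by (intro f_regs[OF P])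

lemma f_reg_bex: "(\<And>x. f_reg P (\<Phi> x)) \<Longrightarrow> f_reg P (f_bex P X \<Phi>)"
  unfolding f_bex_def by (intro f_regs[OF P])

lemma f_reg_fun: "(\<And>x. f_reg P (A x)) \<Longrightarrow> (\<And>x. f_reg P (B x)) \<Longrightarrow> f_reg P (f_fun P F A B)"
  unfolding f_fun_def by (intro f_regs[OF P])

lemma f_reg_bij: "(\<And>x. f_reg P (A x)) \<Longrightarrow> (\<And>x. f_reg P (B x)) \<Longrightarrow> f_reg P (f_bij P F A B)"
  unfolding f_bij_def by (intro f_regs[OF P] f_reg_fun)

lemma f_reg_order_iso: "f_reg P (f_order_iso P F R T)"
  unfolding f_order_iso_def by (intro f_regs[OF P] f_reg_bij)

lemma f_reg_isomorphic: "f_reg P (f_isomorphic P R T)"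
  unfolding f_isomorphic_def by (intro f_regs[OF P] f_reg_order_iso)

lemma f_reg_rigid: "f_reg P (f_rigid P T)"
  unfolding f_rigid_def by (intro f_regs[OF P] f_reg_order_iso)

lemma f_reg_branch: "f_reg P (f_branch P T B)"
  unfolding f_branch_def by (intro f_regs[OF P] f_reg_ball)

lemma f_reg_antichain: "f_reg P (f_antichain P T B)"
  unfolding f_antichain_def by (intro f_regs[OF P] f_reg_ball)

lemma f_reg_wf: "f_reg P (f_wf P R)"
  unfolding f_wf_def by (intro f_regs[OF P])

lemma f_reg_souslin_tree: "f_reg P (f_souslin_tree P r T)"
  unfolding f_souslin_tree_def f_tree_def f_has_height_def
  by (intro f_regs[OF P] f_reg_ball f_reg_bex f_reg_isomorphic f_reg_branch f_reg_antichain f_reg_bij f_reg_wf)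

lemma f_reg_iff: "f_reg P \<phi> \<Longrightarrow> f_reg P \<psi> \<Longrightarrow> f_reg P (f_iff P \<phi> \<psi>)"
  unfolding f_iff_def by (intro f_regs[OF P])

lemma P_under: "(q, p) \<in> P \<Longrightarrow> q \<in> Field P"
  using P_Field(1)[OF P] .

section \<open>Introduction and elimination rules for the forcing relation\<close>

lemma f_exI:
  assumes "f_reg P (\<Phi> x)" "p \<in> \<Phi> x"
  shows "p \<in> f_ex P \<Phi>"
proof -
  have p: "p \<in> Field P" using assms by (auto simp: f_reg_def)
  have "q \<in> \<Phi> x" if "(q, p) \<in> P" for q using f_reg_down[OF P assms that] .
  then show ?thesis unfolding in_f_ex[OF P p] using P_refl[OF P P_under] by blast
qed

lemma f_exD:
  assumes "p \<in> f_ex P \<Phi>" shows "\<exists>t x. (t, p) \<in> P \<and> t \<in> \<Phi> x"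
proof -
  have p: "p \<in> Field P" using assms by (auto simp: f_ex_def f_not_def)
  show ?thesis using assms P_refl[OF P p] unfolding in_f_ex[OF P p] by blast
qed

lemma f_impE: "p \<in> f_imp P \<phi> \<psi> \<Longrightarrow> f_reg P \<phi> \<Longrightarrow> f_reg P \<psi> \<Longrightarrow> (q, p) \<in> P \<Longrightarrow> q \<in> \<phi> \<Longrightarrow> q \<in> \<psi>"
  using in_f_imp[OF P, of \<phi> \<psi> p] P_Field(2)[OF P, of q p] by blast

lemma f_impI: "p \<in> Field P \<Longrightarrow> f_reg P \<phi> \<Longrightarrow> f_reg P \<psi> \<Longrightarrow> (\<And>q. (q, p) \<in> P \<Longrightarrow> q \<in> \<phi> \<Longrightarrow> q \<in> \<psi>) \<Longrightarrow> p \<in> f_imp P \<phi> \<psi>"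
  using in_f_imp[OF P, of \<phi> \<psi> p] by blast

lemma f_allE: "p \<in> f_all P \<Phi> \<Longrightarrow> p \<in> \<Phi> x"
  by (simp add: f_all_def)

lemma f_allI: "p \<in> Field P \<Longrightarrow> (\<And>x. p \<in> \<Phi> x) \<Longrightarrow> p \<in> f_all P \<Phi>"
  by (simp add: f_all_def)

lemma f_ballI: "p \<in> Field P \<Longrightarrow> (\<And>x. f_reg P (\<Phi> x)) \<Longrightarrow> (\<And>x. x \<in> X \<Longrightarrow> p \<in> \<Phi> x) \<Longrightarrow> p \<in> f_ball P X \<Phi>"
  using in_f_ball[OF P] by blast

lemma groundI: "p \<in> Field P \<Longrightarrow> b \<Longrightarrow> p \<in> ground P b"
  and groundE: "p \<in> ground P b \<Longrightarrow> b"
  by (simp_all add: ground_def)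

lemma f_in_down: "t \<in> f_in P x A \<Longrightarrow> (u, t) \<in> P \<Longrightarrow> u \<in> f_in P x A"
  using f_reg_down[OF P f_reg_in[OF P]] .

lemma f_funE:
  assumes q: "q \<in> f_fun P F A B" and AB: "\<And>x. f_reg P (A x)" "\<And>x. f_reg P (B x)"
  shows "(t, q) \<in> P \<Longrightarrow> t \<in> f_in P (x, y) F \<Longrightarrow> t \<in> A x \<and> t \<in> B y"
    and "(t, q) \<in> P \<Longrightarrow> t \<in> A x \<Longrightarrow> \<exists>u y. (u, t) \<in> P \<and> u \<in> f_in P (x, y) F"
    and "(t, q) \<in> P \<Longrightarrow> t \<in> f_in P (x, y) F \<Longrightarrow> t \<in> f_in P (x, y') F \<Longrightarrow> y = y'"
proof -
  note q' = q[unfolded f_fun_def in_f_and[OF P]]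
  show "t \<in> A x \<and> t \<in> B y" if "(t, q) \<in> P" "t \<in> f_in P (x, y) F"
    using f_impE[OF f_allE[OF f_allE[OF conjunct1[OF q']]] _ _ that] AB by (simp add: in_f_and[OF P] f_regs[OF P])
  show "\<exists>u y. (u, t) \<in> P \<and> u \<in> f_in P (x, y) F" if "(t, q) \<in> P" "t \<in> A x"
  proof -
    have "t \<in> f_ex P (\<lambda>y. f_in P (x, y) F)"
      by (rule f_impE[OF f_allE[OF conjunct1[OF conjunct2[OF q']]] _ _ that]) (intro f_regs[OF P] AB)+
    then show ?thesis by (rule f_exD)
  qed
  show "y = y'" if "(t, q) \<in> P" "t \<in> f_in P (x, y) F" "t \<in> f_in P (x, y') F"
  proof -
    have "t \<in> ground P (y = y')"
      by (rule f_impE[OF f_allE[OF f_allE[OF f_allE[OF conjunct2[OF conjunct2[OF q']]]]] _ _ that(1)])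
        (use that in \<open>simp_all add: in_f_and[OF P] f_regs[OF P]\<close>)
    then show ?thesis by (rule groundE)
  qed
qed

lemma f_bijE:
  assumes q: "q \<in> f_bij P F A B" and AB: "\<And>x. f_reg P (A x)" "\<And>x. f_reg P (B x)"
  shows "q \<in> f_fun P F A B"
    and "(t, q) \<in> P \<Longrightarrow> t \<in> f_in P (x, y) F \<Longrightarrow> t \<in> f_in P (x', y) F \<Longrightarrow> x = x'"
    and "(t, q) \<in> P \<Longrightarrow> t \<in> B y \<Longrightarrow> \<exists>u x. (u, t) \<in> P \<and> u \<in> f_in P (x, y) F"
proof -
  note q' = q[unfolded f_bij_def in_f_and[OF P]]
  show "q \<in> f_fun P F A B" using q' by blast
  show "x = x'" if "(t, q) \<in> P" "t \<in> f_in P (x, y) F" "t \<in> f_in P (x', y) F"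
  proof -
    have "t \<in> ground P (x = x')"
      by (rule f_impE[OF f_allE[OF f_allE[OF f_allE[OF conjunct1[OF conjunct2[OF q']]]]] _ _ that(1)])
        (use that in \<open>simp_all add: in_f_and[OF P] f_regs[OF P]\<close>)
    then show ?thesis by (rule groundE)
  qed
  show "\<exists>u x. (u, t) \<in> P \<and> u \<in> f_in P (x, y) F" if "(t, q) \<in> P" "t \<in> B y"
  proof -
    have "t \<in> f_ex P (\<lambda>x. f_in P (x, y) F)"
      by (rule f_impE[OF f_allE[OF conjunct2[OF conjunct2[OF q']]] _ _ that]) (intro f_regs[OF P] AB)+
    then show ?thesis by (rule f_exD)
  qed
qed

lemma f_order_isoE:
  assumes q: "q \<in> f_order_iso P F R T"
  shows "(t, q) \<in> P \<Longrightarrow> t \<in> f_in P (x, y) F \<Longrightarrow> x \<in> Field R \<and> y \<in> Field T"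
    and "(t, q) \<in> P \<Longrightarrow> x \<in> Field R \<Longrightarrow> \<exists>u y. (u, t) \<in> P \<and> u \<in> f_in P (x, y) F"
    and "(t, q) \<in> P \<Longrightarrow> y \<in> Field T \<Longrightarrow> \<exists>u x. (u, t) \<in> P \<and> u \<in> f_in P (x, y) F"
    and "(t, q) \<in> P \<Longrightarrow> t \<in> f_in P (x, y) F \<Longrightarrow> t \<in> f_in P (x', y') F \<Longrightarrow> (x, x') \<in> R \<longleftrightarrow> (y, y') \<in> T"
proof -
  note q' = q[unfolded f_order_iso_def in_f_and[OF P]]
  note b = f_bijE[OF conjunct1[OF q'] f_reg_ground[OF P] f_reg_ground[OF P]]
  note f = f_funE[OF b(1) f_reg_ground[OF P] f_reg_ground[OF P]]
  show "(t, q) \<in> P \<Longrightarrow> t \<in> f_in P (x, y) F \<Longrightarrow> x \<in> Field R \<and> y \<in> Field T" using f(1) groundE by blast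
  show "(t, q) \<in> P \<Longrightarrow> x \<in> Field R \<Longrightarrow> \<exists>u y. (u, t) \<in> P \<and> u \<in> f_in P (x, y) F" using f(2) groundI P_under by blast
  show "(t, q) \<in> P \<Longrightarrow> y \<in> Field T \<Longrightarrow> \<exists>u x. (u, t) \<in> P \<and> u \<in> f_in P (x, y) F" using b(3) groundI P_under by blast
  show "(x, x') \<in> R \<longleftrightarrow> (y, y') \<in> T" if "(t, q) \<in> P" "t \<in> f_in P (x, y) F" "t \<in> f_in P (x', y') F"
  proof -
    have "t \<in> ground P ((x, x') \<in> R \<longleftrightarrow> (y, y') \<in> T)"
      by (rule f_impE[OF f_allE[OF f_allE[OF f_allE[OF f_allE[OF conjunct2[OF q']]]]] _ _ that(1)])
        (use that in \<open>simp_all add: in_f_and[OF P] f_regs[OF P]\<close>)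
    then show ?thesis by (rule groundE)
  qed
qed

text \<open>For each \<open>z\<close> the name lists the conditions at which \<open>V\<close> holds.
  Forced membership then means that \<open>V\<close> holds densely below, and so the converse
  provides only an extension.\<close>

lemma f_in_name:
  assumes mono: "\<And>t u z. V t z \<Longrightarrow> (u, t) \<in> P \<Longrightarrow> V u z" and F: "\<And>t z. V t z \<Longrightarrow> t \<in> Field P"
  shows "V t z \<Longrightarrow> t \<in> f_in P z {(z, t). V t z}"
    and "t \<in> f_in P z {(z, t). V t z} \<Longrightarrow> \<exists>u. (u, t) \<in> P \<and> V u z"
proof -
  show "t \<in> f_in P z {(z, t). V t z}" if V: "V t z"
    unfolding f_in_def under_def using F[OF V] mono[OF V] P_refl[OF P P_under] by blast
  show "\<exists>u. (u, t) \<in> P \<and> V u z" if t: "t \<in> f_in P z {(z, t). V t z}"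
  proof -
    have "t \<in> Field P" "\<forall>q\<in>under P t. \<exists>u\<in>under P q. \<exists>s. V s z \<and> (u, s) \<in> P" using t by (auto simp: f_in_def)
    moreover then have "t \<in> under P t" using P_refl[OF P] by (simp add: under_def)
    ultimately obtain u s where "u \<in> under P t" "V s z" "(u, s) \<in> P" by blast
    then show ?thesis using mono by (auto simp: under_def)
  qed
qed

lemma f_order_isoI:
  assumes q: "q \<in> Field P"
    and mono: "\<And>t u x y. V t x y \<Longrightarrow> (u, t) \<in> P \<Longrightarrow> V u x y"
    and V: "\<And>t x y. V t x y \<Longrightarrow> t \<in> Field P \<and> x \<in> Field R \<and> y \<in> Field T"
    and total: "\<And>t x. t \<in> Field P \<Longrightarrow> x \<in> Field R \<Longrightarrow> \<exists>u y. (u, t) \<in> P \<and> V u x y"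
    and surj: "\<And>t y. t \<in> Field P \<Longrightarrow> y \<in> Field T \<Longrightarrow> \<exists>u x. (u, t) \<in> P \<and> V u x y"
    and fn: "\<And>t x y y'. V t x y \<Longrightarrow> V t x y' \<Longrightarrow> y = y'" and inj: "\<And>t x x' y. V t x y \<Longrightarrow> V t x' y \<Longrightarrow> x = x'"
    and ord: "\<And>t x y x' y'. V t x y \<Longrightarrow> V t x' y' \<Longrightarrow> (x, x') \<in> R \<longleftrightarrow> (y, y') \<in> T"
  shows "q \<in> f_order_iso P {(z, t). V t (fst z) (snd z)} R T"
proof -
  let ?F = "{(z, t). V t (fst z) (snd z)}"
  have i1: "t \<in> f_in P (x, y) ?F" if "V t x y" for t x y
    using f_in_name(1)[of "\<lambda>t z. V t (fst z) (snd z)" t "(x, y)"] mono V that by auto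
  have i2: "\<exists>u. (u, t) \<in> P \<and> V u x y" if "t \<in> f_in P (x, y) ?F" for t x y
    using f_in_name(2)[of "\<lambda>t z. V t (fst z) (snd z)" t "(x, y)"] mono V that by auto
  \<comment> \<open>Two forced memberships become instances of \<open>V\<close> at one common
    extension. This suffices for conclusions about ground model objects, in which the condition no
    longer occurs.\<close>
  have i3: "\<exists>u. (u, t) \<in> P \<and> V u x y \<and> V u x' y'" if t: "t \<in> f_in P (x, y) ?F" "t \<in> f_in P (x', y') ?F" for t x y x' y'
  proof -
    obtain u where u: "(u, t) \<in> P" "V u x y" using i2[OF t(1)] by blast
    obtain v where v: "(v, u) \<in> P" "V v x' y'" using i2[OF f_in_down[OF t(2) u(1)]] by blast
    then show ?thesis using mono[OF u(2) v(1)] P_trans[OF P v(1) u(1)] by blast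
  qed
  have ex: "t \<in> f_ex P \<Phi>" if "t \<in> Field P" "\<And>u. (u, t) \<in> P \<Longrightarrow> \<exists>v x. (v, u) \<in> P \<and> v \<in> \<Phi> x" for t and \<Phi> :: "'z \<Rightarrow> 'p set"
    unfolding in_f_ex[OF P that(1)] using that(2) by blast
  show ?thesis
    unfolding f_order_iso_def f_bij_def f_fun_def in_f_and[OF P]
  proof (intro conjI f_allI[OF q] f_impI[OF q] f_regs[OF P])
    fix x y t assume "(t, q) \<in> P" "t \<in> f_in P (x, y) ?F"
    then show "t \<in> (ground P (x \<in> Field R) \<^bold>\<and> ground P (y \<in> Field T))"
      unfolding in_f_and[OF P] using i2 V groundI P_under by blast
  next
    fix x t assume t: "(t, q) \<in> P" "t \<in> ground P (x \<in> Field R)"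
    show "t \<in> f_ex P (\<lambda>y. f_in P (x, y) ?F)"
    proof (rule ex[OF P_under[OF t(1)]])
      fix u assume "(u, t) \<in> P"
      from total[OF P_under[OF this] groundE[OF t(2)]] obtain v y where "(v, u) \<in> P" "V v x y" by blast
      then show "\<exists>v y. (v, u) \<in> P \<and> v \<in> f_in P (x, y) ?F" using i1 by blast
    qed
  next
    fix x y y' t assume t: "(t, q) \<in> P" "t \<in> (f_in P (x, y) ?F \<^bold>\<and> f_in P (x, y') ?F)"
    from i3[OF conjunct1[OF t(2)[unfolded in_f_and[OF P]]] conjunct2[OF t(2)[unfolded in_f_and[OF P]]]]
    have "y = y'" using fn by blast
    then show "t \<in> ground P (y = y')" by (rule groundI[OF P_under[OF t(1)]])
  next
    fix x x' y t assume t: "(t, q) \<in> P" "t \<in> (f_in P (x, y) ?F \<^bold>\<and> f_in P (x', y) ?F)"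
    from i3[OF conjunct1[OF t(2)[unfolded in_f_and[OF P]]] conjunct2[OF t(2)[unfolded in_f_and[OF P]]]]
    have "x = x'" using inj by blast
    then show "t \<in> ground P (x = x')" by (rule groundI[OF P_under[OF t(1)]])
  next
    fix y t assume t: "(t, q) \<in> P" "t \<in> ground P (y \<in> Field T)"
    show "t \<in> f_ex P (\<lambda>x. f_in P (x, y) ?F)"
    proof (rule ex[OF P_under[OF t(1)]])
      fix u assume "(u, t) \<in> P"
      from surj[OF P_under[OF this] groundE[OF t(2)]] obtain v x where "(v, u) \<in> P" "V v x y" by blast
      then show "\<exists>v x. (v, u) \<in> P \<and> v \<in> f_in P (x, y) ?F" using i1 by blast
    qed
  next
    fix x y x' y' t assume t: "(t, q) \<in> P" "t \<in> (f_in P (x, x') ?F \<^bold>\<and> f_in P (y, y') ?F)"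
    from i3[OF conjunct1[OF t(2)[unfolded in_f_and[OF P]]] conjunct2[OF t(2)[unfolded in_f_and[OF P]]]]
    have "(x, y) \<in> R \<longleftrightarrow> (x', y') \<in> T" using ord by blast
    then show "t \<in> ground P ((x, y) \<in> R \<longleftrightarrow> (x', y') \<in> T)" by (rule groundI[OF P_under[OF t(1)]])
  qed
qed

section \<open>Absoluteness for orders and trees of the ground model\<close>

lemma f_isomorphic_ground:
  assumes "isomorphic R T" "p \<in> Field P"
  shows "p \<in> f_isomorphic P R T"
proof -
  obtain f where f: "bij_betw f (Field R) (Field T)" "\<And>x y. x \<in> Field R \<Longrightarrow> y \<in> Field R \<Longrightarrow> (x, y) \<in> R \<longleftrightarrow> (f x, f y) \<in> T"
    using assms(1) by (auto simp: isomorphic_def order_iso_def)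
  have "p \<in> f_order_iso P {(z, t). t \<in> Field P \<and> fst z \<in> Field R \<and> snd z = f (fst z)} R T"
  proof (rule f_order_isoI[OF assms(2), where V = "\<lambda>t x y. t \<in> Field P \<and> x \<in> Field R \<and> y = f x"])
    show "\<exists>u x. (u, t) \<in> P \<and> u \<in> Field P \<and> x \<in> Field R \<and> y = f x" if "t \<in> Field P" "y \<in> Field T" for t y
      using that f(1) P_refl[OF P] unfolding bij_betw_def by blast
    show "x = x'" if "t \<in> Field P \<and> x \<in> Field R \<and> y = f x" "t \<in> Field P \<and> x' \<in> Field R \<and> y = f x'" for t x x' y
      using that f(1) unfolding bij_betw_def inj_on_def by blast
  qed (use f P_refl[OF P] P_under in \<open>auto simp: bij_betw_def\<close>)
  then show ?thesis
    unfolding f_isomorphic_def by (rule f_exI[where \<Phi> = "\<lambda>F. f_order_iso P F R T", rotated]) (rule f_reg_order_iso)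
qed

lemma f_has_height_ground:
  assumes "has_height T r" "p \<in> Field P"
  shows "p \<in> f_has_height P T r"
  unfolding f_has_height_def in_f_and[OF P]
proof (intro conjI f_ballI[OF assms(2)] f_reg_bex f_reg_isomorphic)
  fix x assume "x \<in> Field T"
  then obtain \<alpha> where "\<alpha> \<in> Field r" "isomorphic (seg T x) (seg r \<alpha>)" using assms(1) by (auto simp: has_height_def)
  then show "p \<in> f_bex P (Field r) (\<lambda>\<alpha>. f_isomorphic P (seg T x) (seg r \<alpha>))"
    unfolding f_bex_def using f_isomorphic_ground[OF _ assms(2)] groundI[OF assms(2)]
    by (intro f_exI[where x = \<alpha>] f_regs[OF P] f_reg_isomorphic) (auto simp: in_f_and[OF P])
next
  fix \<alpha> assume "\<alpha> \<in> Field r"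
  then obtain x where "x \<in> Field T" "isomorphic (seg T x) (seg r \<alpha>)" using assms(1) by (auto simp: has_height_def)
  then show "p \<in> f_bex P (Field T) (\<lambda>x. f_isomorphic P (seg T x) (seg r \<alpha>))"
    unfolding f_bex_def using f_isomorphic_ground[OF _ assms(2)] groundI[OF assms(2)]
    by (intro f_exI[where x = x] f_regs[OF P] f_reg_isomorphic) (auto simp: in_f_and[OF P])
qed

lemma f_wf_ground:
  fixes R :: "'x rel"
  assumes R: "wf R" and p: "p \<in> Field P"
  shows "p \<in> f_wf P R"
  unfolding f_wf_def
proof (intro f_allI[OF p] f_impI[OF p] f_regs[OF P])
  fix A :: "('x, 'p) name" and q assume q: "(q, p) \<in> P" "q \<in> f_ex P (\<lambda>x. f_in P x A)"
  let ?\<Phi> = "\<lambda>x. f_in P x A \<^bold>\<and> f_all P (\<lambda>y. f_imp P (ground P ((y, x) \<in> R)) (f_not P (f_in P y A)))"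
  have "\<exists>u x. (u, t) \<in> P \<and> u \<in> ?\<Phi> x" if t: "(t, q) \<in> P" for t
  proof -
    define X where "X = {x. \<exists>u. (u, t) \<in> P \<and> u \<in> f_in P x A}"
    have "t \<in> f_ex P (\<lambda>x. f_in P x A)" by (rule f_reg_down[OF P _ q(2) t]) (intro f_regs[OF P])
    then have "X \<noteq> {}" unfolding X_def using f_exD by blast
    then obtain x where x: "x \<in> X" "\<And>y. (y, x) \<in> R \<Longrightarrow> y \<notin> X" using wfE_min[OF R] by (metis ex_in_conv)
    then obtain u where u: "(u, t) \<in> P" "u \<in> f_in P x A" by (auto simp: X_def)
    have uF: "u \<in> Field P" using P_under[OF u(1)] .
    have "u \<in> f_all P (\<lambda>y. f_imp P (ground P ((y, x) \<in> R)) (f_not P (f_in P y A)))"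
    proof (intro f_allI[OF uF] f_impI[OF uF] f_regs[OF P])
      fix y v assume v: "(v, u) \<in> P" "v \<in> ground P ((y, x) \<in> R)"
      have "y \<notin> X" using x(2) groundE[OF v(2)] by blast
      then have "w \<notin> f_in P y A" if "(w, v) \<in> P" for w
        using P_trans[OF P that P_trans[OF P v(1) u(1)]] by (auto simp: X_def)
      then show "v \<in> f_not P (f_in P y A)" unfolding in_f_not[OF P P_under[OF v(1)]] by blast
    qed
    then show ?thesis using u by (auto simp: in_f_and[OF P])
  qed
  then show "q \<in> f_ex P ?\<Phi>" unfolding in_f_ex[OF P P_under[OF q(1)]] by blast
qed

lemma f_tree_ground:
  assumes T: "tree T" and p: "p \<in> Field P"
  shows "p \<in> f_tree P T"
  unfolding f_tree_def in_f_and[OF P]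
proof (intro conjI groundI[OF p] f_ballI[OF p] f_regs[OF P] f_reg_wf)
  show "Partial_order T" using T by (simp add: tree_def)
  fix x assume "x \<in> Field T"
  then have wo: "Well_order (seg T x)" using T by (simp add: tree_def)
  have "Linear_order (seg T x)" "wf (seg T x - Id)" using wo by (simp_all add: well_order_on_def)
  then show "p \<in> (ground P (Linear_order (seg T x)) \<^bold>\<and> f_wf P (seg T x - Id))"
    using groundI[OF p] f_wf_ground[OF _ p] by (simp add: in_f_and[OF P])
qed

lemma f_not_ex2I:
  assumes "\<And>u A G. u \<in> Field P \<Longrightarrow> u \<notin> \<Phi> A G" "p \<in> Field P"
  shows "p \<in> f_not P (f_ex P (\<lambda>A. f_ex P (\<lambda>G. \<Phi> A G)))"
proof -
  have "q \<notin> f_ex P (\<lambda>A. f_ex P (\<lambda>G. \<Phi> A G))" for q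
  proof
    assume "q \<in> f_ex P (\<lambda>A. f_ex P (\<lambda>G. \<Phi> A G))"
    then obtain t A where "t \<in> f_ex P (\<lambda>G. \<Phi> A G)" using f_exD by blast
    then obtain u G where "(u, t) \<in> P" "u \<in> \<Phi> A G" using f_exD by blast
    then show False using assms(1) P_under by blast
  qed
  then show ?thesis unfolding in_f_not[OF P assms(2)] by blast
qed

end

section \<open>Realizing an equivalence relation\<close>

context coded_diamond
begin

text \<open>The order is transported along a labelling \<open>e\<close> of the nodes, so that all
  trees can live on a prescribed type.\<close>

definition Tr :: "('o \<times> ('o \<Rightarrow> bit) \<Rightarrow> 'x) \<Rightarrow> 'o \<Rightarrow> 'x rel" where
  "Tr e \<alpha> = {(e u, e v) |u v. u \<in> Tn \<alpha> \<and> v \<in> Tn \<alpha> \<and> u \<unlhd> v}"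

lemma Tr_iff: "inj_on e (Tn \<alpha>) \<Longrightarrow> u \<in> Tn \<alpha> \<Longrightarrow> v \<in> Tn \<alpha> \<Longrightarrow> (e u, e v) \<in> Tr e \<alpha> \<longleftrightarrow> u \<unlhd> v"
  unfolding Tr_def inj_on_def by blast

lemma Field_Tr: "Field (Tr e \<alpha>) = e ` Tn \<alpha>"
proof
  show "Field (Tr e \<alpha>) \<subseteq> e ` Tn \<alpha>" by (auto simp: Tr_def Field_def)
  show "e ` Tn \<alpha> \<subseteq> Field (Tr e \<alpha>)"
  proof
    fix x assume "x \<in> e ` Tn \<alpha>"
    then have "(x, x) \<in> Tr e \<alpha>" using tle_refl unfolding Tr_def by blast
    then show "x \<in> Field (Tr e \<alpha>)" by (rule FieldI1)
  qed
qed

lemma few_nodes_below: "|{z \<in> Tn \<alpha>. fst z \<prec> \<delta>}| \<le>o \<kappa>"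
proof -
  have "|W \<gamma>| \<le>o \<kappa>" if "\<gamma> \<prec> \<delta>" for \<gamma> using gd_all[OF lt_Ord(1)[OF that]] by (simp add: good_def)
  then have "|underS K \<delta> \<times> (\<Union>\<gamma>\<in>underS K \<delta>. snd ` W \<gamma>)| \<le>o \<kappa>" by (intro few_Times few_UN few_image small)
  moreover have "{z \<in> Tn \<alpha>. fst z \<prec> \<delta>} \<subseteq> underS K \<delta> \<times> (\<Union>\<gamma>\<in>underS K \<delta>. snd ` W \<gamma>)"
  proof
    fix z assume z: "z \<in> {z \<in> Tn \<alpha>. fst z \<prec> \<delta>}"
    then have "snd z \<in> snd ` W (fst z)" using TnD(2)[of z \<alpha>] by force
    then show "z \<in> underS K \<delta> \<times> (\<Union>\<gamma>\<in>underS K \<delta>. snd ` W \<gamma>)" using z by (cases z) auto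
  qed
  ultimately show ?thesis by (rule few_subset[rotated])
qed

context
  fixes e :: "'o \<times> ('o \<Rightarrow> bit) \<Rightarrow> 'x" and \<alpha> :: 'o
  assumes e: "inj_on e (Tn \<alpha>)" and \<alpha>: "\<alpha> \<in> Ord"
begin

lemma TrE:
  assumes "(x, y) \<in> Tr e \<alpha>" obtains u v where "x = e u" "y = e v" "u \<in> Tn \<alpha>" "v \<in> Tn \<alpha>" "u \<unlhd> v"
  using assms by (auto simp: Tr_def)

lemma order_Tr: "trans (Tr e \<alpha>)" "antisym (Tr e \<alpha>)" "Refl (Tr e \<alpha>)"
proof -
  show "trans (Tr e \<alpha>)"
  proof (rule transI)
    fix x y z assume "(x, y) \<in> Tr e \<alpha>" "(y, z) \<in> Tr e \<alpha>"
    then obtain u v v' w where *: "x = e u" "y = e v" "u \<in> Tn \<alpha>" "v \<in> Tn \<alpha>" "u \<unlhd> v" "y = e v'" "z = e w" "v' \<in> Tn \<alpha>" "w \<in> Tn \<alpha>" "v' \<unlhd> w"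
      by (elim TrE) blast
    then have "v = v'" using inj_onD[OF e] by metis
    then have "u \<unlhd> w" using * tle_trans by blast
    then show "(x, z) \<in> Tr e \<alpha>" using *(1,3,7,9) unfolding Tr_def by blast
  qed
  show "antisym (Tr e \<alpha>)"
  proof (rule antisymI)
    fix x y assume "(x, y) \<in> Tr e \<alpha>" and yx: "(y, x) \<in> Tr e \<alpha>"
    then obtain u v where *: "x = e u" "y = e v" "u \<in> Tn \<alpha>" "v \<in> Tn \<alpha>" "u \<unlhd> v" by (elim TrE) blast
    moreover have "v \<unlhd> u" using yx Tr_iff[OF e] * by blast
    ultimately show "x = y" using tle_antisym by blast
  qed
  show "Refl (Tr e \<alpha>)" unfolding refl_on_def Field_Tr using Tr_iff[OF e] tle_refl by auto
qed

lemma Partial_order_Tr: "Partial_order (Tr e \<alpha>)"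
  using order_Tr unfolding partial_order_on_def preorder_on_def by (auto simp: Field_def)

lemma wf_Tr: "wf (Tr e \<alpha> - Id)"
proof -
  have "wf (K - Id)" using K by (simp add: order_on_defs)
  then have "wf (inv_image (K - Id) (\<lambda>x. fst (inv_into (Tn \<alpha>) e x)))" by (rule wf_inv_image)
  moreover have "Tr e \<alpha> - Id \<subseteq> inv_image (K - Id) (\<lambda>x. fst (inv_into (Tn \<alpha>) e x))"
  proof
    fix z assume "z \<in> Tr e \<alpha> - Id"
    then obtain x y where xy: "z = (x, y)" "(x, y) \<in> Tr e \<alpha>" "x \<noteq> y" by (cases z) auto
    obtain u v where *: "x = e u" "y = e v" "u \<in> Tn \<alpha>" "v \<in> Tn \<alpha>" "u \<unlhd> v" using xy(2) by (rule TrE)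
    then have "fst u \<noteq> fst v" using tle_eq_lev[of u \<alpha> v \<alpha>] xy(3) by blast
    then show "z \<in> inv_image (K - Id) (\<lambda>x. fst (inv_into (Tn \<alpha>) e x))"
      using * xy(1) by (simp add: inv_into_f_f[OF e] tle_def)
  qed
  ultimately show ?thesis by (rule wf_subset)
qed

lemma underS_Tr: "v \<in> Tn \<alpha> \<Longrightarrow> underS (Tr e \<alpha>) (e v) = e ` {u \<in> Tn \<alpha>. u \<unlhd> v \<and> u \<noteq> v}"
  unfolding underS_def using Tr_iff[OF e] e unfolding Tr_def inj_on_def by blast

lemma Field_seg_Tr: "Field (seg (Tr e \<alpha>) x) = underS (Tr e \<alpha>) x"
proof
  show "Field (seg (Tr e \<alpha>) x) \<subseteq> underS (Tr e \<alpha>) x" by (auto simp: seg_def Field_def)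
  show "underS (Tr e \<alpha>) x \<subseteq> Field (seg (Tr e \<alpha>) x)"
  proof
    fix y assume y: "y \<in> underS (Tr e \<alpha>) x"
    then have "(y, y) \<in> Tr e \<alpha>" using order_Tr(3) underS_subset_Field[of "Tr e \<alpha>" x] by (auto simp: refl_on_def)
    then have "(y, y) \<in> seg (Tr e \<alpha>) x" using y by (simp add: seg_def)
    then show "y \<in> Field (seg (Tr e \<alpha>) x)" by (rule FieldI1)
  qed
qed

lemma tree_Tr: "tree (Tr e \<alpha>)"
  unfolding tree_def
proof (intro conjI ballI Partial_order_Tr)
  fix x assume "x \<in> Field (Tr e \<alpha>)"
  then obtain v where v: "v \<in> Tn \<alpha>" "x = e v" by (auto simp: Field_Tr)
  let ?R = "seg (Tr e \<alpha>) x"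
  have "Refl ?R" unfolding refl_on_def Field_seg_Tr
    using order_Tr(3) underS_subset_Field[of "Tr e \<alpha>" x] by (auto simp: refl_on_def seg_def)
  moreover have "trans ?R" using order_Tr(1) unfolding seg_def trans_def by blast
  moreover have "antisym ?R" using order_Tr(2) unfolding seg_def antisym_def by blast
  moreover have "Total ?R"
    unfolding total_on_def Field_seg_Tr
  proof (intro ballI impI)
    fix y z assume yz: "y \<in> underS (Tr e \<alpha>) x" "z \<in> underS (Tr e \<alpha>) x"
    then obtain u w where u: "y = e u" "u \<in> Tn \<alpha>" "u \<unlhd> v" and w: "z = e w" "w \<in> Tn \<alpha>" "w \<unlhd> v"
      unfolding v(2) underS_Tr[OF v(1)] by blast
    then have "(y, z) \<in> Tr e \<alpha> \<or> (z, y) \<in> Tr e \<alpha>" using Tr_iff[OF e] tle_linear by blast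
    then show "(y, z) \<in> ?R \<or> (z, y) \<in> ?R" using yz by (simp add: seg_def)
  qed
  moreover have "wf (?R - Id)" by (rule wf_subset[OF wf_Tr]) (auto simp: seg_def)
  moreover have "?R \<subseteq> Field ?R \<times> Field ?R" by (auto simp: Field_def)
  ultimately show "Well_order ?R" by (simp add: order_on_defs)
qed

text \<open>The predecessors of \<open>v\<close> are its truncations, exactly one on each lower
  level, so taking the level is the isomorphism.\<close>

lemma seg_Tr_isomorphic:
  assumes v: "v \<in> Tn \<alpha>" shows "isomorphic (seg (Tr e \<alpha>) (e v)) (seg K (fst v))"
  unfolding isomorphic_def order_iso_def
proof (intro exI[of _ "\<lambda>x. fst (inv_into (Tn \<alpha>) e x)"] conjI ballI)
  let ?f = "\<lambda>x. fst (inv_into (Tn \<alpha>) e x)"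
  let ?U = "{u \<in> Tn \<alpha>. u \<unlhd> v \<and> u \<noteq> v}"
  have f: "?f (e u) = fst u" if "u \<in> Tn \<alpha>" for u using inv_into_f_f[OF e that] by simp
  have lt: "fst u \<prec> fst v" if "u \<in> ?U" for u
    using that tle_eq_lev[of u \<alpha> v \<alpha>] v by (auto simp: tle_def underS_def)
  have fld: "Field (seg (Tr e \<alpha>) (e v)) = e ` ?U" unfolding Field_seg_Tr underS_Tr[OF v] ..
  show "bij_betw ?f (Field (seg (Tr e \<alpha>) (e v))) (Field (seg K (fst v)))"
    unfolding fld Field_seg[OF K] bij_betw_def
  proof
    show "inj_on ?f (e ` ?U)"
    proof (rule inj_onI)
      fix x y assume "x \<in> e ` ?U" "y \<in> e ` ?U" and eq: "?f x = ?f y"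
      then obtain u w where u: "x = e u" "u \<in> Tn \<alpha>" "u \<unlhd> v" and w: "y = e w" "w \<in> Tn \<alpha>" "w \<unlhd> v" by blast
      then have "fst u = fst w" using eq f by simp
      then have "u \<unlhd> w" using tle_common[OF u(3) w(3)] le_refl TnD(1)[OF u(2)] by simp
      then show "x = y" using tle_eq_lev[OF u(2) w(2)] \<open>fst u = fst w\<close> u w by blast
    qed
    show "?f ` (e ` ?U) = underS K (fst v)"
    proof
      show "?f ` (e ` ?U) \<subseteq> underS K (fst v)" using f lt by auto
      show "underS K (fst v) \<subseteq> ?f ` (e ` ?U)"
      proof
        fix \<gamma> assume \<gamma>: "\<gamma> \<prec> fst v"
        let ?u = "(\<gamma>, rs \<gamma> (snd v))"
        have u: "?u \<in> Tn \<alpha>" "?u \<unlhd> v" using Tn_restrict[OF v lt_le[OF \<gamma>]] by auto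
        have "?u \<noteq> v" using \<gamma> lt_irrefl[of "fst v"] by (metis fst_conv)
        then have "e ?u \<in> e ` ?U" using u by blast
        moreover have "\<gamma> = ?f (e ?u)" using f[OF u(1)] by simp
        ultimately show "\<gamma> \<in> ?f ` (e ` ?U)" by (rule rev_image_eqI)
      qed
    qed
  qed
  fix x y assume xy: "x \<in> Field (seg (Tr e \<alpha>) (e v))" "y \<in> Field (seg (Tr e \<alpha>) (e v))"
  then obtain u w where u: "x = e u" "u \<in> ?U" and w: "y = e w" "w \<in> ?U" unfolding fld by blast
  have "x \<in> underS (Tr e \<alpha>) (e v)" "y \<in> underS (Tr e \<alpha>) (e v)" using xy by (simp_all add: Field_seg_Tr)
  then have "(x, y) \<in> seg (Tr e \<alpha>) (e v) \<longleftrightarrow> u \<unlhd> w"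
    using Tr_iff[OF e, of u w] u w by (simp add: seg_def)
  also have "\<dots> \<longleftrightarrow> fst u \<preceq> fst w"
  proof
    show "u \<unlhd> w \<Longrightarrow> fst u \<preceq> fst w" by (simp add: tle_def)
    show "fst u \<preceq> fst w \<Longrightarrow> u \<unlhd> w" using tle_common[of u v w] u(2) w(2) by simp
  qed
  also have "\<dots> \<longleftrightarrow> (?f x, ?f y) \<in> seg K (fst v)" using f u w lt[OF u(2)] lt[OF w(2)] by (simp add: seg_def)
  finally show "(x, y) \<in> seg (Tr e \<alpha>) (e v) \<longleftrightarrow> (?f x, ?f y) \<in> seg K (fst v)" .
qed

lemma has_height_Tr: "has_height (Tr e \<alpha>) K"
  unfolding has_height_def
proof (intro conjI ballI)
  fix x assume "x \<in> Field (Tr e \<alpha>)"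
  then obtain v where v: "v \<in> Tn \<alpha>" "x = e v" by (auto simp: Field_Tr)
  then show "\<exists>\<gamma>\<in>Ord. isomorphic (seg (Tr e \<alpha>) x) (seg K \<gamma>)" using seg_Tr_isomorphic TnD(1) by blast
next
  fix \<gamma> assume "\<gamma> \<in> Ord"
  then obtain v where v: "v \<in> Tn \<alpha>" "fst v = \<gamma>" using Tn_extend[OF root_Tn \<alpha>, of \<gamma>] bot(2) by auto
  show "\<exists>x\<in>Field (Tr e \<alpha>). isomorphic (seg (Tr e \<alpha>) x) (seg K \<gamma>)"
    using seg_Tr_isomorphic[OF v(1)] v by (intro bexI[of _ "e v"]) (simp_all add: Field_Tr)
qed

end

end

section \<open>Collapses, automorphisms, and trees of different classes\<close>

context realizing
begin

text \<open>Read \<open>V c a y\<close> as: \<open>c\<close> forces an injection of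
  \<open>\<kappa>\<^sup>+\<close> into \<open>Y\<close> to send \<open>a\<close> to
  \<open>y\<close>. By the chain condition each \<open>y\<close> has at most \<kappa> possible
  preimages, and altogether these do not exhaust \<open>\<kappa>\<^sup>+\<close>.\<close>

lemma no_collapse:
  assumes Y: "|Y| \<le>o \<kappa>" and V: "\<And>c a y. V c a y \<Longrightarrow> y \<in> Y"
    and mono: "\<And>c c' a y. V c a y \<Longrightarrow> c' \<in> PE \<Longrightarrow> c' \<sqsubseteq> c \<Longrightarrow> V c' a y"
    and total: "\<And>a. a \<in> Ord \<Longrightarrow> \<exists>c y. c \<in> PE \<and> V c a y"
    and inj: "\<And>c a a' y. V c a y \<Longrightarrow> V c a' y \<Longrightarrow> a = a'"
  shows False
proof -
  define Dn where "Dn = (\<lambda>y. {c \<in> PE. (\<exists>a. V c a y) \<or> (\<forall>c'\<in>PE. c' \<sqsubseteq> c \<longrightarrow> \<not> (\<exists>a. V c' a y))})"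
  have "\<exists>B\<subseteq>Dn y. |B| \<le>o \<kappa> \<and> (\<forall>c\<in>PE. \<exists>c'\<in>PE. c' \<sqsubseteq> c \<and> (\<exists>d\<in>B. c' \<sqsubseteq> d))" for y
  proof (rule PE_bounded_antichain)
    show "Dn y \<subseteq> PE" by (auto simp: Dn_def)
    show "\<exists>d\<in>Dn y. d \<sqsubseteq> c" if c: "c \<in> PE" for c
    proof (cases "\<forall>c'\<in>PE. c' \<sqsubseteq> c \<longrightarrow> \<not> (\<exists>a. V c' a y)")
      case True
      then have "c \<in> Dn y" using c unfolding Dn_def by blast
      then show ?thesis using PE_refl[OF c] by blast
    next
      case False
      then obtain c' where "c' \<in> PE" "c' \<sqsubseteq> c" "\<exists>a. V c' a y" by blast
      then show ?thesis unfolding Dn_def by blast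
    qed
  qed
  then obtain B where B: "\<And>y. B y \<subseteq> Dn y" "\<And>y. |B y| \<le>o \<kappa>" "\<And>y c. c \<in> PE \<Longrightarrow> \<exists>c'\<in>PE. c' \<sqsubseteq> c \<and> (\<exists>d\<in>B y. c' \<sqsubseteq> d)"
    by metis
  have "Ord \<subseteq> (\<Union>y\<in>Y. (\<lambda>d. SOME a. V d a y) ` B y)"
  proof
    fix a assume "a \<in> Ord"
    then obtain c y where c: "c \<in> PE" "V c a y" using total by blast
    obtain c' d where d: "c' \<in> PE" "c' \<sqsubseteq> c" "d \<in> B y" "c' \<sqsubseteq> d" using B(3)[OF c(1), of y] by blast
    have Vc': "V c' a y" using mono[OF c(2) d(1,2)] .
    have "d \<in> Dn y" using B(1) d(3) by blast
    then have "\<exists>a. V d a y" using Vc' d(1,4) unfolding Dn_def by blast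
    then have "V d (SOME a. V d a y) y" by (rule someI_ex)
    then have "V c' (SOME a. V d a y) y" using mono d(1,4) by blast
    then have "a = (SOME a. V d a y)" using inj Vc' by blast
    then show "a \<in> (\<Union>y\<in>Y. (\<lambda>d. SOME a. V d a y) ` B y)" using V[OF c(2)] d(3) by blast
  qed
  moreover have "|\<Union>y\<in>Y. (\<lambda>d. SOME a. V d a y) ` B y| \<le>o \<kappa>" by (intro few_UN few_image Y B(2))
  ultimately show False using large few_subset by blast
qed

text \<open>A matched pair of incomparable nodes suffices: truncating the higher one to the level of
  the lower gives distinct nodes on one level, and \<open>no_isomorphism\<close> applies. If
  \<open>u\<close> lies below \<open>v\<close>, extend \<open>u\<close> to a node \<open>y\<close>
  incomparable with \<open>v\<close>; its image is above \<open>v\<close>, hence incomparable with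
  \<open>y\<close>. If \<open>v\<close> lies below \<open>u\<close>, argue with preimages.\<close>

lemma no_automorphism:
  assumes \<alpha>: "\<alpha> \<in> Ord" and c0: "c0 \<in> PE"
    and V: "\<And>c x y. V c x y \<Longrightarrow> c \<in> PE \<and> x \<in> Tn \<alpha> \<and> y \<in> Tn \<alpha>"
    and mono: "\<And>c c' x y. V c x y \<Longrightarrow> c' \<in> PE \<Longrightarrow> c' \<sqsubseteq> c \<Longrightarrow> V c' x y"
    and total: "\<And>c x. c \<in> PE \<Longrightarrow> c \<sqsubseteq> c0 \<Longrightarrow> x \<in> Tn \<alpha> \<Longrightarrow> \<exists>c' y. c' \<in> PE \<and> c' \<sqsubseteq> c \<and> V c' x y"
    and surj: "\<And>c y. c \<in> PE \<Longrightarrow> c \<sqsubseteq> c0 \<Longrightarrow> y \<in> Tn \<alpha> \<Longrightarrow> \<exists>c' x. c' \<in> PE \<and> c' \<sqsubseteq> c \<and> V c' x y"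
    and emb: "\<And>c x y x' y'. V c x y \<Longrightarrow> V c x' y' \<Longrightarrow> x \<unlhd> x' \<longleftrightarrow> y \<unlhd> y'"
    and uv: "V c0 u v"
  shows "u = v"
proof (rule ccontr)
  assume "u \<noteq> v"
  have inc: False if c1: "c1 \<in> PE" "c1 \<sqsubseteq> c0" "V c1 x y" and xy: "\<not> x \<unlhd> y" "\<not> y \<unlhd> x" for c1 x y
  proof -
    have T: "x \<in> Tn \<alpha>" "y \<in> Tn \<alpha>" using V[OF c1(3)] by auto
    have main: False if u0: "u0 \<in> Tn \<alpha>" "v0 \<in> Tn \<alpha>" "u0 \<unlhd> x" "v0 \<unlhd> y" "fst u0 = fst v0" "u0 \<noteq> v0" for u0 v0
      by (rule no_isomorphism[where V = V, OF \<alpha> \<alpha> c1(1) V mono total emb c1(3) u0(1-5)])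
        (use stronger_trans[OF _ c1(2)] u0(6) in auto)
    show False
    proof (cases "fst x \<preceq> fst y")
      case True
      let ?v = "(fst x, rs (fst x) (snd y))"
      have v: "?v \<in> Tn \<alpha>" "?v \<unlhd> y" using Tn_restrict[OF T(2) True] by auto
      have "x \<noteq> ?v" using v(2) xy(1) by auto
      then show False using main[OF T(1) v(1) tle_refl[OF T(1)] v(2)] by simp
    next
      case False
      then have le: "fst y \<preceq> fst x" using linear[OF TnD(1)[OF T(1)] TnD(1)[OF T(2)]] lt_le by blast
      let ?u = "(fst y, rs (fst y) (snd x))"
      have u: "?u \<in> Tn \<alpha>" "?u \<unlhd> x" using Tn_restrict[OF T(1) le] by auto
      have "?u \<noteq> y" using u(2) xy(2) by auto
      then show False using main[OF u(1) T(2) u(2) tle_refl[OF T(2)]] by simp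
    qed
  qed
  have T: "u \<in> Tn \<alpha>" "v \<in> Tn \<alpha>" using V[OF uv] by auto
  consider "u \<unlhd> v" | "v \<unlhd> u" | "\<not> u \<unlhd> v" "\<not> v \<unlhd> u" by blast
  then show False
  proof cases
    case 1
    then have lt: "fst u \<prec> fst v" using tle_eq_lev[OF T 1] \<open>u \<noteq> v\<close> le_cases by (auto simp: tle_def)
    obtain y where y: "y \<in> Tn \<alpha>" "(fst u, rs (fst u) (snd v)) \<unlhd> y" "fst u \<prec> fst y" "snd y (fst u) \<noteq> snd v (fst u)"
      using Tn_split[OF T(2) \<alpha> lt] by blast
    have "u = (fst u, rs (fst u) (snd v))" using 1 by (simp add: tle_def prod_eq_iff)
    then have uy: "u \<unlhd> y" using y(2) by simp
    obtain c w where c: "c \<in> PE" "c \<sqsubseteq> c0" "V c y w" using total[OF c0 PE_refl[OF c0] y(1)] by blast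
    have "v \<unlhd> w" using emb[OF mono[OF uv c(1,2)] c(3)] uy by blast
    then show False using inc[OF c] differ_incomparable[OF y(3) lt y(4) tle_refl[OF y(1)]] by blast
  next
    case 2
    then have lt: "fst v \<prec> fst u" using tle_eq_lev[OF T(2,1) 2] \<open>u \<noteq> v\<close> le_cases by (auto simp: tle_def)
    obtain y where y: "y \<in> Tn \<alpha>" "(fst v, rs (fst v) (snd u)) \<unlhd> y" "fst v \<prec> fst y" "snd y (fst v) \<noteq> snd u (fst v)"
      using Tn_split[OF T(1) \<alpha> lt] by blast
    have "v = (fst v, rs (fst v) (snd u))" using 2 by (simp add: tle_def prod_eq_iff)
    then have vy: "v \<unlhd> y" using y(2) by simp
    obtain c w where c: "c \<in> PE" "c \<sqsubseteq> c0" "V c w y" using surj[OF c0 PE_refl[OF c0] y(1)] by blast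
    have "u \<unlhd> w" using emb[OF mono[OF uv c(1,2)] c(3)] vy by blast
    then show False using inc[OF c] differ_incomparable[OF y(3) lt y(4) tle_refl[OF y(1)]] by blast
  next
    case 3
    then show False using inc[OF c0 PE_refl[OF c0] uv] by blast
  qed
qed

text \<open>For inequivalent trees the types alone are independent, so the roots can serve as the
  initial nodes although they coincide.\<close>

lemma no_isomorphism_classes:
  assumes ab: "\<alpha> \<in> Ord" "\<beta> \<in> Ord" "m \<alpha> \<noteq> m \<beta>" and c0: "c0 \<in> PE"
    and V: "\<And>c x y. V c x y \<Longrightarrow> c \<in> PE \<and> x \<in> Tn \<alpha> \<and> y \<in> Tn \<beta>"
    and mono: "\<And>c c' x y. V c x y \<Longrightarrow> c' \<in> PE \<Longrightarrow> c' \<sqsubseteq> c \<Longrightarrow> V c' x y"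
    and total: "\<And>c x. c \<in> PE \<Longrightarrow> c \<sqsubseteq> c0 \<Longrightarrow> x \<in> Tn \<alpha> \<Longrightarrow> \<exists>c' y. c' \<in> PE \<and> c' \<sqsubseteq> c \<and> V c' x y"
    and emb: "\<And>c x y x' y'. V c x y \<Longrightarrow> V c x' y' \<Longrightarrow> x \<unlhd> x' \<longleftrightarrow> y \<unlhd> y'"
  shows False
proof -
  obtain c v where c: "c \<in> PE" "c \<sqsubseteq> c0" "V c (bot, 0) v" using total[OF c0 PE_refl[OF c0] root_Tn] by blast
  have v: "v \<in> Tn \<beta>" using V[OF c(3)] by blast
  show False
    by (rule no_isomorphism[where V = V, OF ab(1,2) c(1) V mono total emb c(3) root_Tn root_Tn tle_refl[OF root_Tn] root_tle[OF v]])
      (use stronger_trans[OF _ c(2)] ab(3) in auto)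
qed

section \<open>Isomorphisms by translation\<close>

definition shift :: "'o cond \<Rightarrow> 'o \<Rightarrow> 'o \<Rightarrow> bit" where
  "shift c \<xi> = (if m \<xi> = \<xi> then 0 else snd (the (snd c (Slot \<xi> 0))))"

definition shift_known :: "'o cond \<Rightarrow> 'o \<Rightarrow> bool" where
  "shift_known c \<xi> \<longleftrightarrow> m \<xi> = \<xi> \<or> Slot \<xi> 0 \<in> dom (snd c)"

lemma shift_known_val:
  assumes c: "c \<in> PE" and ok: "shift_known c \<xi>" "m \<xi> \<noteq> \<xi>"
  shows "snd c (Slot \<xi> 0) = Some (unit \<xi> + unit (m \<xi>), shift c \<xi>)"
proof -
  obtain \<tau> x where e: "snd c (Slot \<xi> 0) = Some (\<tau>, x)" using ok by (auto simp: shift_known_def)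
  have "\<tau> = unit \<xi> + unit (m \<xi>)" using QJ_typ[OF c[unfolded PE_def] e] by simp
  then show ?thesis using e ok(2) by (simp add: shift_def)
qed

text \<open>For a representative there is no generator, and both the type and the default
  translation are 0. Passing through the representative therefore needs no case distinction
  later.\<close>

lemma shift_W:
  assumes c: "c \<in> PE" and ok: "shift_known c \<xi>" and \<gamma>: "\<gamma> \<preceq> fst c"
  shows "(rs \<gamma> (unit \<xi> + unit (m \<xi>)), rs \<gamma> (shift c \<xi>)) \<in> W \<gamma>"
proof (cases "m \<xi> = \<xi>")
  case True
  have "unit \<xi> + unit (m \<xi>) = 0" unfolding True by (rule fun_bit_add_self)
  moreover have "shift c \<xi> = 0" using True by (simp add: shift_def)
  ultimately show ?thesis using gd_0[OF gd_all[OF le_Ord(1)[OF \<gamma>]]] by simp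
next
  case False
  have "(rs (fst c) (unit \<xi> + unit (m \<xi>)), shift c \<xi>) \<in> W (fst c)"
    using QD(5)[OF PE_Q[OF c] shift_known_val[OF c ok False]] .
  then show ?thesis using gd_restrict[OF gd_all[OF PE_lev[OF c]] _ \<gamma>] rs_rs(1)[OF \<gamma>] by metis
qed

lemma shift_mono:
  assumes c: "c \<in> PE" "c' \<in> PE" "c' \<sqsubseteq> c" and ok: "shift_known c \<xi>"
  shows "shift_known c' \<xi>" "\<gamma> \<preceq> fst c \<Longrightarrow> rs \<gamma> (shift c' \<xi>) = rs \<gamma> (shift c \<xi>)"
proof -
  show ok': "shift_known c' \<xi>" using ok stronger_dom[OF c(3)] unfolding shift_known_def by blast
  show "rs \<gamma> (shift c' \<xi>) = rs \<gamma> (shift c \<xi>)" if \<gamma>: "\<gamma> \<preceq> fst c"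
  proof (cases "m \<xi> = \<xi>")
    case False
    have "rs (fst c) (shift c' \<xi>) = shift c \<xi>"
      using stronger_val[OF c(3) shift_known_val[OF c(1) ok False]] shift_known_val[OF c(2) ok' False] by auto
    then show ?thesis using rs_rs(1)[OF \<gamma>] by metis
  qed (simp add: shift_def)
qed

lemma shift_known_dense:
  assumes c: "c \<in> PE" and \<xi>: "\<xi> \<in> Ord"
  shows "\<exists>c'\<in>PE. c' \<sqsubseteq> c \<and> shift_known c' \<xi>"
proof (cases "shift_known c \<xi>")
  case True
  then show ?thesis using c PE_refl by blast
next
  case False
  let ?j = "Slot \<xi> 0" and ?\<tau> = "unit \<xi> + unit (m \<xi>)"
  have j: "?j \<notin> dom (snd c)" "m \<xi> \<noteq> \<xi>" "?j \<in> JE" using False \<xi> by (auto simp: shift_known_def JE_def)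
  have f: "fsup ?\<tau>" by (intro fsup_add fsup_unit \<xi> m_Ord)
  have lev: "fst c \<in> Ord" using PE_lev[OF c] .
  \<comment> \<open>At the root level every type truncates to 0, so extending the zero node from
    there yields a node of any wanted type on any level.\<close>
  have "(rs bot ?\<tau>, 0) \<in> W bot" using gd_0[OF gd_all[OF bot(1)]] by simp
  then obtain y where y: "(rs (fst c) ?\<tau>, y) \<in> W (fst c)" using gd_extend[OF gd_all[OF lev] bot(2)[OF lev] f] by blast
  let ?c = "(fst c, (snd c)(?j \<mapsto> (?\<tau>, y)))"
  have val: "fsup \<tau> \<and> (rs (fst c) \<tau>, x) \<in> W (fst c) \<and> i \<in> JE \<and> \<tau> = unit (ord i) + unit (m (ord i))"
    if i: "((snd c)(?j \<mapsto> (?\<tau>, y))) i = Some (\<tau>, x)" for i \<tau> x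
  proof (cases "i = ?j")
    case True
    then show ?thesis using i y f j(3) by auto
  next
    case False
    then have e: "snd c i = Some (\<tau>, x)" using i by simp
    then show ?thesis using QD(4,5)[OF PE_Q[OF c] e] QJ_typ[OF c[unfolded PE_def] e] QJ_dom[OF c[unfolded PE_def]] by blast
  qed
  have "?c \<in> Q W"
  proof (rule QI[OF lev])
    have "|{?j} \<union> dom (snd c)| <o \<kappa>" by (intro small_Un small_finite QD(2)[OF PE_Q[OF c]]) simp
    then show "|dom ((snd c)(?j \<mapsto> (?\<tau>, y)))| <o \<kappa>" by simp
    show "ord ` dom ((snd c)(?j \<mapsto> (?\<tau>, y))) \<subseteq> Ord" using QD(3)[OF PE_Q[OF c]] \<xi> by simp
  qed (use val in blast)
  moreover have "dom (snd c) \<subseteq> JE" using QJ_dom[OF c[unfolded PE_def]] by blast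
  ultimately have "?c \<in> PE" unfolding PE_def QJ_def using val j(3) by (auto simp del: fun_upd_apply)
  moreover have "?c \<sqsubseteq> c"
    unfolding stronger_def
  proof (intro conjI allI impI)
    show "fst c \<preceq> fst ?c" using le_refl[OF lev] by simp
    fix i \<tau> x assume i: "snd c i = Some (\<tau>, x)"
    then have "i \<noteq> ?j" using j(1) by blast
    then show "\<exists>x'. snd ?c i = Some (\<tau>, x') \<and> rs (fst c) x' = x" using i stronger_val[OF PE_refl[OF c] i] by auto
  qed
  moreover have "shift_known ?c \<xi>" by (simp add: shift_known_def)
  ultimately show ?thesis by blast
qed

text \<open>
  The name of the isomorphism between equivalent trees: add both generators, passing through the representative.
\<close>

definition shift_iso :: "'o \<Rightarrow> 'o \<Rightarrow> 'o cond \<Rightarrow> 'o \<times> ('o \<Rightarrow> bit) \<Rightarrow> 'o \<times> ('o \<Rightarrow> bit) \<Rightarrow> bool" where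
  "shift_iso \<alpha> \<beta> c u v \<longleftrightarrow> c \<in> PE \<and> u \<in> Tn \<alpha> \<and> v \<in> Tn \<beta> \<and> fst v = fst u \<and> fst u \<preceq> fst c \<and> shift_known c \<alpha> \<and> shift_known c \<beta> \<and>
     snd v = snd u + rs (fst u) (shift c \<alpha> + shift c \<beta>)"

text \<open>A translation in a group of exponent two is its own inverse. Surjectivity and
  injectivity of the isomorphism thereby reduce to totality and functionality with \<alpha> and
  \<beta> exchanged.\<close>

lemma shift_iso_sym: "shift_iso \<alpha> \<beta> c u v \<longleftrightarrow> shift_iso \<beta> \<alpha> c v u"
proof -
  have "snd v = snd u + h \<longleftrightarrow> snd u = snd v + h" for h :: "'o \<Rightarrow> bit"
    by (metis add.assoc add.commute fun_bit_add_cancel)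
  then show ?thesis unfolding shift_iso_def by (auto simp: add.commute)
qed

lemma shift_iso_mono:
  assumes V: "shift_iso \<alpha> \<beta> c u v" and c': "c' \<in> PE" "c' \<sqsubseteq> c"
  shows "shift_iso \<alpha> \<beta> c' u v"
proof -
  have V': "c \<in> PE" "shift_known c \<alpha>" "shift_known c \<beta>" "fst u \<preceq> fst c" using V by (auto simp: shift_iso_def)
  have "rs (fst u) (shift c' \<alpha> + shift c' \<beta>) = rs (fst u) (shift c \<alpha> + shift c \<beta>)"
    unfolding rs_add using shift_mono(2)[OF V'(1) c' V'(2,4)] shift_mono(2)[OF V'(1) c' V'(3,4)] by simp
  then show ?thesis using V shift_mono(1)[OF V'(1) c'] c'(1) le_trans[OF V'(4) stronger_lev[OF c'(2)]]
    unfolding shift_iso_def by simp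
qed

lemma shift_iso_total:
  assumes ab: "\<alpha> \<in> Ord" "\<beta> \<in> Ord" "m \<alpha> = m \<beta>" and c: "c \<in> PE" and u: "u \<in> Tn \<alpha>"
  shows "\<exists>c' v. c' \<in> PE \<and> c' \<sqsubseteq> c \<and> shift_iso \<alpha> \<beta> c' u v"
proof -
  obtain c1 where c1: "c1 \<in> PE" "c1 \<sqsubseteq> c" "shift_known c1 \<alpha>" using shift_known_dense[OF c ab(1)] by blast
  obtain c2 where c2: "c2 \<in> PE" "c2 \<sqsubseteq> c1" "shift_known c2 \<beta>" using shift_known_dense[OF c1(1) ab(2)] by blast
  obtain \<gamma> where \<gamma>: "fst c2 \<preceq> \<gamma>" "fst u \<preceq> \<gamma>" using max_Ord[OF PE_lev[OF c2(1)] TnD(1)[OF u]] by blast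
  obtain d where d: "d \<in> PE" "d \<sqsubseteq> c2" "fst d = \<gamma>" using QJ_level_up[OF c2(1)[unfolded PE_def] \<gamma>(1)] unfolding PE_def by blast
  have ok: "shift_known d \<alpha>" "shift_known d \<beta>"
    using shift_mono(1)[OF c2(1) d(1,2) c2(3)] shift_mono(1)[OF c2(1) d(1,2) shift_mono(1)[OF c1(1) c2(1,2) c1(3)]] by auto
  have ud: "fst u \<preceq> fst d" using \<gamma>(2) d(3) by simp
  let ?v = "(fst u, snd u + rs (fst u) (shift d \<alpha> + shift d \<beta>))"
  have "(rs (fst u) (unit \<alpha>) + (rs (fst u) (unit \<alpha> + unit (m \<alpha>)) + rs (fst u) (unit \<beta> + unit (m \<beta>))),
      snd u + (rs (fst u) (shift d \<alpha>) + rs (fst u) (shift d \<beta>))) \<in> W (fst u)"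
    by (intro gd_add gd_all TnD[OF u] shift_W d(1) ok ud)
  \<comment> \<open>On types, the first generator leads from \<alpha> to its representative and the
    second from there to \<beta>; the common representative cancels.\<close>
  moreover have "unit \<alpha> + ((unit \<alpha> + unit (m \<beta>)) + (unit \<beta> + unit (m \<beta>))) = unit \<beta>"
  proof -
    have "unit \<alpha> + ((unit \<alpha> + unit (m \<beta>)) + (unit \<beta> + unit (m \<beta>))) = unit \<alpha> + (unit \<alpha> + (unit (m \<beta>) + (unit (m \<beta>) + unit \<beta>)))"
      by (simp only: ac_simps)
    also have "\<dots> = unit \<beta>" by (simp only: fun_bit_add_cancel)
    finally show ?thesis .
  qed
  ultimately have "(rs (fst u) (unit \<beta>), snd u + rs (fst u) (shift d \<alpha> + shift d \<beta>)) \<in> W (fst u)"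
    unfolding rs_add[symmetric] ab(3) by (simp only:)
  then have "?v \<in> Tn \<beta>" using TnD(1)[OF u] by (simp add: Tn_def)
  then have "shift_iso \<alpha> \<beta> d u ?v" using d(1) u ud ok by (simp add: shift_iso_def)
  moreover have "d \<sqsubseteq> c" using d(2) c2(2) c1(2) stronger_trans by blast
  ultimately show ?thesis using d(1) by blast
qed

lemma shift_iso_functional: "shift_iso \<alpha> \<beta> c u v \<Longrightarrow> shift_iso \<alpha> \<beta> c u v' \<Longrightarrow> v = v'"
  unfolding shift_iso_def by (auto simp: prod_eq_iff)

lemma shift_iso_order:
  assumes V: "shift_iso \<alpha> \<beta> c u v" "shift_iso \<alpha> \<beta> c u' v'"
  shows "u \<unlhd> u' \<longleftrightarrow> v \<unlhd> v'"
proof -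
  have *: "v \<unlhd> v'" if V: "shift_iso \<alpha> \<beta> c u v" "shift_iso \<alpha> \<beta> c u' v'" and le: "u \<unlhd> u'" for \<alpha> \<beta> u v u' v'
  proof -
    have "fst u \<preceq> fst u'" "rs (fst u) (snd u') = snd u" using le by (auto simp: tle_def)
    then show ?thesis using V unfolding shift_iso_def tle_def by (auto simp: rs_add rs_rs(1))
  qed
  show ?thesis using *[OF V] *[of \<beta> \<alpha> v u v' u'] V shift_iso_sym by blast
qed

section \<open>The forcing notion as a relation, and preservation of cofinalities\<close>

definition Pf :: "('o cond \<Rightarrow> 'p) \<Rightarrow> 'p rel" where
  "Pf enc = {(enc c, enc d) |c d. c \<in> PE \<and> d \<in> PE \<and> c \<sqsubseteq> d}"

context
  fixes enc :: "'o cond \<Rightarrow> 'p"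
  assumes enc: "inj_on enc PE"
begin

lemma Pf_iff: "c \<in> PE \<Longrightarrow> d \<in> PE \<Longrightarrow> (enc c, enc d) \<in> Pf enc \<longleftrightarrow> c \<sqsubseteq> d"
  using enc unfolding Pf_def inj_on_def by blast

lemma Field_Pf: "Field (Pf enc) = enc ` PE"
proof
  show "Field (Pf enc) \<subseteq> enc ` PE" by (auto simp: Pf_def Field_def)
  show "enc ` PE \<subseteq> Field (Pf enc)"
  proof
    fix x assume "x \<in> enc ` PE"
    then have "(x, x) \<in> Pf enc" using PE_refl unfolding Pf_def by blast
    then show "x \<in> Field (Pf enc)" by (rule FieldI1)
  qed
qed

lemma PfD: "(t, enc c) \<in> Pf enc \<Longrightarrow> c \<in> PE \<Longrightarrow> \<exists>d\<in>PE. t = enc d \<and> d \<sqsubseteq> c"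
  using Pf_iff unfolding Pf_def by blast

lemma Preorder_Pf: "Preorder (Pf enc)"
  unfolding preorder_on_def
proof (intro conjI)
  show "Pf enc \<subseteq> Field (Pf enc) \<times> Field (Pf enc)" by (auto simp: Field_def)
  show "Refl (Pf enc)" unfolding refl_on_def Field_Pf using Pf_iff PE_refl by blast
  show "trans (Pf enc)"
  proof (rule transI)
    fix x y z assume xy: "(x, y) \<in> Pf enc" and yz: "(y, z) \<in> Pf enc"
    then obtain d where d: "d \<in> PE" "z = enc d" unfolding Pf_def by blast
    obtain c where c: "c \<in> PE" "y = enc c" "c \<sqsubseteq> d" using PfD[OF yz[unfolded d(2)] d(1)] by blast
    obtain b where b: "b \<in> PE" "x = enc b" "b \<sqsubseteq> c" using PfD[OF xy[unfolded c(2)] c(1)] by blast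
    show "(x, z) \<in> Pf enc" using Pf_iff[OF b(1) d(1)] stronger_trans[OF b(3) c(3)] b(2) d(2) by simp
  qed
qed

lemma forcing_notion_Pf: "forcing_notion (Pf enc)"
  unfolding forcing_notion_def using Preorder_Pf Field_Pf PE_empty by auto

text \<open>A cofinal map of the ground model stays cofinal; the point is that no shorter one is
  added. If \<open>s\<close> has size at most \<kappa>, a shorter map has fewer than \<kappa>
  arguments, and distributivity finds one condition that decides it. Otherwise the chain condition
  leaves at most \<kappa> candidates for each value, and all candidates together form a cofinal set
  smaller than \<open>s\<close>.\<close>

lemma cofinality_preserving_Pf: "cofinality_preserving (Pf enc)"
  unfolding cofinality_preserving_def
proof (intro allI impI)
  fix r s :: "'p rel" assume rs: "Well_order r \<and> Well_order s \<and> has_cof r s"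
  then have s: "Well_order s" by blast
  obtain h where h: "cofinal_map h (Field s) r" using rs by (auto simp: has_cof_def)
  have nc: "\<not> cofinal_map g (underS s b) r" if "b \<in> Field s" for g b using rs that by (auto simp: has_cof_def)
  note P = Preorder_Pf
  show "forced (Pf enc) (f_has_cof (Pf enc) r s)"
    unfolding has_cof_forced_iff[OF P]
  proof (intro conjI ballI allI impI notI)
    fix q p assume "q \<in> Field (Pf enc)" "(p, q) \<in> Pf enc"
    then have p: "p \<in> Field (Pf enc)" "(p, p) \<in> Pf enc" using P_under[OF P] P_refl[OF P] by blast+
    have "vcof (Pf enc) p (Field s) r (\<lambda>t a y. (t, p) \<in> Pf enc \<and> a \<in> Field s \<and> y = h a)"
      unfolding vcof_def[OF P]
    proof (intro conjI allI impI)
      fix t a y u assume "((t, p) \<in> Pf enc \<and> a \<in> Field s \<and> y = h a) \<and> (u, t) \<in> Pf enc"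
      then show "(u, p) \<in> Pf enc" "a \<in> Field s" "y = h a" using P_trans[OF P, of u t p] by simp_all
    next
      fix a t assume "a \<in> Field s \<and> (t, p) \<in> Pf enc"
      then show "\<exists>u y. (u, t) \<in> Pf enc \<and> (u, p) \<in> Pf enc \<and> a \<in> Field s \<and> y = h a"
        using P_refl[OF P P_under[OF P, of t p]] by auto
    next
      fix z t assume zt: "z \<in> Field r \<and> (t, p) \<in> Pf enc"
      then obtain a where "a \<in> Field s" "(z, h a) \<in> r" using h by (auto simp: cofinal_map_def)
      then show "\<exists>u a c. (u, t) \<in> Pf enc \<and> ((u, p) \<in> Pf enc \<and> a \<in> Field s \<and> c = h a) \<and> (z, c) \<in> r"
        using zt P_refl[OF P P_under[OF P, of t p]] by auto
    qed (use h in \<open>auto simp: cofinal_map_def\<close>)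
    then show "\<exists>u V. (u, p) \<in> Pf enc \<and> vcof (Pf enc) u (Field s) r V" using p by blast
  next
    fix q b V assume q: "q \<in> Field (Pf enc)" and b: "b \<in> Field s" and V: "vcof (Pf enc) q (underS s b) r V"
    obtain c0 where c0: "c0 \<in> PE" "q = enc c0" using q Field_Pf by blast
    have V1: "V t a y \<Longrightarrow> (u, t) \<in> Pf enc \<Longrightarrow> V u a y"
      and V2: "V t a y \<Longrightarrow> a \<in> underS s b \<and> y \<in> Field r \<and> (t, q) \<in> Pf enc"
      and V3: "a \<in> underS s b \<Longrightarrow> (t, q) \<in> Pf enc \<Longrightarrow> \<exists>u y. (u, t) \<in> Pf enc \<and> V u a y"
      and V4: "V t a y \<Longrightarrow> V t a y' \<Longrightarrow> y = y'"
      and V5: "z \<in> Field r \<Longrightarrow> (t, q) \<in> Pf enc \<Longrightarrow> \<exists>u a c. (u, t) \<in> Pf enc \<and> V u a c \<and> (z, c) \<in> r"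
      for t u a y y' z using V unfolding vcof_def[OF P] by meson+
    have V3': "\<exists>d\<in>PE. d \<sqsubseteq> c \<and> (\<exists>y. V (enc d) a y)" if a: "a \<in> underS s b" and c: "c \<in> PE" "c \<sqsubseteq> c0" for a c
      using V3[OF a, of "enc c"] Pf_iff[OF c(1) c0(1)] c(2) c0(2) PfD[OF _ c(1)] by blast
    \<comment> \<open>A shortest length exceeds its proper initial segments in cardinality, since
      otherwise \<open>h\<close> could be reindexed along such a segment.\<close>
    have bs: "|underS s b| <o |Field s|"
    proof (rule ccontr)
      assume "\<not> ?thesis"
      then have "|Field s| \<le>o |underS s b|" by (simp add: not_ordLess_iff_ordLeq card_of_Well_order)
      then obtain g where "g ` underS s b = Field s" using card_of_ordLeq2[of "Field s" "underS s b"] b by blast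
      then have "cofinal_map (h \<circ> g) (underS s b) r"
        using h unfolding cofinal_map_def image_comp[symmetric] by (auto; metis imageE)
      then show False using nc b by blast
    qed
    show False
    proof (cases "|Field s| \<le>o \<kappa>")
      case True
      let ?D = "\<lambda>a. {c \<in> PE. \<exists>y. V (enc c) a y}"
      have "\<exists>c\<in>PE. c \<sqsubseteq> c0 \<and> (\<forall>\<Delta>\<in>?D ` underS s b. \<exists>d\<in>PE. d \<in> \<Delta> \<and> c \<sqsubseteq> d)"
      proof (rule PE_meet[OF c0(1)])
        show "|?D ` underS s b| <o \<kappa>" by (rule small_image[OF ordLess_ordLeq_trans[OF bs True]])
        fix \<Delta> c assume "\<Delta> \<in> ?D ` underS s b" and c: "c \<in> PE" "c \<sqsubseteq> c0"
        then obtain a where a: "a \<in> underS s b" "\<Delta> = ?D a" by blast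
        show "\<exists>d\<in>PE. d \<in> \<Delta> \<and> d \<sqsubseteq> c" using V3'[OF a(1) c] unfolding a(2) by blast
      qed
      then obtain c where c: "c \<in> PE" "c \<sqsubseteq> c0" "\<forall>\<Delta>\<in>?D ` underS s b. \<exists>d\<in>PE. d \<in> \<Delta> \<and> c \<sqsubseteq> d" by meson
      have "\<exists>y. V (enc c) a y" if "a \<in> underS s b" for a
      proof -
        have "?D a \<in> ?D ` underS s b" using \<open>a \<in> underS s b\<close> by blast
        then obtain d where "d \<in> PE" "d \<in> ?D a" "c \<sqsubseteq> d" using c(3) by meson
        then show ?thesis using V1 Pf_iff[OF c(1)] by blast
      qed
      then obtain f where f: "\<And>a. a \<in> underS s b \<Longrightarrow> V (enc c) a (f a)" by metis
      have "cofinal_map f (underS s b) r"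
        unfolding cofinal_map_def
      proof (intro conjI ballI)
        show "f ` underS s b \<subseteq> Field r" using f V2 by blast
        fix z assume z: "z \<in> Field r"
        have "(enc c, q) \<in> Pf enc" using Pf_iff[OF c(1) c0(1)] c(2) c0(2) by simp
        then obtain u a y where u: "(u, enc c) \<in> Pf enc" "V u a y" "(z, y) \<in> r" using V5[OF z] by blast
        have a: "a \<in> underS s b" using V2[OF u(2)] by blast
        have "y = f a" using V4[OF u(2) V1[OF f[OF a] u(1)]] .
        then show "\<exists>a\<in>underS s b. (z, f a) \<in> r" using u(3) a by blast
      qed
      then show False using nc[OF b] by blast
    next
      case False
      have big: "|Field \<kappa>| <o |Field s|"
      proof -
        have "\<kappa> <o |Field s|" using False Ck by (simp add: not_ordLeq_iff_ordLess card_order_on_def card_of_Well_order)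
        then show ?thesis using card_of_Field_ordIso[OF Ck] ordIso_ordLess_trans by blast
      qed
      have infs: "\<not> finite (Field s)" using inf\<kappa> ordLess_imp_ordLeq[OF big] card_of_ordLeq_finite by blast
      \<comment> \<open>Values of the name are decided densely only below \<open>c0\<close>;
        conditions incompatible with \<open>c0\<close> make the set dense everywhere.\<close>
      define Dn where "Dn = (\<lambda>a. {c \<in> PE. (\<exists>y. V (enc c) a y) \<or> (\<forall>c'\<in>PE. c' \<sqsubseteq> c \<longrightarrow> \<not> c' \<sqsubseteq> c0)})"
      have "\<exists>B\<subseteq>Dn a. |B| \<le>o \<kappa> \<and> (\<forall>c\<in>PE. \<exists>c'\<in>PE. c' \<sqsubseteq> c \<and> (\<exists>d\<in>B. c' \<sqsubseteq> d))" if a: "a \<in> underS s b" for a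
      proof (rule PE_bounded_antichain)
        show "Dn a \<subseteq> PE" by (auto simp: Dn_def)
        fix c assume c: "c \<in> PE"
        show "\<exists>d\<in>Dn a. d \<sqsubseteq> c"
        proof (cases "\<forall>c'\<in>PE. c' \<sqsubseteq> c \<longrightarrow> \<not> c' \<sqsubseteq> c0")
          case True
          then have "c \<in> Dn a" using c unfolding Dn_def by blast
          then show ?thesis using PE_refl[OF c] by blast
        next
          case False
          then obtain c' where c': "c' \<in> PE" "c' \<sqsubseteq> c" "c' \<sqsubseteq> c0" by blast
          obtain d where "d \<in> PE" "d \<sqsubseteq> c'" "\<exists>y. V (enc d) a y" using V3'[OF a c'(1,3)] by blast
          then show ?thesis using stronger_trans[OF _ c'(2)] unfolding Dn_def by blast
        qed
      qed
      then obtain B where B: "\<And>a. a \<in> underS s b \<Longrightarrow> B a \<subseteq> Dn a \<and> |B a| \<le>o \<kappa> \<and> (\<forall>c\<in>PE. \<exists>c'\<in>PE. c' \<sqsubseteq> c \<and> (\<exists>d\<in>B a. c' \<sqsubseteq> d))"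
        by metis
      define B' where "B' = (\<lambda>a. {d \<in> B a. \<exists>y. V (enc d) a y})"
      define Y where "Y = (\<lambda>(a, d). SOME y. V (enc d) a y) ` (SIGMA a : underS s b. B' a)"
      have "|SIGMA a : underS s b. B' a| \<le>o |underS s b <+> Field \<kappa>|"
      proof (rule card_of_Sigma_ordLeq_infinite)
        show "\<not> finite (underS s b <+> Field \<kappa>)" using inf\<kappa> by simp
        show "|underS s b| \<le>o |underS s b <+> Field \<kappa>|" by (rule card_of_Plus1)
        show "\<forall>a\<in>underS s b. |B' a| \<le>o |underS s b <+> Field \<kappa>|"
        proof
          fix a assume a: "a \<in> underS s b"
          have "|B' a| \<le>o \<kappa>" by (rule few_subset[of _ "B a"]) (use B[OF a] in \<open>auto simp: B'_def\<close>)
          then have "|B' a| \<le>o |Field \<kappa>|" using ordIso_symmetric[OF card_of_Field_ordIso[OF Ck]] by (rule ordLeq_ordIso_trans)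
          then show "|B' a| \<le>o |underS s b <+> Field \<kappa>|" using card_of_Plus2 by (rule ordLeq_transitive)
        qed
      qed
      then have "|Y| \<le>o |underS s b <+> Field \<kappa>|" unfolding Y_def using card_of_image by (rule ordLeq_transitive[rotated])
      then have "|Y| <o |Field s|" using card_of_Plus_ordLess_infinite[OF infs bs big] by (rule ordLeq_ordLess_trans)
      \<comment> \<open>A set of fewer than \<open>s\<close> candidates is the image of a proper
        initial segment of \<open>s\<close>, on which a cofinal map is forbidden.\<close>
      then have "|Y| <o s" using card_of_least[OF s] by (rule ordLess_ordLeq_trans)
      then obtain d g where d: "d \<in> Field s" "g ` underS s d = Y" using well_order_less_imp_image_underS[OF s] by meson
      have Vs: "V (enc d) a (SOME y. V (enc d) a y)" if "d \<in> B' a" for a d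
        using that someI_ex[of "\<lambda>y. V (enc d) a y"] unfolding B'_def by blast
      have "cofinal_map g (underS s d) r"
        unfolding cofinal_map_def d(2)
      proof (intro conjI ballI)
        show "Y \<subseteq> Field r"
        proof
          fix y assume "y \<in> Y"
          then obtain z where z: "z \<in> (SIGMA a : underS s b. B' a)" "y = (\<lambda>(a, d). SOME y. V (enc d) a y) z"
            unfolding Y_def by blast
          have "snd z \<in> B' (fst z)" using z(1) by (cases z) simp
          then show "y \<in> Field r" using V2[OF Vs] z(2) by (simp add: case_prod_beta)
        qed
        fix z assume z: "z \<in> Field r"
        have "(q, q) \<in> Pf enc" using P_refl[OF P q] .
        then obtain u a y where u: "(u, q) \<in> Pf enc" "V u a y" "(z, y) \<in> r" using V5[OF z] by blast
        have a: "a \<in> underS s b" using V2[OF u(2)] by blast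
        obtain c where c: "c \<in> PE" "u = enc c" "c \<sqsubseteq> c0" using PfD[OF u(1)[unfolded c0(2)] c0(1)] by blast
        obtain c' d' where c': "c' \<in> PE" "c' \<sqsubseteq> c" "d' \<in> B a" "c' \<sqsubseteq> d'" using B[OF a] c(1) by meson
        have dP: "d' \<in> PE" "d' \<in> Dn a" using B[OF a] c'(3) unfolding Dn_def by blast+
        have "\<exists>y. V (enc d') a y" using dP(2) c' stronger_trans[OF c'(2) c(3)] unfolding Dn_def by blast
        then have d'B: "d' \<in> B' a" using c'(3) unfolding B'_def by blast
        have "V (enc c') a (SOME y. V (enc d') a y)" using V1[OF Vs[OF d'B]] Pf_iff[OF c'(1) dP(1)] c'(4) by blast
        moreover have "V (enc c') a y" using V1[OF u(2)] Pf_iff[OF c'(1) c(1)] c'(2) c(2) by blast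
        ultimately have "y = (SOME y. V (enc d') a y)" using V4 by blast
        then have "y \<in> Y" unfolding Y_def using a d'B by force
        then show "\<exists>x\<in>underS s d. (z, g x) \<in> r" using d(2) u(3) by blast
      qed
      then show False using nc[OF d(1)] by blast
    qed
  qed
qed

end

section \<open>Trees and names of the ground model under a labelling\<close>

context
  fixes e :: "'o \<Rightarrow> 'o \<times> ('o \<Rightarrow> bit) \<Rightarrow> 'x"
  assumes e: "\<And>\<alpha>. \<alpha> \<in> Ord \<Longrightarrow> inj_on (e \<alpha>) (Tn \<alpha>)"
begin

lemma no_large_subset:
  assumes g: "bij_betw g Ord A" and A: "A \<subseteq> Field (Tr (e \<alpha>) \<alpha>)"
    and \<delta>: "\<And>z. z \<in> Tn \<alpha> \<Longrightarrow> e \<alpha> z \<in> A \<Longrightarrow> fst z \<prec> \<delta>"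
  shows False
proof -
  have "A \<subseteq> e \<alpha> ` {z \<in> Tn \<alpha>. fst z \<prec> \<delta>}" using A \<delta> unfolding Field_Tr by blast
  then have "|A| \<le>o \<kappa>" using few_image[OF few_nodes_below] by (rule few_subset)
  moreover have "Ord = inv_into Ord g ` A" using bij_betw_inv_into[OF g] by (simp add: bij_betw_def)
  ultimately have "|Ord| \<le>o \<kappa>" using few_image[of A "inv_into Ord g"] by simp
  then show False using large by blast
qed

text \<open>A ground model set is a name about which all conditions agree. The bounds for forced
  chains and antichains thus apply with a relation that ignores the condition;
  \<open>rigid_Tr\<close> proceeds in the same way.\<close>

lemma souslin_tree_Tr:
  assumes \<alpha>: "\<alpha> \<in> Ord" shows "souslin_tree K (Tr (e \<alpha>) \<alpha>)"
  unfolding souslin_tree_def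
proof (intro conjI notI)
  show "tree (Tr (e \<alpha>) \<alpha>)" by (rule tree_Tr[OF e[OF \<alpha>] \<alpha>])
  show "has_height (Tr (e \<alpha>) \<alpha>) K" by (rule has_height_Tr[OF e[OF \<alpha>] \<alpha>])
next
  assume "\<exists>B g. branch (Tr (e \<alpha>) \<alpha>) B \<and> bij_betw g Ord B"
  then obtain B g where B: "branch (Tr (e \<alpha>) \<alpha>) B" and g: "bij_betw g Ord B" by blast
  have "\<exists>\<delta>\<in>Ord. \<forall>c z. c \<in> PE \<and> z \<in> Tn \<alpha> \<and> e \<alpha> z \<in> B \<longrightarrow> fst z \<prec> \<delta>"
  proof (rule chain_bounded[OF \<alpha>])
    fix c z z' assume z: "c \<in> PE \<and> z \<in> Tn \<alpha> \<and> e \<alpha> z \<in> B" "c \<in> PE \<and> z' \<in> Tn \<alpha> \<and> e \<alpha> z' \<in> B"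
    then have "(e \<alpha> z, e \<alpha> z') \<in> Tr (e \<alpha>) \<alpha> \<or> (e \<alpha> z', e \<alpha> z) \<in> Tr (e \<alpha>) \<alpha>" using B by (simp add: branch_def)
    then show "z \<unlhd> z' \<or> z' \<unlhd> z" using z Tr_iff[OF e[OF \<alpha>]] by blast
  qed auto
  then obtain \<delta> where \<delta>: "\<forall>c z. c \<in> PE \<and> z \<in> Tn \<alpha> \<and> e \<alpha> z \<in> B \<longrightarrow> fst z \<prec> \<delta>" by blast
  show False
  proof (rule no_large_subset[OF g])
    show "B \<subseteq> Field (Tr (e \<alpha>) \<alpha>)" using B by (simp add: branch_def)
  qed (use \<delta> PE_empty in blast)
next
  assume "\<exists>A g. antichain (Tr (e \<alpha>) \<alpha>) A \<and> bij_betw g Ord A"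
  then obtain A g where A: "antichain (Tr (e \<alpha>) \<alpha>) A" and g: "bij_betw g Ord A" by blast
  have "\<exists>\<delta>\<in>Ord. \<forall>c z. c \<in> PE \<and> z \<in> Tn \<alpha> \<and> e \<alpha> z \<in> A \<longrightarrow> fst z \<prec> \<delta>"
  proof (rule antichain_bounded[OF \<alpha>])
    fix c z z' assume z: "c \<in> PE \<and> z \<in> Tn \<alpha> \<and> e \<alpha> z \<in> A" "c \<in> PE \<and> z' \<in> Tn \<alpha> \<and> e \<alpha> z' \<in> A" "z \<unlhd> z'"
    then have "(e \<alpha> z, e \<alpha> z') \<in> Tr (e \<alpha>) \<alpha>" using Tr_iff[OF e[OF \<alpha>]] by blast
    then have "e \<alpha> z = e \<alpha> z'" using A z by (auto simp: antichain_def)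
    then show "z = z'" using inj_onD[OF e[OF \<alpha>]] z by blast
  qed auto
  then obtain \<delta> where \<delta>: "\<forall>c z. c \<in> PE \<and> z \<in> Tn \<alpha> \<and> e \<alpha> z \<in> A \<longrightarrow> fst z \<prec> \<delta>" by blast
  show False
  proof (rule no_large_subset[OF g])
    show "A \<subseteq> Field (Tr (e \<alpha>) \<alpha>)" using A by (simp add: antichain_def)
  qed (use \<delta> PE_empty in blast)
qed

lemma rigid_Tr:
  assumes \<alpha>: "\<alpha> \<in> Ord" shows "rigid (Tr (e \<alpha>) \<alpha>)"
  unfolding rigid_def
proof (intro allI impI ballI)
  fix f x assume f: "order_iso f (Tr (e \<alpha>) \<alpha>) (Tr (e \<alpha>) \<alpha>)" and "x \<in> Field (Tr (e \<alpha>) \<alpha>)"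
  then obtain z where z: "z \<in> Tn \<alpha>" "x = e \<alpha> z" by (auto simp: Field_Tr)
  have im: "f ` e \<alpha> ` Tn \<alpha> = e \<alpha> ` Tn \<alpha>" using f by (simp add: order_iso_def Field_Tr bij_betw_def)
  have "f x \<in> e \<alpha> ` Tn \<alpha>" using im z by blast
  then obtain w where w: "w \<in> Tn \<alpha>" "f x = e \<alpha> w" by blast
  obtain c0 where c0: "c0 \<in> PE" using PE_empty by blast
  have "z = w"
  proof (rule no_automorphism[where V = "\<lambda>c u v. c \<in> PE \<and> u \<in> Tn \<alpha> \<and> v \<in> Tn \<alpha> \<and> f (e \<alpha> u) = e \<alpha> v", OF \<alpha> c0])
    show "\<exists>c' y. c' \<in> PE \<and> c' \<sqsubseteq> c \<and> c' \<in> PE \<and> u \<in> Tn \<alpha> \<and> y \<in> Tn \<alpha> \<and> f (e \<alpha> u) = e \<alpha> y"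
      if c: "c \<in> PE" and u: "u \<in> Tn \<alpha>" for c u
    proof -
      have "f (e \<alpha> u) \<in> e \<alpha> ` Tn \<alpha>" using im u by blast
      then show ?thesis using c u PE_refl[OF c] by blast
    qed
    show "\<exists>c' x. c' \<in> PE \<and> c' \<sqsubseteq> c \<and> c' \<in> PE \<and> x \<in> Tn \<alpha> \<and> y \<in> Tn \<alpha> \<and> f (e \<alpha> x) = e \<alpha> y"
      if c: "c \<in> PE" and y: "y \<in> Tn \<alpha>" for c y
    proof -
      have "e \<alpha> y \<in> f ` e \<alpha> ` Tn \<alpha>" using im y by blast
      then obtain u where "u \<in> Tn \<alpha>" "f (e \<alpha> u) = e \<alpha> y" by (metis imageE)
      then show ?thesis using c y PE_refl[OF c] by blast
    qed
    show "u \<unlhd> u' \<longleftrightarrow> v \<unlhd> v'" if u: "c \<in> PE \<and> u \<in> Tn \<alpha> \<and> v \<in> Tn \<alpha> \<and> f (e \<alpha> u) = e \<alpha> v" "c \<in> PE \<and> u' \<in> Tn \<alpha> \<and> v' \<in> Tn \<alpha> \<and> f (e \<alpha> u') = e \<alpha> v'"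
      for c u v u' v'
    proof -
      have "(e \<alpha> u, e \<alpha> u') \<in> Tr (e \<alpha>) \<alpha> \<longleftrightarrow> (f (e \<alpha> u), f (e \<alpha> u')) \<in> Tr (e \<alpha>) \<alpha>"
        using f u by (simp add: order_iso_def Field_Tr)
      then show ?thesis using u Tr_iff[OF e[OF \<alpha>]] by simp
    qed
  qed (use c0 z w in auto)
  then show "f x = x" using z w by simp
qed

context
  fixes enc :: "'o cond \<Rightarrow> 'p"
  assumes enc: "inj_on enc PE"
begin

lemmas pre = Preorder_Pf[OF enc]

lemma Pf_cond:
  assumes "p \<in> Field (Pf enc)" obtains c where "c \<in> PE" "p = enc c"
  using assms Field_Pf[OF enc] by blast

text \<open>The members of \<open>A\<close> lie on levels below \<delta>, hence among at most
  \<kappa> nodes. A forced bijection with \<open>\<kappa>\<^sup>+\<close> would be the injection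
  that \<open>no_collapse\<close> excludes.\<close>

lemma forced_no_large_subset:
  assumes \<alpha>: "\<alpha> \<in> Ord" and c0: "c0 \<in> PE"
    and G: "enc c0 \<in> f_bij (Pf enc) G (\<lambda>\<gamma>. ground (Pf enc) (\<gamma> \<in> Ord)) (\<lambda>x. f_in (Pf enc) x A)"
    and A: "\<And>t x. (t, enc c0) \<in> Pf enc \<Longrightarrow> t \<in> f_in (Pf enc) x A \<Longrightarrow> x \<in> Field (Tr (e \<alpha>) \<alpha>)"
    and \<delta>: "\<And>c z. c \<in> PE \<Longrightarrow> c \<sqsubseteq> c0 \<Longrightarrow> z \<in> Tn \<alpha> \<Longrightarrow> enc c \<in> f_in (Pf enc) (e \<alpha> z) A \<Longrightarrow> fst z \<prec> \<delta>"
  shows False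
proof -
  note b = f_bijE[OF pre G f_reg_ground[OF pre] f_reg_in[OF pre]]
  note f = f_funE[OF pre b(1) f_reg_ground[OF pre] f_reg_in[OF pre]]
  have lt: "(enc c, enc c0) \<in> Pf enc" if "c \<in> PE" "c \<sqsubseteq> c0" for c using that Pf_iff[OF enc] c0 by blast
  show False
  proof (rule no_collapse[where V = "\<lambda>c a z. c \<in> PE \<and> c \<sqsubseteq> c0 \<and> z \<in> Tn \<alpha> \<and> enc c \<in> f_in (Pf enc) (a, e \<alpha> z) G", OF few_nodes_below])
    show "z \<in> {z \<in> Tn \<alpha>. fst z \<prec> \<delta>}" if "c \<in> PE \<and> c \<sqsubseteq> c0 \<and> z \<in> Tn \<alpha> \<and> enc c \<in> f_in (Pf enc) (a, e \<alpha> z) G" for c a z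
      using that f(1)[OF lt] \<delta> by blast
    show "c' \<in> PE \<and> c' \<sqsubseteq> c0 \<and> z \<in> Tn \<alpha> \<and> enc c' \<in> f_in (Pf enc) (a, e \<alpha> z) G"
      if "c \<in> PE \<and> c \<sqsubseteq> c0 \<and> z \<in> Tn \<alpha> \<and> enc c \<in> f_in (Pf enc) (a, e \<alpha> z) G" "c' \<in> PE" "c' \<sqsubseteq> c" for c c' a z
      using that f_in_down[OF pre] Pf_iff[OF enc] stronger_trans by meson
    show "\<exists>c z. c \<in> PE \<and> c \<in> PE \<and> c \<sqsubseteq> c0 \<and> z \<in> Tn \<alpha> \<and> enc c \<in> f_in (Pf enc) (a, e \<alpha> z) G" if a: "a \<in> Ord" for a
    proof -
      have "(enc c0, enc c0) \<in> Pf enc" using lt[OF c0 PE_refl[OF c0]] .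
      then obtain t x where t: "(t, enc c0) \<in> Pf enc" "t \<in> f_in (Pf enc) (a, x) G"
        using f(2)[of "enc c0" a] groundI[OF pre _ a] P_under[OF pre] by blast
      have "x \<in> Field (Tr (e \<alpha>) \<alpha>)" using A[OF t(1)] f(1)[OF t] by blast
      then obtain z where z: "z \<in> Tn \<alpha>" "x = e \<alpha> z" by (auto simp: Field_Tr)
      obtain c where "c \<in> PE" "t = enc c" "c \<sqsubseteq> c0" using PfD[OF enc t(1) c0] by blast
      then show ?thesis using t(2) z by blast
    qed
    show "a = a'" if "c \<in> PE \<and> c \<sqsubseteq> c0 \<and> z \<in> Tn \<alpha> \<and> enc c \<in> f_in (Pf enc) (a, e \<alpha> z) G"
      "c \<in> PE \<and> c \<sqsubseteq> c0 \<and> z \<in> Tn \<alpha> \<and> enc c \<in> f_in (Pf enc) (a', e \<alpha> z) G" for c a a' z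
      using that b(2)[OF lt] by blast
  qed
qed

lemma forced_subset_tree:
  assumes q: "q \<in> f_all (Pf enc) (\<lambda>x. f_imp (Pf enc) (f_in (Pf enc) x A) (ground (Pf enc) (x \<in> X)))"
    and t: "(t, q) \<in> Pf enc" "t \<in> f_in (Pf enc) x A"
  shows "x \<in> X"
  by (rule groundE[OF pre], rule f_impE[OF pre f_allE[OF pre q] _ _ t]) (intro f_regs[OF pre])+

lemma forced_pair_relation:
  assumes q: "q \<in> f_all (Pf enc) (\<lambda>x. f_all (Pf enc) (\<lambda>y. f_imp (Pf enc) (f_in (Pf enc) x A \<^bold>\<and> f_in (Pf enc) y A) (ground (Pf enc) (R x y))))"
    and t: "(t, q) \<in> Pf enc" "t \<in> f_in (Pf enc) x A" "t \<in> f_in (Pf enc) y A"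
  shows "R x y"
proof -
  have "t \<in> (f_in (Pf enc) x A \<^bold>\<and> f_in (Pf enc) y A)" using t by (simp add: in_f_and[OF pre])
  from f_impE[OF pre f_allE[OF pre f_allE[OF pre q]] _ _ t(1) this]
  have "t \<in> ground (Pf enc) (R x y)" by (simp add: f_regs[OF pre])
  then show ?thesis by (rule groundE[OF pre])
qed

lemma forced_souslin_tree:
  assumes \<alpha>: "\<alpha> \<in> Ord" and p: "p \<in> Field (Pf enc)"
  shows "p \<in> f_souslin_tree (Pf enc) K (Tr (e \<alpha>) \<alpha>)"
  unfolding f_souslin_tree_def in_f_and[OF pre]
proof (intro conjI f_not_ex2I[OF pre _ p] notI)
  show "p \<in> f_tree (Pf enc) (Tr (e \<alpha>) \<alpha>)" by (rule f_tree_ground[OF pre tree_Tr[OF e[OF \<alpha>] \<alpha>] p])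
  show "p \<in> f_has_height (Pf enc) (Tr (e \<alpha>) \<alpha>) K" by (rule f_has_height_ground[OF pre has_height_Tr[OF e[OF \<alpha>] \<alpha>] p])
next
  fix u B G assume "u \<in> Field (Pf enc)"
    and u: "u \<in> (f_branch (Pf enc) (Tr (e \<alpha>) \<alpha>) B \<^bold>\<and> f_bij (Pf enc) G (\<lambda>\<gamma>. ground (Pf enc) (\<gamma> \<in> Ord)) (\<lambda>x. f_in (Pf enc) x B))"
  then obtain c0 where c0: "c0 \<in> PE" "u = enc c0" by (elim Pf_cond)
  note u' = u[unfolded f_branch_def in_f_and[OF pre] c0(2)]
  have lt: "(enc c, enc c0) \<in> Pf enc" if "c \<in> PE" "c \<sqsubseteq> c0" for c using that Pf_iff[OF enc] c0 by blast
  have "\<exists>\<delta>\<in>Ord. \<forall>c z. c \<in> PE \<and> c \<sqsubseteq> c0 \<and> z \<in> Tn \<alpha> \<and> enc c \<in> f_in (Pf enc) (e \<alpha> z) B \<longrightarrow> fst z \<prec> \<delta>"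
  proof (rule chain_bounded[OF \<alpha>])
    fix c z z' assume z: "c \<in> PE \<and> c \<sqsubseteq> c0 \<and> z \<in> Tn \<alpha> \<and> enc c \<in> f_in (Pf enc) (e \<alpha> z) B" "c \<in> PE \<and> c \<sqsubseteq> c0 \<and> z' \<in> Tn \<alpha> \<and> enc c \<in> f_in (Pf enc) (e \<alpha> z') B"
    then have "(e \<alpha> z, e \<alpha> z') \<in> Tr (e \<alpha>) \<alpha> \<or> (e \<alpha> z', e \<alpha> z) \<in> Tr (e \<alpha>) \<alpha>"
      using forced_pair_relation[where R = "\<lambda>x y. (x, y) \<in> Tr (e \<alpha>) \<alpha> \<or> (y, x) \<in> Tr (e \<alpha>) \<alpha>", of "enc c0" B "enc c"] u' lt by blast
    then show "z \<unlhd> z' \<or> z' \<unlhd> z" using z Tr_iff[OF e[OF \<alpha>]] by blast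
  next
    fix c c' z assume "c \<in> PE \<and> c \<sqsubseteq> c0 \<and> z \<in> Tn \<alpha> \<and> enc c \<in> f_in (Pf enc) (e \<alpha> z) B" "c' \<in> PE" "c' \<sqsubseteq> c"
    then show "c' \<in> PE \<and> c' \<sqsubseteq> c0 \<and> z \<in> Tn \<alpha> \<and> enc c' \<in> f_in (Pf enc) (e \<alpha> z) B"
      using f_in_down[OF pre] Pf_iff[OF enc] stronger_trans by meson
  qed auto
  then obtain \<delta> where \<delta>: "\<forall>c z. c \<in> PE \<and> c \<sqsubseteq> c0 \<and> z \<in> Tn \<alpha> \<and> enc c \<in> f_in (Pf enc) (e \<alpha> z) B \<longrightarrow> fst z \<prec> \<delta>" by blast
  show False
    by (rule forced_no_large_subset[where \<delta> = \<delta>, OF \<alpha> c0(1) conjunct2[OF u'] forced_subset_tree[OF conjunct1[OF conjunct1[OF u']]]])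
      (use \<delta> in blast)+
next
  fix u A G assume "u \<in> Field (Pf enc)"
    and u: "u \<in> (f_antichain (Pf enc) (Tr (e \<alpha>) \<alpha>) A \<^bold>\<and> f_bij (Pf enc) G (\<lambda>\<gamma>. ground (Pf enc) (\<gamma> \<in> Ord)) (\<lambda>x. f_in (Pf enc) x A))"
  then obtain c0 where c0: "c0 \<in> PE" "u = enc c0" by (elim Pf_cond)
  note u' = u[unfolded f_antichain_def in_f_and[OF pre] c0(2)]
  have lt: "(enc c, enc c0) \<in> Pf enc" if "c \<in> PE" "c \<sqsubseteq> c0" for c using that Pf_iff[OF enc] c0 by blast
  have "\<exists>\<delta>\<in>Ord. \<forall>c z. c \<in> PE \<and> c \<sqsubseteq> c0 \<and> z \<in> Tn \<alpha> \<and> enc c \<in> f_in (Pf enc) (e \<alpha> z) A \<longrightarrow> fst z \<prec> \<delta>"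
  proof (rule antichain_bounded[OF \<alpha>])
    fix c z z' assume z: "c \<in> PE \<and> c \<sqsubseteq> c0 \<and> z \<in> Tn \<alpha> \<and> enc c \<in> f_in (Pf enc) (e \<alpha> z) A" "c \<in> PE \<and> c \<sqsubseteq> c0 \<and> z' \<in> Tn \<alpha> \<and> enc c \<in> f_in (Pf enc) (e \<alpha> z') A" "z \<unlhd> z'"
    then have "e \<alpha> z \<noteq> e \<alpha> z' \<longrightarrow> (e \<alpha> z, e \<alpha> z') \<notin> Tr (e \<alpha>) \<alpha> \<and> (e \<alpha> z', e \<alpha> z) \<notin> Tr (e \<alpha>) \<alpha>"
      using forced_pair_relation[where R = "\<lambda>x y. x \<noteq> y \<longrightarrow> (x, y) \<notin> Tr (e \<alpha>) \<alpha> \<and> (y, x) \<notin> Tr (e \<alpha>) \<alpha>", of "enc c0" A "enc c"] u' lt by blast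
    moreover have "(e \<alpha> z, e \<alpha> z') \<in> Tr (e \<alpha>) \<alpha>" using z Tr_iff[OF e[OF \<alpha>]] by blast
    ultimately show "z = z'" using inj_onD[OF e[OF \<alpha>]] z by blast
  next
    fix c c' z assume "c \<in> PE \<and> c \<sqsubseteq> c0 \<and> z \<in> Tn \<alpha> \<and> enc c \<in> f_in (Pf enc) (e \<alpha> z) A" "c' \<in> PE" "c' \<sqsubseteq> c"
    then show "c' \<in> PE \<and> c' \<sqsubseteq> c0 \<and> z \<in> Tn \<alpha> \<and> enc c' \<in> f_in (Pf enc) (e \<alpha> z) A"
      using f_in_down[OF pre] Pf_iff[OF enc] stronger_trans by meson
  qed auto
  then obtain \<delta> where \<delta>: "\<forall>c z. c \<in> PE \<and> c \<sqsubseteq> c0 \<and> z \<in> Tn \<alpha> \<and> enc c \<in> f_in (Pf enc) (e \<alpha> z) A \<longrightarrow> fst z \<prec> \<delta>" by blast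
  show False
    by (rule forced_no_large_subset[where \<delta> = \<delta>, OF \<alpha> c0(1) conjunct2[OF u'] forced_subset_tree[OF conjunct1[OF conjunct1[OF u']]]])
      (use \<delta> in blast)+
qed

text \<open>The name is pulled back along the labellings to a relation between conditions and nodes;
  the five claims are the premises on such a relation in \<open>no_automorphism\<close>.\<close>

lemma forced_iso_name:
  fixes F :: "('x \<times> 'x, 'p) name"
  assumes ab: "\<alpha> \<in> Ord" "\<beta> \<in> Ord" and c0: "c0 \<in> PE"
    and F: "enc c0 \<in> f_order_iso (Pf enc) F (Tr (e \<alpha>) \<alpha>) (Tr (e \<beta>) \<beta>)"
    and V_def: "V = (\<lambda>c u v. c \<in> PE \<and> c \<sqsubseteq> c0 \<and> u \<in> Tn \<alpha> \<and> v \<in> Tn \<beta> \<and> enc c \<in> f_in (Pf enc) (e \<alpha> u, e \<beta> v) F)"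
  shows "V c x y \<Longrightarrow> c \<in> PE \<and> x \<in> Tn \<alpha> \<and> y \<in> Tn \<beta>"
    and "V c x y \<Longrightarrow> c' \<in> PE \<Longrightarrow> c' \<sqsubseteq> c \<Longrightarrow> V c' x y"
    and "c \<in> PE \<Longrightarrow> c \<sqsubseteq> c0 \<Longrightarrow> x \<in> Tn \<alpha> \<Longrightarrow> \<exists>c' y. c' \<in> PE \<and> c' \<sqsubseteq> c \<and> V c' x y"
    and "c \<in> PE \<Longrightarrow> c \<sqsubseteq> c0 \<Longrightarrow> y \<in> Tn \<beta> \<Longrightarrow> \<exists>c' x. c' \<in> PE \<and> c' \<sqsubseteq> c \<and> V c' x y"
    and "V c x y \<Longrightarrow> V c x' y' \<Longrightarrow> x \<unlhd> x' \<longleftrightarrow> y \<unlhd> y'"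
proof -
  have lt: "(enc c, enc c0) \<in> Pf enc" if "c \<in> PE" "c \<sqsubseteq> c0" for c using that Pf_iff[OF enc] c0 by blast
  note i = f_order_isoE[OF pre F]
  show "V c x y \<Longrightarrow> c \<in> PE \<and> x \<in> Tn \<alpha> \<and> y \<in> Tn \<beta>" by (simp add: V_def)
  show "V c x y \<Longrightarrow> c' \<in> PE \<Longrightarrow> c' \<sqsubseteq> c \<Longrightarrow> V c' x y"
    unfolding V_def using f_in_down[OF pre] Pf_iff[OF enc] stronger_trans by meson
  show "\<exists>c' y. c' \<in> PE \<and> c' \<sqsubseteq> c \<and> V c' x y" if c: "c \<in> PE" "c \<sqsubseteq> c0" and x: "x \<in> Tn \<alpha>"
  proof -
    have "e \<alpha> x \<in> Field (Tr (e \<alpha>) \<alpha>)" using x by (simp add: Field_Tr)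
    from i(2)[OF lt[OF c] this] obtain t y where t: "(t, enc c) \<in> Pf enc" "t \<in> f_in (Pf enc) (e \<alpha> x, y) F" by blast
    obtain c' where c': "c' \<in> PE" "t = enc c'" "c' \<sqsubseteq> c" using PfD[OF enc t(1) c(1)] by blast
    have c'0: "c' \<sqsubseteq> c0" using stronger_trans[OF c'(3) c(2)] .
    have "y \<in> Field (Tr (e \<beta>) \<beta>)" using i(1)[OF lt[OF c'(1) c'0]] t(2) c'(2) by blast
    then obtain w where "w \<in> Tn \<beta>" "y = e \<beta> w" by (auto simp: Field_Tr)
    then have "V c' x w" using c' c'0 x t(2) by (simp add: V_def)
    then show ?thesis using c' by blast
  qed
  show "\<exists>c' x. c' \<in> PE \<and> c' \<sqsubseteq> c \<and> V c' x y" if c: "c \<in> PE" "c \<sqsubseteq> c0" and y: "y \<in> Tn \<beta>"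
  proof -
    have "e \<beta> y \<in> Field (Tr (e \<beta>) \<beta>)" using y by (simp add: Field_Tr)
    from i(3)[OF lt[OF c] this] obtain t x where t: "(t, enc c) \<in> Pf enc" "t \<in> f_in (Pf enc) (x, e \<beta> y) F" by blast
    obtain c' where c': "c' \<in> PE" "t = enc c'" "c' \<sqsubseteq> c" using PfD[OF enc t(1) c(1)] by blast
    have c'0: "c' \<sqsubseteq> c0" using stronger_trans[OF c'(3) c(2)] .
    have "x \<in> Field (Tr (e \<alpha>) \<alpha>)" using i(1)[OF lt[OF c'(1) c'0]] t(2) c'(2) by blast
    then obtain w where "w \<in> Tn \<alpha>" "x = e \<alpha> w" by (auto simp: Field_Tr)
    then have "V c' w y" using c' c'0 y t(2) by (simp add: V_def)
    then show ?thesis using c' by blast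
  qed
  show "x \<unlhd> x' \<longleftrightarrow> y \<unlhd> y'" if V: "V c x y" "V c x' y'"
  proof -
    have "(e \<alpha> x, e \<alpha> x') \<in> Tr (e \<alpha>) \<alpha> \<longleftrightarrow> (e \<beta> y, e \<beta> y') \<in> Tr (e \<beta>) \<beta>"
      using i(4)[OF lt, of c] V by (simp add: V_def)
    then show ?thesis using V Tr_iff[OF e[OF ab(1)]] Tr_iff[OF e[OF ab(2)]] by (simp add: V_def)
  qed
qed

lemma forced_rigid:
  assumes \<alpha>: "\<alpha> \<in> Ord" and p: "p \<in> Field (Pf enc)"
  shows "p \<in> f_rigid (Pf enc) (Tr (e \<alpha>) \<alpha>)"
  unfolding f_rigid_def
proof (rule f_allI[OF pre p], rule f_impI[OF pre p])
  fix F q assume q: "(q, p) \<in> Pf enc" "q \<in> f_order_iso (Pf enc) F (Tr (e \<alpha>) \<alpha>) (Tr (e \<alpha>) \<alpha>)"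
  have qF: "q \<in> Field (Pf enc)" using P_under[OF pre q(1)] .
  show "q \<in> f_all (Pf enc) (\<lambda>x. f_all (Pf enc) (\<lambda>y. f_imp (Pf enc) (f_in (Pf enc) (x, y) F) (ground (Pf enc) (y = x))))"
  proof (intro f_allI[OF pre qF] f_impI[OF pre qF] f_regs[OF pre])
    fix x y t assume t: "(t, q) \<in> Pf enc" "t \<in> f_in (Pf enc) (x, y) F"
    have tF: "t \<in> Field (Pf enc)" using P_under[OF pre t(1)] .
    have iso: "t \<in> f_order_iso (Pf enc) F (Tr (e \<alpha>) \<alpha>) (Tr (e \<alpha>) \<alpha>)"
      by (rule f_reg_down[OF pre f_reg_order_iso[OF pre] q(2) t(1)])
    obtain c0 where c0: "c0 \<in> PE" "t = enc c0" using tF by (rule Pf_cond)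
    have "x \<in> Field (Tr (e \<alpha>) \<alpha>) \<and> y \<in> Field (Tr (e \<alpha>) \<alpha>)"
      using f_order_isoE(1)[OF pre iso P_refl[OF pre tF] t(2)] .
    then obtain u v where uv: "u \<in> Tn \<alpha>" "v \<in> Tn \<alpha>" "x = e \<alpha> u" "y = e \<alpha> v" by (auto simp: Field_Tr)
    define V where "V = (\<lambda>c u v. c \<in> PE \<and> c \<sqsubseteq> c0 \<and> u \<in> Tn \<alpha> \<and> v \<in> Tn \<alpha> \<and> enc c \<in> f_in (Pf enc) (e \<alpha> u, e \<alpha> v) F)"
    note n = forced_iso_name[OF \<alpha> \<alpha> c0(1) iso[unfolded c0(2)] V_def]
    have "V c0 u v" using uv c0 t(2) PE_refl[OF c0(1)] by (simp add: V_def)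
    then have "u = v" by (intro no_automorphism[where V = V, OF \<alpha> c0(1) n])
    then show "t \<in> ground (Pf enc) (y = x)" using uv groundI[OF pre tF] by simp
  qed
qed (intro f_regs[OF pre] f_reg_order_iso[OF pre])+

lemma forced_isomorphic:
  assumes ab: "\<alpha> \<in> Ord" "\<beta> \<in> Ord" "m \<alpha> = m \<beta>" and p: "p \<in> Field (Pf enc)"
  shows "p \<in> f_isomorphic (Pf enc) (Tr (e \<alpha>) \<alpha>) (Tr (e \<beta>) \<beta>)"
proof -
  define V where "V = (\<lambda>t x y. \<exists>c u v. t = enc c \<and> x = e \<alpha> u \<and> y = e \<beta> v \<and> shift_iso \<alpha> \<beta> c u v)"
  have VI: "V (enc c) (e \<alpha> u) (e \<beta> v)" if "shift_iso \<alpha> \<beta> c u v" for c u v using that unfolding V_def by blast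
  have shift_iso_D: "c \<in> PE" "u \<in> Tn \<alpha>" "v \<in> Tn \<beta>" if "shift_iso \<alpha> \<beta> c u v" for c u v using that by (auto simp: shift_iso_def)
  \<comment> \<open>Two instances of \<open>V\<close> at the same \<open>t\<close> come from the
    same condition because \<open>enc\<close> is injective.\<close>
  have both: "\<exists>c u v u' v'. t = enc c \<and> x = e \<alpha> u \<and> y = e \<beta> v \<and> x' = e \<alpha> u' \<and> y' = e \<beta> v' \<and> shift_iso \<alpha> \<beta> c u v \<and> shift_iso \<alpha> \<beta> c u' v'"
    if "V t x y" "V t x' y'" for t x y x' y'
  proof -
    obtain c u v where c: "t = enc c" "x = e \<alpha> u" "y = e \<beta> v" "shift_iso \<alpha> \<beta> c u v" using \<open>V t x y\<close> unfolding V_def by blast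
    obtain c' u' v' where c': "t = enc c'" "x' = e \<alpha> u'" "y' = e \<beta> v'" "shift_iso \<alpha> \<beta> c' u' v'" using \<open>V t x' y'\<close> unfolding V_def by blast
    have "c = c'" using inj_onD[OF enc, of c c'] shift_iso_D(1)[OF c(4)] shift_iso_D(1)[OF c'(4)] c(1) c'(1) by simp
    then show ?thesis using c c' by blast
  qed
  have "p \<in> f_order_iso (Pf enc) {(z, t). V t (fst z) (snd z)} (Tr (e \<alpha>) \<alpha>) (Tr (e \<beta>) \<beta>)"
  proof (rule f_order_isoI[OF pre p])
    fix t u x y assume "V t x y" and u: "(u, t) \<in> Pf enc"
    then obtain c a b where c: "t = enc c" "x = e \<alpha> a" "y = e \<beta> b" "shift_iso \<alpha> \<beta> c a b" unfolding V_def by blast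
    obtain d where d: "d \<in> PE" "u = enc d" "d \<sqsubseteq> c" using PfD[OF enc u[unfolded c(1)] shift_iso_D(1)[OF c(4)]] by blast
    show "V u x y" unfolding d(2) c(2,3) by (rule VI[OF shift_iso_mono[OF c(4) d(1,3)]])
  next
    fix t x y assume "V t x y"
    then show "t \<in> Field (Pf enc) \<and> x \<in> Field (Tr (e \<alpha>) \<alpha>) \<and> y \<in> Field (Tr (e \<beta>) \<beta>)"
      unfolding V_def Field_Tr Field_Pf[OF enc] using shift_iso_D by blast
  next
    fix t x assume t: "t \<in> Field (Pf enc)" and "x \<in> Field (Tr (e \<alpha>) \<alpha>)"
    then obtain u where u: "u \<in> Tn \<alpha>" "x = e \<alpha> u" by (auto simp: Field_Tr)
    obtain c where c: "c \<in> PE" "t = enc c" using t by (rule Pf_cond)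
    obtain d v where d: "d \<in> PE" "d \<sqsubseteq> c" "shift_iso \<alpha> \<beta> d u v" using shift_iso_total[OF ab c(1) u(1)] by blast
    then have "(enc d, t) \<in> Pf enc" using Pf_iff[OF enc d(1) c(1)] c(2) by simp
    then show "\<exists>u y. (u, t) \<in> Pf enc \<and> V u x y" using VI[OF d(3)] u(2) by blast
  next
    fix t y assume t: "t \<in> Field (Pf enc)" and "y \<in> Field (Tr (e \<beta>) \<beta>)"
    then obtain v where v: "v \<in> Tn \<beta>" "y = e \<beta> v" by (auto simp: Field_Tr)
    obtain c where c: "c \<in> PE" "t = enc c" using t by (rule Pf_cond)
    obtain d u where d: "d \<in> PE" "d \<sqsubseteq> c" "shift_iso \<alpha> \<beta> d u v"
      using shift_iso_total[OF ab(2,1) ab(3)[symmetric] c(1) v(1)] shift_iso_sym by blast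
    then have "(enc d, t) \<in> Pf enc" using Pf_iff[OF enc d(1) c(1)] c(2) by simp
    then show "\<exists>u x. (u, t) \<in> Pf enc \<and> V u x y" using VI[OF d(3)] v(2) by blast
  next
    fix t x y y' assume "V t x y" "V t x y'"
    from both[OF this] obtain c u v u' v' where *: "x = e \<alpha> u" "y = e \<beta> v" "x = e \<alpha> u'" "y' = e \<beta> v'" "shift_iso \<alpha> \<beta> c u v" "shift_iso \<alpha> \<beta> c u' v'" by blast
    then have "u = u'" using inj_onD[OF e[OF ab(1)]] shift_iso_D(2) by metis
    then show "y = y'" using shift_iso_functional * by blast
  next
    fix t x x' y assume "V t x y" "V t x' y"
    from both[OF this] obtain c u v u' v' where *: "x = e \<alpha> u" "y = e \<beta> v" "x' = e \<alpha> u'" "y = e \<beta> v'" "shift_iso \<alpha> \<beta> c u v" "shift_iso \<alpha> \<beta> c u' v'" by blast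
    then have "v = v'" using inj_onD[OF e[OF ab(2)]] shift_iso_D(3) by metis
    then show "x = x'" using shift_iso_functional[of \<beta> \<alpha>] shift_iso_sym * by blast
  next
    fix t x y x' y' assume "V t x y" "V t x' y'"
    from both[OF this] obtain c u v u' v' where *: "x = e \<alpha> u" "y = e \<beta> v" "x' = e \<alpha> u'" "y' = e \<beta> v'" "shift_iso \<alpha> \<beta> c u v" "shift_iso \<alpha> \<beta> c u' v'" by blast
    show "(x, x') \<in> Tr (e \<alpha>) \<alpha> \<longleftrightarrow> (y, y') \<in> Tr (e \<beta>) \<beta>"
      unfolding *(1-4) using shift_iso_order[OF *(5,6)] Tr_iff[OF e[OF ab(1)]] Tr_iff[OF e[OF ab(2)]] shift_iso_D[OF *(5)] shift_iso_D[OF *(6)] by simp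
  qed
  then show ?thesis
    unfolding f_isomorphic_def
    by (rule f_exI[OF pre, where \<Phi> = "\<lambda>F. f_order_iso (Pf enc) F (Tr (e \<alpha>) \<alpha>) (Tr (e \<beta>) \<beta>)", rotated]) (rule f_reg_order_iso[OF pre])
qed

lemma forced_realizes:
  assumes E: "\<And>\<alpha> \<beta>. \<alpha> \<in> Ord \<Longrightarrow> \<beta> \<in> Ord \<Longrightarrow> (\<alpha>, \<beta>) \<in> E \<longleftrightarrow> m \<alpha> = m \<beta>" and p: "p \<in> Field (Pf enc)"
  shows "p \<in> f_realizes (Pf enc) Ord (\<lambda>\<alpha>. Tr (e \<alpha>) \<alpha>) E"
  unfolding f_realizes_def
proof (intro f_ballI[OF pre p] f_reg_ball[OF pre] f_reg_iff[OF pre] f_reg_ground[OF pre] f_reg_isomorphic[OF pre])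
  fix \<alpha> \<beta> assume ab: "\<alpha> \<in> Ord" "\<beta> \<in> Ord"
  show "p \<in> f_iff (Pf enc) (ground (Pf enc) ((\<alpha>, \<beta>) \<in> E)) (f_isomorphic (Pf enc) (Tr (e \<alpha>) \<alpha>) (Tr (e \<beta>) \<beta>))"
    unfolding f_iff_def in_f_and[OF pre]
  proof (intro conjI f_impI[OF pre p] f_reg_ground[OF pre] f_reg_isomorphic[OF pre])
    fix q assume q: "(q, p) \<in> Pf enc" "q \<in> ground (Pf enc) ((\<alpha>, \<beta>) \<in> E)"
    then have "m \<alpha> = m \<beta>" using E[OF ab] groundE[OF pre] by blast
    then show "q \<in> f_isomorphic (Pf enc) (Tr (e \<alpha>) \<alpha>) (Tr (e \<beta>) \<beta>)" by (rule forced_isomorphic[OF ab _ P_under[OF pre q(1)]])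
  next
    fix q assume q: "(q, p) \<in> Pf enc" "q \<in> f_isomorphic (Pf enc) (Tr (e \<alpha>) \<alpha>) (Tr (e \<beta>) \<beta>)"
    obtain t F where t: "(t, q) \<in> Pf enc" "t \<in> f_order_iso (Pf enc) F (Tr (e \<alpha>) \<alpha>) (Tr (e \<beta>) \<beta>)"
      using f_exD[OF pre q(2)[unfolded f_isomorphic_def]] by blast
    obtain c0 where c0: "c0 \<in> PE" "t = enc c0" using P_under[OF pre t(1)] by (rule Pf_cond)
    define V where "V = (\<lambda>c u v. c \<in> PE \<and> c \<sqsubseteq> c0 \<and> u \<in> Tn \<alpha> \<and> v \<in> Tn \<beta> \<and> enc c \<in> f_in (Pf enc) (e \<alpha> u, e \<beta> v) F)"
    note n = forced_iso_name[OF ab c0(1) t(2)[unfolded c0(2)] V_def]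
    have "m \<alpha> = m \<beta>"
    proof (rule ccontr)
      assume "m \<alpha> \<noteq> m \<beta>"
      then show False by (rule no_isomorphism_classes[where V = V, OF ab _ c0(1) n(1,2,3,5)])
    qed
    then show "q \<in> ground (Pf enc) ((\<alpha>, \<beta>) \<in> E)" using E[OF ab] groundI[OF pre P_under[OF pre q(1)]] by simp
  qed
qed

end

lemma weakly_able_to_realize_Tr:
  assumes E: "\<And>\<alpha> \<beta>. \<alpha> \<in> Ord \<Longrightarrow> \<beta> \<in> Ord \<Longrightarrow> (\<alpha>, \<beta>) \<in> E \<longleftrightarrow> m \<alpha> = m \<beta>"
    and enc: "inj_on (enc :: 'o cond \<Rightarrow> 'p) PE"
  shows "weakly_able_to_realize TYPE('p) K Ord (\<lambda>\<alpha>. Tr (e \<alpha>) \<alpha>) E"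
  unfolding weakly_able_to_realize_def
proof (intro conjI ballI exI[of _ "Pf enc"] souslin_tree_Tr rigid_Tr forcing_notion_Pf[OF enc] cofinality_preserving_Pf[OF enc])
  let ?P = "Pf enc"
  note pre = Preorder_Pf[OF enc]
  show "forced ?P (f_ball ?P Ord (\<lambda>\<alpha>. f_souslin_tree ?P K (Tr (e \<alpha>) \<alpha>) \<^bold>\<and> f_rigid ?P (Tr (e \<alpha>) \<alpha>)))"
    unfolding forced_def
  proof
    fix p assume p: "p \<in> Field ?P"
    show "p \<in> f_ball ?P Ord (\<lambda>\<alpha>. f_souslin_tree ?P K (Tr (e \<alpha>) \<alpha>) \<^bold>\<and> f_rigid ?P (Tr (e \<alpha>) \<alpha>))"
    proof (intro f_ballI[OF pre p] f_reg_and[OF pre] f_reg_souslin_tree[OF pre] f_reg_rigid[OF pre])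
      fix \<alpha> assume "\<alpha> \<in> Ord"
      then show "p \<in> (f_souslin_tree ?P K (Tr (e \<alpha>) \<alpha>) \<^bold>\<and> f_rigid ?P (Tr (e \<alpha>) \<alpha>))"
        using forced_souslin_tree[OF enc _ p] forced_rigid[OF enc _ p] by (simp add: in_f_and[OF pre])
    qed
  qed
  show "forced ?P (f_realizes ?P Ord (\<lambda>\<alpha>. Tr (e \<alpha>) \<alpha>) E)"
    unfolding forced_def using forced_realizes[OF enc E] by blast
qed

end

end

section \<open>Choice of labels and conclusion\<close>

context coded_diamond
begin

text \<open>A node is turned into a condition with one slot, so that the injective coding of
  conditions also labels the nodes by ordinals.\<close>

definition node_code :: "'o \<Rightarrow> 'o \<times> ('o \<Rightarrow> bit) \<Rightarrow> 'o" where
  "node_code \<alpha> z = code (fst z, [Slot \<alpha> 0 \<mapsto> (unit \<alpha>, snd z)])"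

lemma inj_node_code: "\<alpha> \<in> Ord \<Longrightarrow> inj_on (node_code \<alpha>) (Tn \<alpha>)"
proof (rule inj_onI)
  fix z w assume \<alpha>: "\<alpha> \<in> Ord" and zw: "z \<in> Tn \<alpha>" "w \<in> Tn \<alpha>" and eq: "node_code \<alpha> z = node_code \<alpha> w"
  have "(fst z, [Slot \<alpha> 0 \<mapsto> (unit \<alpha>, snd z)]) \<in> U" if z: "z \<in> Tn \<alpha>" for z
  proof -
    have "(fst z, [Slot \<alpha> 0 \<mapsto> (unit \<alpha>, snd z)]) \<in> Q W"
    proof (rule QI[OF TnD(1)[OF z]])
      show "|dom [Slot \<alpha> 0 \<mapsto> (unit \<alpha>, snd z)]| <o \<kappa>" by (rule small_finite) simp
    qed (use \<alpha> TnD(2)[OF z] fsup_unit in \<open>auto split: if_splits\<close>)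
    then show ?thesis using Q_U by blast
  qed
  from inj_onD[OF code_inj eq[unfolded node_code_def] this[OF zw(1)] this[OF zw(2)]]
  have "fst z = fst w" "[Slot \<alpha> 0 \<mapsto> (unit \<alpha>, snd z)] (Slot \<alpha> 0) = [Slot \<alpha> 0 \<mapsto> (unit \<alpha>, snd w)] (Slot \<alpha> 0)" by simp_all
  then show "z = w" by (simp add: prod_eq_iff)
qed

lemma weakly_able_to_realize_equiv:
  assumes E: "equiv Ord E"
  shows "weakly_able_to_realize TYPE('o set) K Ord (\<lambda>\<alpha>. Tr (node_code \<alpha>) \<alpha>) E"
proof -
  \<comment> \<open>The choice depends on the class alone, so equivalent ordinals get the same
    representative and \<open>m\<close> is idempotent.\<close>
  define m where "m \<xi> = (SOME \<eta>. \<eta> \<in> E `` {\<xi>})" for \<xi>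
  have mE: "(\<xi>, m \<xi>) \<in> E" if "\<xi> \<in> Ord" for \<xi>
  proof -
    have "\<xi> \<in> E `` {\<xi>}" using E that by (rule equiv_class_self)
    then have "m \<xi> \<in> E `` {\<xi>}" unfolding m_def by (rule someI)
    then show ?thesis by simp
  qed
  have m_eq: "m \<xi> = m \<eta>" if "(\<xi>, \<eta>) \<in> E" for \<xi> \<eta> using equiv_class_eq[OF E that] by (simp add: m_def)
  have EO: "E \<subseteq> Ord \<times> Ord" using E by (rule equiv_type)
  interpret realizing \<kappa> K S D code m
  proof
    show "m \<xi> \<in> Ord" if "\<xi> \<in> Ord" for \<xi> using mE[OF that] EO by blast
    show "m (m \<xi>) = m \<xi>" if "\<xi> \<in> Ord" for \<xi> using m_eq[OF mE[OF that]] by simp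
  qed
  show ?thesis
  proof (rule weakly_able_to_realize_Tr[OF inj_node_code])
    show "(\<alpha>, \<beta>) \<in> E \<longleftrightarrow> m \<alpha> = m \<beta>" if "\<alpha> \<in> Ord" "\<beta> \<in> Ord" for \<alpha> \<beta>
    proof
      assume "m \<alpha> = m \<beta>"
      then have "(\<alpha>, m \<alpha>) \<in> E" "(m \<alpha>, \<beta>) \<in> E" using mE[of \<alpha>] mE[of \<beta>] that E by (auto simp: equiv_def sym_def)
      then show "(\<alpha>, \<beta>) \<in> E" using E by (meson equivE transD)
    qed (rule m_eq)
    \<comment> \<open>Singletons of codes carry the conditions into the type \<open>'o set\<close>;
      the larger type makes \<open>cofinality_preserving\<close> range over more orders.\<close>
    show "inj_on (\<lambda>c. {code c}) PE"
    proof (rule inj_onI)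
      fix c d assume c: "c \<in> PE" and d: "d \<in> PE" and "{code c} = {code d}"
      then have "code c = code d" by simp
      then show "c = d" by (rule inj_onD[OF code_inj _ subsetD[OF Q_U PE_Q[OF c]] subsetD[OF Q_U PE_Q[OF d]]])
    qed
  qed
qed

end

theorem theorem3p3:
  fixes \<kappa> :: "'a rel"
  assumes "Cinfinite \<kappa>"
    and "two_less \<kappa> =o \<kappa>"
    and "diamond (cardSuc \<kappa>) (CF \<kappa>)"
  shows "\<exists>T :: 'a set \<Rightarrow> 'a set rel.
           (\<forall>\<alpha>\<in>Field (cardSuc \<kappa>). souslin_tree (cardSuc \<kappa>) (T \<alpha>)) \<and>
           (\<forall>E. equiv (Field (cardSuc \<kappa>)) E \<longrightarrow>
              weakly_able_to_realize TYPE('a set set) (cardSuc \<kappa>) (Field (cardSuc \<kappa>)) T E)"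
proof -
  obtain D where D: "diamond_setting \<kappa> (cardSuc \<kappa>) (CF \<kappa>) D" using diamond_settingI[OF assms] by blast
  obtain code where code: "inj_on code (diamond_setting.U \<kappa> (cardSuc \<kappa>))"
    "code ` diamond_setting.U \<kappa> (cardSuc \<kappa>) \<subseteq> Field (cardSuc \<kappa>)"
    using diamond_setting.ex_code[OF D] by blast
  interpret coded_diamond \<kappa> "cardSuc \<kappa>" "CF \<kappa>" D code
    by (rule coded_diamond.intro[OF D coded_diamond_axioms.intro[OF code]])
  let ?T = "\<lambda>\<alpha>. Tr (node_code \<alpha>) \<alpha>"
  have T: "weakly_able_to_realize TYPE('a set set) (cardSuc \<kappa>) (Field (cardSuc \<kappa>)) ?T E"
    if "equiv (Field (cardSuc \<kappa>)) E" for E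
    using that by (rule weakly_able_to_realize_equiv)
  \<comment> \<open>That the trees are Souslin is part of weak realizability and independent of
    \<open>E\<close>; it is read off from the case of equality.\<close>
  have "equiv Ord (Id_on Ord)" by (auto simp: equiv_def refl_on_def sym_def trans_def)
  from T[OF this] have "\<forall>\<alpha>\<in>Ord. souslin_tree (cardSuc \<kappa>) (?T \<alpha>)" by (simp add: weakly_able_to_realize_def)
  then show ?thesis using T by (intro exI[of _ ?T]) simp
qed

end
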